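(* Let $d\ge1$, $s\in(0,1)$, and let $u$ be a weak solution, constructed as in the existence theorem (recalled in the context), of $\partial_tu=\mathrm{div}(u\nabla p)$, $p=(-\Delta)^su$ in $\mathbb{R}^d\times(0,+\infty)$, with initial datum $u_0$, such that $x\cdot\nabla u(\cdot,t)\in L^2(\mathbb{R}^d)$ for a.a. $t\in(0,+\infty)$. Then, for a.a. $t>0$, $$\int_{\mathbb{R}^d}\frac{|x|^2}2u(x,t)\,dx\le\int_{\mathbb{R}^d}\frac{|x|^2}2u_0(x)\,dx+\frac{d+2s}2\int_0^t\int_{\mathbb{R}^d}|(-\Delta)^{s/2}u|^2\,dx\,dr .$$
   Context: $(-\Delta)^s$ is the fractional Laplacian on $\mathbb{R}^d$ (Fourier multiplier $|\xi|^{2s}$); $(-\Delta)^{s/2}\nabla u$ is taken componentwise; $0\log0=0$; $\mathscr{F}(v)=\int_{\mathbb{R}^d}v\log v$; $Q=\mathbb{R}^d\times(0,+\infty)$. Weak solution with (nonnegative) initial datum $u_0$: (i) $u\ge0$ a.e. in $Q$; (ii) $u\in L^\infty(0,+\infty;H^s(\mathbb{R}^d))\cap L^2(0,+\infty;H^{1+s}(\mathbb{R}^d))$; (iii) $p=(-\Delta)^su\in L^2(0,+\infty;H^{1-s}(\mathbb{R}^d))$; (iv) for all $\varphi\in C_c^\infty(\mathbb{R}^d\times[0,+\infty))$, $-\iint_Qu\,\partial_t\varphi-\iint_Qp\,u\,\Delta\varphi-\iint_Qp\,\nabla u\cdot\nabla\varphi=\int_{\mathbb{R}^d}u_0\varphi(x,0)\,dx$.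 Existence theorem: for $u_0$ measurable, nonnegative, in $H^s(\mathbb{R}^d)$ with $\mathscr{F}(u_0)<+\infty$ there is a weak solution $u$ that also satisfies, for a.a. $t>0$: (1) $\int u(x,t)dx=\int u_0\,dx$; (2) $\mathscr{F}(u(t))+\int_0^t\int|(-\Delta)^{s/2}\nabla u|^2dx\,dr\le\mathscr{F}(u_0)$; (3) $\frac12\int|(-\Delta)^{s/2}u(t)|^2dx+\int_0^t\int|\xi|^2dx\,dr\le\frac12\int|(-\Delta)^{s/2}u_0|^2dx$, where the vector field $\xi\in L^2(0,+\infty;L^2(\mathbb{R}^d))$ satisfies $\nabla(up)-p\nabla u=u^{1/2}\xi$ a.e. in $Q$. It is constructed by approximation: with $m_\varepsilon(y)=y^++\varepsilon$ and $m_\varepsilon^M=\min\{M,m_\varepsilon\}$ one solves $\partial_tu=\mathrm{div}(m_\varepsilon^M(u)\nabla p)$, $p=(-\Delta)^su$, $u(\cdot,0)=u_0$ (by implicit Euler time discretisation on balls $B_R(0)$ with $u=0$ outside $B_R(0)$ and initial data converging to $u_0$ in $H^s$, letting the time step go to $0$ and then $R\to+\infty$), then lets $M\to+\infty$ to get $u_\varepsilon$ solving the problem with mobility $m_\varepsilon$, and finally $u=\lim u_\varepsilon$ along a subsequence $\varepsilon\to0$. *)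

theory Defs
  imports "HOL-Analysis.Analysis"
begin

text \<open>
  \<open>\<real>\<^sup>d\<close> is a type \<open>'a :: euclidean_space\<close>, with \<open>d = DIM('a)\<close>. Elements of \<open>L\<^sup>2\<close>, \<open>H\<^sup>\<sigma>\<close>, ... are
  represented by Borel functions, and all statements about them hold almost everywhere.
  A function on \<open>\<real>\<^sup>d \<times> (0, \<infinity>)\<close> is a curried function \<open>u :: real \<Rightarrow> 'a \<Rightarrow> _\<close> with \<open>u t x\<close> the value at
  \<open>(x, t)\<close>; the time variable comes first, and values at \<open>t \<le> 0\<close> are irrelevant.
\<close>

section \<open>Test functions and weak derivatives\<close>

primrec times_differentiable :: "nat \<Rightarrow> ('b::real_normed_vector \<Rightarrow> real) \<Rightarrow> bool" where
  "times_differentiable 0 f \<longleftrightarrow> continuous_on UNIV f"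
| "times_differentiable (Suc n) f \<longleftrightarrow> (\<forall>x. f differentiable (at x)) \<and>
     (\<forall>v. times_differentiable n (\<lambda>x. frechet_derivative f (at x) v))"

definition test_function :: "'b::euclidean_space set \<Rightarrow> ('b \<Rightarrow> real) \<Rightarrow> bool" where
  "test_function \<Omega> \<phi> \<longleftrightarrow> (\<forall>n. times_differentiable n \<phi>) \<and>
     compact (closure {x. \<phi> x \<noteq> 0}) \<and> closure {x. \<phi> x \<noteq> 0} \<subseteq> \<Omega>"

definition grad :: "('a::euclidean_space \<Rightarrow> real) \<Rightarrow> 'a \<Rightarrow> 'a" where
  "grad f x = (\<Sum>b\<in>Basis. frechet_derivative f (at x) b *\<^sub>R b)"

definition laplacian :: "('a::euclidean_space \<Rightarrow> real) \<Rightarrow> 'a \<Rightarrow> real" where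
  "laplacian f x = (\<Sum>b\<in>Basis. grad (\<lambda>y. grad f y \<bullet> b) x \<bullet> b)"

definition locally_integrable ::
    "'a::euclidean_space set \<Rightarrow> ('a \<Rightarrow> 'b::{banach, second_countable_topology}) \<Rightarrow> bool" where
  "locally_integrable \<Omega> f \<longleftrightarrow> (\<forall>K. compact K \<and> K \<subseteq> \<Omega> \<longrightarrow> set_integrable lborel K f)"

definition has_weak_gradient ::
    "'a::euclidean_space set \<Rightarrow> ('a \<Rightarrow> real) \<Rightarrow> ('a \<Rightarrow> 'a) \<Rightarrow> bool" where
  "has_weak_gradient \<Omega> f g \<longleftrightarrow> locally_integrable \<Omega> f \<and> locally_integrable \<Omega> g \<and>
     (\<forall>\<phi>. test_function \<Omega> \<phi> \<longrightarrow>
        (LINT x:\<Omega>|lborel. f x *\<^sub>R grad \<phi> x) = - (LINT x:\<Omega>|lborel. \<phi> x *\<^sub>R g x))"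

section \<open>Fourier transform, Sobolev spaces, fractional Laplacian\<close>

definition L2 :: "('a::euclidean_space \<Rightarrow> 'b::{banach, second_countable_topology}) \<Rightarrow> bool" where
  "L2 f \<longleftrightarrow> f \<in> borel_measurable lborel \<and> (\<integral>\<^sup>+ x. ennreal ((norm (f x))\<^sup>2) \<partial>lborel) < \<infinity>"

definition fourier_integral :: "('a::euclidean_space \<Rightarrow> real) \<Rightarrow> 'a \<Rightarrow> complex" where
  "fourier_integral f \<xi> = complex_of_real ((2 * pi) powr (- real DIM('a) / 2)) *
     (LINT x|lborel. cis (- (x \<bullet> \<xi>)) * complex_of_real (f x))"

text \<open>
  The unitary (Plancherel) Fourier transform of \<open>f \<in> L\<^sup>2\<close>: the limit in \<open>L\<^sup>2\<close> of the Fourier integrals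
  of the truncations \<open>f 1\<^sub>B \<in> L\<^sup>1 \<inter> L\<^sup>2\<close>, \<open>B = B\<^sub>n(0)\<close>. It is determined up to a null set.
\<close>

definition fourier :: "('a::euclidean_space \<Rightarrow> real) \<Rightarrow> 'a \<Rightarrow> complex" where
  "fourier f = (SOME g. L2 g \<and>
     (\<lambda>n. \<integral>\<^sup>+ \<xi>. ennreal ((cmod (fourier_integral (\<lambda>x. indicator (ball 0 (real n)) x * f x) \<xi> - g \<xi>))\<^sup>2)
            \<partial>lborel) \<longlonglongrightarrow> 0)"

definition sobolev_sqnorm :: "real \<Rightarrow> ('a::euclidean_space \<Rightarrow> real) \<Rightarrow> ennreal" where
  "sobolev_sqnorm \<sigma> f =
     (\<integral>\<^sup>+ \<xi>. ennreal ((1 + (norm \<xi>)\<^sup>2) powr \<sigma> * (cmod (fourier f \<xi>))\<^sup>2) \<partial>lborel)"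

text \<open>Membership in \<open>H\<^sup>\<sigma>(\<real>\<^sup>d)\<close>; only used for \<open>\<sigma> \<ge> 0\<close>.\<close>

definition sobolev :: "real \<Rightarrow> ('a::euclidean_space \<Rightarrow> real) \<Rightarrow> bool" where
  "sobolev \<sigma> f \<longleftrightarrow> L2 f \<and> sobolev_sqnorm \<sigma> f < \<infinity>"

text \<open>\<open>frac_laplacian \<sigma> f\<close> is \<open>(-\<Delta>)\<^sup>\<sigma> f\<close>, for \<open>f \<in> H\<^bsup>2\<sigma>\<^esup>\<close>; it is determined up to a null set.\<close>

definition frac_laplacian :: "real \<Rightarrow> ('a::euclidean_space \<Rightarrow> real) \<Rightarrow> 'a \<Rightarrow> real" where
  "frac_laplacian \<sigma> f = (SOME w. L2 w \<and>
     (AE \<xi> in lborel. fourier w \<xi> = complex_of_real (norm \<xi> powr (2 * \<sigma>)) * fourier f \<xi>))"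

definition frac_laplacian_vec :: "real \<Rightarrow> ('a::euclidean_space \<Rightarrow> 'a) \<Rightarrow> 'a \<Rightarrow> 'a" where
  "frac_laplacian_vec \<sigma> g x = (\<Sum>b\<in>Basis. frac_laplacian \<sigma> (\<lambda>y. g y \<bullet> b) x *\<^sub>R b)"

section \<open>Function spaces on space-time\<close>

definition measurable_Q :: "'a::euclidean_space set \<Rightarrow> (real \<Rightarrow> 'a \<Rightarrow> 'b::euclidean_space) \<Rightarrow> bool" where
  "measurable_Q \<Omega> u \<longleftrightarrow> set_borel_measurable lborel ({0<..} \<times> \<Omega>) (\<lambda>(t, x). u t x)"

text \<open>\<open>L\<^sup>\<infinity>(0, \<infinity>; H\<^sup>\<sigma>)\<close>, \<open>L\<^sup>2(0, \<infinity>; H\<^sup>\<sigma>)\<close> and \<open>L\<^sup>2(0, \<infinity>; L\<^sup>2(\<Omega>))\<close>.\<close>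

definition Linf_sobolev :: "real \<Rightarrow> (real \<Rightarrow> 'a::euclidean_space \<Rightarrow> real) \<Rightarrow> bool" where
  "Linf_sobolev \<sigma> u \<longleftrightarrow> measurable_Q UNIV u \<and>
     (\<exists>C. AE t in lborel. 0 < t \<longrightarrow> sobolev \<sigma> (u t) \<and> sobolev_sqnorm \<sigma> (u t) \<le> ennreal C)"

definition L2_sobolev :: "real \<Rightarrow> (real \<Rightarrow> 'a::euclidean_space \<Rightarrow> real) \<Rightarrow> bool" where
  "L2_sobolev \<sigma> u \<longleftrightarrow> measurable_Q UNIV u \<and>
     (AE t in lborel. 0 < t \<longrightarrow> sobolev \<sigma> (u t)) \<and>
     (\<integral>\<^sup>+ t\<in>{0<..}. sobolev_sqnorm \<sigma> (u t) \<partial>lborel) < \<infinity>"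

definition L2_L2 :: "'a::euclidean_space set \<Rightarrow> (real \<Rightarrow> 'a \<Rightarrow> 'b::euclidean_space) \<Rightarrow> bool" where
  "L2_L2 \<Omega> g \<longleftrightarrow> measurable_Q \<Omega> g \<and>
     (\<integral>\<^sup>+ t\<in>{0<..}. (\<integral>\<^sup>+ x\<in>\<Omega>. ennreal ((norm (g t x))\<^sup>2) \<partial>lborel) \<partial>lborel) < \<infinity>"

text \<open>Convergence in \<open>L\<^sup>2\<^sub>l\<^sub>o\<^sub>c(\<real>\<^sup>d \<times> [0, \<infinity>))\<close>.\<close>

definition converges_L2loc ::
    "(nat \<Rightarrow> real \<Rightarrow> 'a::euclidean_space \<Rightarrow> real) \<Rightarrow> (real \<Rightarrow> 'a \<Rightarrow> real) \<Rightarrow> bool" where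
  "converges_L2loc U u \<longleftrightarrow> (\<forall>T>0. \<forall>r>0.
     (\<lambda>n. \<integral>\<^sup>+ t\<in>{0<..T}. (\<integral>\<^sup>+ x\<in>ball 0 r. ennreal ((U n t x - u t x)\<^sup>2) \<partial>lborel) \<partial>lborel) \<longlonglongrightarrow> 0)"

section \<open>Weak solutions\<close>

text \<open>
  The functions \<open>p = (-\<Delta>)\<^sup>s u\<close> and \<open>G = \<nabla>u\<close> are determined by \<open>u\<close> up to null sets and are carried along
  in order to have names for them. Test functions in \<open>C\<^sub>c\<^sup>\<infinity>(\<real>\<^sup>d \<times> [0, \<infinity>))\<close> are the restrictions to
  \<open>t \<ge> 0\<close> of test functions on \<open>\<real> \<times> \<real>\<^sup>d\<close>.
\<close>

definition weak_solution ::
    "real \<Rightarrow> ('a::euclidean_space \<Rightarrow> real) \<Rightarrow> (real \<Rightarrow> 'a \<Rightarrow> real) \<Rightarrow> (real \<Rightarrow> 'a \<Rightarrow> real) \<Rightarrow>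
     (real \<Rightarrow> 'a \<Rightarrow> 'a) \<Rightarrow> bool" where
  "weak_solution s u0 u p G \<longleftrightarrow>
     (AE (t, x) in lborel. 0 < t \<longrightarrow> 0 \<le> u t x) \<and>
     Linf_sobolev s u \<and> L2_sobolev (1 + s) u \<and>
     measurable_Q UNIV G \<and> (AE t in lborel. 0 < t \<longrightarrow> has_weak_gradient UNIV (u t) (G t)) \<and>
     (AE t in lborel. 0 < t \<longrightarrow> (AE x in lborel. p t x = frac_laplacian s (u t) x)) \<and>
     L2_sobolev (1 - s) p \<and>
     (\<forall>\<phi>. test_function UNIV \<phi> \<longrightarrow>
        - (LINT (t, x):{0<..} \<times> UNIV|lborel. u t x * deriv (\<lambda>r. \<phi> (r, x)) t)
        - (LINT (t, x):{0<..} \<times> UNIV|lborel. p t x * u t x * laplacian (\<lambda>y. \<phi> (t, y)) x)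
        - (LINT (t, x):{0<..} \<times> UNIV|lborel. p t x * (G t x \<bullet> grad (\<lambda>y. \<phi> (t, y)) x))
        = (LINT x|lborel. u0 x * \<phi> (0, x)))"

text \<open>
  \<open>\<F>(v) = \<integral> v log v\<close>, as an extended real number; the positive part is integrable for \<open>v \<in> L\<^sup>2\<close>.
  Note \<open>ln 0 = 0\<close>.
\<close>

definition entropy :: "('a::euclidean_space \<Rightarrow> real) \<Rightarrow> ereal" where
  "entropy v = enn2ereal (\<integral>\<^sup>+ x. ennreal (v x * ln (v x)) \<partial>lborel)
             - enn2ereal (\<integral>\<^sup>+ x. ennreal (- (v x * ln (v x))) \<partial>lborel)"

definition mass_entropy_energy ::
    "real \<Rightarrow> ('a::euclidean_space \<Rightarrow> real) \<Rightarrow> (real \<Rightarrow> 'a \<Rightarrow> real) \<Rightarrow> (real \<Rightarrow> 'a \<Rightarrow> real) \<Rightarrow>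
     (real \<Rightarrow> 'a \<Rightarrow> 'a) \<Rightarrow> bool" where
  "mass_entropy_energy s u0 u p G \<longleftrightarrow>
     (AE t in lborel. 0 < t \<longrightarrow>
        (\<integral>\<^sup>+ x. ennreal (u t x) \<partial>lborel) = (\<integral>\<^sup>+ x. ennreal (u0 x) \<partial>lborel)) \<and>
     (AE t in lborel. 0 < t \<longrightarrow>
        entropy (u t) +
        enn2ereal (\<integral>\<^sup>+ r\<in>{0<..<t}.
          (\<integral>\<^sup>+ x. ennreal ((norm (frac_laplacian_vec (s / 2) (G r) x))\<^sup>2) \<partial>lborel) \<partial>lborel)
        \<le> entropy u0) \<and>
     (\<exists>\<xi> :: real \<Rightarrow> 'a \<Rightarrow> 'a. L2_L2 UNIV \<xi> \<and>
        (AE t in lborel. 0 < t \<longrightarrow>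
           (\<exists>W. has_weak_gradient UNIV (\<lambda>x. u t x * p t x) W \<and>
                (AE x in lborel. W x - p t x *\<^sub>R G t x = sqrt (u t x) *\<^sub>R \<xi> t x))) \<and>
        (AE t in lborel. 0 < t \<longrightarrow>
           ennreal (1 / 2) * (\<integral>\<^sup>+ x. ennreal ((frac_laplacian (s / 2) (u t) x)\<^sup>2) \<partial>lborel) +
           (\<integral>\<^sup>+ r\<in>{0<..<t}. (\<integral>\<^sup>+ x. ennreal ((norm (\<xi> r x))\<^sup>2) \<partial>lborel) \<partial>lborel)
           \<le> ennreal (1 / 2) * (\<integral>\<^sup>+ x. ennreal ((frac_laplacian (s / 2) u0 x)\<^sup>2) \<partial>lborel)))"

section \<open>The approximation procedure\<close>

definition mob :: "real \<Rightarrow> real \<Rightarrow> real" where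
  "mob \<epsilon> y = max y 0 + \<epsilon>"

definition mob_trunc :: "real \<Rightarrow> real \<Rightarrow> real \<Rightarrow> real" where
  "mob_trunc \<epsilon> M y = min M (mob \<epsilon> y)"

text \<open>
  \<open>p = (-\<Delta>)\<^sup>s u\<close> in the open set \<open>\<Omega>\<close>, for \<open>u \<in> H\<^sup>s(\<real>\<^sup>d)\<close>; here \<open>(-\<Delta>)\<^sup>s u\<close> is in general only a
  distribution, given by the quadratic form of \<open>(-\<Delta>)\<^sup>s\<close>.
\<close>

definition weak_frac_laplacian ::
    "'a::euclidean_space set \<Rightarrow> real \<Rightarrow> ('a \<Rightarrow> real) \<Rightarrow> ('a \<Rightarrow> real) \<Rightarrow> bool" where
  "weak_frac_laplacian \<Omega> s u p \<longleftrightarrow> locally_integrable \<Omega> p \<and>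
     (\<forall>\<phi>. test_function \<Omega> \<phi> \<longrightarrow>
        (LINT x:\<Omega>|lborel. p x * \<phi> x) =
        (LINT x|lborel. frac_laplacian (s / 2) u x * frac_laplacian (s / 2) \<phi> x))"

text \<open>
  Implicit Euler scheme \<open>w\<^sub>k\<^sub>+\<^sub>1 - w\<^sub>k = \<tau> div (m(w\<^sub>k\<^sub>+\<^sub>1) \<nabla>(-\<Delta>)\<^sup>s w\<^sub>k\<^sub>+\<^sub>1)\<close> in \<open>\<Omega>\<close>, \<open>w\<^sub>k = 0\<close> outside \<open>\<Omega>\<close>, \<open>w\<^sub>0 = v\<close>.
  The equation is understood in the sense of distributions in \<open>\<Omega>\<close>; no boundary condition
  is imposed on \<open>(-\<Delta>)\<^sup>s w\<^sub>k\<close>.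
\<close>

definition euler_scheme ::
    "real \<Rightarrow> (real \<Rightarrow> real) \<Rightarrow> 'a::euclidean_space set \<Rightarrow> real \<Rightarrow> ('a \<Rightarrow> real) \<Rightarrow>
     (nat \<Rightarrow> 'a \<Rightarrow> real) \<Rightarrow> bool" where
  "euler_scheme s m \<Omega> \<tau> v w \<longleftrightarrow> w 0 = v \<and>
     (\<forall>k. sobolev s (w k) \<and> (AE x in lborel. x \<notin> \<Omega> \<longrightarrow> w k x = 0)) \<and>
     (\<forall>k. \<exists>q g. weak_frac_laplacian \<Omega> s (w (Suc k)) q \<and> has_weak_gradient \<Omega> q g \<and>
        L2 (\<lambda>x. indicator \<Omega> x *\<^sub>R g x) \<and>
        (\<forall>\<phi>. test_function \<Omega> \<phi> \<longrightarrow>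
           (LINT x:\<Omega>|lborel. (w (Suc k) x - w k x) * \<phi> x) =
           - \<tau> * (LINT x:\<Omega>|lborel. m (w (Suc k) x) * (g x \<bullet> grad \<phi> x))))"

text \<open>The interpolant equal to \<open>w k\<close> on \<open>((k - 1) \<tau>, k \<tau>]\<close>.\<close>

definition piecewise_constant :: "real \<Rightarrow> (nat \<Rightarrow> 'a \<Rightarrow> real) \<Rightarrow> real \<Rightarrow> 'a \<Rightarrow> real" where
  "piecewise_constant \<tau> w t = w (nat \<lceil>t / \<tau>\<rceil>)"

text \<open>
  \<open>\<partial>\<^sub>t u = div (m(u) \<nabla>p)\<close>, \<open>p = (-\<Delta>)\<^sup>s u\<close> in \<open>\<Omega> \<times> (0, \<infinity>)\<close>, with \<open>u = 0\<close> outside \<open>\<Omega>\<close> and initial datum \<open>v\<close>;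
  meant for mobilities \<open>m\<close> bounded below by a positive constant, so that \<open>\<nabla>p \<in> L\<^sup>2\<close>.
\<close>

definition mobility_solution ::
    "real \<Rightarrow> (real \<Rightarrow> real) \<Rightarrow> 'a::euclidean_space set \<Rightarrow> ('a \<Rightarrow> real) \<Rightarrow>
     (real \<Rightarrow> 'a \<Rightarrow> real) \<Rightarrow> bool" where
  "mobility_solution s m \<Omega> v u \<longleftrightarrow> Linf_sobolev s u \<and>
     (AE t in lborel. 0 < t \<longrightarrow> (AE x in lborel. x \<notin> \<Omega> \<longrightarrow> u t x = 0)) \<and>
     (\<exists>p g. L2_L2 \<Omega> g \<and>
        (AE t in lborel. 0 < t \<longrightarrow>
           weak_frac_laplacian \<Omega> s (u t) (p t) \<and> has_weak_gradient \<Omega> (p t) (g t)) \<and>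
        (\<forall>\<phi>. test_function (UNIV \<times> \<Omega>) \<phi> \<longrightarrow>
           - (LINT (t, x):{0<..} \<times> \<Omega>|lborel. u t x * deriv (\<lambda>r. \<phi> (r, x)) t)
           + (LINT (t, x):{0<..} \<times> \<Omega>|lborel. m (u t x) * (g t x \<bullet> grad (\<lambda>y. \<phi> (t, y)) x))
           = (LINT x:\<Omega>|lborel. v x * \<phi> (0, x))))"

text \<open>The four limits: time step \<open>\<tau> \<rightarrow> 0\<close>, radius \<open>R \<rightarrow> \<infinity>\<close>, truncation \<open>M \<rightarrow> \<infinity>\<close>, and \<open>\<epsilon> \<rightarrow> 0\<close>.\<close>

definition limit_of_euler ::
    "real \<Rightarrow> (real \<Rightarrow> real) \<Rightarrow> real \<Rightarrow> ('a::euclidean_space \<Rightarrow> real) \<Rightarrow>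
     (real \<Rightarrow> 'a \<Rightarrow> real) \<Rightarrow> bool" where
  "limit_of_euler s m R v u \<longleftrightarrow> mobility_solution s m (ball 0 R) v u \<and>
     (\<exists>\<tau> w. (\<forall>n. 0 < \<tau> n \<and> euler_scheme s m (ball 0 R) (\<tau> n) v (w n)) \<and> \<tau> \<longlonglongrightarrow> 0 \<and>
        converges_L2loc (\<lambda>n. piecewise_constant (\<tau> n) (w n)) u)"

definition limit_of_balls ::
    "real \<Rightarrow> (real \<Rightarrow> real) \<Rightarrow> ('a::euclidean_space \<Rightarrow> real) \<Rightarrow> (real \<Rightarrow> 'a \<Rightarrow> real) \<Rightarrow> bool" where
  "limit_of_balls s m u0 u \<longleftrightarrow> mobility_solution s m UNIV u0 u \<and>
     (\<exists>R v U. (\<forall>n. 0 < R n \<and> limit_of_euler s m (R n) (v n) (U n)) \<and>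
        filterlim R at_top sequentially \<and>
        (\<lambda>n. sobolev_sqnorm s (\<lambda>x. v n x - u0 x)) \<longlonglongrightarrow> 0 \<and>
        converges_L2loc U u)"

definition limit_of_truncations ::
    "real \<Rightarrow> real \<Rightarrow> ('a::euclidean_space \<Rightarrow> real) \<Rightarrow> (real \<Rightarrow> 'a \<Rightarrow> real) \<Rightarrow> bool" where
  "limit_of_truncations s \<epsilon> u0 u \<longleftrightarrow> mobility_solution s (mob \<epsilon>) UNIV u0 u \<and>
     (\<exists>M U. (\<forall>n. 0 < M n \<and> limit_of_balls s (mob_trunc \<epsilon> (M n)) u0 (U n)) \<and>
        filterlim M at_top sequentially \<and> converges_L2loc U u)"

definition limit_of_regularisations ::
    "real \<Rightarrow> ('a::euclidean_space \<Rightarrow> real) \<Rightarrow> (real \<Rightarrow> 'a \<Rightarrow> real) \<Rightarrow> bool" where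
  "limit_of_regularisations s u0 u \<longleftrightarrow>
     (\<exists>\<epsilon> U. (\<forall>n. 0 < \<epsilon> n \<and> limit_of_truncations s (\<epsilon> n) u0 (U n)) \<and>
        \<epsilon> \<longlonglongrightarrow> 0 \<and> converges_L2loc U u)"

definition constructed_weak_solution ::
    "real \<Rightarrow> ('a::euclidean_space \<Rightarrow> real) \<Rightarrow> (real \<Rightarrow> 'a \<Rightarrow> real) \<Rightarrow> (real \<Rightarrow> 'a \<Rightarrow> real) \<Rightarrow>
     (real \<Rightarrow> 'a \<Rightarrow> 'a) \<Rightarrow> bool" where
  "constructed_weak_solution s u0 u p G \<longleftrightarrow>
     weak_solution s u0 u p G \<and> mass_entropy_energy s u0 u p G \<and> limit_of_regularisations s u0 u"

end

theory Submission
  imports Defs "HOL-Probability.Probability"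
begin

text \<open>
  Test the equation with $\eta(t)\psi_n(x)$, where $\psi_n(x) = n^2 \psi(x/n)$ for a bump $\psi \le |x|^2/2$ with compact
  support and $\psi \sim |x|^2/2$ at $0$. By scaling, $\Delta\psi_n$ and the Lipschitz constant of $\nabla\psi_n$ are bounded
  uniformly in $n$. The term $\int p u \Delta\psi_n$ tends to $d \int p u = d E$, $E = \|(-\Delta)^{s/2}u\|^2$.

  For $\int p \nabla u \cdot \nabla\psi_n$, write $p = c \int_0^\infty (u - e^{l\Delta}u) l^{-1-s} dl$. Integration by parts against
  the heat kernel, symmetrised in $x$ and $y$, turns $\int (e^{l\Delta}u) \nabla u \cdot \nabla\psi_n$ into a double integral of
  $(u(x)-u(y))^2$ and a local term in $u^2$. Since $l^{-1-s}$ is not integrable at $0$, the local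
  contributions must cancel, and integration in $l$ leaves $-\frac12$ times the double integral of
  $(u(x)-u(y))^2 |x-y|^{-d-2s}$, normalised to give $E$, against the multiplier
  $\Delta\psi_n(x) + \Delta\psi_n(y) - (d+2s) (x-y) \cdot (\nabla\psi_n(x)-\nabla\psi_n(y)) / |x-y|^2$, which is bounded and
  tends to $2d - (d+2s) = d - 2s$. Dominated convergence in space and time, together with Fatou's lemma for
  the left hand side, gives the factor $d - (d-2s)/2 = (d+2s)/2$.
\<close>

section \<open>Square-integrable functions\<close>

text \<open>The kernel |x-y|^(-d-2s) is singular on the diagonal, so its product with \<nabla>\<psi>
  is no admissible test field for the weak gradient. The heat kernel is smooth with Gaussian decay:
  at fixed l every integral converges absolutely and the integration by parts is legitimate. The
  singularity enters only with the integral in l, where the factor 1/(2l) produced by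
  differentiating the kernel is compensated by |x-y|^2; that factor is available because
  symmetrisation replaces \<nabla>\<psi>(x) by a difference of gradients. The constant d + 2s is the
  degree of homogeneity of the singular kernel. It is obtained from one integration by parts in l,
  without a closed form of the kernel.

  A second obstacle is that \<open>fourier\<close> and \<open>frac_laplacian\<close> are chosen
  functions, fixed only up to null sets and separately at each time. Before either can be used,
  Plancherel's theorem and the surjectivity of the transform have to be available; both are derived
  from Gaussian integrals. Measurability in time of the energy is read off the double integral of
  squared differences, not off the chosen functions.\<close>

definition L2sq :: "('a::euclidean_space \<Rightarrow> 'b::{banach, second_countable_topology}) \<Rightarrow> real" where
  "L2sq f = (LINT x|lborel. (norm (f x))\<^sup>2)"

lemma L2_iff: "L2 f \<longleftrightarrow> f \<in> borel_measurable lborel \<and> integrable lborel (\<lambda>x. (norm (f x))\<^sup>2)"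
  by (auto simp: L2_def integrable_iff_bounded)

lemma L2_measurable [measurable_dest]: "L2 f \<Longrightarrow> f \<in> borel_measurable lborel"
  by (simp add: L2_def)

lemma L2_integrable: "L2 f \<Longrightarrow> integrable lborel (\<lambda>x. (norm (f x))\<^sup>2)"
  by (simp add: L2_iff)

lemma L2sq_nonneg [simp]: "0 \<le> L2sq f"
  by (simp add: L2sq_def)

lemma nn_integral_L2sq: "L2 f \<Longrightarrow> (\<integral>\<^sup>+ x. ennreal ((norm (f x))\<^sup>2) \<partial>lborel) = ennreal (L2sq f)"
  unfolding L2sq_def by (rule nn_integral_eq_integral) (auto simp: L2_iff)

lemma L2_bound:
  assumes "L2 f" "g \<in> borel_measurable lborel" "AE x in lborel. norm (g x) \<le> c * norm (f x)"
  shows "L2 g"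
proof -
  have "integrable lborel (\<lambda>x. c\<^sup>2 * (norm (f x))\<^sup>2)"
    using assms(1) by (auto simp: L2_iff)
  then have "integrable lborel (\<lambda>x. (norm (g x))\<^sup>2)"
  proof (rule Bochner_Integration.integrable_bound)
    show "(\<lambda>x. (norm (g x))\<^sup>2) \<in> borel_measurable lborel"
      using assms(2) by measurable
    show "AE x in lborel. norm ((norm (g x))\<^sup>2) \<le> norm (c\<^sup>2 * (norm (f x))\<^sup>2)"
      using assms(3) 
      by eventually_elim (auto simp: power_mult_distrib[symmetric] simp del: power_mult_distrib intro!: power_mono)
  qed
  then show ?thesis using assms(2) by (simp add: L2_iff)
qed

lemma L2_cong_AE:
  assumes "L2 f" "g \<in> borel_measurable lborel" "AE x in lborel. g x = f x"
  shows "L2 g"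
  by (rule L2_bound[of f _ 1]) (use assms in auto)

lemma L2sq_cong_AE:
  assumes "f \<in> borel_measurable lborel" "g \<in> borel_measurable lborel" "AE x in lborel. g x = f x"
  shows "L2sq g = L2sq f"
  unfolding L2sq_def by (rule integral_cong_AE) (use assms in auto)

lemma power2_norm_add_le: "(norm (a + b))\<^sup>2 \<le> 2 * (norm a)\<^sup>2 + 2 * (norm (b::'b::real_normed_vector))\<^sup>2"
proof -
  have "(norm (a + b))\<^sup>2 \<le> (norm a + norm b)\<^sup>2" by (intro power_mono norm_triangle_ineq) simp
  also have "\<dots> \<le> 2 * (norm a)\<^sup>2 + 2 * (norm b)\<^sup>2"
    using sum_squares_bound[of "norm a" "norm b"] by (simp add: power2_sum)
  finally show ?thesis .
qed

lemma L2_add: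
  assumes "L2 f" "L2 g" shows "L2 (\<lambda>x. f x + g x)"
proof -
  have [measurable]: "f \<in> borel_measurable lborel" "g \<in> borel_measurable lborel"
    using assms by (auto simp: L2_def)
  have "integrable lborel (\<lambda>x. (norm (f x + g x))\<^sup>2)"
  proof (rule Bochner_Integration.integrable_bound)
    show "integrable lborel (\<lambda>x. 2 * (norm (f x))\<^sup>2 + 2 * (norm (g x))\<^sup>2)"
      using assms by (auto simp: L2_iff)
    show "AE x in lborel. norm ((norm (f x + g x))\<^sup>2) \<le> norm (2 * (norm (f x))\<^sup>2 + 2 * (norm (g x))\<^sup>2)"
      using power2_norm_add_le by auto
  qed measurable
  then show ?thesis by (simp add: L2_iff)
qed

lemma L2_zero [simp]: "L2 (\<lambda>x. 0)"
  by (simp add: L2_iff)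

lemma L2_scaleR:
  assumes "L2 f" shows "L2 (\<lambda>x. c *\<^sub>R f x)"
  by (rule L2_bound[OF assms, of _ "\<bar>c\<bar>"]) (use assms in \<open>auto simp: L2_def\<close>)

lemma L2_cmult:
  fixes f :: "'a::euclidean_space \<Rightarrow> 'b::{banach, second_countable_topology, real_normed_div_algebra}"
  assumes "L2 f" shows "L2 (\<lambda>x. c * f x)"
  by (rule L2_bound[OF assms, of _ "norm c"]) (use assms in \<open>auto simp: L2_def norm_mult\<close>)

lemma L2_minus: "L2 f \<Longrightarrow> L2 (\<lambda>x. - f x)"
  using L2_scaleR[of f "-1"] by simp

lemma L2_diff:
  assumes "L2 f" "L2 g" shows "L2 (\<lambda>x. f x - g x)"
  using L2_add[OF assms(1) L2_minus[OF assms(2)]] by simp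

lemma L2_sum: "(\<And>i. i \<in> I \<Longrightarrow> L2 (f i)) \<Longrightarrow> L2 (\<lambda>x. \<Sum>i\<in>I. f i x)"
  by (induction I rule: infinite_finite_induct) (auto intro: L2_add)

lemma L2_norm: "L2 f \<Longrightarrow> L2 (\<lambda>x. norm (f x))"
  by (auto simp: L2_iff)

lemma L2_bounded_mult:
  fixes f :: "'a::euclidean_space \<Rightarrow> 'b::{banach, second_countable_topology}"
  assumes "L2 f" "m \<in> borel_measurable lborel" "\<And>x. \<bar>m x\<bar> \<le> B"
  shows "L2 (\<lambda>x. m x *\<^sub>R f x)"
  by (rule L2_bound[OF assms(1), of _ B]) (use assms in \<open>auto simp: L2_def intro!: mult_right_mono\<close>)

lemma L2_bounded_mult_real:
  fixes f :: "'a::euclidean_space \<Rightarrow> real"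
  assumes "L2 f" "m \<in> borel_measurable lborel" "\<And>x. \<bar>m x\<bar> \<le> B"
  shows "L2 (\<lambda>x. m x * f x)"
  using L2_bounded_mult[OF assms] by simp

lemma L2_prod_integrable:
  fixes f g :: "'a::euclidean_space \<Rightarrow> 'b::{banach, second_countable_topology, real_normed_div_algebra}"
  assumes "L2 f" "L2 g" shows "integrable lborel (\<lambda>x. f x * g x)"
proof (rule Bochner_Integration.integrable_bound)
  show "integrable lborel (\<lambda>x. (norm (f x))\<^sup>2 + (norm (g x))\<^sup>2)"
    using assms by (auto simp: L2_iff)
  show "(\<lambda>x. f x * g x) \<in> borel_measurable lborel"
    using assms by (auto simp: L2_def)
  have "norm (a * b) \<le> norm ((norm a)\<^sup>2 + (norm b)\<^sup>2)" for a b :: 'b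
  proof -
    have "2 * norm a * norm b \<le> (norm a)\<^sup>2 + (norm b)\<^sup>2" by (rule sum_squares_bound)
    moreover have "0 \<le> norm a * norm b" by simp
    ultimately have "norm a * norm b \<le> (norm a)\<^sup>2 + (norm b)\<^sup>2" by linarith
    then show ?thesis by (simp add: norm_mult)
  qed
  then show "AE x in lborel. norm (f x * g x) \<le> norm ((norm (f x))\<^sup>2 + (norm (g x))\<^sup>2)" by auto
qed

text \<open>The polynomial t -> ||f - t g||^2 is nonnegative, and its value at the minimiser t = B /
  C is the claim. If C = 0, then g vanishes almost everywhere, hence so does the product.\<close>

lemma L2_cauchy_schwarz_real:
  fixes f g :: "'a::euclidean_space \<Rightarrow> real"
  assumes "L2 f" "L2 g"
  shows "\<bar>LINT x|lborel. f x * g x\<bar> \<le> sqrt (L2sq f) * sqrt (L2sq g)"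
proof -
  define A where "A = L2sq f"
  define B where "B = (LINT x|lborel. f x * g x)"
  define C where "C = L2sq g"
  have fg: "integrable lborel (\<lambda>x. f x * g x)" and f2: "integrable lborel (\<lambda>x. (f x)\<^sup>2)" 
    and g2: "integrable lborel (\<lambda>x. (g x)\<^sup>2)"
    using assms L2_prod_integrable[OF assms] by (auto simp: L2_iff)
  have q: "0 \<le> A - 2 * t * B + t\<^sup>2 * C" for t
  proof -
    have "0 \<le> (LINT x|lborel. (f x - t * g x)\<^sup>2)" by simp
    also have "(\<lambda>x. (f x - t * g x)\<^sup>2) = (\<lambda>x. (f x)\<^sup>2 - 2 * t * (f x * g x) + t\<^sup>2 * (g x)\<^sup>2)"
      by (auto simp: power2_diff power_mult_distrib algebra_simps)
    also have "(LINT x|lborel. (f x)\<^sup>2 - 2 * t * (f x * g x) + t\<^sup>2 * (g x)\<^sup>2) = A - 2 * t * B + t\<^sup>2 * C"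
      using fg f2 g2 by (simp add: A_def B_def C_def L2sq_def)
    finally show ?thesis .
  qed
  have "B\<^sup>2 \<le> A * C"
  proof (cases "C = 0")
    case True
    then have "AE x in lborel. (g x)\<^sup>2 = 0"
      using integral_nonneg_eq_0_iff_AE[OF g2] by (simp add: C_def L2sq_def)
    then have "B = (LINT x|(lborel :: 'a measure). 0)"
      unfolding B_def by (intro integral_cong_AE) (use assms in \<open>auto simp: L2_def\<close>)
    then show ?thesis using True by simp
  next
    case False
    then have "0 < C" by (simp add: C_def less_le)
    then show ?thesis using q[of "B / C"] by (simp add: field_simps power2_eq_square)
  qed
  then have "\<bar>B\<bar> \<le> sqrt (A * C)" by (simp add: real_le_rsqrt abs_le_square_iff)
  then show ?thesis by (simp add: A_def B_def C_def real_sqrt_mult)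
qed

lemma L2_cauchy_schwarz:
  fixes f g :: "'a::euclidean_space \<Rightarrow> 'b::{banach, second_countable_topology, real_normed_div_algebra}"
  assumes "L2 f" "L2 g"
  shows "norm (LINT x|lborel. f x * g x) \<le> sqrt (L2sq f) * sqrt (L2sq g)"
proof -
  have "norm (LINT x|lborel. f x * g x) \<le> (LINT x|lborel. norm (f x * g x))" by (rule integral_norm_bound)
  also have "\<dots> = (LINT x|lborel. norm (f x) * norm (g x))" by (simp add: norm_mult)
  also have "\<dots> \<le> sqrt (L2sq (\<lambda>x. norm (f x))) * sqrt (L2sq (\<lambda>x. norm (g x)))"
    using L2_cauchy_schwarz_real[OF L2_norm[OF assms(1)] L2_norm[OF assms(2)]] by linarith
  finally show ?thesis by (simp add: L2sq_def)
qed

lemma L2sq_triangle: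
  assumes "L2 f" "L2 g"
  shows "sqrt (L2sq (\<lambda>x. f x + g x)) \<le> sqrt (L2sq f) + sqrt (L2sq g)"
proof -
  note L = L2_norm[OF assms(1)] L2_norm[OF assms(2)]
  have "L2sq (\<lambda>x. f x + g x) \<le> (LINT x|lborel. (norm (f x))\<^sup>2 + 2 * (norm (f x) * norm (g x)) + (norm (g x))\<^sup>2)"
    unfolding L2sq_def
  proof (rule integral_mono)
    show "integrable lborel (\<lambda>x. (norm (f x + g x))\<^sup>2)" using L2_integrable[OF L2_add[OF assms]] .
    show "integrable lborel (\<lambda>x. (norm (f x))\<^sup>2 + 2 * (norm (f x) * norm (g x)) + (norm (g x))\<^sup>2)"
      using L2_integrable[OF assms(1)] L2_integrable[OF assms(2)] L2_prod_integrable[OF L] by simp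
    show "(norm (f x + g x))\<^sup>2 \<le> (norm (f x))\<^sup>2 + 2 * (norm (f x) * norm (g x)) + (norm (g x))\<^sup>2" for x
      using power_mono[OF norm_triangle_ineq[of "f x" "g x"], of 2] by (simp add: power2_sum algebra_simps)
  qed
  also have "\<dots> = L2sq f + 2 * (LINT x|lborel. norm (f x) * norm (g x)) + L2sq g"
    using L2_integrable[OF assms(1)] L2_integrable[OF assms(2)] L2_prod_integrable[OF L] by (simp add: L2sq_def)
  also have "\<dots> \<le> L2sq f + 2 * (sqrt (L2sq f) * sqrt (L2sq g)) + L2sq g"
    using L2_cauchy_schwarz_real[OF L] by (simp add: L2sq_def abs_le_iff)
  also have "\<dots> = (sqrt (L2sq f) + sqrt (L2sq g))\<^sup>2" by (simp add: power2_sum)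
  finally show ?thesis by (simp add: real_le_lsqrt)
qed

lemma L2sq_minus: "L2sq (\<lambda>x. - f x) = L2sq f"
  by (simp add: L2sq_def)

lemma L2sq_diff_commute: "L2sq (\<lambda>x. f x - g x) = L2sq (\<lambda>x. g x - f x)"
  by (simp add: L2sq_def norm_minus_commute)

lemma L2sq_cmult:
  fixes f :: "'a::euclidean_space \<Rightarrow> 'b::{banach, second_countable_topology, real_normed_div_algebra}"
  shows "L2sq (\<lambda>x. c * f x) = (norm c)\<^sup>2 * L2sq f"
  by (simp add: L2sq_def norm_mult power_mult_distrib)

lemma L2sq_add_le:
  assumes "L2 f" "L2 g"
  shows "L2sq (\<lambda>x. f x + g x) \<le> 2 * L2sq f + 2 * L2sq g"
proof -
  have "L2sq (\<lambda>x. f x + g x) \<le> (LINT x|lborel. 2 * (norm (f x))\<^sup>2 + 2 * (norm (g x))\<^sup>2)"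
    unfolding L2sq_def
    using L2_integrable[OF assms(1)] L2_integrable[OF assms(2)] L2_integrable[OF L2_add[OF assms]] power2_norm_add_le
    by (intro integral_mono) auto
  also have "\<dots> = 2 * L2sq f + 2 * L2sq g"
    using L2_integrable[OF assms(1)] L2_integrable[OF assms(2)] by (simp add: L2sq_def)
  finally show ?thesis .
qed

lemma L2sq_eq_0_iff:
  assumes "L2 f" shows "L2sq f = 0 \<longleftrightarrow> (AE x in lborel. f x = 0)"
  unfolding L2sq_def using integral_nonneg_eq_0_iff_AE[OF L2_integrable[OF assms]] by simp

text \<open>Membership of every term and of the limit is part of the notion because
  \<open>L2sq\<close> is a Bochner integral, with value 0 when the square is not integrable.
  Convergence of these real numbers alone would carry no information.\<close>

definition L2_tendsto :: "(nat \<Rightarrow> 'a::euclidean_space \<Rightarrow> 'b::{banach, second_countable_topology}) \<Rightarrow> ('a \<Rightarrow> 'b) \<Rightarrow> bool" where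
  "L2_tendsto F f \<longleftrightarrow> (\<forall>n. L2 (F n)) \<and> L2 f \<and> (\<lambda>n. L2sq (\<lambda>x. F n x - f x)) \<longlonglongrightarrow> 0"

lemma L2_tendsto_L2: "L2_tendsto F f \<Longrightarrow> L2 (F n)" "L2_tendsto F f \<Longrightarrow> L2 f"
  by (auto simp: L2_tendsto_def)

lemma L2_tendsto_sqrt: "L2_tendsto F f \<Longrightarrow> (\<lambda>n. sqrt (L2sq (\<lambda>x. F n x - f x))) \<longlonglongrightarrow> 0"
  using tendsto_real_sqrt[of _ 0] by (force simp: L2_tendsto_def)

lemma L2_tendsto_add:
  assumes "L2_tendsto F f" "L2_tendsto G g"
  shows "L2_tendsto (\<lambda>n x. F n x + G n x) (\<lambda>x. f x + g x)"
proof -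
  note L = assms[unfolded L2_tendsto_def]
  have "(\<lambda>n. L2sq (\<lambda>x. F n x + G n x - (f x + g x))) \<longlonglongrightarrow> 0"
  proof (rule tendsto_sandwich[OF _ _ tendsto_const])
    show "\<forall>\<^sub>F n in sequentially. L2sq (\<lambda>x. F n x + G n x - (f x + g x)) \<le>
        2 * L2sq (\<lambda>x. F n x - f x) + 2 * L2sq (\<lambda>x. G n x - g x)"
    proof (rule always_eventually, rule allI)
      fix n
      show "L2sq (\<lambda>x. F n x + G n x - (f x + g x)) \<le> 2 * L2sq (\<lambda>x. F n x - f x) + 2 * L2sq (\<lambda>x. G n x - g x)"
        using L2sq_add_le[OF L2_diff L2_diff, of "F n" f "G n" g] L by (simp add: add_diff_add)
    qed
    show "(\<lambda>n. 2 * L2sq (\<lambda>x. F n x - f x) + 2 * L2sq (\<lambda>x. G n x - g x)) \<longlonglongrightarrow> 0"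
      using L by (auto intro!: tendsto_eq_intros)
  qed simp
  then show ?thesis using L by (auto simp: L2_tendsto_def intro: L2_add)
qed

lemma L2_tendsto_cmult:
  fixes F :: "nat \<Rightarrow> 'a::euclidean_space \<Rightarrow> 'b::{banach, second_countable_topology, real_normed_div_algebra}"
  assumes "L2_tendsto F f"
  shows "L2_tendsto (\<lambda>n x. c * F n x) (\<lambda>x. c * f x)"
proof -
  have "(\<lambda>n. L2sq (\<lambda>x. c * (F n x - f x))) \<longlonglongrightarrow> 0"
    unfolding L2sq_cmult using assms by (auto simp: L2_tendsto_def intro!: tendsto_eq_intros)
  then show ?thesis using assms by (auto simp: L2_tendsto_def algebra_simps intro!: L2_cmult)
qed

text \<open>Transports convergence through any pointwise Lipschitz operation, such as conjugation or
  multiplication by a bounded function. Membership of the single term \<open>G 0\<close> suffices: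
  every difference \<open>G n - g\<close> is dominated, so \<open>g\<close> and then all
  \<open>G n\<close> are recovered from it.\<close>

lemma L2_tendsto_bound:
  assumes "L2_tendsto F f" "\<And>n. G n \<in> borel_measurable lborel" "g \<in> borel_measurable lborel"
    "L2 (G 0)" "\<And>n. AE x in lborel. norm (G n x - g x) \<le> c * norm (F n x - f x)"
  shows "L2_tendsto G g"
proof -
  note L = assms(1)[unfolded L2_tendsto_def]
  have d: "L2 (\<lambda>x. G n x - g x)" for n
    by (rule L2_bound[of "\<lambda>x. F n x - f x" _ c]) (use L assms in \<open>auto intro: L2_diff\<close>)
  have g: "L2 g" using L2_diff[OF assms(4) d[of 0]] by simp
  have "L2 (G n)" for n using L2_add[OF d[of n] g] by simp
  moreover have "(\<lambda>n. L2sq (\<lambda>x. G n x - g x)) \<longlonglongrightarrow> 0"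
  proof (rule tendsto_sandwich[OF _ _ tendsto_const])
    show "(\<lambda>n. c\<^sup>2 * L2sq (\<lambda>x. F n x - f x)) \<longlonglongrightarrow> 0"
      using L by (auto intro!: tendsto_eq_intros)
    show "\<forall>\<^sub>F n in sequentially. L2sq (\<lambda>x. G n x - g x) \<le> c\<^sup>2 * L2sq (\<lambda>x. F n x - f x)"
    proof (rule always_eventually, rule allI)
      fix n
      have "L2sq (\<lambda>x. G n x - g x) \<le> (LINT x|lborel. c\<^sup>2 * (norm (F n x - f x))\<^sup>2)"
        unfolding L2sq_def
      proof (rule integral_mono_AE)
        show "integrable lborel (\<lambda>x. c\<^sup>2 * (norm (F n x - f x))\<^sup>2)"
          using L2_integrable[of "\<lambda>x. F n x - f x"] L by (auto intro: L2_diff)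
        show "AE x in lborel. (norm (G n x - g x))\<^sup>2 \<le> c\<^sup>2 * (norm (F n x - f x))\<^sup>2"
          using assms(5)[of n] by eventually_elim
            (auto simp: power_mult_distrib[symmetric] simp del: power_mult_distrib intro!: power_mono)
      qed (use L2_integrable[OF d] in auto)
      then show "L2sq (\<lambda>x. G n x - g x) \<le> c\<^sup>2 * L2sq (\<lambda>x. F n x - f x)" by (simp add: L2sq_def)
    qed
  qed simp
  ultimately show ?thesis using g by (simp add: L2_tendsto_def)
qed

lemma L2_tendsto_sqrt_L2sq:
  assumes "L2_tendsto F f"
  shows "(\<lambda>n. sqrt (L2sq (F n))) \<longlonglongrightarrow> sqrt (L2sq f)"
proof -
  note L = assms[unfolded L2_tendsto_def]
  have "\<bar>sqrt (L2sq (F n)) - sqrt (L2sq f)\<bar> \<le> sqrt (L2sq (\<lambda>x. F n x - f x))" for n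
    using L2sq_triangle[of "\<lambda>x. F n x - f x" f] L2sq_triangle[of "\<lambda>x. f x - F n x" "F n"] L
    by (auto simp: L2_diff L2sq_diff_commute[of f] abs_le_iff)
  then have "(\<lambda>n. sqrt (L2sq (F n)) - sqrt (L2sq f)) \<longlonglongrightarrow> 0"
    by (intro Lim_null_comparison[OF _ L2_tendsto_sqrt[OF assms]]) auto
  then show ?thesis by (rule LIM_zero_cancel)
qed

lemma L2_tendsto_L2sq:
  assumes "L2_tendsto F f"
  shows "(\<lambda>n. L2sq (F n)) \<longlonglongrightarrow> L2sq f"
  using tendsto_power[OF L2_tendsto_sqrt_L2sq[OF assms], of 2] by simp

text \<open>The difference splits as (F n - f) G n + f (G n - g), and Cauchy-Schwarz applies to each
  half; the norms of \<open>G n\<close> converge, so the first product tends to 0.\<close>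

lemma L2_tendsto_integral_mult:
  fixes F G :: "nat \<Rightarrow> 'a::euclidean_space \<Rightarrow> 'b::{banach, second_countable_topology, real_normed_field}"
  assumes "L2_tendsto F f" "L2_tendsto G g"
  shows "(\<lambda>n. LINT x|lborel. F n x * G n x) \<longlonglongrightarrow> (LINT x|lborel. f x * g x)"
proof -
  note L = assms[unfolded L2_tendsto_def]
  have "(LINT x|lborel. F n x * G n x) - (LINT x|lborel. f x * g x)
      = (LINT x|lborel. (F n x - f x) * G n x) + (LINT x|lborel. f x * (G n x - g x))" for n
    using L by (simp add: algebra_simps L2_prod_integrable)
  moreover have "norm ((LINT x|lborel. (F n x - f x) * G n x) + (LINT x|lborel. f x * (G n x - g x)))
     \<le> sqrt (L2sq (\<lambda>x. F n x - f x)) * sqrt (L2sq (G n)) + sqrt (L2sq f) * sqrt (L2sq (\<lambda>x. G n x - g x))" for n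
    using L by (intro order_trans[OF norm_triangle_ineq] add_mono L2_cauchy_schwarz) (auto intro: L2_diff)
  moreover have "(\<lambda>n. sqrt (L2sq (\<lambda>x. F n x - f x)) * sqrt (L2sq (G n)) + sqrt (L2sq f) * sqrt (L2sq (\<lambda>x. G n x - g x))) \<longlonglongrightarrow> 0"
    using tendsto_add[OF tendsto_mult[OF L2_tendsto_sqrt[OF assms(1)] L2_tendsto_sqrt_L2sq[OF assms(2)]]
      tendsto_mult[OF tendsto_const L2_tendsto_sqrt[OF assms(2)]]] by simp
  ultimately have "(\<lambda>n. (LINT x|lborel. F n x * G n x) - (LINT x|lborel. f x * g x)) \<longlonglongrightarrow> 0"
    by (simp only:) (rule Lim_null_comparison, rule always_eventually, rule allI, assumption+)
  then show ?thesis by (rule LIM_zero_cancel)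
qed

lemma L2_tendsto_unique:
  assumes "L2_tendsto F f" "L2_tendsto F g"
  shows "AE x in lborel. f x = g x"
proof -
  note L = assms[unfolded L2_tendsto_def]
  have "L2_tendsto (\<lambda>n x. F n x - F n x) (\<lambda>x. f x - g x)"
  proof -
    have "L2_tendsto (\<lambda>n x. - F n x) (\<lambda>x. - g x)"
      by (rule L2_tendsto_bound[OF assms(2), of _ _ 1])
        (use L in \<open>auto intro: L2_minus simp: norm_minus_commute L2_def\<close>)
    from L2_tendsto_add[OF assms(1) this] show ?thesis by simp
  qed
  then have "L2sq (\<lambda>x. f x - g x) = 0"
    using L2_tendsto_L2sq LIMSEQ_unique[OF _ tendsto_const] by (fastforce simp: L2sq_def)
  then show ?thesis using L by (subst (asm) L2sq_eq_0_iff) (auto intro: L2_diff)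
qed

text \<open>Along a rapidly converging subsequence, $\sum_k 2^k \|f_{k+1}-f_k\|^2$ is integrable, so the
  increments are pointwise dominated by a geometric series.\<close>

lemma L2_complete:
  fixes F :: "nat \<Rightarrow> 'a::euclidean_space \<Rightarrow> 'b::{banach, second_countable_topology}"
  assumes L: "\<And>n. L2 (F n)" and a: "a \<longlonglongrightarrow> (0::real)"
    and C: "\<And>m n. n \<le> m \<Longrightarrow> L2sq (\<lambda>x. F m x - F n x) \<le> a n"
  shows "\<exists>f. L2_tendsto F f"
proof -
  have [measurable]: "F n \<in> borel_measurable lborel" for n using L by (simp add: L2_def)
  have "\<exists>r. \<forall>n\<ge>r. \<bar>a n\<bar> < (1/4) ^ k" for k :: nat
    using a by (auto simp: LIMSEQ_def dist_real_def)
  then obtain r0 where r0: "\<And>k n. n \<ge> r0 k \<Longrightarrow> \<bar>a n\<bar> < (1/4) ^ k" by metis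
  \<comment> \<open>The sum makes \<open>r\<close> nondecreasing and at least \<open>r0 k\<close>,
    so that increments are controlled by \<open>(1/4) ^ k\<close>; the summand \<open>k\<close>
    forces \<open>r k\<close> to infinity.\<close>
  define r where "r k = (\<Sum>i\<le>k. r0 i) + k" for k
  have r_ge: "r0 k \<le> r k" for k
    unfolding r_def by (simp add: member_le_sum trans_le_add1)
  have r_k: "k \<le> r k" for k by (simp add: r_def)
  have r_Suc: "r k \<le> r (Suc k)" for k by (simp add: r_def)
  define D where "D k x = F (r (Suc k)) x - F (r k) x" for k x
  have [measurable]: "D k \<in> borel_measurable lborel" for k unfolding D_def by measurable
  have D: "(\<integral>\<^sup>+ x. ennreal (2 ^ k * (norm (D k x))\<^sup>2) \<partial>lborel) \<le> ennreal ((1/2) ^ k)" for k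
  proof -
    have "L2 (D k)" unfolding D_def by (intro L2_diff L)
    have "L2sq (D k) \<le> a (r k)" unfolding D_def by (rule C[OF r_Suc])
    also have "\<dots> \<le> (1/4) ^ k" using r0[OF r_ge[of k]] by linarith
    finally have "2 ^ k * L2sq (D k) \<le> 2 ^ k * (1/4) ^ k" by simp
    also have "\<dots> = (2 * (1/4)) ^ k" by (rule power_mult_distrib[symmetric])
    also have "\<dots> = (1/2) ^ k" by simp
    finally have "ennreal (2 ^ k * L2sq (D k)) \<le> ennreal ((1/2) ^ k)" by (rule ennreal_leI)
    moreover have "(\<integral>\<^sup>+ x. ennreal (2 ^ k * (norm (D k x))\<^sup>2) \<partial>lborel) = ennreal (2 ^ k * L2sq (D k))"
      using nn_integral_L2sq[OF \<open>L2 (D k)\<close>]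
      by (simp add: ennreal_mult nn_integral_cmult)
    ultimately show ?thesis by simp
  qed
  have "(\<integral>\<^sup>+ x. (\<Sum>k. ennreal (2 ^ k * (norm (D k x))\<^sup>2)) \<partial>lborel) = (\<Sum>k. \<integral>\<^sup>+ x. ennreal (2 ^ k * (norm (D k x))\<^sup>2) \<partial>lborel)"
    by (rule nn_integral_suminf) measurable
  also have "\<dots> \<le> (\<Sum>k. ennreal ((1/2) ^ k))" by (intro suminf_le D) auto
  also have "\<dots> = ennreal (\<Sum>k. (1/2) ^ k)"
    by (rule suminf_ennreal2) (auto intro!: summable_geometric)
  also have "\<dots> < \<infinity>" by (rule ennreal_less_top[folded infinity_ennreal_def])
  finally have "AE x in lborel. (\<Sum>k. ennreal (2 ^ k * (norm (D k x))\<^sup>2)) \<noteq> \<infinity>"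
    by (intro nn_integral_noteq_infinite) auto
  then have conv: "AE x in lborel. convergent (\<lambda>k. F (r k) x)"
  proof eventually_elim
    case (elim x)
    have "summable (\<lambda>k. 2 ^ k * (norm (D k x))\<^sup>2)"
      using elim by (intro summable_suminf_not_top) auto
    then have "(\<lambda>k. 2 ^ k * (norm (D k x))\<^sup>2) \<longlonglongrightarrow> 0" by (rule summable_LIMSEQ_zero)
    then have "Bseq (\<lambda>k. 2 ^ k * (norm (D k x))\<^sup>2)" by (intro convergent_imp_Bseq convergentI)
    then obtain K where K: "K > 0" "\<And>k. norm (2 ^ k * (norm (D k x))\<^sup>2) \<le> K" by (auto simp: Bseq_def)
    have b: "norm (D k x) \<le> sqrt K * (1 / sqrt 2) ^ k" for k
    proof -
      have "(sqrt 2 ^ k * norm (D k x))\<^sup>2 = ((sqrt 2)\<^sup>2) ^ k * (norm (D k x))\<^sup>2"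
        unfolding power_mult_distrib power_mult[symmetric] by (simp only: mult.commute)
      also have "\<dots> = 2 ^ k * (norm (D k x))\<^sup>2" by simp
      also have "\<dots> \<le> K" using K(2)[of k] by simp
      finally have "sqrt 2 ^ k * norm (D k x) \<le> sqrt K" by (rule real_le_rsqrt)
      then show ?thesis by (simp add: field_simps power_divide)
    qed
    have "summable (\<lambda>k. sqrt K * (1 / sqrt 2) ^ k)"
      by (intro summable_mult summable_geometric) simp
    then have "summable (\<lambda>k. D k x)"
      by (rule summable_comparison_test'[where N=0]) (use b in auto)
    then have "convergent (\<lambda>n. \<Sum>k<n. D k x)" by (simp add: summable_iff_convergent)
    moreover have "(\<Sum>k<n. D k x) = F (r n) x - F (r 0) x" for n
      unfolding D_def by (induction n) auto
    ultimately have "convergent (\<lambda>n. (F (r n) x - F (r 0) x) + F (r 0) x)"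
      by (intro convergent_add convergent_const) simp
    then show ?case by simp
  qed
  define f where "f x = lim (\<lambda>k. F (r k) x)" for x
  have [measurable]: "f \<in> borel_measurable lborel"
    unfolding f_def by measurable
  have lim: "AE x in lborel. (\<lambda>k. F (r k) x) \<longlonglongrightarrow> f x"
    using conv by eventually_elim (simp add: f_def convergent_LIMSEQ_iff)
  \<comment> \<open>Fatou's lemma along the subsequence passes the Cauchy bound between
    \<open>F n\<close> and \<open>F (r k)\<close> on to \<open>F n\<close> and \<open>f\<close>.
    This gives convergence of the full sequence, with the same rate.\<close>
  have bd: "(\<integral>\<^sup>+ x. ennreal ((norm (F n x - f x))\<^sup>2) \<partial>lborel) \<le> ennreal (a n)" for n
  proof -
    have "(\<integral>\<^sup>+ x. ennreal ((norm (F n x - f x))\<^sup>2) \<partial>lborel)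
        = (\<integral>\<^sup>+ x. liminf (\<lambda>k. ennreal ((norm (F n x - F (r k) x))\<^sup>2)) \<partial>lborel)"
    proof (rule nn_integral_cong_AE)
      show "AE x in lborel. ennreal ((norm (F n x - f x))\<^sup>2) = liminf (\<lambda>k. ennreal ((norm (F n x - F (r k) x))\<^sup>2))"
        using lim
      proof eventually_elim
        case (elim x)
        have "(\<lambda>k. ennreal ((norm (F n x - F (r k) x))\<^sup>2)) \<longlonglongrightarrow> ennreal ((norm (F n x - f x))\<^sup>2)"
          using elim by (intro tendsto_intros) 
        then show ?case by (metis lim_imp_Liminf sequentially_bot)
      qed
    qed
    also have "\<dots> \<le> liminf (\<lambda>k. \<integral>\<^sup>+ x. ennreal ((norm (F n x - F (r k) x))\<^sup>2) \<partial>lborel)"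
      by (rule nn_integral_liminf) measurable
    also have "\<dots> \<le> ennreal (a n)"
    proof -
      have "\<forall>\<^sub>F k in sequentially. (\<integral>\<^sup>+ x. ennreal ((norm (F n x - F (r k) x))\<^sup>2) \<partial>lborel) \<le> ennreal (a n)"
        using eventually_ge_at_top[of n]
      proof eventually_elim
        case (elim k)
        then have "n \<le> r k" using r_k[of k] by linarith
        from C[OF this] have "L2sq (\<lambda>x. F n x - F (r k) x) \<le> a n" by (simp add: L2sq_diff_commute[of "F n"])
        then show ?case using nn_integral_L2sq[OF L2_diff[OF L[of n] L[of "r k"]]] by (simp add: ennreal_leI)
      qed
      then show ?thesis by (intro Liminf_le) auto
    qed
    finally show ?thesis .
  qed
  have "a n \<ge> 0" for n using C[of n n] L2sq_nonneg[of "\<lambda>x. F n x - F n x"] by linarith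
  have d: "L2 (\<lambda>x. F n x - f x)" for n
    using le_less_trans[OF bd[of n]] by (auto simp: L2_def)
  have "L2 f" using L2_diff[OF L[of 0] d[of 0]] by simp
  have "L2sq (\<lambda>x. F n x - f x) \<le> a n" for n
    using bd[of n] nn_integral_L2sq[OF d[of n]] \<open>a n \<ge> 0\<close> by simp
  then have "(\<lambda>n. L2sq (\<lambda>x. F n x - f x)) \<longlonglongrightarrow> 0"
    by (intro tendsto_sandwich[OF _ _ tendsto_const a]) auto
  then show ?thesis using L \<open>L2 f\<close> by (auto simp: L2_tendsto_def)
qed

section \<open>Integration on Euclidean space\<close>

lemma nn_integral_affine:
  fixes t :: "'a::euclidean_space" and c :: real and f :: "'a \<Rightarrow> ennreal"
  assumes c: "c \<noteq> 0" and [measurable]: "f \<in> borel_measurable lborel"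
  shows "(\<integral>\<^sup>+ x. f x \<partial>lborel) = ennreal (\<bar>c\<bar> ^ DIM('a)) * (\<integral>\<^sup>+ x. f (t + c *\<^sub>R x) \<partial>lborel)"
proof -
  have [measurable]: "(\<lambda>x. t + c *\<^sub>R x) \<in> borel_measurable borel" by measurable
  have [measurable]: "f \<in> borel_measurable borel" using assms by simp
  show ?thesis
    by (subst lborel_affine[OF c, of t]) 
      (simp add: nn_integral_density nn_integral_distr nn_integral_cmult)
qed

lemma integrable_affine:
  fixes t :: "'a::euclidean_space" and c :: real and g :: "'a \<Rightarrow> 'b::{banach, second_countable_topology}"
  assumes c: "c \<noteq> 0" and g: "integrable lborel g"
  shows "integrable lborel (\<lambda>x. g (t + c *\<^sub>R x))"
proof -
  have [measurable]: "(\<lambda>x. t + c *\<^sub>R x) \<in> borel_measurable borel" by measurable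
  have [measurable]: "g \<in> borel_measurable borel" using g by simp
  have "(\<integral>\<^sup>+ x. ennreal (norm (g x)) \<partial>lborel) < \<infinity>" using g by (simp add: integrable_iff_bounded)
  then have "(\<integral>\<^sup>+ x. ennreal (norm (g (t + c *\<^sub>R x))) \<partial>lborel) < \<infinity>"
    using c nn_integral_affine[OF c, of "\<lambda>x. ennreal (norm (g x))" t] by (auto simp: ennreal_mult_less_top)
  then show ?thesis by (simp add: integrable_iff_bounded)
qed

lemma integrable_affine_iff:
  fixes t :: "'a::euclidean_space" and g :: "'a \<Rightarrow> 'b::{banach, second_countable_topology}"
  assumes c: "c \<noteq> 0"
  shows "integrable lborel (\<lambda>x. g (t + c *\<^sub>R x)) \<longleftrightarrow> integrable lborel g"
  using integrable_affine[OF c, of g t] 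
    integrable_affine[of "1/c" "\<lambda>x. g (t + c *\<^sub>R x)" "- (1 / c) *\<^sub>R t"] c
  by (auto simp: algebra_simps)

text \<open>Holds for every g: integrability is invariant under the affine map, and if it fails both
  sides are 0 by convention. Later changes of variables therefore need no side condition.\<close>

lemma integral_affine:
  fixes t :: "'a::euclidean_space" and g :: "'a \<Rightarrow> 'b::{banach, second_countable_topology}"
  assumes c: "c \<noteq> 0"
  shows "(LINT x|lborel. g x) = \<bar>c\<bar> ^ DIM('a) *\<^sub>R (LINT x|lborel. g (t + c *\<^sub>R x))"
proof (cases "integrable lborel g")
  case True
  then have [measurable]: "g \<in> borel_measurable borel" by simp
  have [measurable]: "(\<lambda>x. t + c *\<^sub>R x) \<in> borel_measurable borel" by measurable
  show ?thesis
    using integrable_affine[OF c True, of t]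
    by (subst lborel_affine[OF c, of t]) (simp add: integral_density integral_distr)
next
  case False
  then show ?thesis using integrable_affine_iff[OF c, of g t] by (simp add: not_integrable_integral_eq)
qed

lemma integral_translate:
  fixes t :: "'a::euclidean_space" and g :: "'a \<Rightarrow> 'b::{banach, second_countable_topology}"
  shows "(LINT x|lborel. g (x + t)) = (LINT x|lborel. g x)"
  using integral_affine[of 1 g t] by (simp add: add.commute)

lemma integrable_translate:
  fixes t :: "'a::euclidean_space" and g :: "'a \<Rightarrow> 'b::{banach, second_countable_topology}"
  shows "integrable lborel g \<Longrightarrow> integrable lborel (\<lambda>x. g (x + t))"
  using integrable_affine[of 1 g t] by (simp add: add.commute)

lemma
  fixes t :: "'a::euclidean_space" and g :: "'a \<Rightarrow> 'b::{banach, second_countable_topology}"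
  shows integral_reflect: "(LINT x|lborel. g (t - x)) = (LINT x|lborel. g x)"
    and integrable_reflect: "integrable lborel g \<Longrightarrow> integrable lborel (\<lambda>x. g (t - x))"
  using integral_affine[of "-1" g t] integrable_affine[of "-1" g t] by simp_all

lemma nn_integral_reflect:
  fixes t :: "'a::euclidean_space"
  assumes "f \<in> borel_measurable lborel"
  shows "(\<integral>\<^sup>+ x. f (t - x) \<partial>lborel) = (\<integral>\<^sup>+ x. f x \<partial>lborel)"
  using nn_integral_affine[of "-1" f t] assms by simp

lemma nn_integral_translate:
  fixes t :: "'a::euclidean_space"
  assumes "f \<in> borel_measurable lborel"
  shows "(\<integral>\<^sup>+ x. f (x - t) \<partial>lborel) = (\<integral>\<^sup>+ x. f x \<partial>lborel)"
  using nn_integral_affine[of "1" f "-t"] assms by (simp add: algebra_simps)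

lemma integrable_pairI:
  fixes f :: "'a::euclidean_space \<Rightarrow> 'b::euclidean_space \<Rightarrow> 'c::{banach, second_countable_topology}"
  assumes [measurable]: "(\<lambda>(x, y). f x y) \<in> borel_measurable (lborel \<Otimes>\<^sub>M lborel)"
    and fin: "(\<integral>\<^sup>+ x. \<integral>\<^sup>+ y. ennreal (norm (f x y)) \<partial>lborel \<partial>lborel) < \<infinity>"
  shows "integrable (lborel \<Otimes>\<^sub>M lborel) (\<lambda>(x, y). f x y)"
proof (rule integrableI_bounded)
  have "(\<lambda>(x, y). ennreal (norm (f x y))) = (\<lambda>z. ennreal (norm ((\<lambda>(x, y). f x y) z)))" by auto
  also have "\<dots> \<in> borel_measurable (lborel \<Otimes>\<^sub>M lborel)" by measurable
  finally have m: "(\<lambda>(x, y). ennreal (norm (f x y))) \<in> borel_measurable (lborel \<Otimes>\<^sub>M lborel)" .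
  have "(\<integral>\<^sup>+ z. ennreal (norm (case z of (x, y) \<Rightarrow> f x y)) \<partial>(lborel \<Otimes>\<^sub>M lborel)) =
     (\<integral>\<^sup>+ z. (\<lambda>(x, y). ennreal (norm (f x y))) z \<partial>(lborel \<Otimes>\<^sub>M lborel))"
    by (intro nn_integral_cong) auto
  also have "\<dots> = (\<integral>\<^sup>+ x. \<integral>\<^sup>+ y. ennreal (norm (f x y)) \<partial>lborel \<partial>lborel)"
    using lborel.nn_integral_fst[OF m] by simp
  finally show "(\<integral>\<^sup>+ z. ennreal (norm (case z of (x, y) \<Rightarrow> f x y)) \<partial>(lborel \<Otimes>\<^sub>M lborel)) < \<infinity>"
    using fin by simp
qed fact

text \<open>\<open>lborel\<close> is the image of a product of one-dimensional Lebesgue measures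
  under the map from coordinates to vectors. Gaussian integrals in any dimension are thereby reduced
  to dimension one.\<close>

lemma
  fixes f :: "'a::euclidean_space \<Rightarrow> real \<Rightarrow> 'b::{real_normed_field, banach, second_countable_topology}"
  assumes "\<And>b. b \<in> Basis \<Longrightarrow> integrable lborel (f b)"
  shows integrable_lborel_prod: "integrable lborel (\<lambda>x. \<Prod>b\<in>Basis. f b (x \<bullet> b))"
    and integral_lborel_prod: "(LINT x|lborel. (\<Prod>b\<in>Basis. f b (x \<bullet> b))) = (\<Prod>b\<in>Basis. LINT y|lborel. f b y)"
proof -
  interpret product_sigma_finite "\<lambda>_::'a. lborel :: real measure"
    by standard
  have [measurable]: "f b \<in> borel_measurable borel" if "b \<in> Basis" for b
    using borel_measurable_integrable[OF assms[OF that]] by simp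
  let ?T = "\<lambda>f. \<Sum>b\<in>Basis. f b *\<^sub>R (b::'a)"
  have T: "?T \<in> measurable (\<Pi>\<^sub>M b\<in>Basis. lborel) borel" by measurable
  have m: "(\<lambda>x. \<Prod>b\<in>Basis. f b (x \<bullet> b)) \<in> borel_measurable borel" by measurable
  have e: "(\<Prod>b\<in>Basis. f b (?T g \<bullet> b)) = (\<Prod>b\<in>Basis. f b (g b))" for g
    by (intro prod.cong refl) simp
  show "integrable lborel (\<lambda>x. \<Prod>b\<in>Basis. f b (x \<bullet> b))"
    unfolding lborel_eq[where 'a='a] integrable_distr_eq[OF T m] e
    by (intro product_integrable_prod assms) auto
  show "(LINT x|lborel. (\<Prod>b\<in>Basis. f b (x \<bullet> b))) = (\<Prod>b\<in>Basis. LINT y|lborel. f b y)"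
    unfolding lborel_eq[where 'a='a] integral_distr[OF T m] e
    by (intro product_integral_prod assms) auto
qed

section \<open>The heat kernel\<close>

lemma cis_sum: "finite I \<Longrightarrow> cis (\<Sum>i\<in>I. f i) = (\<Prod>i\<in>I. cis (f i))"
  by (induction I rule: finite_induct) (auto simp flip: cis_mult)

text \<open>The substitution y = c x with c = 1 / sqrt (2 l) gives l y^2 = x^2 / 2. The Gaussian
  becomes a multiple of the standard normal density, and the integral its characteristic function at
  - a c.\<close>

lemma gaussian_fourier_real:
  assumes l: "0 < l"
  shows "integrable lborel (\<lambda>y::real. cis (- (a * y)) * complex_of_real (exp (- l * y\<^sup>2)))"
    and "(LINT y|lborel. cis (- (a * y)) * complex_of_real (exp (- l * y\<^sup>2)))
           = complex_of_real (sqrt (pi / l) * exp (- a\<^sup>2 / (4 * l)))"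
proof -
  define c where "c = 1 / sqrt (2 * l)"
  have c: "c > 0" using l by (simp add: c_def)
  have c2: "c\<^sup>2 = 1 / (2 * l)" using l by (simp add: c_def power_divide)
  define h where "h y = cis (- (a * y)) * complex_of_real (exp (- l * y\<^sup>2))" for y
  have h: "h (0 + c * x) = complex_of_real (sqrt (2 * pi)) * (complex_of_real (std_normal_density x) * cis (- (a * c) * x))" for x
  proof -
    have "l * (c * x)\<^sup>2 = x\<^sup>2 / 2" using l by (simp add: power_mult_distrib c2)
    then have "exp (- (l * (c * x)\<^sup>2)) = sqrt (2 * pi) * std_normal_density x"
      by (simp add: std_normal_density_def)
    then show ?thesis by (simp add: h_def mult_ac del: exp_eq_polar)
  qed
  have "integrable lborel (\<lambda>x. complex_of_real (std_normal_density x) * cis (- (a * c) * x))"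
  proof (rule Bochner_Integration.integrable_bound)
    show "integrable lborel std_normal_density" using integrable_std_normal_moment[of 0] by simp
    show "(\<lambda>x. complex_of_real (std_normal_density x) * cis (- (a * c) * x)) \<in> borel_measurable lborel"
      by (auto intro!: borel_measurable_continuous_onI continuous_intros simp: normal_density_def)
    show "AE x in lborel. norm (complex_of_real (std_normal_density x) * cis (- (a * c) * x)) \<le> norm (std_normal_density x)"
      by (auto simp: norm_mult)
  qed
  then have ih: "integrable lborel (\<lambda>x. h (0 + c * x))"
    unfolding h by (rule integrable_mult_right)
  then show "integrable lborel (\<lambda>y. cis (- (a * y)) * complex_of_real (exp (- l * y\<^sup>2)))"
    using lborel_integrable_real_affine_iff[of c h 0] c unfolding h_def by simp
  have "(LINT x|lborel. complex_of_real (std_normal_density x) * cis (- (a * c) * x)) 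
      = char std_normal_distribution (- (a * c))"
    unfolding char_def
    by (subst integral_density) (auto simp: normal_density_nonneg cis_conv_exp scaleR_conv_of_real mult_ac
      intro!: borel_measurable_continuous_onI continuous_intros)
  also have "\<dots> = complex_of_real (exp (- (a * c)\<^sup>2 / 2))"
    by (simp add: char_std_normal_distribution)
  finally have ch: "(LINT x|lborel. complex_of_real (std_normal_density x) * cis (- (a * c) * x)) = complex_of_real (exp (- (a * c)\<^sup>2 / 2))" .
  have "(LINT y|lborel. h y) = c *\<^sub>R (LINT x|lborel. h (0 + c * x))"
    using lborel_integral_real_affine[of c h 0] c by simp
  also have "\<dots> = complex_of_real (c * sqrt (2 * pi) * exp (- (a * c)\<^sup>2 / 2))"
    unfolding h by (simp add: ch[simplified] scaleR_conv_of_real)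
  also have "c * sqrt (2 * pi) = sqrt (pi / l)"
    using l by (simp add: c_def real_sqrt_divide real_sqrt_mult)
  also have "- (a * c)\<^sup>2 / 2 = - a\<^sup>2 / (4 * l)" by (simp add: power_mult_distrib c2)
  finally show "(LINT y|lborel. cis (- (a * y)) * complex_of_real (exp (- l * y\<^sup>2)))
           = complex_of_real (sqrt (pi / l) * exp (- a\<^sup>2 / (4 * l)))" by (simp add: h_def)
qed

lemma norm_sq_Basis: "(norm (x::'a::euclidean_space))\<^sup>2 = (\<Sum>b\<in>Basis. (x \<bullet> b)\<^sup>2)"
  unfolding power2_norm_eq_inner by (subst euclidean_inner) (simp add: power2_eq_square)

lemma prod_sqrt_Basis: "0 < a \<Longrightarrow> (\<Prod>b\<in>(Basis::'a::euclidean_space set). sqrt a) = a powr (real DIM('a) / 2)"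
  by (simp add: powr_half_sqrt[symmetric] powr_realpow[symmetric] powr_powr)

text \<open>Character and Gaussian both factor over the coordinates, so the integral is a product of
  one-dimensional ones.\<close>

lemma gaussian_fourier:
  fixes x :: "'a::euclidean_space"
  assumes l: "0 < l"
  shows "integrable lborel (\<lambda>\<xi>::'a. cis (- (x \<bullet> \<xi>)) * complex_of_real (exp (- l * (norm \<xi>)\<^sup>2)))"
    and "(LINT \<xi>|lborel. cis (- (x \<bullet> \<xi>)) * complex_of_real (exp (- l * (norm \<xi>)\<^sup>2)))
           = complex_of_real ((pi / l) powr (real DIM('a) / 2) * exp (- (norm x)\<^sup>2 / (4 * l)))"
proof -
  define f where "f b y = cis (- ((x \<bullet> b) * y)) * complex_of_real (exp (- l * y\<^sup>2))" for b :: 'a and y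
  have f: "cis (- (x \<bullet> \<xi>)) * complex_of_real (exp (- l * (norm \<xi>)\<^sup>2)) = (\<Prod>b\<in>Basis. f b (\<xi> \<bullet> b))" for \<xi> :: 'a
  proof -
    have "cis (- (x \<bullet> \<xi>)) = (\<Prod>b\<in>Basis. cis (- ((x \<bullet> b) * (\<xi> \<bullet> b))))"
      by (subst euclidean_inner) (simp add: cis_sum[symmetric] sum_negf)
    moreover have "complex_of_real (exp (- l * (norm \<xi>)\<^sup>2)) = (\<Prod>b\<in>Basis. complex_of_real (exp (- l * (\<xi> \<bullet> b)\<^sup>2)))"
      unfolding norm_sq_Basis of_real_prod[symmetric]
      by (subst exp_sum[symmetric]) (auto simp: sum_distrib_left)
    ultimately show ?thesis unfolding f_def prod.distrib by simp
  qed
  have i: "integrable lborel (f b)" for b unfolding f_def by (rule gaussian_fourier_real(1)[OF l])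
  show "integrable lborel (\<lambda>\<xi>::'a. cis (- (x \<bullet> \<xi>)) * complex_of_real (exp (- l * (norm \<xi>)\<^sup>2)))"
    unfolding f by (rule integrable_lborel_prod[OF i])
  have "(LINT \<xi>|lborel. (\<Prod>b\<in>Basis. f b (\<xi> \<bullet> b))) = (\<Prod>b\<in>Basis. LINT y|lborel. f b y)"
    by (rule integral_lborel_prod[OF i])
  also have "\<dots> = (\<Prod>b\<in>Basis. complex_of_real (sqrt (pi / l) * exp (- (x \<bullet> b)\<^sup>2 / (4 * l))))"
    unfolding f_def using gaussian_fourier_real(2)[OF l] by simp
  also have "\<dots> = complex_of_real ((\<Prod>b\<in>(Basis::'a set). sqrt (pi / l)) * (\<Prod>b\<in>Basis. exp (- (x \<bullet> b)\<^sup>2 / (4 * l))))"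
    by (simp only: of_real_prod of_real_mult prod.distrib)
  also have "(\<Prod>b\<in>(Basis::'a set). sqrt (pi / l)) = (pi / l) powr (real DIM('a) / 2)"
    using l by (intro prod_sqrt_Basis) simp
  also have "(\<Prod>b\<in>Basis. exp (- (x \<bullet> b)\<^sup>2 / (4 * l))) = exp (- (norm x)\<^sup>2 / (4 * l))"
    unfolding norm_sq_Basis by (subst exp_sum[symmetric]) (auto simp: sum_negf sum_divide_distrib)
  finally show "(LINT \<xi>|lborel. cis (- (x \<bullet> \<xi>)) * complex_of_real (exp (- l * (norm \<xi>)\<^sup>2)))
           = complex_of_real ((pi / l) powr (real DIM('a) / 2) * exp (- (norm x)\<^sup>2 / (4 * l)))"
    unfolding f .
qed

text \<open>The Gauss-Weierstrass kernel of exp (l \<Delta>), with Fourier multiplier exp (- l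
  |\<xi>|^2); the time l is meant to be positive.\<close>

definition heat :: "real \<Rightarrow> 'a::euclidean_space \<Rightarrow> real" where
  "heat l x = (4 * pi * l) powr (- real DIM('a) / 2) * exp (- (norm x)\<^sup>2 / (4 * l))"

lemma heat_nonneg [simp]: "0 \<le> heat l x" by (simp add: heat_def)

lemma heat_minus [simp]: "heat l (- x) = heat l x" by (simp add: heat_def)

lemma heat_commute: "heat l (x - y) = heat l (y - x)" by (simp add: heat_def norm_minus_commute)

lemma continuous_heat: "continuous_on A f \<Longrightarrow> continuous_on A (\<lambda>x. heat l (f x))"
  unfolding heat_def by (cases "l = 0") (auto intro!: continuous_intros)

lemma measurable_heat [measurable]: "heat l \<in> borel_measurable borel"
  by (intro borel_measurable_continuous_onI continuous_heat continuous_intros)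

lemma power2_powr_half:
  fixes a :: real assumes "0 < a" shows "(a\<^sup>2) powr (real n / 2) = a ^ n"
proof -
  have "a\<^sup>2 = a powr 2" using powr_realpow[OF assms, of 2] by simp
  then have "(a\<^sup>2) powr (real n / 2) = a powr real n" by (simp only: powr_powr) simp
  then show ?thesis using assms by (simp add: powr_realpow)
qed

text \<open>Integrating out the frequency against a Gaussian leaves the heat kernel; this is the
  form in which the kernel enters Plancherel's theorem. The constants match because (2 pi)^2 = (pi /
  l) (4 pi l).\<close>

lemma gaussian_fourier_heat:
  fixes x :: "'a::euclidean_space"
  assumes l: "0 < l"
  shows "(LINT \<xi>|lborel. cis (- (x \<bullet> \<xi>)) * complex_of_real (exp (- l * (norm \<xi>)\<^sup>2)))
           = complex_of_real ((2 * pi) ^ DIM('a) * heat l x)"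
proof -
  have "(2 * pi) ^ DIM('a) = ((2 * pi)\<^sup>2) powr (real DIM('a) / 2)"
    by (rule power2_powr_half[symmetric]) simp
  also have "\<dots> = (pi / l * (4 * pi * l)) powr (real DIM('a) / 2)"
  proof -
    have "(2 * pi)\<^sup>2 = pi / l * (4 * pi * l)" using l by (simp add: power2_eq_square)
    then show ?thesis by (simp only:)
  qed
  also have "\<dots> = (pi / l) powr (real DIM('a) / 2) * (4 * pi * l) powr (real DIM('a) / 2)"
    using l by (intro powr_mult)
  finally have "(2 * pi) ^ DIM('a) * (4 * pi * l) powr (- real DIM('a) / 2) = (pi / l) powr (real DIM('a) / 2)"
    using l by (simp add: powr_minus field_simps)
  then have "(2 * pi) ^ DIM('a) * heat l x = (pi / l) powr (real DIM('a) / 2) * exp (- (norm x)\<^sup>2 / (4 * l))"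
    unfolding heat_def by (simp only: mult.assoc[symmetric])
  then show ?thesis using gaussian_fourier(2)[OF l, of x] by simp
qed

text \<open>This is the Gaussian transform with parameter 1 / (4 l), evaluated at frequency
  0.\<close>

lemma
  assumes l: "0 < l"
  shows integrable_heat [simp]: "integrable lborel (heat l :: 'a::euclidean_space \<Rightarrow> real)"
    and integral_heat [simp]: "(LINT x|lborel. heat l (x::'a)) = 1"
proof -
  have m: "0 < 1 / (4 * l)" using l by simp
  define g where "g x = complex_of_real (exp (- (1 / (4 * l)) * (norm (x::'a))\<^sup>2))" for x
  have g: "integrable lborel g" "(LINT x|lborel. g x) = complex_of_real ((4 * pi * l) powr (real DIM('a) / 2))"
    using gaussian_fourier[OF m, of "0::'a"] l unfolding g_def by (simp_all add: mult_ac)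
  have h: "heat l = (\<lambda>x::'a. (4 * pi * l) powr (- real DIM('a) / 2) * Re (g x))"
    by (auto simp: heat_def g_def)
  show "integrable lborel (heat l :: 'a \<Rightarrow> real)"
    unfolding h using g by simp
  show "(LINT x|lborel. heat l (x::'a)) = 1"
    unfolding h using g l by (simp add: powr_minus)
qed

section \<open>Quadratic forms with an integrable convolution kernel\<close>

lemma integrable_tensor:
  fixes f :: "'a::euclidean_space \<Rightarrow> 'c::{real_normed_field, banach, second_countable_topology}"
    and g :: "'b::euclidean_space \<Rightarrow> 'c"
  assumes f: "integrable lborel f" and g: "integrable lborel g"
  shows "integrable (lborel \<Otimes>\<^sub>M lborel) (\<lambda>(x, y). f x * g y)"
proof (rule integrable_pairI)
  have [measurable]: "f \<in> borel_measurable borel" "g \<in> borel_measurable borel" using f g by auto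
  show "(\<lambda>(x, y). f x * g y) \<in> borel_measurable (lborel \<Otimes>\<^sub>M lborel)" by measurable
  have "(\<integral>\<^sup>+ x. \<integral>\<^sup>+ y. ennreal (norm (f x * g y)) \<partial>lborel \<partial>lborel)
      = (\<integral>\<^sup>+ x. ennreal (norm (f x)) \<partial>lborel) * (\<integral>\<^sup>+ y. ennreal (norm (g y)) \<partial>lborel)"
    by (simp add: norm_mult ennreal_mult nn_integral_cmult nn_integral_multc)
  also have "\<dots> < \<infinity>" using f g by (auto simp: integrable_iff_bounded ennreal_mult_less_top)
  finally show "(\<integral>\<^sup>+ x. \<integral>\<^sup>+ y. ennreal (norm (f x * g y)) \<partial>lborel \<partial>lborel) < \<infinity>" .
qed

lemma integral_tensor:
  fixes f :: "'a::euclidean_space \<Rightarrow> 'c::{real_normed_field, banach, second_countable_topology}"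
    and g :: "'b::euclidean_space \<Rightarrow> 'c"
  assumes f: "integrable lborel f" and g: "integrable lborel g"
  shows "(LINT z|(lborel \<Otimes>\<^sub>M lborel). f (fst z) * g (snd z)) = (LINT x|lborel. f x) * (LINT y|lborel. g y)"
proof -
  have "(LINT z|(lborel \<Otimes>\<^sub>M lborel). f (fst z) * g (snd z)) = (LINT z|(lborel \<Otimes>\<^sub>M lborel). (\<lambda>(x, y). f x * g y) z)"
    by (intro Bochner_Integration.integral_cong) auto
  also have "\<dots> = (LINT x|lborel. LINT y|lborel. f x * g y)"
    using lborel_pair.integral_fst'[OF integrable_tensor[OF f g]] by simp
  also have "\<dots> = (LINT x|lborel. f x) * (LINT y|lborel. g y)" by simp
  finally show ?thesis .
qed

lemma nn_integral_pair_swap: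
  fixes f :: "'a::euclidean_space \<Rightarrow> 'b::euclidean_space \<Rightarrow> ennreal"
  assumes "(\<lambda>(x, y). f x y) \<in> borel_measurable (lborel \<Otimes>\<^sub>M lborel)"
  shows "(\<integral>\<^sup>+ x. \<integral>\<^sup>+ y. f x y \<partial>lborel \<partial>lborel) = (\<integral>\<^sup>+ y. \<integral>\<^sup>+ x. f x y \<partial>lborel \<partial>lborel)"
  using lborel_pair.Fubini'[OF assms] by simp

text \<open>Tonelli and invariance of Lebesgue measure: with one variable fixed, j (x - y)
  integrates over the other one to the same constant.\<close>

lemma kernel_sq_integrable:
  fixes f :: "'a::euclidean_space \<Rightarrow> real"
  assumes f: "L2 f" and j: "integrable lborel j"
  shows "integrable (lborel \<Otimes>\<^sub>M lborel) (\<lambda>(x, y). (f x)\<^sup>2 * j (x - y))"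
    and "(LINT z|(lborel \<Otimes>\<^sub>M lborel). (f (fst z))\<^sup>2 * j (fst z - snd z)) = L2sq f * (LINT x|lborel. j x)"
    and "integrable (lborel \<Otimes>\<^sub>M lborel) (\<lambda>(x, y). (f y)\<^sup>2 * j (x - y))"
    and "(LINT z|(lborel \<Otimes>\<^sub>M lborel). (f (snd z))\<^sup>2 * j (fst z - snd z)) = L2sq f * (LINT x|lborel. j x)"
proof -
  have [measurable]: "f \<in> borel_measurable borel" "j \<in> borel_measurable borel" using f j by (auto simp: L2_def)
  have f2: "integrable lborel (\<lambda>x. (f x)\<^sup>2)" using f by (simp add: L2_iff)
  have n: "(\<integral>\<^sup>+ x. \<integral>\<^sup>+ y. ennreal (norm ((f x)\<^sup>2 * j (x - y))) \<partial>lborel \<partial>lborel) 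
     = (\<integral>\<^sup>+ x. ennreal (norm ((f x)\<^sup>2)) \<partial>lborel) * (\<integral>\<^sup>+ x. ennreal (norm (j x)) \<partial>lborel)" 
  proof -
    have "(\<integral>\<^sup>+ y. ennreal (norm ((f x)\<^sup>2 * j (x - y))) \<partial>lborel) = ennreal (norm ((f x)\<^sup>2)) * (\<integral>\<^sup>+ y. ennreal (norm (j y)) \<partial>lborel)" for x
      using nn_integral_reflect[of "\<lambda>y. ennreal (norm (j y))" x]
      by (simp add: norm_mult abs_mult ennreal_mult nn_integral_cmult)
    then show ?thesis by (simp add: nn_integral_multc)
  qed
  have fin: "(\<integral>\<^sup>+ x. ennreal (norm ((f x)\<^sup>2)) \<partial>lborel) * (\<integral>\<^sup>+ x. ennreal (norm (j x)) \<partial>lborel) < \<infinity>"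
    using f2 j by (auto simp: integrable_iff_bounded ennreal_mult_less_top)
  show i1: "integrable (lborel \<Otimes>\<^sub>M lborel) (\<lambda>(x, y). (f x)\<^sup>2 * j (x - y))"
    by (rule integrable_pairI) (use n fin in auto)
  have "(\<integral>\<^sup>+ x. \<integral>\<^sup>+ y. ennreal (norm ((f y)\<^sup>2 * j (x - y))) \<partial>lborel \<partial>lborel) 
     = (\<integral>\<^sup>+ x. ennreal (norm ((f x)\<^sup>2)) \<partial>lborel) * (\<integral>\<^sup>+ x. ennreal (norm (j x)) \<partial>lborel)" 
  proof -
    have "(\<integral>\<^sup>+ x. ennreal (norm ((f y)\<^sup>2 * j (x - y))) \<partial>lborel) = ennreal (norm ((f y)\<^sup>2)) * (\<integral>\<^sup>+ y. ennreal (norm (j y)) \<partial>lborel)" for y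
      using nn_integral_translate[of "\<lambda>y. ennreal (norm (j y))" y]
      by (simp add: norm_mult abs_mult ennreal_mult nn_integral_cmult)
    then show ?thesis by (subst nn_integral_pair_swap) (auto simp: nn_integral_multc)
  qed
  then show i2: "integrable (lborel \<Otimes>\<^sub>M lborel) (\<lambda>(x, y). (f y)\<^sup>2 * j (x - y))"
    by (intro integrable_pairI) (use fin in auto)
  have "(LINT z|(lborel \<Otimes>\<^sub>M lborel). (f (fst z))\<^sup>2 * j (fst z - snd z)) = (LINT z|(lborel \<Otimes>\<^sub>M lborel). (\<lambda>(x, y). (f x)\<^sup>2 * j (x - y)) z)"
    by (intro Bochner_Integration.integral_cong) auto
  also have "\<dots> = (LINT x|lborel. LINT y|lborel. (f x)\<^sup>2 * j (x - y))"
    using lborel_pair.integral_fst'[OF i1] by simp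
  finally show "(LINT z|(lborel \<Otimes>\<^sub>M lborel). (f (fst z))\<^sup>2 * j (fst z - snd z)) = L2sq f * (LINT x|lborel. j x)"
    by (simp add: integral_reflect L2sq_def)
  have "(LINT z|(lborel \<Otimes>\<^sub>M lborel). (f (snd z))\<^sup>2 * j (fst z - snd z)) = (LINT z|(lborel \<Otimes>\<^sub>M lborel). (\<lambda>(x, y). (f y)\<^sup>2 * j (x - y)) z)"
    by (intro Bochner_Integration.integral_cong) auto
  also have "\<dots> = (LINT y|lborel. LINT x|lborel. (f y)\<^sup>2 * j (x - y))"
    using lborel_pair.integral_snd[OF i2] by simp
  finally show "(LINT z|(lborel \<Otimes>\<^sub>M lborel). (f (snd z))\<^sup>2 * j (fst z - snd z)) = L2sq f * (LINT x|lborel. j x)"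
    using integral_translate[of j "- _"] by (simp add: L2sq_def)
qed

text \<open>The choice t = sqrt V / sqrt U makes both summands equal to sqrt U sqrt V. If U or V
  vanishes, the infimum over t is 0, and an explicit large or small t contradicts a > 0.\<close>

lemma young_optimal:
  fixes a U V :: real
  assumes "U \<ge> 0" "V \<ge> 0" and le: "\<And>t. t > 0 \<Longrightarrow> a \<le> (t * U + V / t) / 2"
  shows "a \<le> sqrt U * sqrt V"
proof (cases "U = 0 \<or> V = 0")
  case True
  have "\<not> a > 0"
  proof
    assume a: "a > 0"
    show False
    proof (cases "U = 0")
      case True
      have "a \<le> ((V + 1) / a * U + V / ((V + 1) / a)) / 2" by (rule le) (use a assms in auto)
      then show False using True a assms by (simp add: field_simps) (smt (verit) mult_nonneg_nonneg)
    next
      case False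
      then have "V = 0" using \<open>U = 0 \<or> V = 0\<close> by auto
      moreover have "a \<le> (a / (U + 1) * U + V / (a / (U + 1))) / 2" by (rule le) (use a assms in auto)
      ultimately show False using a assms by (simp add: field_simps) (smt (verit) mult_nonneg_nonneg)
    qed
  qed
  then show ?thesis using True by auto
next
  case False
  then have UV: "U > 0" "V > 0" using assms by auto
  have "a \<le> (sqrt V / sqrt U * U + V / (sqrt V / sqrt U)) / 2" by (rule le) (use UV in auto)
  also have "sqrt V / sqrt U * U = sqrt U * sqrt V" 
    using UV by (metis real_div_sqrt less_imp_le mult.commute times_divide_eq_left times_divide_eq_right)
  also have "V / (sqrt V / sqrt U) = sqrt U * sqrt V" 
    using UV by (metis real_div_sqrt less_imp_le divide_divide_eq_right mult.commute times_divide_eq_left)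
  finally show ?thesis by simp
qed

text \<open>Young's convolution inequality in bilinear form. Pointwise, ab \<le> (t a^2 + b^2 / t) /
  2 reduces integrability and bound to kernels with a single square; optimising over t restores the
  product of the norms.\<close>

lemma kernel_integrable:
  fixes f g :: "'a::euclidean_space \<Rightarrow> real"
  assumes f: "L2 f" and g: "L2 g" and j: "integrable lborel j"
  shows "integrable (lborel \<Otimes>\<^sub>M lborel) (\<lambda>(x, y). f x * g y * j (x - y))"
    and "\<bar>LINT z|(lborel \<Otimes>\<^sub>M lborel). f (fst z) * g (snd z) * j (fst z - snd z)\<bar> 
       \<le> (LINT x|lborel. \<bar>j x\<bar>) * (sqrt (L2sq f) * sqrt (L2sq g))"
proof -
  have [measurable]: "f \<in> borel_measurable borel" "g \<in> borel_measurable borel" "j \<in> borel_measurable borel" 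
    using f g j by (auto simp: L2_def)
  have j': "integrable lborel (\<lambda>x. \<bar>j x\<bar>)" using j by auto
  note kf = kernel_sq_integrable[OF f j'] and kg = kernel_sq_integrable[OF g j']
  have young: "\<bar>f x * g y * j (x - y)\<bar> \<le> t / 2 * ((f x)\<^sup>2 * \<bar>j (x - y)\<bar>) + 1 / (2 * t) * ((g y)\<^sup>2 * \<bar>j (x - y)\<bar>)" 
    if t: "t > 0" for x y t
  proof -
    have "2 * (sqrt t * \<bar>f x\<bar>) * (\<bar>g y\<bar> / sqrt t) \<le> (sqrt t * \<bar>f x\<bar>)\<^sup>2 + (\<bar>g y\<bar> / sqrt t)\<^sup>2" by (rule sum_squares_bound)
    then have "\<bar>f x\<bar> * \<bar>g y\<bar> \<le> t / 2 * (f x)\<^sup>2 + 1 / (2 * t) * (g y)\<^sup>2"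
      using t by (simp add: power_mult_distrib power_divide)
    then have "\<bar>f x\<bar> * \<bar>g y\<bar> * \<bar>j (x - y)\<bar> \<le> (t / 2 * (f x)\<^sup>2 + 1 / (2 * t) * (g y)\<^sup>2) * \<bar>j (x - y)\<bar>"
      by (rule mult_right_mono) simp
    then show ?thesis by (simp add: abs_mult algebra_simps)
  qed
  have ib: "integrable (lborel \<Otimes>\<^sub>M lborel) (\<lambda>z. t / 2 * ((f (fst z))\<^sup>2 * \<bar>j (fst z - snd z)\<bar>) + 1 / (2 * t) * ((g (snd z))\<^sup>2 * \<bar>j (fst z - snd z)\<bar>))" for t
    using kf(1) kg(3) by (intro Bochner_Integration.integrable_add integrable_mult_right) (auto simp: case_prod_beta')
  have i: "integrable (lborel \<Otimes>\<^sub>M lborel) (\<lambda>z. f (fst z) * g (snd z) * j (fst z - snd z))"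
    by (rule Bochner_Integration.integrable_bound[OF ib[of 1]])
      (use young[of 1] in \<open>auto intro!: AE_I2 order_trans[OF _ abs_ge_self]\<close>)
  then show "integrable (lborel \<Otimes>\<^sub>M lborel) (\<lambda>(x, y). f x * g y * j (x - y))" by (simp add: case_prod_beta')
  define J where "J = (LINT x|lborel. \<bar>j x\<bar>)"
  have J: "J \<ge> 0" by (simp add: J_def)
  have "\<bar>LINT z|(lborel \<Otimes>\<^sub>M lborel). f (fst z) * g (snd z) * j (fst z - snd z)\<bar> \<le> (t * (L2sq f * J) + (L2sq g * J) / t) / 2"
    if t: "t > 0" for t
  proof -
    have "\<bar>LINT z|(lborel \<Otimes>\<^sub>M lborel). f (fst z) * g (snd z) * j (fst z - snd z)\<bar> 
       \<le> (LINT z|(lborel \<Otimes>\<^sub>M lborel). \<bar>f (fst z) * g (snd z) * j (fst z - snd z)\<bar>)" by (rule integral_abs_bound)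
    also have "\<dots> \<le> (LINT z|(lborel \<Otimes>\<^sub>M lborel). t / 2 * ((f (fst z))\<^sup>2 * \<bar>j (fst z - snd z)\<bar>) + 1 / (2 * t) * ((g (snd z))\<^sup>2 * \<bar>j (fst z - snd z)\<bar>))"
      by (rule integral_mono) (use i ib young[OF t] in auto)
    also have "\<dots> = t / 2 * (L2sq f * J) + 1 / (2 * t) * (L2sq g * J)"
      using kf kg by (subst Bochner_Integration.integral_add) (auto simp: J_def case_prod_beta')
    also have "\<dots> = (t * (L2sq f * J) + (L2sq g * J) / t) / 2" using t by (simp add: field_simps)
    finally show ?thesis .
  qed
  then have "\<bar>LINT z|(lborel \<Otimes>\<^sub>M lborel). f (fst z) * g (snd z) * j (fst z - snd z)\<bar> \<le> sqrt (L2sq f * J) * sqrt (L2sq g * J)"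
    by (intro young_optimal) (use J in auto)
  also have "\<dots> = J * (sqrt (L2sq f) * sqrt (L2sq g))" using J by (simp add: real_sqrt_mult)
  finally show "\<bar>LINT z|(lborel \<Otimes>\<^sub>M lborel). f (fst z) * g (snd z) * j (fst z - snd z)\<bar> 
       \<le> (LINT x|lborel. \<bar>j x\<bar>) * (sqrt (L2sq f) * sqrt (L2sq g))" by (simp add: J_def)
qed

text \<open>The pairing of f with exp (l \<Delta>) g, written over pairs of points so that the heat
  operator itself never has to be defined on L2.\<close>

definition heat_form :: "real \<Rightarrow> ('a::euclidean_space \<Rightarrow> real) \<Rightarrow> ('a \<Rightarrow> real) \<Rightarrow> real" where
  "heat_form l f g = (LINT z|(lborel \<Otimes>\<^sub>M lborel). f (fst z) * g (snd z) * heat l (fst z - snd z))"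

lemma heat_form_integrable:
  assumes "0 < l" "L2 f" "L2 g"
  shows "integrable (lborel \<Otimes>\<^sub>M lborel) (\<lambda>z. f (fst z) * g (snd z) * heat l (fst z - snd z))"
  using kernel_integrable(1)[OF assms(2,3) integrable_heat[OF assms(1)]] by (simp add: case_prod_beta')

lemma heat_form_bound:
  assumes "0 < l" "L2 f" "L2 g"
  shows "\<bar>heat_form l f g\<bar> \<le> sqrt (L2sq f) * sqrt (L2sq g)"
  using kernel_integrable(2)[OF assms(2,3) integrable_heat[OF assms(1)]] assms(1) by (simp add: heat_form_def)

lemma heat_form_diff:
  assumes "0 < l" "L2 f" "L2 g" "L2 f'" "L2 g'"
  shows "heat_form l f g - heat_form l f' g' = heat_form l (\<lambda>x. f x - f' x) g + heat_form l f' (\<lambda>x. g x - g' x)"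
  using heat_form_integrable[OF assms(1-3)] heat_form_integrable[OF assms(1,4,3)]
    heat_form_integrable[OF assms(1,4,5)]
  unfolding heat_form_def by (simp add: algebra_simps)

text \<open>The bound does not depend on l, since the heat kernel has mass 1. This uniformity
  permits approximation of the arguments before l tends to 0.\<close>

lemma heat_form_diff_bound:
  assumes "0 < l" "L2 f" "L2 g" "L2 f'" "L2 g'"
  shows "\<bar>heat_form l f g - heat_form l f' g'\<bar> 
    \<le> sqrt (L2sq (\<lambda>x. f x - f' x)) * sqrt (L2sq g) + sqrt (L2sq f') * sqrt (L2sq (\<lambda>x. g x - g' x))"
  unfolding heat_form_diff[OF assms]
  by (intro order_trans[OF abs_triangle_ineq] add_mono heat_form_bound L2_diff assms)

lemma L2_tendsto_heat_form:
  assumes l: "0 < l" and F: "L2_tendsto F f" and G: "L2_tendsto G g"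
  shows "(\<lambda>n. heat_form l (F n) (G n)) \<longlonglongrightarrow> heat_form l f g"
proof -
  have "(\<lambda>n. sqrt (L2sq (\<lambda>x. F n x - f x)) * sqrt (L2sq (G n)) + sqrt (L2sq f) * sqrt (L2sq (\<lambda>x. G n x - g x))) \<longlonglongrightarrow> 0"
    using tendsto_add[OF tendsto_mult[OF L2_tendsto_sqrt[OF F] L2_tendsto_sqrt_L2sq[OF G]]
      tendsto_mult[OF tendsto_const L2_tendsto_sqrt[OF G]]] by simp
  then have "(\<lambda>n. heat_form l (F n) (G n) - heat_form l f g) \<longlonglongrightarrow> 0"
    by (rule Lim_null_comparison[rotated], intro always_eventually allI)
      (use heat_form_diff_bound[OF l L2_tendsto_L2(1)[OF F] L2_tendsto_L2(1)[OF G] L2_tendsto_L2(2)[OF F]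
        L2_tendsto_L2(2)[OF G]] in simp)
  then show ?thesis by (rule LIM_zero_cancel)
qed

section \<open>Density of continuous functions\<close>

definition cutoff :: "real \<Rightarrow> 'a::euclidean_space \<Rightarrow> real" where
  "cutoff N x = max 0 (min 1 (N - norm x))"

lemma cutoff_bounds: "0 \<le> cutoff N x" "cutoff N x \<le> 1" by (auto simp: cutoff_def)

lemma continuous_cutoff: "continuous_on A (cutoff N)"
  unfolding cutoff_def by (intro continuous_intros)

lemma measurable_cutoff [measurable]: "cutoff N \<in> borel_measurable borel"
  by (intro borel_measurable_continuous_onI continuous_cutoff)

lemma cutoff_eq_0: "N \<le> norm x \<Longrightarrow> cutoff N x = 0" by (simp add: cutoff_def)

lemma L2_bounded_support:
  fixes f :: "'a::euclidean_space \<Rightarrow> real"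
  assumes "f \<in> borel_measurable lborel" "\<And>x. \<bar>f x\<bar> \<le> B" "\<And>x. r \<le> norm x \<Longrightarrow> f x = 0"
  shows "L2 f"
proof -
  have i: "integrable lborel (indicator (ball (0::'a) r) :: 'a \<Rightarrow> real)"
    using emeasure_lborel_ball_finite[of "0::'a" r] by (intro integrable_real_indicator) auto
  have B: "0 \<le> B" using order_trans[OF abs_ge_zero assms(2)] .
  have "integrable lborel (\<lambda>x. (norm (f x))\<^sup>2)"
  proof (rule Bochner_Integration.integrable_bound[OF integrable_mult_right[OF i, of "B\<^sup>2"]])
    show "AE x in lborel. norm ((norm (f x))\<^sup>2) \<le> norm (B\<^sup>2 * indicator (ball (0::'a) r) x)"
      using assms(2,3) B by (auto simp: indicator_def abs_le_square_iff[symmetric])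
  qed (use assms in auto)
  then show ?thesis using assms by (simp add: L2_iff)
qed

text \<open>Two approximations: f is clipped in value and cut off in space, which converges in L2
  under the majorant 4 f^2; then a sequence of continuous functions tending to f almost everywhere
  is clipped and cut off in the same way, so that dominated convergence applies on a fixed
  ball.\<close>

lemma L2_dense_continuous:
  fixes f :: "'a::euclidean_space \<Rightarrow> real"
  assumes f: "L2 f" and e: "0 < e"
  shows "\<exists>g B r. continuous_on UNIV g \<and> (\<forall>x. \<bar>g x\<bar> \<le> B) \<and> (\<forall>x. r \<le> norm x \<longrightarrow> g x = 0) \<and> 
    L2sq (\<lambda>x. f x - g x) < e"
proof -
  have [measurable]: "f \<in> borel_measurable borel" using f by (simp add: L2_def)
  define clip where "clip N v = max (- real N) (min (real N) v)" for N :: nat and v :: real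
  have clip_abs: "\<bar>clip N v\<bar> \<le> real N" "\<bar>clip N v\<bar> \<le> \<bar>v\<bar>" for N v unfolding clip_def by auto
  have clip_cont: "continuous_on A (clip N)" for A N unfolding clip_def by (intro continuous_intros)
  have [measurable]: "clip N \<in> borel_measurable borel" for N
    by (intro borel_measurable_continuous_onI clip_cont)
  define fN where "fN N x = clip N (f x) * cutoff (real N) x" for N x
  have [measurable]: "fN N \<in> borel_measurable borel" for N unfolding fN_def by measurable
  have fN_abs: "\<bar>fN N x\<bar> \<le> \<bar>f x\<bar>" for N x
    unfolding fN_def abs_mult using mult_mono[OF clip_abs(2)[of N "f x"], of "\<bar>cutoff (real N) x\<bar>" 1]
      cutoff_bounds[of "real N" x] by simp
  have fN_ev: "\<forall>\<^sub>F N in sequentially. fN N x = f x" for x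
    using eventually_ge_at_top[of "nat \<lceil>\<bar>f x\<bar> + norm x + 1\<rceil>"]
  proof eventually_elim
    case (elim N)
    then have "\<bar>f x\<bar> + norm x + 1 \<le> real N" by linarith
    then have "\<bar>f x\<bar> \<le> real N" "1 \<le> real N - norm x" using norm_ge_zero[of x] by linarith+
    then show ?case unfolding fN_def clip_def cutoff_def by auto
  qed
  have "(\<lambda>N. LINT x|lborel. (f x - fN N x)\<^sup>2) \<longlonglongrightarrow> (LINT x|(lborel::'a measure). 0)"
  proof (rule integral_dominated_convergence)
    show "integrable lborel (\<lambda>x. 4 * (f x)\<^sup>2)" using f by (simp add: L2_iff)
    show "AE x in lborel. (\<lambda>N. (f x - fN N x)\<^sup>2) \<longlonglongrightarrow> 0"
    proof (rule AE_I2)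
      fix x
      show "(\<lambda>N. (f x - fN N x)\<^sup>2) \<longlonglongrightarrow> 0"
        by (rule tendsto_eventually) (use fN_ev[of x] in \<open>auto elim: eventually_mono\<close>)
    qed
    show "AE x in lborel. norm ((f x - fN N x)\<^sup>2) \<le> 4 * (f x)\<^sup>2" for N
    proof (rule AE_I2)
      fix x
      have "\<bar>f x - fN N x\<bar> \<le> 2 * \<bar>f x\<bar>" using fN_abs[of N x] by linarith
      then have "(f x - fN N x)\<^sup>2 \<le> (2 * \<bar>f x\<bar>)\<^sup>2" by (intro power2_le_iff_abs_le[THEN iffD2]) auto
      then show "norm ((f x - fN N x)\<^sup>2) \<le> 4 * (f x)\<^sup>2" by (simp add: power_mult_distrib)
    qed
  qed measurable
  then have "(\<lambda>N. L2sq (\<lambda>x. f x - fN N x)) \<longlonglongrightarrow> 0" by (simp add: L2sq_def)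
  then have "\<forall>\<^sub>F N in sequentially. L2sq (\<lambda>x. f x - fN N x) < e / 4"
    using e by (intro order_tendstoD(2)) auto
  then obtain N where N: "L2sq (\<lambda>x. f x - fN N x) < e / 4" using eventually_happens by force
  have L2N: "L2 (fN N)" 
    by (rule L2_bound[OF f, of _ 1]) (use fN_abs in auto)
  \<comment> \<open>Lebesgue measurability is equivalent to being a limit of continuous functions
    off a negligible set; this supplies the continuous approximants without regularity of
    measures.\<close>
  have "f \<in> borel_measurable lebesgue" using f by (simp add: L2_def measurable_completion)
  then have "f measurable_on UNIV" by (intro lebesgue_measurable_imp_measurable_on_real) auto
  then obtain Z F where Z: "negligible Z" and cF: "\<And>n. continuous_on UNIV (F n)" 
    and F: "\<And>x. x \<notin> Z \<Longrightarrow> (\<lambda>n. F n x) \<longlonglongrightarrow> f x"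
    by (auto simp: measurable_on_def)
  have AEZ: "AE x in lborel. x \<notin> Z"
  proof -
    have "AE x in lebesgue. x \<notin> Z" using Z by (intro AE_not_in) (simp add: negligible_iff_null_sets)
    then show ?thesis by (simp add: AE_completion_iff)
  qed
  define g where "g n x = clip N (F n x) * cutoff (real N) x" for n x
  have g_cont: "continuous_on UNIV (g n)" for n unfolding g_def
    by (intro continuous_intros continuous_cutoff continuous_on_compose2[OF clip_cont cF]) auto
  have g_abs: "\<bar>g n x\<bar> \<le> real N" for n x
    unfolding g_def abs_mult using mult_mono[OF clip_abs(1)[of N "F n x"], of "\<bar>cutoff (real N) x\<bar>" 1]
      cutoff_bounds[of "real N" x] by simp
  have g_0: "real N \<le> norm x \<Longrightarrow> g n x = 0" for n x by (simp add: g_def cutoff_eq_0)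
  have fN_absN: "\<bar>fN N x\<bar> \<le> real N" for x
    unfolding fN_def abs_mult using mult_mono[OF clip_abs(1)[of N "f x"], of "\<bar>cutoff (real N) x\<bar>" 1]
      cutoff_bounds[of "real N" x] by simp
  have [measurable]: "g n \<in> borel_measurable borel" for n
    by (intro borel_measurable_continuous_onI g_cont)
  have L2g: "L2 (g n)" for n by (rule L2_bounded_support[of _ "real N" "real N"]) (use g_abs g_0 in auto)
  have i: "integrable lborel (indicator (ball (0::'a) (real N)) :: 'a \<Rightarrow> real)"
    using emeasure_lborel_ball_finite[of "0::'a" "real N"] by (intro integrable_real_indicator) auto
  have "(\<lambda>n. LINT x|lborel. (fN N x - g n x)\<^sup>2) \<longlonglongrightarrow> (LINT x|(lborel::'a measure). 0)"
  proof (rule integral_dominated_convergence)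
    show "integrable lborel (\<lambda>x::'a. (2 * real N)\<^sup>2 * indicator (ball 0 (real N)) x)"
      by (rule integrable_mult_right[OF i])
    show "AE x in lborel. (\<lambda>n. (fN N x - g n x)\<^sup>2) \<longlonglongrightarrow> 0"
      using AEZ
    proof eventually_elim
      case (elim x)
      have "(\<lambda>n. clip N (F n x)) \<longlonglongrightarrow> clip N (f x)"
        by (rule continuous_on_tendsto_compose[OF clip_cont[of UNIV] F[OF elim]]) auto
      then have "(\<lambda>n. g n x) \<longlonglongrightarrow> fN N x" unfolding g_def fN_def by (intro tendsto_intros)
      then have "(\<lambda>n. (fN N x - g n x)\<^sup>2) \<longlonglongrightarrow> (fN N x - fN N x)\<^sup>2" by (intro tendsto_intros)
      then show ?case by simp
    qed
    show "AE x in lborel. norm ((fN N x - g n x)\<^sup>2) \<le> (2 * real N)\<^sup>2 * indicator (ball 0 (real N)) x" for n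
    proof (rule AE_I2)
      fix x :: 'a
      show "norm ((fN N x - g n x)\<^sup>2) \<le> (2 * real N)\<^sup>2 * indicator (ball 0 (real N)) x"
      proof (cases "norm x < real N")
        case True
        have "\<bar>fN N x - g n x\<bar> \<le> 2 * real N" using fN_absN[of x] g_abs[of n x] by linarith
        from power_mono[OF this, of 2] have "(fN N x - g n x)\<^sup>2 \<le> (2 * real N)\<^sup>2" by simp
        then show ?thesis using True by simp
      next
        case False
        then show ?thesis by (simp add: g_0 fN_def cutoff_eq_0)
      qed
    qed
  qed measurable
  then have "(\<lambda>n. L2sq (\<lambda>x. fN N x - g n x)) \<longlonglongrightarrow> 0" by (simp add: L2sq_def)
  then have "\<forall>\<^sub>F n in sequentially. L2sq (\<lambda>x. fN N x - g n x) < e / 4"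
    using e by (intro order_tendstoD(2)) auto
  then obtain n where n: "L2sq (\<lambda>x. fN N x - g n x) < e / 4" using eventually_happens by force
  have "L2sq (\<lambda>x. f x - g n x) = L2sq (\<lambda>x. (f x - fN N x) + (fN N x - g n x))" by simp
  also have "\<dots> \<le> 2 * L2sq (\<lambda>x. f x - fN N x) + 2 * L2sq (\<lambda>x. fN N x - g n x)"
    by (intro L2sq_add_le L2_diff f L2N L2g)
  also have "\<dots> < e" using N n by linarith
  finally show ?thesis using g_cont g_abs g_0 by blast
qed

lemma heat_scale: "0 < l \<Longrightarrow> sqrt l ^ DIM('a) * heat l (sqrt l *\<^sub>R x) = heat 1 (x::'a::euclidean_space)"
proof -
  assume l: "0 < l"
  have "sqrt l ^ DIM('a) = ((sqrt l)\<^sup>2) powr (real DIM('a) / 2)"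
    using l by (intro power2_powr_half[symmetric]) simp
  then have "sqrt l ^ DIM('a) = l powr (real DIM('a) / 2)" using l by simp
  moreover have "(4 * pi * l) powr (- real DIM('a) / 2) = (4 * pi) powr (- real DIM('a) / 2) * l powr (- real DIM('a) / 2)"
    using l by (intro powr_mult) 
  moreover have "l powr (real DIM('a) / 2) * l powr (- real DIM('a) / 2) = 1"
    using l by (simp add: powr_add[symmetric])
  ultimately show ?thesis using l by (simp add: heat_def power_mult_distrib)
qed

text \<open>With y = x - sqrt l z the kernel becomes the fixed density \<open>heat 1\<close>, and
  the dependence on l moves into the continuous function g. Dominated convergence then applies, in z
  first and afterwards in x.\<close>

lemma heat_form_tendsto_continuous:
  fixes g :: "'a::euclidean_space \<Rightarrow> real"
  assumes c: "continuous_on UNIV g" and B: "\<And>x. \<bar>g x\<bar> \<le> B" and r: "\<And>x. r \<le> norm x \<Longrightarrow> g x = 0"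
    and l: "\<And>n. 0 < l n" "l \<longlonglongrightarrow> 0"
  shows "(\<lambda>n. heat_form (l n) g g) \<longlonglongrightarrow> L2sq g"
proof -
  have [measurable]: "g \<in> borel_measurable borel" by (rule borel_measurable_continuous_onI[OF c])
  have L: "L2 g" by (rule L2_bounded_support[of _ B r]) (use B r in auto)
  have i: "integrable lborel (indicator (ball (0::'a) r) :: 'a \<Rightarrow> real)"
    using emeasure_lborel_ball_finite[of "0::'a" r] by (intro integrable_real_indicator) auto
  have ig: "integrable lborel g"
  proof (rule Bochner_Integration.integrable_bound[OF integrable_mult_right[OF i, of B]])
    show "AE x in lborel. norm (g x) \<le> norm (B * indicator (ball (0::'a) r) x)"
    proof (rule AE_I2)
      fix x show "norm (g x) \<le> norm (B * indicator (ball (0::'a) r) x)"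
        using B[of x] r[of x] by (cases "norm x < r") auto
    qed
  qed auto
  define K where "K n x = (LINT z|lborel. g (x - sqrt (l n) *\<^sub>R z) * heat 1 z)" for n x
  have K: "(LINT y|lborel. g y * heat (l n) (x - y)) = K n x" for n x
  proof -
    have "(LINT y|lborel. g y * heat (l n) (x - y)) = sqrt (l n) ^ DIM('a) *\<^sub>R 
       (LINT z|lborel. g (x + (- sqrt (l n)) *\<^sub>R z) * heat (l n) (x - (x + (- sqrt (l n)) *\<^sub>R z)))"
      using l(1)[of n] by (subst integral_affine[of "- sqrt (l n)" _ x]) auto
    also have "\<dots> = (LINT z|lborel. g (x - sqrt (l n) *\<^sub>R z) * (sqrt (l n) ^ DIM('a) * heat (l n) (sqrt (l n) *\<^sub>R z)))"
      by (simp add: mult_ac)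
    finally show ?thesis unfolding K_def heat_scale[OF l(1)] .
  qed
  have [measurable]: "K n \<in> borel_measurable borel" for n 
    unfolding K_def by measurable
  have KB: "\<bar>K n x\<bar> \<le> B" for n x
  proof -
    have "\<bar>K n x\<bar> \<le> (LINT z|lborel. \<bar>g (x - sqrt (l n) *\<^sub>R z) * heat 1 z\<bar>)"
      unfolding K_def by (rule integral_abs_bound)
    also have "\<dots> \<le> (LINT z|lborel. B * heat 1 (z::'a))"
    proof (rule integral_mono)
      show "integrable lborel (\<lambda>z. \<bar>g (x - sqrt (l n) *\<^sub>R z) * heat 1 z\<bar>)"
        by (rule Bochner_Integration.integrable_bound[OF integrable_mult_right[OF integrable_heat[of 1], of B]])
          (use B in \<open>auto simp: abs_mult intro!: mult_right_mono order_trans[OF _ abs_ge_self]\<close>)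
    qed (use B in \<open>auto simp: abs_mult intro!: mult_right_mono\<close>)
    also have "\<dots> = B" by simp
    finally show ?thesis .
  qed
  have Klim: "(\<lambda>n. K n x) \<longlonglongrightarrow> g x" for x
  proof -
    have "(\<lambda>n. LINT z|lborel. g (x - sqrt (l n) *\<^sub>R z) * heat 1 z) \<longlonglongrightarrow> (LINT z|lborel. g x * heat 1 (z::'a))"
    proof (rule integral_dominated_convergence)
      show "integrable lborel (\<lambda>z::'a. B * heat 1 z)" by simp
      show "AE z in lborel. (\<lambda>n. g (x - sqrt (l n) *\<^sub>R z) * heat 1 z) \<longlonglongrightarrow> g x * heat 1 z"
      proof (rule AE_I2)
        fix z :: 'a
        have "(\<lambda>n. x - sqrt (l n) *\<^sub>R z) \<longlonglongrightarrow> x - sqrt 0 *\<^sub>R z" by (intro tendsto_intros l)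
        then have "(\<lambda>n. g (x - sqrt (l n) *\<^sub>R z)) \<longlonglongrightarrow> g x"
          by (intro continuous_on_tendsto_compose[OF c]) auto
        then show "(\<lambda>n. g (x - sqrt (l n) *\<^sub>R z) * heat 1 z) \<longlonglongrightarrow> g x * heat 1 z" by (intro tendsto_intros)
      qed
    qed (use B in \<open>auto simp: abs_mult intro!: mult_right_mono\<close>)
    then show ?thesis by (simp add: K_def)
  qed
  have hf: "heat_form (l n) g g = (LINT x|lborel. g x * K n x)" for n
  proof -
    have "heat_form (l n) g g = (LINT x|lborel. LINT y|lborel. g x * g y * heat (l n) (x - y))"
      using lborel_pair.integral_fst'[OF heat_form_integrable[OF l(1)[of n] L L]] by (simp add: heat_form_def)
    also have "\<dots> = (LINT x|lborel. g x * K n x)"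
      unfolding K[symmetric] by (simp add: mult.assoc)
    finally show ?thesis .
  qed
  have "(\<lambda>n. LINT x|lborel. g x * K n x) \<longlonglongrightarrow> (LINT x|lborel. g x * g x)"
  proof (rule integral_dominated_convergence)
    show "integrable lborel (\<lambda>x. B * \<bar>g x\<bar>)" using ig by auto
    show "AE x in lborel. (\<lambda>n. g x * K n x) \<longlonglongrightarrow> g x * g x" using Klim by (auto intro!: tendsto_intros)
    show "AE x in lborel. norm (g x * K n x) \<le> B * \<bar>g x\<bar>" for n
    proof (rule AE_I2)
      fix x show "norm (g x * K n x) \<le> B * \<bar>g x\<bar>"
        using mult_right_mono[OF KB[of n x], of "\<bar>g x\<bar>"] by (simp add: abs_mult mult.commute)
    qed
  qed auto
  then show ?thesis unfolding hf by (simp add: L2sq_def power2_eq_square)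
qed

text \<open>The heat semigroup is an approximate identity on L2: the continuous case extends by
  density, since the error of replacing f by g is bounded uniformly in l.\<close>

lemma heat_form_tendsto:
  fixes f :: "'a::euclidean_space \<Rightarrow> real"
  assumes f: "L2 f" and l: "\<And>n. 0 < l n" "l \<longlonglongrightarrow> 0"
  shows "(\<lambda>n. heat_form (l n) f f) \<longlonglongrightarrow> L2sq f"
proof (rule LIMSEQ_I)
  fix e :: real assume e: "0 < e"
  define A where "A = sqrt (L2sq f)"
  have A: "A \<ge> 0" by (simp add: A_def)
  \<comment> \<open>With A = ||f|| and ||f - g|| \<le> d \<le> 1, both the forms and the squared
    norms change by at most d (2 A + 1). The denominator, with 2 A + 2, keeps this below e /
    4.\<close>
  define d where "d = min 1 (e / (4 * (2 * A + 2)))"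
  have d: "0 < d" "d \<le> 1" "d * (2 * A + 1) \<le> e / 4"
  proof -
    show "0 < d" "d \<le> 1" using e A by (auto simp: d_def)
    have "d * (2 * A + 1) \<le> e / (4 * (2 * A + 2)) * (2 * A + 2)"
      using e A by (intro mult_mono) (auto simp: d_def)
    also have "\<dots> = e / 4" using A by (simp add: divide_simps)
    finally show "d * (2 * A + 1) \<le> e / 4" .
  qed
  obtain g B r where g: "continuous_on UNIV g" "\<And>x. \<bar>g x\<bar> \<le> B" "\<And>x. r \<le> norm x \<Longrightarrow> g x = 0"
    "L2sq (\<lambda>x. f x - g x) < d\<^sup>2"
    using L2_dense_continuous[OF f, of "d\<^sup>2"] d by (auto simp: zero_less_power)
  have Lg: "L2 g" by (rule L2_bounded_support[of _ B r]) (use g in \<open>auto intro: borel_measurable_continuous_onI\<close>)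
  define D where "D = sqrt (L2sq (\<lambda>x. f x - g x))"
  have D: "0 \<le> D" "D \<le> d"
    using g(4) d by (auto simp: D_def intro!: real_le_lsqrt)
  have gA: "sqrt (L2sq g) \<le> A + D"
    using L2sq_triangle[OF L2_diff[OF Lg f] f] by (simp add: A_def D_def L2sq_diff_commute[of g])
  have fA: "A \<le> sqrt (L2sq g) + D"
    using L2sq_triangle[OF L2_diff[OF f Lg] Lg] by (simp add: A_def D_def)
  have b1: "\<bar>heat_form (l n) f f - heat_form (l n) g g\<bar> \<le> e / 4" for n
  proof -
    have "\<bar>heat_form (l n) f f - heat_form (l n) g g\<bar> \<le> D * A + sqrt (L2sq g) * D"
      using heat_form_diff_bound[OF l(1) f f Lg Lg, of n] by (simp add: D_def A_def)
    also have "\<dots> \<le> D * A + (A + D) * D" using gA D by (intro add_left_mono mult_right_mono) auto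
    also have "\<dots> = D * (2 * A + D)" by (simp add: algebra_simps)
    also have "\<dots> \<le> d * (2 * A + 1)" using D d A by (intro mult_mono) auto
    finally show ?thesis using d by simp
  qed
  have b2: "\<bar>L2sq f - L2sq g\<bar> \<le> e / 4"
  proof -
    have "L2sq f - L2sq g = (A - sqrt (L2sq g)) * (A + sqrt (L2sq g))" by (simp add: A_def algebra_simps)
    then have "\<bar>L2sq f - L2sq g\<bar> = \<bar>A - sqrt (L2sq g)\<bar> * (A + sqrt (L2sq g))" using A by (simp add: abs_mult)
    also have "\<dots> \<le> D * (A + (A + D))" using gA fA A D by (intro mult_mono) auto
    also have "\<dots> \<le> d * (2 * A + 1)" using D d A by (intro mult_mono) auto
    finally show ?thesis using d by simp
  qed
  have "(\<lambda>n. heat_form (l n) g g) \<longlonglongrightarrow> L2sq g" by (rule heat_form_tendsto_continuous[OF g(1-3) l])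
  then obtain N where N: "\<And>n. n \<ge> N \<Longrightarrow> \<bar>heat_form (l n) g g - L2sq g\<bar> < e / 4"
    using e LIMSEQ_D[of _ _ "e / 4"] by (metis real_norm_def divide_pos_pos zero_less_numeral)
  have "\<bar>heat_form (l n) f f - L2sq f\<bar> < e" if "n \<ge> N" for n
    using b1[of n] b2 N[OF that] e by linarith
  then show "\<exists>no. \<forall>n\<ge>no. norm (heat_form (l n) f f - L2sq f) < e" by auto
qed

section \<open>The Plancherel theorem\<close>

lemma measurable_cis [measurable]: "cis \<in> borel_measurable borel"
  by (intro borel_measurable_continuous_onI continuous_intros)

lemma measurable_fourier_integral [measurable]:
  assumes [measurable]: "f \<in> borel_measurable borel"
  shows "fourier_integral f \<in> borel_measurable borel"
  unfolding fourier_integral_def by measurable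

lemma fourier_integrand_integrable:
  assumes f: "integrable lborel f"
  shows "integrable lborel (\<lambda>x::'a::euclidean_space. cis (- (x \<bullet> \<xi>)) * complex_of_real (f x))"
proof (rule Bochner_Integration.integrable_bound[OF f])
  have [measurable]: "f \<in> borel_measurable borel" using f by simp
  show "(\<lambda>x::'a. cis (- (x \<bullet> \<xi>)) * complex_of_real (f x)) \<in> borel_measurable lborel" by measurable
qed (simp add: norm_mult)

lemma gaussian_integrable:
  assumes l: "0 < l"
  shows "integrable lborel (\<lambda>\<xi>::'a::euclidean_space. exp (- l * (norm \<xi>)\<^sup>2))"
  using integrable_Re[OF gaussian_fourier(1)[OF l, of "0::'a"]] by simp

lemma fourier_const: "complex_of_real ((2 * pi) powr (- real n / 2)) * complex_of_real ((2 * pi) powr (- real n / 2)) 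
    * complex_of_real ((2 * pi) ^ n) = 1"
proof -
  have "b powr (- real n / 2) * b powr (- real n / 2) * b ^ n = 1" if "b > 0" for b :: real
    using that by (simp add: powr_add[symmetric] powr_realpow[symmetric])
  from this[of "2 * pi"] show ?thesis unfolding of_real_mult[symmetric] by simp
qed

text \<open>Plancherel's identity with a Gaussian regulariser. The regulariser makes the integral
  over the frequency and both space variables absolutely convergent; performing the frequency
  integral first turns it into the heat kernel, and the three powers of 2 pi cancel.\<close>

lemma fourier_integral_heat:
  fixes f g :: "'a::euclidean_space \<Rightarrow> real"
  assumes l: "0 < l" and f: "integrable lborel f" and g: "integrable lborel g"
  shows "integrable lborel (\<lambda>\<xi>. complex_of_real (exp (- l * (norm \<xi>)\<^sup>2)) * (fourier_integral f \<xi> * cnj (fourier_integral g \<xi>)))"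
    and "(LINT \<xi>|lborel. complex_of_real (exp (- l * (norm \<xi>)\<^sup>2)) * (fourier_integral f \<xi> * cnj (fourier_integral g \<xi>)))
      = complex_of_real (heat_form l f g)"
proof -
  have [measurable]: "f \<in> borel_measurable borel" "g \<in> borel_measurable borel" using f g by auto
  define C where "C = complex_of_real ((2 * pi) powr (- real DIM('a) / 2))"
  define e where "e \<xi> = exp (- l * (norm \<xi>)\<^sup>2)" for \<xi> :: 'a
  define w where "w z = f (fst z) * g (snd z)" for z :: "'a \<times> 'a"
  have ie: "integrable lborel e" unfolding e_def by (rule gaussian_integrable[OF l])
  have [measurable]: "e \<in> borel_measurable borel" using ie by simp
  have iw: "integrable lborel w"
    using integrable_tensor[OF f g] unfolding w_def by (simp add: lborel_prod case_prod_beta')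
  have [measurable]: "w \<in> borel_measurable borel" using iw by simp
  define H where "H = (\<lambda>(\<xi>::'a) (z::'a \<times> 'a). complex_of_real (e \<xi> * w z) * cis (- ((fst z - snd z) \<bullet> \<xi>)))"
  have [measurable]: "fst \<in> borel_measurable (borel :: ('a \<times> 'a) measure)" "snd \<in> borel_measurable (borel :: ('a \<times> 'a) measure)"
    by (auto intro!: borel_measurable_continuous_onI continuous_intros)
  have iH: "integrable (lborel \<Otimes>\<^sub>M lborel) (\<lambda>(\<xi>, z). H \<xi> z)"
  proof (rule Bochner_Integration.integrable_bound[OF integrable_tensor[OF ie iw]])
    show "(\<lambda>(\<xi>, z). H \<xi> z) \<in> borel_measurable (lborel \<Otimes>\<^sub>M lborel)" unfolding H_def by measurable
  qed (auto simp: H_def norm_mult)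
  define A where "A \<xi> = (LINT x|lborel. cis (- (x \<bullet> \<xi>)) * complex_of_real (f x))" for \<xi>
  define B where "B \<xi> = (LINT x|lborel. cis (- (x \<bullet> \<xi>)) * complex_of_real (g x))" for \<xi>
  have fA: "fourier_integral f \<xi> = C * A \<xi>" and gB: "fourier_integral g \<xi> = C * B \<xi>" for \<xi>
    by (simp_all add: fourier_integral_def C_def A_def B_def)
  have z: "(LINT z|lborel. H \<xi> z) = complex_of_real (e \<xi>) * (A \<xi> * cnj (B \<xi>))" for \<xi>
  proof -
    have cB: "cnj (B \<xi>) = (LINT x|lborel. cnj (cis (- (x \<bullet> \<xi>)) * complex_of_real (g x)))"
      unfolding B_def by (rule Bochner_Integration.integral_cnj[symmetric])
    have "A \<xi> * cnj (B \<xi>) = (LINT z|(lborel \<Otimes>\<^sub>M lborel). 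
       (cis (- (fst z \<bullet> \<xi>)) * complex_of_real (f (fst z))) * cnj (cis (- (snd z \<bullet> \<xi>)) * complex_of_real (g (snd z))))"
      unfolding cB A_def 
      by (rule integral_tensor[symmetric, OF fourier_integrand_integrable[OF f]])
        (rule integrable_cnj[OF fourier_integrand_integrable[OF g]])
    also have "\<dots> = (LINT z|lborel. complex_of_real (w z) * cis (- ((fst z - snd z) \<bullet> \<xi>)))"
      unfolding lborel_prod
    proof (rule Bochner_Integration.integral_cong[OF refl])
      fix z :: "'a \<times> 'a"
      have "cis (- ((fst z - snd z) \<bullet> \<xi>)) = cis (- (fst z \<bullet> \<xi>)) * cis (snd z \<bullet> \<xi>)"
        by (simp add: cis_mult inner_diff_left)
      then show "(cis (- (fst z \<bullet> \<xi>)) * complex_of_real (f (fst z))) * cnj (cis (- (snd z \<bullet> \<xi>)) * complex_of_real (g (snd z)))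
         = complex_of_real (w z) * cis (- ((fst z - snd z) \<bullet> \<xi>))"
        by (simp add: w_def cis_cnj mult_ac)
    qed
    finally show ?thesis unfolding H_def by (simp add: mult.assoc)
  qed
  have x: "(LINT \<xi>|lborel. H \<xi> z) = complex_of_real ((2 * pi) ^ DIM('a)) * complex_of_real (w z * heat l (fst z - snd z))" for z
  proof -
    have "(LINT \<xi>|lborel. H \<xi> z) = (LINT \<xi>|lborel. complex_of_real (w z) * (cis (- ((fst z - snd z) \<bullet> \<xi>)) * complex_of_real (e \<xi>)))"
      unfolding H_def by (simp add: mult_ac)
    also have "\<dots> = complex_of_real (w z) * (LINT \<xi>|lborel. cis (- ((fst z - snd z) \<bullet> \<xi>)) * complex_of_real (e \<xi>))"
      by (rule integral_mult_right_zero)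
    finally show ?thesis unfolding e_def gaussian_fourier_heat[OF l] by simp
  qed
  have CC: "complex_of_real (exp (- l * (norm \<xi>)\<^sup>2)) * (fourier_integral f \<xi> * cnj (fourier_integral g \<xi>))
     = C * C * (LINT z|lborel. H \<xi> z)" for \<xi>
    unfolding z fA gB by (simp add: e_def C_def mult_ac)
  show "integrable lborel (\<lambda>\<xi>. complex_of_real (exp (- l * (norm \<xi>)\<^sup>2)) * (fourier_integral f \<xi> * cnj (fourier_integral g \<xi>)))"
    unfolding CC using lborel_pair.integrable_fst'[OF iH] by (intro integrable_mult_right) simp
  have "(LINT \<xi>|lborel. complex_of_real (exp (- l * (norm \<xi>)\<^sup>2)) * (fourier_integral f \<xi> * cnj (fourier_integral g \<xi>)))
      = C * C * (LINT \<xi>|lborel. LINT z|lborel. H \<xi> z)"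
    unfolding CC by (rule integral_mult_right_zero)
  also have "(LINT \<xi>|lborel. LINT z|lborel. H \<xi> z) = (LINT z|lborel. LINT \<xi>|lborel. H \<xi> z)"
    using lborel_pair.Fubini_integral[OF iH] by simp
  also have "C * C * (LINT z|lborel. LINT \<xi>|lborel. H \<xi> z) = (C * C * complex_of_real ((2 * pi) ^ DIM('a))) * complex_of_real (heat_form l f g)"
    unfolding x heat_form_def lborel_prod
    by (subst integral_mult_right_zero) (simp only: integral_complex_of_real w_def mult.assoc)
  also have "\<dots> = complex_of_real (heat_form l f g)" unfolding C_def fourier_const by simp
  finally show "(LINT \<xi>|lborel. complex_of_real (exp (- l * (norm \<xi>)\<^sup>2)) * (fourier_integral f \<xi> * cnj (fourier_integral g \<xi>)))
      = complex_of_real (heat_form l f g)" .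
qed

text \<open>Let l decrease to 0 in the regularised identity with f = g. The left side increases to
  the squared norm of the transform, the right side tends to that of f; monotone convergence yields
  integrability along with the value.\<close>

lemma plancherel_fourier_integral:
  fixes f :: "'a::euclidean_space \<Rightarrow> real"
  assumes f: "integrable lborel f" and L: "L2 f"
  shows "L2 (fourier_integral f)" and "L2sq (fourier_integral f) = L2sq f"
proof -
  have [measurable]: "f \<in> borel_measurable borel" using f by simp
  define l where "l n = inverse (real (Suc n))" for n
  have l: "0 < l n" for n by (simp add: l_def)
  have l0: "l \<longlonglongrightarrow> 0" unfolding l_def by (rule LIMSEQ_inverse_real_of_nat)
  define h where "h n \<xi> = exp (- l n * (norm \<xi>)\<^sup>2) * (norm (fourier_integral f \<xi>))\<^sup>2" for n and \<xi> :: 'a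
  have h: "complex_of_real (h n \<xi>) = complex_of_real (exp (- l n * (norm \<xi>)\<^sup>2)) * (fourier_integral f \<xi> * cnj (fourier_integral f \<xi>))" for n \<xi>
    unfolding h_def of_real_mult complex_norm_square ..
  have ih: "integrable lborel (h n)" for n
    using fourier_integral_heat(1)[OF l f f] unfolding h[symmetric] by (simp only: complex_of_real_integrable_eq)
  have Ih: "(LINT \<xi>|lborel. h n \<xi>) = heat_form (l n) f f" for n
    using fourier_integral_heat(2)[OF l f f] unfolding h[symmetric] by (simp only: integral_complex_of_real of_real_eq_iff)
  have mono: "mono (\<lambda>n. h n \<xi>)" for \<xi> :: 'a
  proof (rule monoI)
    fix m n :: nat assume "m \<le> n"
    then have "l n \<le> l m" by (simp add: l_def)
    then have "l n * (norm \<xi>)\<^sup>2 \<le> l m * (norm \<xi>)\<^sup>2" by (intro mult_right_mono) auto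
    then show "h m \<xi> \<le> h n \<xi>" unfolding h_def by (intro mult_right_mono) auto
  qed
  have lim: "(\<lambda>n. h n \<xi>) \<longlonglongrightarrow> (norm (fourier_integral f \<xi>))\<^sup>2" for \<xi> :: 'a
  proof -
    have "(\<lambda>n. h n \<xi>) \<longlonglongrightarrow> exp (- 0 * (norm \<xi>)\<^sup>2) * (norm (fourier_integral f \<xi>))\<^sup>2"
      unfolding h_def by (intro tendsto_intros l0)
    then show ?thesis by simp
  qed
  have conv: "(\<lambda>n. LINT \<xi>|lborel. h n \<xi>) \<longlonglongrightarrow> L2sq f"
    unfolding Ih by (rule heat_form_tendsto[OF L l l0])
  have mc: "AE \<xi> in lborel. mono (\<lambda>n. h n \<xi>)" "AE \<xi> in lborel. (\<lambda>n. h n \<xi>) \<longlonglongrightarrow> (norm (fourier_integral f \<xi>))\<^sup>2"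
    "(\<lambda>\<xi>. (norm (fourier_integral f \<xi>))\<^sup>2) \<in> borel_measurable lborel"
    using mono lim by simp_all
  have "integrable lborel (\<lambda>\<xi>. (norm (fourier_integral f \<xi>))\<^sup>2)"
    by (rule integrable_monotone_convergence[OF ih mc(1,2) conv mc(3)])
  then show "L2 (fourier_integral f)" by (simp add: L2_iff)
  show "L2sq (fourier_integral f) = L2sq f"
    unfolding L2sq_def using integral_monotone_convergence[OF ih mc(1,2) conv mc(3)] by (simp add: L2sq_def)
qed

section \<open>The transform on L2 as a limit along truncations to balls\<close>

abbreviation trunc :: "nat \<Rightarrow> ('a::euclidean_space \<Rightarrow> real) \<Rightarrow> 'a \<Rightarrow> real" where
  "trunc n f \<equiv> (\<lambda>x. indicator (ball 0 (real n)) x * f x)"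

lemma L2_indicator_ball: "L2 (indicator (ball 0 r) :: 'a::euclidean_space \<Rightarrow> real)"
  by (rule L2_bounded_support[of _ 1 r]) (auto intro!: borel_measurable_indicator)

lemma measurable_trunc [measurable]:
  "f \<in> borel_measurable borel \<Longrightarrow> trunc n f \<in> borel_measurable borel"
  by (intro borel_measurable_times borel_measurable_indicator) auto

lemma measurable_cnj [measurable]: "cnj \<in> borel_measurable borel"
  by (intro borel_measurable_continuous_onI continuous_intros)

lemma L2_cnj: 
  assumes "L2 f" shows "L2 (\<lambda>x. cnj (f x))"
proof -
  have [measurable]: "f \<in> borel_measurable borel" using assms by (simp add: L2_def)
  have "(\<lambda>x. cnj (f x)) \<in> borel_measurable borel" by measurable
  then show ?thesis using assms by (simp add: L2_iff)
qed

lemma L2_trunc: "L2 f \<Longrightarrow> L2 (trunc n f)"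
  by (rule L2_bounded_mult_real[of _ _ 1]) (auto simp: indicator_def)

lemma integrable_trunc: "L2 f \<Longrightarrow> integrable lborel (trunc n f)"
  by (rule L2_prod_integrable[OF L2_indicator_ball])

lemma trunc_tendsto:
  fixes f :: "'a::euclidean_space \<Rightarrow> real"
  assumes f: "L2 f" shows "L2_tendsto (\<lambda>n. trunc n f) f"
proof -
  have [measurable]: "f \<in> borel_measurable borel" using f by (simp add: L2_def)
  have "(\<lambda>n. LINT x|lborel. (norm (trunc n f x - f x))\<^sup>2) \<longlonglongrightarrow> (LINT x|(lborel::'a measure). 0)"
  proof (rule integral_dominated_convergence)
    show "integrable lborel (\<lambda>x. (norm (f x))\<^sup>2)" by (rule L2_integrable[OF f])
    show "AE x in lborel. (\<lambda>n. (norm (trunc n f x - f x))\<^sup>2) \<longlonglongrightarrow> 0"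
    proof (rule AE_I2)
      fix x :: 'a
      have "\<forall>\<^sub>F n in sequentially. (norm (trunc n f x - f x))\<^sup>2 = 0"
        using eventually_gt_at_top[of "nat \<lceil>norm x\<rceil>"]
      proof eventually_elim
        case (elim n) then have "norm x < real n" by linarith
        then show ?case by simp
      qed
      then show "(\<lambda>n. (norm (trunc n f x - f x))\<^sup>2) \<longlonglongrightarrow> 0" by (rule tendsto_eventually)
    qed
  qed (auto simp: indicator_def)
  then show ?thesis using f L2_trunc[OF f] by (simp add: L2_tendsto_def L2sq_def)
qed

lemma fourier_integral_linear:
  assumes f: "integrable lborel f" and g: "integrable lborel g"
  shows "fourier_integral (\<lambda>x. a * f x + b * g x) \<xi> = complex_of_real a * fourier_integral f \<xi> + complex_of_real b * fourier_integral g \<xi>"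
proof -
  have "(LINT x|lborel. cis (- (x \<bullet> \<xi>)) * complex_of_real (a * f x + b * g x))
     = (LINT x|lborel. complex_of_real a * (cis (- (x \<bullet> \<xi>)) * complex_of_real (f x)) + complex_of_real b * (cis (- (x \<bullet> \<xi>)) * complex_of_real (g x)))"
    by (simp add: algebra_simps)
  also have "\<dots> = complex_of_real a * (LINT x|lborel. cis (- (x \<bullet> \<xi>)) * complex_of_real (f x)) + 
     complex_of_real b * (LINT x|lborel. cis (- (x \<bullet> \<xi>)) * complex_of_real (g x))"
    by (subst Bochner_Integration.integral_add)
      (auto intro!: integrable_mult_right fourier_integrand_integrable f g)
  finally show ?thesis by (simp add: fourier_integral_def algebra_simps)
qed

lemma fourier_integral_diff:
  assumes f: "integrable lborel f" and g: "integrable lborel g"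
  shows "fourier_integral (\<lambda>x. f x - g x) \<xi> = fourier_integral f \<xi> - fourier_integral g \<xi>"
  using fourier_integral_linear[OF f g, of 1 "-1" \<xi>] by simp

text \<open>Shows that the choice in \<open>fourier\<close> is not vacuous. By Plancherel on the
  truncations the transforms form a Cauchy sequence: for n \<le> m the difference of two truncations
  is pointwise at most |trunc n f - f|, which tends to 0 in L2.\<close>

lemma fourier_tendsto:
  fixes f :: "'a::euclidean_space \<Rightarrow> real"
  assumes f: "L2 f" shows "L2_tendsto (\<lambda>n. fourier_integral (trunc n f)) (fourier f)"
proof -
  have Lf: "L2 (fourier_integral (trunc n f))" for n
    by (rule plancherel_fourier_integral(1)[OF integrable_trunc[OF f] L2_trunc[OF f]])
  have "\<exists>g. L2_tendsto (\<lambda>n. fourier_integral (trunc n f)) g"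
  proof (rule L2_complete[OF Lf])
    show "(\<lambda>n. L2sq (\<lambda>x. trunc n f x - f x)) \<longlonglongrightarrow> 0" using trunc_tendsto[OF f] by (simp add: L2_tendsto_def)
    fix m n :: nat assume mn: "n \<le> m"
    have d: "integrable lborel (\<lambda>x. trunc m f x - trunc n f x)" "L2 (\<lambda>x. trunc m f x - trunc n f x)"
      using integrable_trunc[OF f] L2_trunc[OF f] by (auto intro: L2_diff)
    have "L2sq (\<lambda>x. fourier_integral (trunc m f) x - fourier_integral (trunc n f) x) = 
       L2sq (fourier_integral (\<lambda>x. trunc m f x - trunc n f x))"
      using fourier_integral_diff[OF integrable_trunc[OF f] integrable_trunc[OF f]] by presburger
    also have "\<dots> = L2sq (\<lambda>x. trunc m f x - trunc n f x)" by (rule plancherel_fourier_integral(2)[OF d])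
    also have "\<dots> \<le> L2sq (\<lambda>x. trunc n f x - f x)"
      unfolding L2sq_def
      by (rule integral_mono[OF L2_integrable[OF d(2)] L2_integrable[OF L2_diff[OF L2_trunc[OF f] f]]])
        (use mn in \<open>auto simp: indicator_def\<close>)
    finally show "L2sq (\<lambda>x. fourier_integral (trunc m f) x - fourier_integral (trunc n f) x) \<le> L2sq (\<lambda>x. trunc n f x - f x)" .
  qed
  then obtain g where g: "L2_tendsto (\<lambda>n. fourier_integral (trunc n f)) g" by blast
  have eq: "(\<integral>\<^sup>+ \<xi>. ennreal ((cmod (fourier_integral (trunc n f) \<xi> - h \<xi>))\<^sup>2) \<partial>lborel)
     = ennreal (L2sq (\<lambda>\<xi>. fourier_integral (trunc n f) \<xi> - h \<xi>))" if "L2 h" for h n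
    by (rule nn_integral_L2sq[OF L2_diff[OF Lf that]])
  let ?P = "\<lambda>g. L2 g \<and> (\<lambda>n. \<integral>\<^sup>+ \<xi>. ennreal ((cmod (fourier_integral (trunc n f) \<xi> - g \<xi>))\<^sup>2) \<partial>lborel) \<longlonglongrightarrow> 0"
  have "?P g" using g eq[of g] by (auto simp: L2_tendsto_def simp flip: ennreal_0)
  then have "?P (SOME g. ?P g)" by (rule someI[of ?P g])
  then have "?P (fourier f)" by (simp only: fourier_def)
  then show ?thesis using Lf eq[of "fourier f"] by (auto simp: L2_tendsto_def simp flip: ennreal_0)
qed

lemma L2_fourier: "L2 f \<Longrightarrow> L2 (fourier f)"
  using fourier_tendsto by (rule L2_tendsto_L2(2))

lemma L2sq_fourier:
  assumes f: "L2 f" shows "L2sq (fourier f) = L2sq f"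
proof -
  have "(\<lambda>n. L2sq (fourier_integral (trunc n f))) \<longlonglongrightarrow> L2sq (fourier f)"
    by (rule L2_tendsto_L2sq[OF fourier_tendsto[OF f]])
  moreover have "(\<lambda>n. L2sq (fourier_integral (trunc n f))) \<longlonglongrightarrow> L2sq f"
    unfolding plancherel_fourier_integral(2)[OF integrable_trunc[OF f] L2_trunc[OF f]]
    by (rule L2_tendsto_L2sq[OF trunc_tendsto[OF f]])
  ultimately show ?thesis by (rule LIMSEQ_unique)
qed

text \<open>On the intersection of L1 and L2 the transforms of the truncations also converge to the
  plain Fourier integral, again by Plancherel; limits in L2 are unique almost everywhere.\<close>

lemma fourier_eq_fourier_integral:
  assumes f: "integrable lborel f" "L2 f"
  shows "AE \<xi> in lborel. fourier f \<xi> = fourier_integral f \<xi>"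
proof (rule L2_tendsto_unique[OF fourier_tendsto[OF f(2)]])
  have "(\<lambda>\<xi>. fourier_integral (trunc n f) \<xi> - fourier_integral f \<xi>) = fourier_integral (\<lambda>x. trunc n f x - f x)" for n
    using fourier_integral_diff[OF integrable_trunc[OF f(2)] f(1)] by (simp add: fun_eq_iff)
  then have "L2sq (\<lambda>\<xi>. fourier_integral (trunc n f) \<xi> - fourier_integral f \<xi>) = L2sq (\<lambda>x. trunc n f x - f x)" for n
    using plancherel_fourier_integral(2)[of "\<lambda>x. trunc n f x - f x"] integrable_trunc[OF f(2)] f
    by (simp add: L2_diff L2_trunc)
  then show "L2_tendsto (\<lambda>n. fourier_integral (trunc n f)) (fourier_integral f)"
    using trunc_tendsto[OF f(2)] plancherel_fourier_integral(1)[OF f]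
      plancherel_fourier_integral(1)[OF integrable_trunc[OF f(2)] L2_trunc[OF f(2)]]
    unfolding L2_tendsto_def by simp
qed

text \<open>The transforms are equal as functions, not only almost everywhere: the predicate behind
  the choice sees f only through integrals, so both sides make the same choice.\<close>

lemma fourier_cong_AE:
  assumes "f \<in> borel_measurable lborel" "g \<in> borel_measurable lborel" "AE x in lborel. f x = g x"
  shows "fourier f = fourier g"
proof -
  have [measurable]: "f \<in> borel_measurable borel" "g \<in> borel_measurable borel" using assms by auto
  have "fourier_integral (trunc n f) = fourier_integral (trunc n g)" for n
    unfolding fourier_integral_def
  proof (rule ext, rule arg_cong[where f="\<lambda>z. _ * z"], rule integral_cong_AE)
    fix \<xi>
    show "AE x in lborel. cis (- (x \<bullet> \<xi>)) * complex_of_real (trunc n f x) = cis (- (x \<bullet> \<xi>)) * complex_of_real (trunc n g x)"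
      using assms(3) by eventually_elim simp
  qed measurable
  then show ?thesis unfolding fourier_def by simp
qed

lemma fourier_linear:
  assumes f: "L2 f" and g: "L2 g"
  shows "AE \<xi> in lborel. fourier (\<lambda>x. a * f x + b * g x) \<xi> = complex_of_real a * fourier f \<xi> + complex_of_real b * fourier g \<xi>"
proof (rule L2_tendsto_unique)
  show "L2_tendsto (\<lambda>n. fourier_integral (trunc n (\<lambda>x. a * f x + b * g x))) (fourier (\<lambda>x. a * f x + b * g x))"
    by (intro fourier_tendsto L2_add L2_cmult f g)
  have eq: "fourier_integral (trunc n (\<lambda>x. a * f x + b * g x)) = (\<lambda>\<xi>. 
     complex_of_real a * fourier_integral (trunc n f) \<xi> + complex_of_real b * fourier_integral (trunc n g) \<xi>)" for n
    using fourier_integral_linear[OF integrable_trunc[OF f] integrable_trunc[OF g], of a n b n]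
    by (simp add: algebra_simps fun_eq_iff)
  show "L2_tendsto (\<lambda>n. fourier_integral (trunc n (\<lambda>x. a * f x + b * g x))) 
     (\<lambda>\<xi>. complex_of_real a * fourier f \<xi> + complex_of_real b * fourier g \<xi>)"
    unfolding eq
    by (rule L2_tendsto_add[OF L2_tendsto_cmult[OF fourier_tendsto[OF f]] L2_tendsto_cmult[OF fourier_tendsto[OF g]]])
qed

lemma L2_tendsto_cnj: 
  assumes "L2_tendsto F f" shows "L2_tendsto (\<lambda>n x. cnj (F n x)) (\<lambda>x. cnj (f x))"
proof (rule L2_tendsto_bound[OF assms, where c=1])
  have L: "L2 (F n)" "L2 f" for n using assms by (auto simp: L2_tendsto_def)
  then show "(\<lambda>x. cnj (F n x)) \<in> borel_measurable lborel" "(\<lambda>x. cnj (f x)) \<in> borel_measurable lborel"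
    "L2 (\<lambda>x. cnj (F 0 x))" for n
    using L2_cnj L2_measurable by blast+
  show "AE x in lborel. cmod (cnj (F n x) - cnj (f x)) \<le> 1 * cmod (F n x - f x)" for n
    by (auto simp flip: complex_cnj_diff)
qed



section \<open>Parseval identities, with and without the Gaussian regulariser\<close>

lemma fourier_inner_integrable:
  assumes f: "L2 f" and g: "L2 g"
  shows "integrable lborel (\<lambda>\<xi>. fourier f \<xi> * cnj (fourier g \<xi>))"
  by (intro L2_prod_integrable L2_cnj L2_fourier f g)

text \<open>The regularised identity holds for truncations, which are integrable. Both sides are
  continuous in L2, the left one because multiplication by a Gaussian is a contraction.\<close>

lemma parseval_heat:
  fixes f g :: "'a::euclidean_space \<Rightarrow> real"
  assumes l: "0 < l" and f: "L2 f" and g: "L2 g"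
  shows "(LINT \<xi>|lborel. exp (- l * (norm \<xi>)\<^sup>2) * Re (fourier f \<xi> * cnj (fourier g \<xi>))) = heat_form l f g"
proof -
  define e where "e \<xi> = complex_of_real (exp (- l * (norm \<xi>)\<^sup>2))" for \<xi> :: 'a
  have e1: "cmod (e \<xi>) \<le> 1" for \<xi> using l by (simp add: e_def)
  have [measurable]: "e \<in> borel_measurable borel" unfolding e_def by measurable
  have eF: "L2_tendsto (\<lambda>n \<xi>. e \<xi> * fourier_integral (trunc n f) \<xi>) (\<lambda>\<xi>. e \<xi> * fourier f \<xi>)"
  proof (rule L2_tendsto_bound[OF fourier_tendsto[OF f], where c=1])
    have L: "L2 (fourier_integral (trunc n f))" "L2 (fourier f)" for n 
      using fourier_tendsto[OF f] by (auto simp: L2_tendsto_def)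
    then have [measurable]: "fourier_integral (trunc n f) \<in> borel_measurable borel" "fourier f \<in> borel_measurable borel" for n
      by (auto simp: L2_def)
    show "(\<lambda>\<xi>. e \<xi> * fourier_integral (trunc n f) \<xi>) \<in> borel_measurable lborel" "(\<lambda>\<xi>. e \<xi> * fourier f \<xi>) \<in> borel_measurable lborel" for n
      by measurable
    show "L2 (\<lambda>\<xi>. e \<xi> * fourier_integral (trunc 0 f) \<xi>)"
      by (rule L2_bound[OF L(1)[of 0], of _ 1]) (use e1 mult_right_mono[OF e1] in \<open>auto simp: norm_mult\<close>)
    show "AE \<xi> in lborel. cmod (e \<xi> * fourier_integral (trunc n f) \<xi> - e \<xi> * fourier f \<xi>) \<le> 1 * cmod (fourier_integral (trunc n f) \<xi> - fourier f \<xi>)" for n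
      unfolding right_diff_distrib[symmetric] norm_mult using mult_right_mono[OF e1] by auto
  qed
  have "(\<lambda>n. LINT \<xi>|lborel. e \<xi> * fourier_integral (trunc n f) \<xi> * cnj (fourier_integral (trunc n g) \<xi>))
     \<longlonglongrightarrow> (LINT \<xi>|lborel. e \<xi> * fourier f \<xi> * cnj (fourier g \<xi>))"
    by (rule L2_tendsto_integral_mult[OF eF L2_tendsto_cnj[OF fourier_tendsto[OF g]]])
  moreover have "(LINT \<xi>|lborel. e \<xi> * fourier_integral (trunc n f) \<xi> * cnj (fourier_integral (trunc n g) \<xi>)) 
     = complex_of_real (heat_form l (trunc n f) (trunc n g))" for n
    unfolding e_def mult.assoc by (rule fourier_integral_heat(2)[OF l integrable_trunc[OF f] integrable_trunc[OF g]])
  moreover have "(\<lambda>n. complex_of_real (heat_form l (trunc n f) (trunc n g))) \<longlonglongrightarrow> complex_of_real (heat_form l f g)"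
    by (intro tendsto_of_real L2_tendsto_heat_form[OF l] trunc_tendsto f g)
  ultimately have c: "(LINT \<xi>|lborel. e \<xi> * fourier f \<xi> * cnj (fourier g \<xi>)) = complex_of_real (heat_form l f g)"
    using LIMSEQ_unique by simp
  have i: "integrable lborel (\<lambda>\<xi>. e \<xi> * fourier f \<xi> * cnj (fourier g \<xi>))"
    by (rule L2_prod_integrable[OF L2_tendsto_L2(2)[OF eF] L2_cnj[OF L2_fourier[OF g]]])
  have "Re (e \<xi> * fourier f \<xi> * cnj (fourier g \<xi>)) = exp (- l * (norm \<xi>)\<^sup>2) * Re (fourier f \<xi> * cnj (fourier g \<xi>))" for \<xi>
    unfolding e_def mult.assoc by (simp only: Re_complex_of_real Im_complex_of_real times_complex.sel)
  then show ?thesis using integral_Re[OF i] c by simp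
qed

lemma L2sq_expand_add:
  fixes f g :: "'a::euclidean_space \<Rightarrow> complex"
  assumes f: "L2 f" and g: "L2 g"
  shows "L2sq (\<lambda>x. f x + g x) = L2sq f + 2 * (LINT x|lborel. Re (f x * cnj (g x))) + L2sq g"
proof -
  define r where "r = (\<lambda>x. Re (f x * cnj (g x)))"
  have i: "integrable lborel r"
    unfolding r_def by (intro integrable_Re L2_prod_integrable f L2_cnj g)
  have "(norm (f x + g x))\<^sup>2 = (norm (f x))\<^sup>2 + 2 * r x + (norm (g x))\<^sup>2" for x
    unfolding cmod_power2 r_def by (simp add: power2_sum algebra_simps)
  then have "L2sq (\<lambda>x. f x + g x) = (LINT x|lborel. (norm (f x))\<^sup>2 + 2 * r x + (norm (g x))\<^sup>2)"
    by (simp add: L2sq_def)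
  also have "\<dots> = L2sq f + 2 * (LINT x|lborel. r x) + L2sq g"
    unfolding L2sq_def using i L2_integrable[OF f] L2_integrable[OF g] by simp
  finally show ?thesis unfolding r_def .
qed

text \<open>Polarisation: the expansions of ||f + g||^2 on both sides are compared. Real functions
  make the inner product symmetric, so the real part on the frequency side is all that is
  compared.\<close>

lemma parseval:
  fixes f g :: "'a::euclidean_space \<Rightarrow> real"
  assumes f: "L2 f" and g: "L2 g"
  shows "(LINT \<xi>|lborel. Re (fourier f \<xi> * cnj (fourier g \<xi>))) = (LINT x|lborel. f x * g x)"
proof -
  have fg: "integrable lborel (\<lambda>x. f x * g x)" by (rule L2_prod_integrable[OF f g])
  have "L2sq (\<lambda>x. f x + g x) = L2sq f + 2 * (LINT x|lborel. f x * g x) + L2sq g"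
  proof -
    have "L2sq (\<lambda>x. f x + g x) = (LINT x|lborel. (norm (f x))\<^sup>2 + 2 * (f x * g x) + (norm (g x))\<^sup>2)"
      by (simp add: L2sq_def power2_sum algebra_simps)
    also have "\<dots> = L2sq f + 2 * (LINT x|lborel. f x * g x) + L2sq g"
      unfolding L2sq_def using fg L2_integrable[OF f] L2_integrable[OF g] by simp
    finally show ?thesis .
  qed
  moreover have "L2sq (\<lambda>x. f x + g x) = L2sq (\<lambda>\<xi>. fourier f \<xi> + fourier g \<xi>)"
  proof -
    have "L2sq (\<lambda>x. f x + g x) = L2sq (fourier (\<lambda>x. f x + g x))" by (rule L2sq_fourier[symmetric, OF L2_add[OF f g]])
    also have "\<dots> = L2sq (\<lambda>\<xi>. fourier f \<xi> + fourier g \<xi>)"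
      using fourier_linear[OF f g, of 1 1] L2_fourier[OF f] L2_fourier[OF g] L2_fourier[OF L2_add[OF f g]]
      by (intro L2sq_cong_AE) (auto simp: L2_def)
    finally show ?thesis .
  qed
  ultimately show ?thesis
    using L2sq_expand_add[OF L2_fourier[OF f] L2_fourier[OF g]] by (simp add: L2sq_fourier f g)
qed

text \<open>The kernel exp (- i x . \<xi>) is symmetric in its two arguments, so Fubini exchanges
  the roles of f and g. This is the adjoint relation behind surjectivity.\<close>

lemma fourier_multiplication:
  fixes f g :: "'a::euclidean_space \<Rightarrow> real"
  assumes f: "L2 f" and g: "L2 g"
  shows "(LINT \<xi>|lborel. fourier f \<xi> * complex_of_real (g \<xi>)) = (LINT x|lborel. fourier g x * complex_of_real (f x))"
proof -
  have *: "(LINT \<xi>|lborel. fourier_integral f \<xi> * complex_of_real (g \<xi>)) = (LINT x|lborel. fourier_integral g x * complex_of_real (f x))"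
    if f: "integrable lborel f" and g: "integrable lborel g" for f g :: "'a \<Rightarrow> real"
  proof -
    have [measurable]: "f \<in> borel_measurable borel" "g \<in> borel_measurable borel" using f g by auto
    define H where "H = (\<lambda>\<xi> x :: 'a. cis (- (x \<bullet> \<xi>)) * complex_of_real (g \<xi> * f x))"
    have iH: "integrable (lborel \<Otimes>\<^sub>M lborel) (\<lambda>(\<xi>, x). H \<xi> x)"
    proof (rule Bochner_Integration.integrable_bound[OF integrable_tensor[OF g f]])
      show "(\<lambda>(\<xi>, x). H \<xi> x) \<in> borel_measurable (lborel \<Otimes>\<^sub>M lborel)" unfolding H_def by measurable
    qed (auto simp: H_def norm_mult)
    have "(LINT x|lborel. H \<xi> x) = (LINT x|lborel. cis (- (x \<bullet> \<xi>)) * complex_of_real (f x)) * complex_of_real (g \<xi>)" for \<xi>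
      unfolding H_def by (subst integral_mult_left_zero[symmetric]) (simp add: mult_ac)
    moreover have "(LINT \<xi>|lborel. H \<xi> x) = (LINT \<xi>|lborel. cis (- (\<xi> \<bullet> x)) * complex_of_real (g \<xi>)) * complex_of_real (f x)" for x
      unfolding H_def by (subst integral_mult_left_zero[symmetric]) (simp add: mult_ac inner_commute)
    moreover have "(LINT \<xi>|lborel. LINT x|lborel. H \<xi> x) = (LINT x|lborel. LINT \<xi>|lborel. H \<xi> x)"
      using lborel_pair.Fubini_integral[OF iH] by simp
    ultimately show ?thesis unfolding fourier_integral_def by (simp add: mult.assoc)
  qed
  have R: "L2_tendsto (\<lambda>n x. complex_of_real (trunc n h x)) (\<lambda>x. complex_of_real (h x))" if "L2 h" for h :: "'a \<Rightarrow> real"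
    using trunc_tendsto[OF that] by (auto simp: L2_tendsto_def L2_iff L2sq_def simp flip: of_real_diff of_real_mult)
  have "(\<lambda>n. LINT \<xi>|lborel. fourier_integral (trunc n f) \<xi> * complex_of_real (trunc n g \<xi>)) \<longlonglongrightarrow> 
     (LINT \<xi>|lborel. fourier f \<xi> * complex_of_real (g \<xi>))"
    by (rule L2_tendsto_integral_mult[OF fourier_tendsto[OF f] R[OF g]])
  moreover have "(\<lambda>n. LINT \<xi>|lborel. fourier_integral (trunc n g) \<xi> * complex_of_real (trunc n f \<xi>)) \<longlonglongrightarrow> 
     (LINT \<xi>|lborel. fourier g \<xi> * complex_of_real (f \<xi>))"
    by (rule L2_tendsto_integral_mult[OF fourier_tendsto[OF g] R[OF f]])
  ultimately show ?thesis
    unfolding *[OF integrable_trunc[OF f] integrable_trunc[OF g]] by (rule LIMSEQ_unique)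
qed

section \<open>Reflection symmetry and surjectivity onto Hermitian functions\<close>

lemma fourier_integral_minus_arg: "fourier_integral f (- \<xi>) = cnj (fourier_integral f \<xi>)"
  unfolding fourier_integral_def by (simp add: cis_cnj flip: Bochner_Integration.integral_cnj)

lemma fourier_integral_reflect: "fourier_integral (\<lambda>x. f (- x)) \<xi> = cnj (fourier_integral f \<xi>)"
proof -
  have "(LINT x|lborel. cis (- (x \<bullet> \<xi>)) * complex_of_real (f (- x))) = (LINT x|lborel. cis (x \<bullet> \<xi>) * complex_of_real (f x))"
    using integral_reflect[of "\<lambda>x. cis (x \<bullet> \<xi>) * complex_of_real (f x)" 0] by simp
  then show ?thesis
    unfolding fourier_integral_def by (simp add: cis_cnj flip: Bochner_Integration.integral_cnj)
qed

lemma L2_reflect: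
  fixes f :: "'a::euclidean_space \<Rightarrow> 'b::{banach, second_countable_topology}"
  shows "L2 f \<Longrightarrow> L2 (\<lambda>x. f (- x))"
  using integrable_reflect[of "\<lambda>x. (norm (f x))\<^sup>2" 0] by (auto simp: L2_iff)

lemma L2sq_reflect: "L2sq (\<lambda>x. f (- x)) = L2sq f"
  using integral_reflect[of "\<lambda>x. (norm (f x))\<^sup>2" 0] by (simp add: L2sq_def)

lemma fourier_minus_arg:
  assumes f: "L2 f"
  shows "AE \<xi> in lborel. fourier f (- \<xi>) = cnj (fourier f \<xi>)"
proof (rule L2_tendsto_unique[OF _ L2_tendsto_cnj[OF fourier_tendsto[OF f]]])
  show "L2_tendsto (\<lambda>n \<xi>. cnj (fourier_integral (trunc n f) \<xi>)) (\<lambda>\<xi>. fourier f (- \<xi>))"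
    unfolding fourier_integral_minus_arg[symmetric]
    using fourier_tendsto[OF f] L2sq_reflect[of "\<lambda>\<xi>. fourier_integral (trunc _ f) \<xi> - fourier f \<xi>"]
    by (auto simp: L2_tendsto_def intro: L2_reflect)
qed

lemma fourier_reflect:
  assumes f: "L2 f"
  shows "AE \<xi> in lborel. fourier (\<lambda>x. f (- x)) \<xi> = cnj (fourier f \<xi>)"
proof (rule L2_tendsto_unique[OF _ L2_tendsto_cnj[OF fourier_tendsto[OF f]]])
  have eq: "fourier_integral (trunc n (\<lambda>x. f (- x))) = (\<lambda>\<xi>. cnj (fourier_integral (trunc n f) \<xi>))" for n
    using fourier_integral_reflect[of "trunc n f"] by (simp add: indicator_def fun_eq_iff)
  show "L2_tendsto (\<lambda>n \<xi>. cnj (fourier_integral (trunc n f) \<xi>)) (fourier (\<lambda>x. f (- x)))"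
    using fourier_tendsto[OF L2_reflect[OF f]] unfolding eq .
qed

lemma L2_Re_Im:
  assumes "L2 f" shows "L2 (\<lambda>x. Re (f x))" "L2 (\<lambda>x. Im (f x))"
  by (rule L2_bound[OF assms, of _ 1]; use assms in \<open>auto simp: L2_def abs_Re_le_cmod abs_Im_le_cmod\<close>)+

text \<open>The adjoint of the Fourier transform is the conjugate of an isometry, hence an isometry itself,
  which makes the isometric Fourier transform onto.\<close>

lemma fourier_surj:
  fixes g :: "'a::euclidean_space \<Rightarrow> complex"
  assumes g: "L2 g" and sym: "AE \<xi> in lborel. g (- \<xi>) = cnj (g \<xi>)"
  shows "\<exists>w. L2 w \<and> (AE \<xi> in lborel. fourier w \<xi> = g \<xi>)"
proof -
  define a where "a = (\<lambda>\<xi>. Re (g \<xi>))"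
  define b where "b = (\<lambda>\<xi>. Im (g \<xi>))"
  have a: "L2 a" and b: "L2 b" using L2_Re_Im[OF g] by (auto simp: a_def b_def)
  note Fa = L2_fourier[OF a] and Fb = L2_fourier[OF b]
  have "AE \<xi> in lborel. a (- \<xi>) = a \<xi>" using sym by eventually_elim (simp add: a_def)
  then have "fourier (\<lambda>x. a (- x)) = fourier a"
    by (intro fourier_cong_AE) (use a L2_reflect[OF a] in \<open>auto simp: L2_def\<close>)
  \<comment> \<open>By Hermitian symmetry a is even and b is odd, hence the transform of a is real
    and that of b purely imaginary.\<close>
  then have Fa_real: "AE \<xi> in lborel. Im (fourier a \<xi>) = 0"
    using fourier_reflect[OF a] by (auto elim!: eventually_mono simp: complex_eq_iff)
  have "AE \<xi> in lborel. b (- \<xi>) = (-1) * b \<xi> + 0 * b \<xi>" using sym by eventually_elim (simp add: b_def)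
  then have "fourier (\<lambda>x. b (- x)) = fourier (\<lambda>\<xi>. (-1) * b \<xi> + 0 * b \<xi>)"
    by (intro fourier_cong_AE) (use b L2_reflect[OF b] in \<open>auto simp: L2_def\<close>)
  then have Fb_imag: "AE \<xi> in lborel. Re (fourier b \<xi>) = 0"
    using fourier_reflect[OF b] fourier_linear[OF b b, of "-1" 0]
    by (auto elim!: eventually_elim2 simp: complex_eq_iff)
  \<comment> \<open>This is the inverse transform of g = a + i b: inversion is the transform
    composed with reflection, the transform of a is real and even, and that of b is i times a real
    odd function, so i b contributes its imaginary part.\<close>
  define w where "w = (\<lambda>x. Re (fourier a x) + Im (fourier b x))"
  note RI = L2_Re_Im[OF Fa] L2_Re_Im[OF Fb]
  have w: "L2 w" unfolding w_def by (intro L2_add RI)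
  \<comment> \<open>A product of an even and an odd function integrates to 0, so the two summands of
    w are orthogonal and ||w|| = ||g||.\<close>
  have cross: "(LINT x|lborel. Re (fourier a x) * Im (fourier b x)) = 0"
  proof -
    have "(LINT x|lborel. Re (fourier a (- x)) * Im (fourier b (- x))) = (LINT x|lborel. - (Re (fourier a x) * Im (fourier b x)))"
    proof (rule integral_cong_AE)
      show "AE x in lborel. Re (fourier a (- x)) * Im (fourier b (- x)) = - (Re (fourier a x) * Im (fourier b x))"
        using fourier_minus_arg[OF a] fourier_minus_arg[OF b] by eventually_elim simp
    qed (use RI L2_reflect[OF RI(1)] L2_reflect[OF RI(4)] in \<open>auto simp: L2_def\<close>)
    then show ?thesis using integral_reflect[of "\<lambda>x. Re (fourier a x) * Im (fourier b x)" 0] by simp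
  qed
  have na: "(LINT x|lborel. (Re (fourier a x))\<^sup>2) = L2sq a"
  proof -
    have "L2sq (fourier a) = (LINT x|lborel. (Re (fourier a x))\<^sup>2)"
      unfolding L2sq_def by (rule integral_cong_AE) (use Fa RI Fa_real in \<open>auto simp: L2_def cmod_power2 elim!: eventually_mono\<close>)
    then show ?thesis by (simp add: L2sq_fourier[OF a])
  qed
  have nb: "(LINT x|lborel. (Im (fourier b x))\<^sup>2) = L2sq b"
  proof -
    have "L2sq (fourier b) = (LINT x|lborel. (Im (fourier b x))\<^sup>2)"
      unfolding L2sq_def by (rule integral_cong_AE) (use Fb RI Fb_imag in \<open>auto simp: L2_def cmod_power2 elim!: eventually_mono\<close>)
    then show ?thesis by (simp add: L2sq_fourier[OF b])
  qed
  have i1: "integrable lborel (\<lambda>x. (Re (fourier a x))\<^sup>2)" "integrable lborel (\<lambda>x. (Im (fourier b x))\<^sup>2)"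
    using RI by (auto simp: L2_iff)
  have i2: "integrable lborel (\<lambda>x. Re (fourier a x) * Im (fourier b x))" by (intro L2_prod_integrable RI)
  have ab: "integrable lborel (\<lambda>x. (a x)\<^sup>2)" "integrable lborel (\<lambda>x. (b x)\<^sup>2)" using a b by (auto simp: L2_iff)
  have wn: "L2sq w = L2sq a + L2sq b"
  proof -
    have "L2sq w = (LINT x|lborel. (Re (fourier a x))\<^sup>2 + 2 * (Re (fourier a x) * Im (fourier b x)) + (Im (fourier b x))\<^sup>2)"
      by (simp add: L2sq_def w_def power2_sum algebra_simps)
    also have "\<dots> = L2sq a + L2sq b" using i1 i2 cross na nb by simp
    finally show ?thesis .
  qed
  have gn: "L2sq g = L2sq a + L2sq b"
    using ab by (simp add: L2sq_def cmod_power2 a_def b_def)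
  note Fw = L2_fourier[OF w]
  have Ra: "L2 (\<lambda>x. complex_of_real (a x))" "L2 (\<lambda>x. complex_of_real (b x))" using a b by (auto simp: L2_iff)
  have wRa: "(LINT \<xi>|lborel. Re (fourier w \<xi>) * a \<xi>) = (LINT x|lborel. w x * Re (fourier a x))"
  proof -
    have "Re (LINT \<xi>|lborel. fourier w \<xi> * complex_of_real (a \<xi>)) = (LINT \<xi>|lborel. Re (fourier w \<xi>) * a \<xi>)"
      using integral_Re[OF L2_prod_integrable[OF Fw Ra(1)]] by simp
    moreover have "Re (LINT x|lborel. fourier a x * complex_of_real (w x)) = (LINT x|lborel. w x * Re (fourier a x))"
      using integral_Re[OF L2_prod_integrable[OF Fa, of "\<lambda>x. complex_of_real (w x)"]] w by (auto simp: L2_iff mult.commute)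
    ultimately show ?thesis using fourier_multiplication[OF w a] by simp
  qed
  have wIb: "(LINT \<xi>|lborel. Im (fourier w \<xi>) * b \<xi>) = (LINT x|lborel. w x * Im (fourier b x))"
  proof -
    have "Im (LINT \<xi>|lborel. fourier w \<xi> * complex_of_real (b \<xi>)) = (LINT \<xi>|lborel. Im (fourier w \<xi>) * b \<xi>)"
      using integral_Im[OF L2_prod_integrable[OF Fw Ra(2)]] by simp
    moreover have "Im (LINT x|lborel. fourier b x * complex_of_real (w x)) = (LINT x|lborel. w x * Im (fourier b x))"
      using integral_Im[OF L2_prod_integrable[OF Fb, of "\<lambda>x. complex_of_real (w x)"]] w by (auto simp: L2_iff mult.commute)
    ultimately show ?thesis using fourier_multiplication[OF w b] by simp
  qed
  \<comment> \<open>The multiplication formula moves the transform from w onto a and b, where it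
    reassembles w. Expanding the square of the norm of \<open>fourier w - g\<close> then gives
    ||w||^2 - 2 ||w||^2 + ||g||^2 = 0.\<close>
  have inner: "(LINT \<xi>|lborel. Re (fourier w \<xi> * cnj (- g \<xi>))) = - L2sq w"
  proof -
    have "(LINT \<xi>|lborel. Re (fourier w \<xi> * cnj (- g \<xi>))) = (LINT \<xi>|lborel. - (Re (fourier w \<xi>) * a \<xi> + Im (fourier w \<xi>) * b \<xi>))"
      by (simp add: a_def b_def)
    also have "\<dots> = - ((LINT \<xi>|lborel. Re (fourier w \<xi>) * a \<xi>) + (LINT \<xi>|lborel. Im (fourier w \<xi>) * b \<xi>))"
      using L2_prod_integrable[OF L2_Re_Im(1)[OF Fw] a] L2_prod_integrable[OF L2_Re_Im(2)[OF Fw] b] by simp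
    also have "(LINT \<xi>|lborel. Re (fourier w \<xi>) * a \<xi>) + (LINT \<xi>|lborel. Im (fourier w \<xi>) * b \<xi>) 
       = (LINT x|lborel. w x * Re (fourier a x) + w x * Im (fourier b x))"
      unfolding wRa wIb using L2_prod_integrable[OF w RI(1)] L2_prod_integrable[OF w RI(4)] by simp
    also have "\<dots> = (LINT x|lborel. (w x)\<^sup>2)" by (simp add: w_def power2_eq_square algebra_simps)
    finally show ?thesis by (simp add: L2sq_def)
  qed
  have "L2sq (\<lambda>\<xi>. fourier w \<xi> + - g \<xi>) = L2sq w + 2 * (- L2sq w) + L2sq g"
    using L2sq_expand_add[OF Fw L2_minus[OF g]] inner by (simp add: L2sq_fourier[OF w] L2sq_minus)
  then have "L2sq (\<lambda>\<xi>. fourier w \<xi> + - g \<xi>) = 0" using wn gn by simp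
  then have "AE \<xi> in lborel. fourier w \<xi> + - g \<xi> = 0"
    using L2sq_eq_0_iff[OF L2_add[OF Fw L2_minus[OF g]]] by simp
  then have "AE \<xi> in lborel. fourier w \<xi> = g \<xi>" by eventually_elim simp
  then show ?thesis using w by blast
qed

text \<open>The multiplier is real and even, so it preserves Hermitian symmetry, and surjectivity
  provides a real function with the required transform. Only then does the choice in
  \<open>frac_laplacian\<close> have content.\<close>

lemma frac_laplacian_spec:
  fixes f :: "'a::euclidean_space \<Rightarrow> real"
  assumes f: "L2 f" and m: "L2 (\<lambda>\<xi>. complex_of_real (norm \<xi> powr (2 * \<sigma>)) * fourier f \<xi>)"
  shows "L2 (frac_laplacian \<sigma> f)"
    and "AE \<xi> in lborel. fourier (frac_laplacian \<sigma> f) \<xi> = complex_of_real (norm \<xi> powr (2 * \<sigma>)) * fourier f \<xi>"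
proof -
  have "AE \<xi> in lborel. complex_of_real (norm (- \<xi>) powr (2 * \<sigma>)) * fourier f (- \<xi>) = 
     cnj (complex_of_real (norm \<xi> powr (2 * \<sigma>)) * fourier f \<xi>)"
    using fourier_minus_arg[OF f] by eventually_elim simp
  from fourier_surj[OF m this]
  have "L2 (frac_laplacian \<sigma> f) \<and> (AE \<xi> in lborel. fourier (frac_laplacian \<sigma> f) \<xi> = complex_of_real (norm \<xi> powr (2 * \<sigma>)) * fourier f \<xi>)"
    unfolding frac_laplacian_def by (rule someI_ex)
  then show "L2 (frac_laplacian \<sigma> f)"
    and "AE \<xi> in lborel. fourier (frac_laplacian \<sigma> f) \<xi> = complex_of_real (norm \<xi> powr (2 * \<sigma>)) * fourier f \<xi>" by auto
qed

section \<open>Smooth functions\<close>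

text \<open>The differentiability part of \<open>test_function\<close>, separated because heat
  kernels and trigonometric functions enter as smooth factors without compact support.\<close>

definition smooth :: "('b::real_normed_vector \<Rightarrow> real) \<Rightarrow> bool" where
  "smooth f \<longleftrightarrow> (\<forall>n. times_differentiable n f)"

lemma times_differentiable_continuous: "times_differentiable n f \<Longrightarrow> continuous_on UNIV f"
  by (cases n) (auto intro!: differentiable_imp_continuous_on simp: differentiable_on_def intro: differentiable_at_withinI)

lemma times_differentiable_SucD: "times_differentiable (Suc n) f \<Longrightarrow> times_differentiable n f"
proof (induction n arbitrary: f)
  case 0
  show ?case using times_differentiable_continuous[OF 0] by simp
next
  case (Suc n)
  then show ?case by (metis times_differentiable.simps(2))
qed

lemma times_differentiable_SucI:
  assumes "\<And>x. (f has_derivative f' x) (at x)" "\<And>v. times_differentiable n (\<lambda>x. f' x v)"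
  shows "times_differentiable (Suc n) f"
proof -
  have "frechet_derivative f (at x) = f' x" for x
    using frechet_derivative_at[OF assms(1)] by simp
  then show ?thesis using assms by (auto simp: differentiable_def)
qed

lemma times_differentiable_const [simp]: "times_differentiable n (\<lambda>x. c)"
proof (induction n arbitrary: c)
  case (Suc n)
  show ?case by (rule times_differentiable_SucI[where f'="\<lambda>_ _. 0"]) (auto intro: Suc)
qed simp

lemma times_differentiable_linear: "bounded_linear f \<Longrightarrow> times_differentiable n f"
  by (cases n) (auto intro!: times_differentiable_SucI bounded_linear_imp_has_derivative linear_continuous_on
    simp del: times_differentiable.simps(2))

lemma times_differentiable_has_derivative:
  "times_differentiable (Suc n) f \<Longrightarrow> (f has_derivative frechet_derivative f (at x)) (at x)"
  by (simp add: frechet_derivative_works)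

lemma times_differentiable_add:
  "times_differentiable n f \<Longrightarrow> times_differentiable n g \<Longrightarrow> times_differentiable n (\<lambda>x. f x + g x)"
proof (induction n arbitrary: f g)
  case 0 then show ?case by (auto intro: continuous_intros)
next
  case (Suc n)
  show ?case
  proof (rule times_differentiable_SucI)
    show "((\<lambda>x. f x + g x) has_derivative (\<lambda>v. frechet_derivative f (at x) v + frechet_derivative g (at x) v)) (at x)" for x
      using Suc.prems by (intro has_derivative_add times_differentiable_has_derivative)
  qed (use Suc in auto)
qed

lemma times_differentiable_mult:
  "times_differentiable n f \<Longrightarrow> times_differentiable n g \<Longrightarrow> times_differentiable n (\<lambda>x. f x * g x)"
proof (induction n arbitrary: f g)
  case 0 then show ?case by (auto intro: continuous_intros)
next
  case (Suc n)
  show ?case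
  proof (rule times_differentiable_SucI)
    show "((\<lambda>x. f x * g x) has_derivative (\<lambda>v. f x * frechet_derivative g (at x) v + frechet_derivative f (at x) v * g x)) (at x)" for x
      using Suc.prems by (intro has_derivative_mult times_differentiable_has_derivative)
    show "times_differentiable n (\<lambda>x. f x * frechet_derivative g (at x) v + frechet_derivative f (at x) v * g x)" for v
      using Suc.prems times_differentiable_SucD[OF Suc.prems(1)] times_differentiable_SucD[OF Suc.prems(2)]
      by (intro times_differentiable_add Suc.IH) auto
  qed
qed

lemma times_differentiable_compose:
  fixes h :: "real \<Rightarrow> real"
  shows "times_differentiable n h \<Longrightarrow> times_differentiable n f \<Longrightarrow> times_differentiable n (\<lambda>x. h (f x))"
proof (induction n arbitrary: h f)
  case 0 then show ?case by (auto intro: continuous_on_compose2)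
next
  case (Suc n)
  show ?case
  proof (rule times_differentiable_SucI)
    fix x
    have h: "(h has_derivative frechet_derivative h (at (f x))) (at (f x))"
      using Suc.prems(1) by (rule times_differentiable_has_derivative)
    have lin: "frechet_derivative h (at (f x)) v = frechet_derivative h (at (f x)) 1 * v" for v
      using linear_scale[OF has_derivative_linear[OF h], of v 1] by (simp add: mult.commute)
    have "((\<lambda>x. h (f x)) has_derivative (\<lambda>v. frechet_derivative h (at (f x)) (frechet_derivative f (at x) v))) (at x)"
      using has_derivative_compose[OF times_differentiable_has_derivative[OF Suc.prems(2)] h] .
    then show "((\<lambda>x. h (f x)) has_derivative (\<lambda>v. frechet_derivative h (at (f x)) 1 * frechet_derivative f (at x) v)) (at x)"
      by (subst (asm) lin)
  next
    show "times_differentiable n (\<lambda>x. frechet_derivative h (at (f x)) 1 * frechet_derivative f (at x) v)" for v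
      using Suc.prems times_differentiable_SucD[OF Suc.prems(2)]
      by (intro times_differentiable_mult Suc.IH[of "\<lambda>y. frechet_derivative h (at y) 1"]) auto
  qed
qed

text \<open>Smoothness by coinduction: a family closed under directional derivatives consists of
  smooth functions, although no formula for the n-th derivative is available.\<close>

lemma smooth_coinduct:
  assumes "f \<in> S" "\<And>f x. f \<in> S \<Longrightarrow> f differentiable (at x)"
    "\<And>f v. f \<in> S \<Longrightarrow> (\<lambda>x. frechet_derivative f (at x) v) \<in> S"
  shows "smooth f"
proof -
  have "\<forall>f\<in>S. times_differentiable n f" for n
  proof (induction n)
    case 0
    then show ?case using assms(2) by (auto intro!: differentiable_imp_continuous_on simp: differentiable_on_def intro: differentiable_at_withinI)
  next
    case (Suc n) then show ?case using assms(2,3) by auto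
  qed
  then show ?thesis using assms(1) by (auto simp: smooth_def)
qed

lemma smooth_const [simp, intro]: "smooth (\<lambda>x. c)"
  and smooth_linear: "bounded_linear f \<Longrightarrow> smooth f"
  and smooth_add [intro]: "smooth f \<Longrightarrow> smooth g \<Longrightarrow> smooth (\<lambda>x. f x + g x)"
  and smooth_mult [intro]: "smooth f \<Longrightarrow> smooth g \<Longrightarrow> smooth (\<lambda>x. f x * g x)"
  and smooth_compose: "smooth h \<Longrightarrow> smooth f \<Longrightarrow> smooth (\<lambda>x. h (f x))" for h :: "real \<Rightarrow> real"
  by (simp_all add: smooth_def times_differentiable_linear times_differentiable_add
    times_differentiable_mult times_differentiable_compose)

lemma smooth_minus [intro]: "smooth f \<Longrightarrow> smooth (\<lambda>x. - f x)"
  using smooth_mult[OF smooth_const[of "-1"]] by simp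

lemma smooth_diff [intro]: "smooth f \<Longrightarrow> smooth g \<Longrightarrow> smooth (\<lambda>x. f x - g x)"
  using smooth_add[OF _ smooth_minus] by simp

lemma smooth_sum: "(\<And>i. i \<in> I \<Longrightarrow> smooth (f i)) \<Longrightarrow> smooth (\<lambda>x. \<Sum>i\<in>I. f i x)"
  by (induction I rule: infinite_finite_induct) auto

lemma smooth_prod: "(\<And>i. i \<in> I \<Longrightarrow> smooth (f i)) \<Longrightarrow> smooth (\<lambda>x. \<Prod>i\<in>I. f i x)"
  by (induction I rule: infinite_finite_induct) auto

lemma smooth_differentiable: "smooth f \<Longrightarrow> f differentiable (at x)"
  by (metis smooth_def times_differentiable.simps(2))

lemma smooth_has_derivative: "smooth f \<Longrightarrow> (f has_derivative frechet_derivative f (at x)) (at x)"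
  using smooth_differentiable frechet_derivative_works by blast

lemma smooth_frechet: "smooth f \<Longrightarrow> smooth (\<lambda>x. frechet_derivative f (at x) v)"
  unfolding smooth_def by (metis times_differentiable.simps(2))

lemma smooth_continuous: "smooth f \<Longrightarrow> continuous_on A f"
  using times_differentiable_continuous continuous_on_subset unfolding smooth_def by blast

lemma smooth_isCont: "smooth f \<Longrightarrow> isCont f x"
  using smooth_continuous[of f UNIV] by (simp add: continuous_on_eq_continuous_at)

lemma smooth_measurable: "smooth f \<Longrightarrow> f \<in> borel_measurable borel"
  for f :: "'a::euclidean_space \<Rightarrow> real"
  by (intro borel_measurable_continuous_onI smooth_continuous)

lemma smooth_inner: "smooth (\<lambda>x::'a::euclidean_space. x \<bullet> b)"
  by (intro smooth_linear bounded_linear_intros)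

lemma smooth_compose_linear:
  assumes f: "smooth f" and A: "bounded_linear A"
  shows "smooth (\<lambda>x. f (A x))"
proof (rule smooth_coinduct[of _ "{\<lambda>x. g (A x) |g. smooth g}"])
  show "(\<lambda>x. f (A x)) \<in> {\<lambda>x. g (A x) |g. smooth g}" using f by blast
  fix h assume "h \<in> {\<lambda>x. g (A x) |g. smooth g}"
  then obtain g where h: "h = (\<lambda>x. g (A x))" and g: "smooth g" by blast
  have d: "(h has_derivative (\<lambda>v. frechet_derivative g (at (A x)) (A v))) (at x)" for x
    unfolding h by (rule has_derivative_compose[OF bounded_linear_imp_has_derivative[OF A] smooth_has_derivative[OF g]])
  show "h differentiable (at x)" for x using d by (auto simp: differentiable_def)
  have "frechet_derivative h (at x) v = frechet_derivative g (at (A x)) (A v)" for x v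
    using frechet_derivative_at[OF d[of x]] by (metis (no_types, lifting))
  then show "(\<lambda>x. frechet_derivative h (at x) v) \<in> {\<lambda>x. g (A x) |g. smooth g}" for v
    using smooth_frechet[OF g, of "A v"] by auto
qed

lemma smooth_norm_sq: "smooth (\<lambda>x::'a::euclidean_space. (norm x)\<^sup>2)"
  unfolding norm_sq_Basis unfolding power2_eq_square by (intro smooth_sum smooth_mult smooth_inner)

lemma smooth_real:
  fixes f f' :: "real \<Rightarrow> real"
  assumes "\<And>x. (f has_real_derivative f' x) (at x)" "smooth f'"
  shows "smooth f"
  unfolding smooth_def
proof
  fix n
  have "times_differentiable (Suc n) f"
  proof (rule times_differentiable_SucI)
    show "(f has_derivative (\<lambda>v. f' x * v)) (at x)" for x
      using assms(1) by (simp add: has_field_derivative_def)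
    show "times_differentiable n (\<lambda>x. f' x * v)" for v
      using assms(2) by (auto simp: smooth_def intro: times_differentiable_mult)
  qed
  then show "times_differentiable n f" by (rule times_differentiable_SucD)
qed

text \<open>The Frechet derivative in direction v is v times f', so the family has to absorb
  arbitrary real factors.\<close>

lemma smooth_real_coinduct:
  fixes f :: "real \<Rightarrow> real"
  assumes "f \<in> S" and S: "\<And>f. f \<in> S \<Longrightarrow> \<exists>f'. (\<forall>x. (f has_real_derivative f' x) (at x)) \<and> (\<forall>c. (\<lambda>x. c * f' x) \<in> S)"
  shows "smooth f"
proof (rule smooth_coinduct[OF assms(1)])
  fix f x assume "f \<in> S"
  then show "f differentiable (at x)" using S by (meson real_differentiable_def)
next
  fix f v assume f: "f \<in> S"
  obtain f' where f': "\<And>x. (f has_real_derivative f' x) (at x)" "\<And>c. (\<lambda>x. c * f' x) \<in> S" using S[OF f] by blast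
  have "frechet_derivative f (at x) v = v * f' x" for x
    using frechet_derivative_at[OF f'(1)[of x, unfolded has_field_derivative_def]] by (simp add: mult.commute fun_eq_iff)
  then show "(\<lambda>x. frechet_derivative f (at x) v) \<in> S" using f'(2)[of v] by simp
qed

lemma smooth_exp: "smooth (exp :: real \<Rightarrow> real)"
proof (rule smooth_real_coinduct[of _ "range (\<lambda>c x. c * exp x)"])
  show "exp \<in> range (\<lambda>c x. c * exp x :: real)" by (rule range_eqI[of _ _ 1]) auto
  fix f :: "real \<Rightarrow> real" assume "f \<in> range (\<lambda>c x. c * exp x)"
  then obtain c where f: "f = (\<lambda>x. c * exp x)" by auto
  show "\<exists>f'. (\<forall>x. (f has_real_derivative f' x) (at x)) \<and> (\<forall>d. (\<lambda>x. d * f' x) \<in> range (\<lambda>c x. c * exp x))"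
    by (rule exI[of _ f]) (auto simp: f intro!: derivative_eq_intros range_eqI[of _ _ "_ * c"])
qed

definition hexp :: "real \<Rightarrow> real" where "hexp y = (if 0 < y then exp (- (1 / y)) else 0)"

lemma poly_exp_tendsto_0:
  fixes p :: "real poly"
  shows "((\<lambda>z. poly p z * exp (- z)) \<longlongrightarrow> 0) at_top"
proof -
  have "((\<lambda>z. \<Sum>i\<le>degree p. coeff p i * (z ^ i / exp z)) \<longlongrightarrow> (\<Sum>i\<le>degree p. coeff p i * 0)) at_top"
    by (intro tendsto_sum tendsto_mult tendsto_const tendsto_power_div_exp_0)
  then show ?thesis
    by (simp add: poly_altdef exp_minus sum_distrib_right divide_inverse mult.assoc)
qed

text \<open>The functions p(1/y) exp (-1/y), extended by 0, are closed under differentiation: the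
  product rule replaces p by X^2 (p - p'). At 0 the exponential beats every polynomial in
  1/h.\<close>

lemma hexp_derivative:
  fixes p :: "real poly"
  defines "F q \<equiv> (\<lambda>y. if 0 < y then poly q (1 / y) * exp (- (1 / y)) else 0 :: real)"
  shows "(F p has_real_derivative F (monom 1 2 * (p - pderiv p)) y) (at y)"
proof -
  consider "0 < y" | "y < 0" | "y = 0" by linarith
  then show ?thesis
  proof cases
    case 1
    have "((\<lambda>y. poly p (1 / y) * exp (- (1 / y))) has_real_derivative poly (monom 1 2 * (p - pderiv p)) (1 / y) * exp (- (1 / y))) (at y)"
      using 1 by (auto intro!: derivative_eq_intros DERIV_chain2[OF poly_DERIV]
        simp: poly_monom field_simps power2_eq_square)
    then have "(F p has_real_derivative poly (monom 1 2 * (p - pderiv p)) (1 / y) * exp (- (1 / y))) (at y)"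
      by (rule has_field_derivative_transform_within_open[of _ _ _ "{0<..}"]) (use 1 in \<open>auto simp: F_def\<close>)
    then show ?thesis using 1 by (simp add: F_def)
  next
    case 2
    have "((\<lambda>y. 0) has_real_derivative 0) (at y)" by simp
    then have "(F p has_real_derivative 0) (at y)"
      by (rule has_field_derivative_transform_within_open[of _ _ _ "{..<0}"]) (use 2 in \<open>auto simp: F_def\<close>)
    then show ?thesis using 2 by (simp add: F_def)
  next
    case 3
    have "((\<lambda>h. F p h / h) \<longlongrightarrow> 0) (at_left 0)"
      by (rule tendsto_eventually) (auto simp: F_def eventually_at_filter)
    moreover have "((\<lambda>h. F p h / h) \<longlongrightarrow> 0) (at_right 0)"
    proof -
      \<comment> \<open>The right difference quotient F(h)/h equals (X p)(1/h) exp (-1/h), and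
        \<open>pCons 0 p\<close> is X p.\<close>
      have "((\<lambda>h. poly (pCons 0 p) (inverse h) * exp (- inverse h)) \<longlongrightarrow> 0) (at_right 0)"
        by (rule filterlim_compose[OF poly_exp_tendsto_0 filterlim_inverse_at_top_right])
      then show ?thesis
        by (rule Lim_transform_eventually) (auto simp: F_def eventually_at_filter field_simps)
    qed
    ultimately have "((\<lambda>h. F p h / h) \<longlongrightarrow> 0) (at 0)" by (simp add: filterlim_split_at)
    moreover have "F p 0 = 0" by (simp add: F_def)
    ultimately have "(F p has_real_derivative 0) (at 0)" unfolding DERIV_def by simp
    then show ?thesis using 3 by (simp add: F_def)
  qed
qed

lemma smooth_hexp: "smooth hexp"
proof -
  define F :: "real poly \<Rightarrow> real \<Rightarrow> real" where "F = (\<lambda>q y. if 0 < y then poly q (1 / y) * exp (- (1 / y)) else 0)"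
  have F_smult: "(\<lambda>y. c * F q y) = F (smult c q)" for c q by (auto simp: F_def fun_eq_iff)
  have "F 1 \<in> range F" by simp
  then have "smooth (F 1)"
  proof (rule smooth_real_coinduct)
    fix f assume "f \<in> range F"
    then obtain p where f: "f = F p" by auto
    have "(F p has_real_derivative F (monom 1 2 * (p - pderiv p)) y) (at y)" for y
      unfolding F_def by (rule hexp_derivative)
    then show "\<exists>f'. (\<forall>x. (f has_real_derivative f' x) (at x)) \<and> (\<forall>c. (\<lambda>x. c * f' x) \<in> range F)"
      by (intro exI[of _ "F (monom 1 2 * (p - pderiv p))"]) (auto simp: f F_smult)
  qed
  also have "F 1 = hexp" by (auto simp: F_def hexp_def)
  finally show ?thesis .
qed

lemma hexp_bounds: "0 \<le> hexp y" "hexp y \<le> 1"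
  by (auto simp: hexp_def)

lemma hexp_mono: "x \<le> y \<Longrightarrow> hexp x \<le> hexp y"
  by (auto simp: hexp_def intro: divide_left_mono)

text \<open>Multiplying the argument by a large number turns the flat function into a smooth
  approximation of the indicator of the positive half-line; the test functions on boxes are built
  from it.\<close>

lemma hexp_scale_tendsto:
  "(\<lambda>n. hexp (real (Suc n) * y)) \<longlonglongrightarrow> (if 0 < y then 1 else 0)"
proof (cases "0 < y")
  case True
  have "(\<lambda>n. exp (- (inverse (real (Suc n)) * (1 / y)))) \<longlonglongrightarrow> exp (- (0 * (1 / y)))"
    by (intro tendsto_intros LIMSEQ_inverse_real_of_nat)
  moreover have "exp (- (inverse (real (Suc n)) * (1 / y))) = hexp (real (Suc n) * y)" for n
    using True by (simp add: hexp_def divide_inverse mult.commute del: of_nat_Suc)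
  ultimately show ?thesis using True by simp
next
  case False
  then have "hexp (real (Suc n) * y) = 0" for n by (simp add: hexp_def zero_less_mult_iff del: of_nat_Suc)
  then show ?thesis using False by simp
qed

section \<open>Test functions\<close>

lemma test_functionI:
  assumes "smooth \<phi>" "closed K" "bounded K" "K \<subseteq> \<Omega>" "\<And>x. x \<notin> K \<Longrightarrow> \<phi> x = 0"
  shows "test_function \<Omega> \<phi>"
proof -
  have "closure {x. \<phi> x \<noteq> 0} \<subseteq> K" using assms by (intro closure_minimal) auto
  then show ?thesis using assms bounded_subset[of K "closure {x. \<phi> x \<noteq> 0}"]
    by (auto simp: test_function_def smooth_def compact_eq_bounded_closed)
qed

lemma test_function_smooth: "test_function \<Omega> \<phi> \<Longrightarrow> smooth \<phi>"
  by (simp add: test_function_def smooth_def)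

lemma test_function_mult:
  assumes "test_function \<Omega> \<phi>" "smooth f"
  shows "test_function \<Omega> (\<lambda>x. f x * \<phi> x)"
  by (rule test_functionI[of _ "closure {x. \<phi> x \<noteq> 0}"])
    (use assms closure_subset[of "{x. \<phi> x \<noteq> 0}"] in \<open>auto simp: test_function_def smooth_def compact_eq_bounded_closed intro: times_differentiable_mult\<close>)

lemma test_function_frechet:
  assumes "test_function \<Omega> \<phi>"
  shows "test_function \<Omega> (\<lambda>x. frechet_derivative \<phi> (at x) v)"
proof (rule test_functionI[of _ "closure {x. \<phi> x \<noteq> 0}"])
  let ?K = "closure {x. \<phi> x \<noteq> 0}"
  fix x assume x: "x \<notin> ?K"
  have "((\<lambda>x. 0) has_derivative (\<lambda>v. 0)) (at x)" by simp
  then have "(\<phi> has_derivative (\<lambda>v. 0)) (at x)"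
    by (rule has_derivative_transform_within_open[of _ _ _ UNIV "- ?K"])
      (use x closure_subset[of "{x. \<phi> x \<noteq> 0}"] in auto)
  then show "frechet_derivative \<phi> (at x) v = 0" using frechet_derivative_at by metis
qed (use assms smooth_frechet[OF test_function_smooth[OF assms]] in \<open>auto simp: test_function_def compact_eq_bounded_closed\<close>)

lemma test_function_bounds:
  fixes \<phi> :: "'a::euclidean_space \<Rightarrow> real"
  assumes "test_function \<Omega> \<phi>"
  shows "\<exists>B r. 0 < B \<and> 0 < r \<and> (\<forall>x. \<bar>\<phi> x\<bar> \<le> B) \<and> (\<forall>x. r \<le> norm x \<longrightarrow> \<phi> x = 0)"
proof -
  let ?K = "closure {x. \<phi> x \<noteq> 0}"
  have K: "compact ?K" using assms by (simp add: test_function_def)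
  obtain r where r: "0 < r" "\<And>x. x \<in> ?K \<Longrightarrow> norm x < r"
    using compact_imp_bounded[OF K] bounded_pos_less by blast
  have "compact (\<phi> ` ?K)" 
    by (intro compact_continuous_image smooth_continuous test_function_smooth[OF assms] K)
  from compact_imp_bounded[OF this] obtain B where B: "0 < B" "\<forall>y\<in>\<phi> ` ?K. norm y \<le> B"
    unfolding bounded_pos by metis
  have "\<bar>\<phi> x\<bar> \<le> B" for x
  proof (cases "\<phi> x = 0")
    case False then have "x \<in> ?K" using closure_subset[of "{x. \<phi> x \<noteq> 0}"] by auto
    then have "norm (\<phi> x) \<le> B" using B(2) by blast
    then show ?thesis by simp
  qed (use B in auto)
  moreover have "\<phi> x = 0" if "r \<le> norm x" for x
    using r(2)[of x] that closure_subset[of "{x. \<phi> x \<noteq> 0}"] by force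
  ultimately show ?thesis using B r by blast
qed

lemma test_function_measurable: "test_function \<Omega> \<phi> \<Longrightarrow> \<phi> \<in> borel_measurable borel"
  for \<phi> :: "'a::euclidean_space \<Rightarrow> real"
  by (intro smooth_measurable test_function_smooth)

lemma test_function_L2: "test_function \<Omega> \<phi> \<Longrightarrow> L2 \<phi>" for \<phi> :: "'a::euclidean_space \<Rightarrow> real"
proof -
  assume t: "test_function \<Omega> \<phi>"
  obtain B r where "\<And>x. \<bar>\<phi> x\<bar> \<le> B" "\<And>x. r \<le> norm x \<Longrightarrow> \<phi> x = 0" using test_function_bounds[OF t] by blast
  then show ?thesis using test_function_measurable[OF t] by (intro L2_bounded_support[of _ B r]) auto
qed

lemma test_function_integrable: "test_function \<Omega> \<phi> \<Longrightarrow> integrable lborel \<phi>" for \<phi> :: "'a::euclidean_space \<Rightarrow> real"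
proof -
  assume t: "test_function \<Omega> \<phi>"
  obtain B r where B: "\<And>x. r \<le> norm x \<Longrightarrow> \<phi> x = 0" using test_function_bounds[OF t] by blast
  then have eq: "indicator (ball 0 r) x * \<phi> x = \<phi> x" for x by (auto simp: indicator_def not_less)
  have "integrable lborel (\<lambda>x. indicator (ball 0 r) x * \<phi> x)"
    by (intro L2_prod_integrable L2_indicator_ball test_function_L2[OF t])
  then show ?thesis by (simp only: eq)
qed

section \<open>Gradients, Laplacians and vanishing integrals of derivatives\<close>

lemma grad_inner_Basis: "b \<in> Basis \<Longrightarrow> grad f x \<bullet> b = frechet_derivative f (at x) b"
  by (simp add: grad_def inner_sum_left inner_Basis if_distrib[where f="\<lambda>x. _ * x"] cong: if_cong)

lemma grad_has_derivative:
  assumes "smooth f" shows "(f has_derivative (\<lambda>v. grad f x \<bullet> v)) (at x)"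
proof -
  have d: "(f has_derivative frechet_derivative f (at x)) (at x)" using assms by (rule smooth_has_derivative)
  note lin = has_derivative_linear[OF d]
  have "frechet_derivative f (at x) v = grad f x \<bullet> v" for v
  proof -
    have "frechet_derivative f (at x) v = frechet_derivative f (at x) (\<Sum>b\<in>Basis. (v \<bullet> b) *\<^sub>R b)" by (simp add: euclidean_representation)
    also have "\<dots> = (\<Sum>b\<in>Basis. (v \<bullet> b) * frechet_derivative f (at x) b)"
      by (simp add: linear_sum[OF lin] linear_scale[OF lin])
    also have "\<dots> = grad f x \<bullet> v" by (subst euclidean_inner) (simp add: grad_inner_Basis mult.commute)
    finally show ?thesis .
  qed
  then show ?thesis using d by (metis (no_types, lifting) ext)
qed

lemma laplacian_eq: "laplacian f x = (\<Sum>b\<in>Basis. frechet_derivative (\<lambda>y. frechet_derivative f (at y) b) (at x) b)"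
  unfolding laplacian_def by (intro sum.cong) (simp_all add: grad_inner_Basis)

lemma smooth_laplacian: "smooth f \<Longrightarrow> smooth (laplacian f)"
  unfolding laplacian_eq by (intro smooth_sum smooth_frechet)

lemma test_function_sum:
  assumes "\<And>i. i \<in> I \<Longrightarrow> test_function UNIV (f i)" "finite I"
  shows "test_function UNIV (\<lambda>x. \<Sum>i\<in>I. f i x)"
proof (rule test_functionI[of _ "\<Union>i\<in>I. closure {x. f i x \<noteq> 0}"])
  show "smooth (\<lambda>x. \<Sum>i\<in>I. f i x)" using assms by (intro smooth_sum) (auto intro: test_function_smooth)
  show "closed (\<Union>i\<in>I. closure {x. f i x \<noteq> 0})" using assms(2) by auto
  show "bounded (\<Union>i\<in>I. closure {x. f i x \<noteq> 0})" using assms by (auto simp: test_function_def compact_eq_bounded_closed)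
  fix x assume "x \<notin> (\<Union>i\<in>I. closure {x. f i x \<noteq> 0})"
  then have "f i x = 0" if "i \<in> I" for i using that closure_subset[of "{x. f i x \<noteq> 0}"] by auto
  then show "(\<Sum>i\<in>I. f i x) = 0" by simp
qed simp

lemma test_function_laplacian: "test_function UNIV \<phi> \<Longrightarrow> test_function UNIV (laplacian \<phi>)"
  unfolding laplacian_eq by (intro test_function_sum test_function_frechet) auto

lemma test_function_lipschitz:
  fixes \<phi> :: "'a::euclidean_space \<Rightarrow> real"
  assumes "test_function \<Omega> \<phi>"
  shows "\<exists>L>0. \<forall>x y. \<bar>\<phi> x - \<phi> y\<bar> \<le> L * norm (x - y)"
proof -
  have "\<exists>B. \<forall>x. \<bar>frechet_derivative \<phi> (at x) b\<bar> \<le> B" for b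
    using test_function_bounds[OF test_function_frechet[OF assms, of b]] by blast
  then obtain B where B: "\<And>b x. \<bar>frechet_derivative \<phi> (at x) b\<bar> \<le> B b" by metis
  define L where "L = (\<Sum>b\<in>(Basis::'a set). B b) + 1"
  have Bp: "0 \<le> B b" for b using order_trans[OF abs_ge_zero B] .
  have L: "0 < L" using Bp by (auto simp: L_def intro!: add_nonneg_pos sum_nonneg)
  have "norm (grad \<phi> x) \<le> L" for x
  proof -
    have "norm (grad \<phi> x) \<le> (\<Sum>b\<in>Basis. \<bar>grad \<phi> x \<bullet> b\<bar>)" by (rule norm_le_l1)
    also have "\<dots> \<le> (\<Sum>b\<in>Basis. B b)" using B by (intro sum_mono) (simp add: grad_inner_Basis)
    finally show ?thesis by (simp add: L_def)
  qed
  note gL = this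
  have "onorm (\<lambda>v. grad \<phi> x \<bullet> v) \<le> L" for x
  proof (rule onorm_le)
    fix v
    have "norm (grad \<phi> x \<bullet> v) \<le> norm (grad \<phi> x) * norm v" using Cauchy_Schwarz_ineq2 by simp
    also have "\<dots> \<le> L * norm v" by (intro mult_right_mono gL) simp
    finally show "norm (grad \<phi> x \<bullet> v) \<le> L * norm v" .
  qed
  then have "norm (\<phi> x - \<phi> y) \<le> L * norm (x - y)" for x y
    by (intro differentiable_bound[of UNIV \<phi> "\<lambda>x v. grad \<phi> x \<bullet> v"])
      (auto intro: grad_has_derivative[OF test_function_smooth[OF assms]])
  then show ?thesis using L by auto
qed

text \<open>Difference quotients have integral 0 by translation invariance. The Lipschitz bound and
  the bounded support allow dominated convergence to the derivative.\<close>

lemma integral_frechet_test_function: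
  fixes \<phi> :: "'a::euclidean_space \<Rightarrow> real"
  assumes t: "test_function \<Omega> \<phi>"
  shows "(LINT x|lborel. frechet_derivative \<phi> (at x) v) = 0"
proof -
  obtain L where L: "0 < L" "\<And>x y. \<bar>\<phi> x - \<phi> y\<bar> \<le> L * norm (x - y)" using test_function_lipschitz[OF t] by blast
  obtain r where r: "0 < r" "\<And>x. r \<le> norm x \<Longrightarrow> \<phi> x = 0" using test_function_bounds[OF t] by blast
  have [measurable]: "\<phi> \<in> borel_measurable borel" by (rule test_function_measurable[OF t])
  define h where "h n = inverse (real (Suc n))" for n
  have h: "0 < h n" "h n \<le> 1" for n by (auto simp: h_def divide_simps)
  have h0: "h \<longlonglongrightarrow> 0" unfolding h_def by (rule LIMSEQ_inverse_real_of_nat)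
  define q where "q n x = (\<phi> (x + h n *\<^sub>R v) - \<phi> x) / h n" for n x
  have q0: "(LINT x|lborel. q n x) = 0" for n
    using test_function_integrable[OF t] integrable_translate[OF test_function_integrable[OF t], of "h n *\<^sub>R v"]
    by (simp add: q_def integral_translate)
  have "(\<lambda>n. LINT x|lborel. q n x) \<longlonglongrightarrow> (LINT x|lborel. frechet_derivative \<phi> (at x) v)"
  proof (rule integral_dominated_convergence)
    show "(\<lambda>x. frechet_derivative \<phi> (at x) v) \<in> borel_measurable lborel"
      using test_function_measurable[OF test_function_frechet[OF t]] by simp
    show "q n \<in> borel_measurable lborel" for n unfolding q_def by measurable
    \<comment> \<open>The increments h n v are at most |v| long because h n \<le> 1, so all
      difference quotients are supported in this single ball.\<close>
    have "integrable lborel (indicator (ball (0::'a) (r + norm v)) :: 'a \<Rightarrow> real)"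
      using emeasure_lborel_ball_finite[of "0::'a"] by (intro integrable_real_indicator) auto
    then show "integrable lborel (\<lambda>x. L * norm v * indicator (ball (0::'a) (r + norm v)) x)" by (rule integrable_mult_right)
    show "AE x in lborel. (\<lambda>n. q n x) \<longlonglongrightarrow> frechet_derivative \<phi> (at x) v"
    proof (rule AE_I2)
      fix x
      have d: "(\<phi> has_derivative frechet_derivative \<phi> (at x)) (at (x + 0 *\<^sub>R v))"
        using smooth_has_derivative[OF test_function_smooth[OF t]] by simp
      have l: "((\<lambda>t. x + t *\<^sub>R v) has_derivative (\<lambda>t. t *\<^sub>R v)) (at 0)" by (auto intro!: derivative_eq_intros)
      have "((\<lambda>t. \<phi> (x + t *\<^sub>R v)) has_derivative (\<lambda>t. frechet_derivative \<phi> (at x) (t *\<^sub>R v))) (at 0)"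
        using has_derivative_compose[OF l d] .
      then have "((\<lambda>t. \<phi> (x + t *\<^sub>R v)) has_real_derivative frechet_derivative \<phi> (at x) v) (at 0)"
        unfolding has_field_derivative_def
        using linear_scale[OF has_derivative_linear[OF d], of _ v] by (simp add: mult_commute_abs)
      then have "((\<lambda>t. (\<phi> (x + t *\<^sub>R v) - \<phi> x) / t) \<longlongrightarrow> frechet_derivative \<phi> (at x) v) (at 0)"
        by (simp add: DERIV_def)
      moreover have "filterlim h (at 0) sequentially" 
        unfolding filterlim_at using h0 h(1) by (auto intro!: always_eventually simp: less_imp_neq[symmetric] dest: less_imp_neq)
      ultimately show "(\<lambda>n. q n x) \<longlonglongrightarrow> frechet_derivative \<phi> (at x) v"
        unfolding q_def by (rule filterlim_compose)
    qed
    show "AE x in lborel. norm (q n x) \<le> L * norm v * indicator (ball 0 (r + norm v)) x" for n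
    proof (rule AE_I2)
      fix x
      show "norm (q n x) \<le> L * norm v * indicator (ball 0 (r + norm v)) x"
      proof (cases "norm x < r + norm v")
        case True
        have "\<bar>\<phi> (x + h n *\<^sub>R v) - \<phi> x\<bar> \<le> L * (h n * norm v)"
          using L(2)[of "x + h n *\<^sub>R v" x] h(1)[of n] by simp
        then show ?thesis using True h(1)[of n] by (simp add: q_def divide_le_eq mult_ac)
      next
        case False
        have "norm (h n *\<^sub>R v) \<le> norm v" using h[of n] by (simp add: mult_left_le_one_le)
        moreover have "norm x \<le> norm (x + h n *\<^sub>R v) + norm (h n *\<^sub>R v)"
          using norm_triangle_ineq4[of "x + h n *\<^sub>R v" "h n *\<^sub>R v"] by simp
        ultimately have "r \<le> norm (x + h n *\<^sub>R v)" "r \<le> norm x"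
          using False norm_ge_zero[of v] by linarith+
        then show ?thesis using False r(2) by (simp add: q_def)
      qed
    qed
  qed
  then show ?thesis unfolding q0 using LIMSEQ_unique tendsto_const by blast
qed

section \<open>The fundamental lemma of the calculus of variations\<close>

text \<open>The positive and the negative part of f, taken as densities, define measures that agree
  on open boxes. These form an intersection-stable generator of the Borel sets, so the measures
  coincide and so do the densities almost everywhere.\<close>

lemma AE_zero_if_box_integrals_zero:
  fixes f :: "'a::euclidean_space \<Rightarrow> real"
  assumes f: "integrable lborel f" and z: "\<And>a b. (LINT x|lborel. indicator (box a b) x * f x) = 0"
  shows "AE x in lborel. f x = 0"
proof -
  have [measurable]: "f \<in> borel_measurable borel" using f by simp
  let ?P = "density lborel (\<lambda>x. ennreal (f x))" and ?N = "density lborel (\<lambda>x. ennreal (- f x))"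
  let ?E = "range (\<lambda>(a, b). box a b::'a set)"
  have int: "integrable lborel (\<lambda>x. indicator (box a b) x * f x)" for a b
    using integrable_real_mult_indicator[OF _ f, of "box a b"] by (simp add: mult.commute)
  have pos: "emeasure ?P (box a b) = ennreal (LINT x|lborel. max 0 (indicator (box a b) x * f x))" for a b
  proof -
    have "emeasure ?P (box a b) = (\<integral>\<^sup>+ x. ennreal (max 0 (indicator (box a b) x * f x)) \<partial>lborel)"
      by (subst emeasure_density) (auto intro!: nn_integral_cong simp: indicator_def max_def ennreal_neg)
    also have "\<dots> = ennreal (LINT x|lborel. max 0 (indicator (box a b) x * f x))"
      using int[of a b] by (intro nn_integral_eq_integral) auto
    finally show ?thesis .
  qed
  have neg: "emeasure ?N (box a b) = ennreal (LINT x|lborel. max 0 (- (indicator (box a b) x * f x)))" for a b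
  proof -
    have "emeasure ?N (box a b) = (\<integral>\<^sup>+ x. ennreal (max 0 (- (indicator (box a b) x * f x))) \<partial>lborel)"
      by (subst emeasure_density) (auto intro!: nn_integral_cong simp: indicator_def max_def ennreal_neg)
    also have "\<dots> = ennreal (LINT x|lborel. max 0 (- (indicator (box a b) x * f x)))"
      using int[of a b] by (intro nn_integral_eq_integral) auto
    finally show ?thesis .
  qed
  have eq: "emeasure ?P (box a b) = emeasure ?N (box a b)" for a b
  proof -
    have "(LINT x|lborel. max 0 (indicator (box a b) x * f x)) - (LINT x|lborel. max 0 (- (indicator (box a b) x * f x)))
       = (LINT x|lborel. max 0 (indicator (box a b) x * f x) - max 0 (- (indicator (box a b) x * f x)))"
      using int[of a b] by (intro Bochner_Integration.integral_diff[symmetric]) auto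
    also have "\<dots> = (LINT x|lborel. indicator (box a b) x * f x)"
      by (intro Bochner_Integration.integral_cong) (auto simp: max_def)
    finally show ?thesis unfolding pos neg z by simp
  qed
  have "?P = ?N"
  proof (rule measure_eqI_generator_eq)
    show "Int_stable ?E" by (auto simp: Int_stable_def box_Int_box)
    show "?E \<subseteq> Pow UNIV" "sets ?P = sigma_sets UNIV ?E" "sets ?N = sigma_sets UNIV ?E"
      by (simp_all add: borel_eq_box)
    let ?A = "\<lambda>n::nat. box (- (real n *\<^sub>R One)) (real n *\<^sub>R One) :: 'a set"
    show "range ?A \<subseteq> ?E" "(\<Union>i. ?A i) = UNIV" unfolding UN_box_eq_UNIV by auto
    show "emeasure ?P (?A i) \<noteq> \<infinity>" for i unfolding pos by simp
    show "emeasure ?P X = emeasure ?N X" if "X \<in> ?E" for X using that eq by auto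
  qed
  then have "AE x in lborel. ennreal (f x) = ennreal (- f x)"
    by (subst (asm) sigma_finite_measure.density_unique_iff[OF sigma_finite_lborel]) auto
  then show ?thesis
  proof eventually_elim
    case (elim x)
    then show ?case by (cases "0 \<le> f x") (auto simp: ennreal_neg ennreal_eq_0_iff)
  qed
qed

text \<open>In each coordinate the quadratic (x - a)(c - x) is positive exactly inside the interval.
  Applying the flat function to large multiples of it and taking the product gives test functions
  increasing in steepness towards the indicator of the open box.\<close>

lemma test_function_box:
  fixes a c :: "'a::euclidean_space"
  assumes ac: "\<And>b. b \<in> Basis \<Longrightarrow> a \<bullet> b < c \<bullet> b" and sub: "cbox a c \<subseteq> \<Omega>"
  shows "\<exists>\<zeta>. (\<forall>n. test_function \<Omega> (\<zeta> n)) \<and> (\<forall>n x. \<bar>\<zeta> n x\<bar> \<le> indicator (cbox a c) x) \<and>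
    (\<forall>x. (\<lambda>n. \<zeta> n x) \<longlonglongrightarrow> indicator (box a c) x)"
proof -
  define g where "g b x = (x \<bullet> b - a \<bullet> b) * (c \<bullet> b - x \<bullet> b)" for b x :: 'a
  define \<zeta> where "\<zeta> n x = (\<Prod>b\<in>Basis. hexp (real (Suc n) * g b x))" for n :: nat and x :: 'a
  have g: "0 < g b x \<longleftrightarrow> a \<bullet> b < x \<bullet> b \<and> x \<bullet> b < c \<bullet> b" if "b \<in> Basis" for b x
    using ac[OF that] by (auto simp: g_def zero_less_mult_iff)
  have out: "\<zeta> n x = 0" if x: "x \<notin> box a c" for n x
  proof -
    obtain b where b: "b \<in> Basis" "\<not> (a \<bullet> b < x \<bullet> b \<and> x \<bullet> b < c \<bullet> b)" using x by (auto simp: box_def)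
    then have "\<not> 0 < g b x" using g by blast
    then have "hexp (real (Suc n) * g b x) = 0" by (simp add: hexp_def zero_less_mult_iff del: of_nat_Suc)
    then show ?thesis unfolding \<zeta>_def using b(1) by (intro prod_zero) auto
  qed
  have "smooth (\<zeta> n)" for n unfolding \<zeta>_def g_def
    by (intro smooth_prod smooth_compose[OF smooth_hexp] smooth_mult smooth_const smooth_diff smooth_inner)
  then have t: "test_function \<Omega> (\<zeta> n)" for n
    by (rule test_functionI[of _ "cbox a c"]) (use sub out box_subset_cbox[of a c] in \<open>auto simp: closed_cbox bounded_cbox\<close>)
  have z1: "0 \<le> \<zeta> n x" "\<zeta> n x \<le> 1" for n x
    unfolding \<zeta>_def using hexp_bounds by (auto intro!: prod_nonneg prod_le_1)
  have b: "\<bar>\<zeta> n x\<bar> \<le> indicator (cbox a c) x" for n x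
  proof (cases "x \<in> cbox a c")
    case True then show ?thesis using z1[of n x] by simp
  next
    case False then have "x \<notin> box a c" using box_subset_cbox[of a c] by auto
    then show ?thesis using out by simp
  qed
  have "(\<lambda>n. \<zeta> n x) \<longlonglongrightarrow> indicator (box a c) x" for x
  proof -
    have "(\<lambda>n. \<zeta> n x) \<longlonglongrightarrow> (\<Prod>b\<in>Basis. if 0 < g b x then 1 else 0)"
      unfolding \<zeta>_def by (intro tendsto_prod hexp_scale_tendsto)
    also have "(\<Prod>b\<in>Basis. if 0 < g b x then 1 else 0) = (indicator (box a c) x :: real)"
    proof (cases "x \<in> box a c")
      case True
      then have "(\<Prod>b\<in>Basis. if 0 < g b x then 1 else (0::real)) = (\<Prod>b\<in>(Basis::'a set). 1)"
        using g by (intro prod.cong) (auto simp: box_def)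
      then show ?thesis using True by simp
    next
      case False
      then obtain b where b: "b \<in> Basis" "\<not> (a \<bullet> b < x \<bullet> b \<and> x \<bullet> b < c \<bullet> b)" by (auto simp: box_def)
      then have "(\<Prod>b\<in>Basis. if 0 < g b x then 1 else (0::real)) = 0" using g by (intro prod_zero) auto
      then show ?thesis using False by simp
    qed
    finally show ?thesis .
  qed
  then show ?thesis using t b by blast
qed

text \<open>Testing with approximate indicators shows that integrals over boxes inside \<Omega>
  vanish. This settles each closed box in \<Omega>, and countably many of them cover the open set,
  so only integrability on boxes is ever asked of f.\<close>

lemma fundamental_lemma:
  fixes f :: "'a::euclidean_space \<Rightarrow> real"
  assumes [measurable]: "f \<in> borel_measurable borel" and \<Omega>: "open \<Omega>"
    and loc: "\<And>a c. cbox a c \<subseteq> \<Omega> \<Longrightarrow> integrable lborel (\<lambda>x. indicator (cbox a c) x * f x)"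
    and zero: "\<And>\<phi>. test_function \<Omega> \<phi> \<Longrightarrow> (LINT x|lborel. f x * \<phi> x) = 0"
  shows "AE x in lborel. x \<in> \<Omega> \<longrightarrow> f x = 0"
proof -
  have box: "(LINT x|lborel. indicator (box a c) x * f x) = 0" if sub: "cbox a c \<subseteq> \<Omega>" for a c
  proof (cases "box a c = {}")
    case False
    then have "\<And>b. b \<in> Basis \<Longrightarrow> a \<bullet> b < c \<bullet> b" by (simp add: box_ne_empty)
    from test_function_box[OF this sub] obtain \<zeta> where \<zeta>: "\<And>n. test_function \<Omega> (\<zeta> n)"
      "\<And>n x. \<bar>\<zeta> n x\<bar> \<le> indicator (cbox a c) x" "\<And>x. (\<lambda>n. \<zeta> n x) \<longlonglongrightarrow> indicator (box a c) x" by blast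
    have [measurable]: "\<zeta> n \<in> borel_measurable borel" for n by (rule test_function_measurable[OF \<zeta>(1)])
    have "(\<lambda>n. LINT x|lborel. f x * \<zeta> n x) \<longlonglongrightarrow> (LINT x|lborel. f x * indicator (box a c) x)"
    proof (rule integral_dominated_convergence)
      show "integrable lborel (\<lambda>x. norm (indicator (cbox a c) x * f x))" by (rule integrable_norm[OF loc[OF sub]])
      show "AE x in lborel. (\<lambda>n. f x * \<zeta> n x) \<longlonglongrightarrow> f x * indicator (box a c) x"
        by (intro AE_I2 tendsto_intros \<zeta>)
      show "AE x in lborel. norm (f x * \<zeta> n x) \<le> norm (indicator (cbox a c) x * f x)" for n
      proof (rule AE_I2)
        fix x
        have "\<bar>f x\<bar> * \<bar>\<zeta> n x\<bar> \<le> \<bar>f x\<bar> * indicator (cbox a c) x" by (intro mult_left_mono \<zeta>(2)) simp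
        then show "norm (f x * \<zeta> n x) \<le> norm (indicator (cbox a c) x * f x)" by (simp add: abs_mult mult.commute)
      qed
    qed auto
    then show ?thesis unfolding zero[OF \<zeta>(1)] using LIMSEQ_unique[OF _ tendsto_const] by (force simp: mult.commute)
  qed simp
  have cb: "AE x in lborel. indicator (cbox a c) x * f x = 0" if sub: "cbox a c \<subseteq> \<Omega>" for a c
  proof (rule AE_zero_if_box_integrals_zero[OF loc[OF sub]])
    fix a' c' :: 'a
    obtain l u where lu: "box l u = box a c \<inter> box a' c'" unfolding box_Int_box by blast
    show "(LINT x|lborel. indicator (box a' c') x * (indicator (cbox a c) x * f x)) = 0"
    proof (cases "box l u = {}")
      case True
      \<comment> \<open>Closed and open box differ by a null set. Off it, the product of the two
        indicators is that of the intersection, which is empty in this case.\<close>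
      have "AE x in lborel. x \<notin> cbox a c - box a c" by (rule AE_not_in[OF null_sets_cbox_Diff_box])
      then have "(LINT x|lborel. indicator (box a' c') x * (indicator (cbox a c) x * f x)) = (LINT x|(lborel::'a measure). 0)"
        by (intro integral_cong_AE) (use True lu in \<open>auto simp: indicator_def elim!: eventually_mono\<close>)
      then show ?thesis by simp
    next
      case False
      then have "cbox l u \<subseteq> cbox a c" using lu by (metis Int_lower1 box_subset_cbox closed_cbox closure_box closure_minimal order_trans)
      then have "(LINT x|lborel. indicator (box l u) x * f x) = 0" using sub by (intro box) auto
      moreover have "AE x in lborel. x \<notin> cbox a c - box a c" by (rule AE_not_in[OF null_sets_cbox_Diff_box])
      then have "(LINT x|lborel. indicator (box a' c') x * (indicator (cbox a c) x * f x)) = (LINT x|lborel. indicator (box l u) x * f x)"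
        unfolding lu by (intro integral_cong_AE) 
          (use box_subset_cbox[of a c] in \<open>auto simp: indicator_def elim!: eventually_mono\<close>)
      ultimately show ?thesis by simp
    qed
  qed
  obtain D where D: "countable D" "D \<subseteq> Pow \<Omega>" "\<And>X. X \<in> D \<Longrightarrow> \<exists>a b. X = cbox a b" "\<Union>D = \<Omega>"
    using open_countable_Union_open_cbox[OF \<Omega>] by blast
  have "AE x in lborel. \<forall>X\<in>D. indicator X x * f x = 0"
  proof (subst AE_ball_countable[OF D(1)], rule ballI)
    fix X assume "X \<in> D"
    then show "AE x in lborel. indicator X x * f x = 0" using D(2,3) cb by (metis Pow_iff subsetD)
  qed
  then show ?thesis using D(4) by (auto elim!: eventually_mono simp: indicator_def)
qed

section \<open>Weak gradients of functions in the Sobolev space $H^1$\<close>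

text \<open>The span of sin and cos is closed under differentiation and real multiples, as the
  coinduction requires.\<close>

lemma smooth_sin_cos: "smooth (sin :: real \<Rightarrow> real)" "smooth (cos :: real \<Rightarrow> real)"
proof -
  let ?S = "{f. \<exists>a b. f = (\<lambda>x::real. a * sin x + b * cos x)}"
  have *: "smooth f" if "f \<in> ?S" for f
  proof (rule smooth_real_coinduct[OF that])
    fix f assume "f \<in> ?S"
    then obtain a b where f: "f = (\<lambda>x. a * sin x + b * cos x)" by auto
    show "\<exists>f'. (\<forall>x. (f has_real_derivative f' x) (at x)) \<and> (\<forall>c. (\<lambda>x. c * f' x) \<in> ?S)"
    proof (intro exI[of _ "\<lambda>x. a * cos x - b * sin x"] conjI allI)
      show "(f has_real_derivative a * cos x - b * sin x) (at x)" for x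
        unfolding f by (auto intro!: derivative_eq_intros)
      show "(\<lambda>x. c * (a * cos x - b * sin x)) \<in> ?S" for c
        by (rule CollectI, rule exI[of _ "- c * b"], rule exI[of _ "c * a"]) (simp add: fun_eq_iff algebra_simps)
    qed
  qed
  show "smooth (sin :: real \<Rightarrow> real)" by (rule *, rule CollectI, rule exI[of _ 1], rule exI[of _ 0]) simp
  show "smooth (cos :: real \<Rightarrow> real)" by (rule *, rule CollectI, rule exI[of _ 0], rule exI[of _ 1]) simp
qed

lemma frechet_derivative_mult_smooth:
  assumes "smooth f" "smooth g"
  shows "frechet_derivative (\<lambda>x. f x * g x) (at x) v = f x * frechet_derivative g (at x) v + frechet_derivative f (at x) v * g x"
  using frechet_derivative_at[OF has_derivative_mult[OF smooth_has_derivative[OF assms(1)] smooth_has_derivative[OF assms(2)], of x]]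
  by (metis (no_types, lifting))

lemma frechet_derivative_compose_inner:
  fixes \<xi> :: "'a::euclidean_space"
  assumes "\<And>y. (h has_real_derivative h' y) (at y)"
  shows "frechet_derivative (\<lambda>x. h (x \<bullet> \<xi>)) (at x) v = h' (x \<bullet> \<xi>) * (v \<bullet> \<xi>)"
proof -
  have "((\<lambda>x. h (x \<bullet> \<xi>)) has_derivative (\<lambda>v. h' (x \<bullet> \<xi>) * (v \<bullet> \<xi>))) (at x)"
    using has_derivative_compose[of "\<lambda>x. x \<bullet> \<xi>" "\<lambda>v. v \<bullet> \<xi>" x UNIV h "\<lambda>v. h' (x \<bullet> \<xi>) * v"] assms[of "x \<bullet> \<xi>"]
    by (simp add: has_field_derivative_def bounded_linear_imp_has_derivative bounded_linear_inner_left)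
  from frechet_derivative_at[OF this] show ?thesis by (metis (no_types, lifting))
qed

text \<open>The derivatives of cos (x . \<xi>) \<phi> and sin (x . \<xi>) \<phi> integrate to 0.
  Cosine and sine are treated separately because test functions are real valued; together they are
  the real and imaginary parts of the usual rule.\<close>

lemma fourier_integral_frechet:
  fixes \<phi> :: "'a::euclidean_space \<Rightarrow> real"
  assumes t: "test_function UNIV \<phi>"
  shows "fourier_integral (\<lambda>x. frechet_derivative \<phi> (at x) v) \<xi> = \<i> * complex_of_real (v \<bullet> \<xi>) * fourier_integral \<phi> \<xi>"
proof -
  let ?D = "\<lambda>x. frechet_derivative \<phi> (at x) v"
  note s = test_function_smooth[OF t]
  have tD: "test_function UNIV ?D" by (rule test_function_frechet[OF t])
  have sc: "smooth (\<lambda>x::'a. cos (x \<bullet> \<xi>))" "smooth (\<lambda>x::'a. sin (x \<bullet> \<xi>))"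
    by (rule smooth_compose[OF smooth_sin_cos(2) smooth_inner], rule smooth_compose[OF smooth_sin_cos(1) smooth_inner])
  have ti: "integrable lborel (\<lambda>x. cos (x \<bullet> \<xi>) * \<psi> x)" "integrable lborel (\<lambda>x. sin (x \<bullet> \<xi>) * \<psi> x)"
    if "test_function UNIV \<psi>" for \<psi> :: "'a \<Rightarrow> real"
    by (auto intro!: test_function_integrable[of UNIV] test_function_mult that sc)
  have dc: "frechet_derivative (\<lambda>x. cos (x \<bullet> \<xi>) * \<phi> x) (at x) v = cos (x \<bullet> \<xi>) * ?D x - (v \<bullet> \<xi>) * (sin (x \<bullet> \<xi>) * \<phi> x)" for x
    using frechet_derivative_mult_smooth[OF sc(1) s, of x v]
      frechet_derivative_compose_inner[of cos "\<lambda>y. - sin y" \<xi> x v] by (simp add: DERIV_cos)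
  have ds: "frechet_derivative (\<lambda>x. sin (x \<bullet> \<xi>) * \<phi> x) (at x) v = sin (x \<bullet> \<xi>) * ?D x + (v \<bullet> \<xi>) * (cos (x \<bullet> \<xi>) * \<phi> x)" for x
    using frechet_derivative_mult_smooth[OF sc(2) s, of x v]
      frechet_derivative_compose_inner[of sin cos \<xi> x v] by (simp add: DERIV_sin)
  have c: "(LINT x|lborel. cos (x \<bullet> \<xi>) * ?D x) = (v \<bullet> \<xi>) * (LINT x|lborel. sin (x \<bullet> \<xi>) * \<phi> x)"
    using integral_frechet_test_function[OF test_function_mult[OF t sc(1)], of v] ti[OF t] ti[OF tD]
    by (simp add: dc)
  have d: "(LINT x|lborel. sin (x \<bullet> \<xi>) * ?D x) = - ((v \<bullet> \<xi>) * (LINT x|lborel. cos (x \<bullet> \<xi>) * \<phi> x))"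
    using integral_frechet_test_function[OF test_function_mult[OF t sc(2)], of v] ti[OF t] ti[OF tD]
    by (simp add: ds)
  have split: "(LINT x|lborel. cis (- (x \<bullet> \<xi>)) * complex_of_real (\<psi> x)) = 
     Complex (LINT x|lborel. cos (x \<bullet> \<xi>) * \<psi> x) (- (LINT x|lborel. sin (x \<bullet> \<xi>) * \<psi> x))"
    if "test_function UNIV \<psi>" for \<psi> :: "'a \<Rightarrow> real"
  proof -
    note i = fourier_integrand_integrable[OF test_function_integrable[OF that], of \<xi>]
    show ?thesis using integral_Re[OF i] integral_Im[OF i] by (simp add: complex_eq_iff)
  qed
  show ?thesis
    unfolding fourier_integral_def split[OF tD] split[OF t] c d
    by (simp add: complex_eq_iff)
qed

section \<open>From locally integrable weak gradients to Fourier multipliers\<close>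

lemma locally_integrable_measurable:
  fixes g :: "'a::euclidean_space \<Rightarrow> 'b::{banach, second_countable_topology}"
  assumes "locally_integrable UNIV g" shows "g \<in> borel_measurable lborel"
proof (rule borel_measurable_LIMSEQ_metric)
  have "integrable lborel (\<lambda>x. indicator (cball 0 (real n)) x *\<^sub>R g x)" for n
    using assms by (simp add: locally_integrable_def set_integrable_def)
  then show "(\<lambda>x. indicator (cball 0 (real n)) x *\<^sub>R g x) \<in> borel_measurable lborel" for n
    by (rule borel_measurable_integrable)
  fix x
  show "(\<lambda>n. indicator (cball 0 (real n)) x *\<^sub>R g x) \<longlonglongrightarrow> g x"
  proof (rule tendsto_eventually)
    show "\<forall>\<^sub>F n in sequentially. indicator (cball 0 (real n)) x *\<^sub>R g x = g x"
      using eventually_ge_at_top[of "nat \<lceil>norm x\<rceil>"]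
    proof eventually_elim
      case (elim n)
      then have "norm x \<le> real n" by linarith
      then show ?case by simp
    qed
  qed
qed

lemma locally_integrable_test_function:
  fixes g :: "'a::euclidean_space \<Rightarrow> 'b::{banach, second_countable_topology}"
  assumes g: "locally_integrable UNIV g" and t: "test_function UNIV \<phi>"
  shows "integrable lborel (\<lambda>x. \<phi> x *\<^sub>R g x)"
proof -
  obtain B r where B: "0 < B" "\<And>x. \<bar>\<phi> x\<bar> \<le> B" "\<And>x. r \<le> norm x \<Longrightarrow> \<phi> x = 0" using test_function_bounds[OF t] by blast
  have i: "integrable lborel (\<lambda>x. B *\<^sub>R (indicator (cball 0 r) x *\<^sub>R g x))"
    using g by (intro integrable_scaleR_right) (auto simp: locally_integrable_def set_integrable_def)
  show ?thesis
  proof (rule Bochner_Integration.integrable_bound[OF i])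
    show "(\<lambda>x. \<phi> x *\<^sub>R g x) \<in> borel_measurable lborel"
      using locally_integrable_measurable[OF g] test_function_measurable[OF t] by auto
    show "AE x in lborel. norm (\<phi> x *\<^sub>R g x) \<le> norm (B *\<^sub>R (indicator (cball 0 r) x *\<^sub>R g x))"
    proof (rule AE_I2)
      fix x show "norm (\<phi> x *\<^sub>R g x) \<le> norm (B *\<^sub>R (indicator (cball 0 r) x *\<^sub>R g x))"
        using B(1) B(2)[of x] B(3)[of x] by (cases "norm x \<le> r") (auto intro!: mult_right_mono)
    qed
  qed
qed

text \<open>Reads the vector identity of the definition in one coordinate. The inner product with b
  is taken out of a Bochner integral, which is why integrability of both vector integrands is
  established.\<close>

lemma weak_gradient_component:
  fixes u :: "'a::euclidean_space \<Rightarrow> real"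
  assumes G: "has_weak_gradient UNIV u G" and t: "test_function UNIV \<phi>" and b: "b \<in> Basis"
  shows "(LINT x|lborel. u x * frechet_derivative \<phi> (at x) b) = - (LINT x|lborel. \<phi> x * (G x \<bullet> b))"
proof -
  have lu: "locally_integrable UNIV u" and lG: "locally_integrable UNIV G" using G by (auto simp: has_weak_gradient_def)
  have "integrable lborel (\<lambda>x. \<Sum>c\<in>Basis. (frechet_derivative \<phi> (at x) c *\<^sub>R u x) *\<^sub>R (c::'a))"
    by (intro Bochner_Integration.integrable_sum integrable_scaleR_left locally_integrable_test_function lu test_function_frechet t)
  then have i: "integrable lborel (\<lambda>x. u x *\<^sub>R grad \<phi> x)"
    by (simp add: grad_def scaleR_sum_right mult.commute)
  have "(LINT x|lborel. u x *\<^sub>R grad \<phi> x) = - (LINT x|lborel. \<phi> x *\<^sub>R G x)"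
    using G t by (auto simp: has_weak_gradient_def set_lebesgue_integral_def)
  then have "(LINT x|lborel. u x *\<^sub>R grad \<phi> x) \<bullet> b = - ((LINT x|lborel. \<phi> x *\<^sub>R G x) \<bullet> b)" by simp
  then show ?thesis
    using i locally_integrable_test_function[OF lG t] b
    by (simp add: integral_inner_left[symmetric] grad_inner_Basis)
qed

lemma L2_indicator_cbox: "L2 (indicator (cbox a c) :: 'a::euclidean_space \<Rightarrow> real)"
proof -
  have "(\<lambda>x. (norm (indicator (cbox a c) x :: real))\<^sup>2) = indicator (cbox a c)" by (auto simp: indicator_def fun_eq_iff)
  then show ?thesis
    using integrable_real_indicator[of "cbox a c" lborel] emeasure_lborel_cbox_finite[of a c]
    by (auto simp: L2_iff intro!: borel_measurable_indicator)
qed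

lemma L2_locally_integrable:
  fixes f :: "'a::euclidean_space \<Rightarrow> real"
  assumes "L2 f" shows "integrable lborel (\<lambda>x. indicator (cbox a c) x * f x)"
  by (rule L2_prod_integrable[OF L2_indicator_cbox assms])

text \<open>Surjectivity provides w in L2 with transform i (b . \<xi>) times that of u. By Parseval
  and the transform of a derivative, w and G . b have the same integrals against all test functions,
  so they agree almost everywhere; the bound follows from |b . \<xi>| \<le> |\<xi>|.\<close>

lemma weak_gradient_L2:
  fixes u :: "'a::euclidean_space \<Rightarrow> real"
  assumes u: "L2 u" and m: "L2 (\<lambda>\<xi>. complex_of_real (norm \<xi>) * fourier u \<xi>)"
    and G: "has_weak_gradient UNIV u G" and b: "b \<in> Basis"
  shows "L2 (\<lambda>x. G x \<bullet> b)" and "L2sq (\<lambda>x. G x \<bullet> b) \<le> L2sq (\<lambda>\<xi>. complex_of_real (norm \<xi>) * fourier u \<xi>)"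
proof -
  have lG: "locally_integrable UNIV G" using G by (auto simp: has_weak_gradient_def)
  have [measurable]: "fourier u \<in> borel_measurable borel" using L2_fourier[OF u] by (simp add: L2_def)
  define g where "g = (\<lambda>\<xi>. \<i> * complex_of_real (b \<bullet> \<xi>) * fourier u \<xi>)"
  have gm: "norm (g \<xi>) \<le> norm (complex_of_real (norm \<xi>) * fourier u \<xi>)" for \<xi>
    using Cauchy_Schwarz_ineq2[of b \<xi>] b by (auto simp: g_def norm_mult intro!: mult_right_mono)
  have g: "L2 g" by (rule L2_bound[OF m, of _ 1]) (use gm in \<open>auto simp: g_def\<close>)
  have "AE \<xi> in lborel. g (- \<xi>) = cnj (g \<xi>)"
    using fourier_minus_arg[OF u] by eventually_elim (simp add: g_def)
  from fourier_surj[OF g this] obtain w where w: "L2 w" "AE \<xi> in lborel. fourier w \<xi> = g \<xi>" by blast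
  have zero: "(LINT x|lborel. (G x \<bullet> b - w x) * \<phi> x) = 0" if t: "test_function UNIV \<phi>" for \<phi>
  proof -
    let ?D = "\<lambda>x. frechet_derivative \<phi> (at x) b"
    note tD = test_function_frechet[OF t, of b]
    note L = test_function_L2[OF t] test_function_L2[OF tD]
    have [measurable]: "fourier w \<in> borel_measurable borel" "fourier \<phi> \<in> borel_measurable borel" "fourier ?D \<in> borel_measurable borel"
      using L2_fourier[OF w(1)] L2_fourier[OF L(1)] L2_fourier[OF L(2)] by (auto simp: L2_def)
    have "(LINT x|lborel. u x * ?D x) = (LINT \<xi>|lborel. Re (fourier u \<xi> * cnj (fourier ?D \<xi>)))"
      by (rule parseval[symmetric, OF u L(2)])
    also have "\<dots> = (LINT \<xi>|lborel. - Re (fourier w \<xi> * cnj (fourier \<phi> \<xi>)))"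
    proof (rule integral_cong_AE)
      show "AE \<xi> in lborel. Re (fourier u \<xi> * cnj (fourier ?D \<xi>)) = - Re (fourier w \<xi> * cnj (fourier \<phi> \<xi>))"
        using w(2) fourier_eq_fourier_integral[OF test_function_integrable[OF t] L(1)]
          fourier_eq_fourier_integral[OF test_function_integrable[OF tD] L(2)]
        by eventually_elim (simp add: fourier_integral_frechet[OF t] g_def algebra_simps)
    qed auto
    also have "\<dots> = - (LINT x|lborel. w x * \<phi> x)" using parseval[OF w(1) L(1)] by (simp only: Bochner_Integration.integral_minus)
    finally have "(LINT x|lborel. \<phi> x * (G x \<bullet> b)) = (LINT x|lborel. w x * \<phi> x)"
      using weak_gradient_component[OF G t b] by simp
    moreover have "integrable lborel (\<lambda>x. \<phi> x * (G x \<bullet> b))"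
      using integrable_inner_left[OF locally_integrable_test_function[OF lG t], of b] by simp
    ultimately show ?thesis
      using L2_prod_integrable[OF w(1) L(1)] by (simp add: algebra_simps)
  qed
  have [measurable]: "G \<in> borel_measurable borel" using locally_integrable_measurable[OF lG] by simp
  have [measurable]: "w \<in> borel_measurable borel" using w by (simp add: L2_def)
  have "AE x in lborel. x \<in> UNIV \<longrightarrow> G x \<bullet> b - w x = 0"
  proof (rule fundamental_lemma[OF _ open_UNIV _ zero])
    fix a c :: 'a
    have "integrable lborel (\<lambda>x. indicator (cbox a c) x *\<^sub>R G x)"
      using lG by (auto simp: locally_integrable_def set_integrable_def)
    from integrable_inner_left[OF this, of b] L2_locally_integrable[OF w(1), of a c]
    show "integrable lborel (\<lambda>x. indicator (cbox a c) x * (G x \<bullet> b - w x))"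
      by (simp add: algebra_simps)
  qed measurable
  then have eq: "AE x in lborel. G x \<bullet> b = w x" by eventually_elim simp
  show "L2 (\<lambda>x. G x \<bullet> b)" by (rule L2_cong_AE[OF w(1) _ eq]) measurable
  have "L2sq (\<lambda>x. G x \<bullet> b) = L2sq w" by (rule L2sq_cong_AE[OF _ _ eq]) measurable
  also have "\<dots> = L2sq g"
    using L2sq_cong_AE[OF _ _ w(2)] L2_fourier[OF w(1)] g by (simp add: L2sq_fourier[OF w(1), symmetric] L2_def)
  also have "\<dots> \<le> L2sq (\<lambda>\<xi>. complex_of_real (norm \<xi>) * fourier u \<xi>)"
    unfolding L2sq_def by (rule integral_mono[OF L2_integrable[OF g] L2_integrable[OF m]]) (intro power_mono gm norm_ge_zero)
  finally show "L2sq (\<lambda>x. G x \<bullet> b) \<le> L2sq (\<lambda>\<xi>. complex_of_real (norm \<xi>) * fourier u \<xi>)" .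
qed

section \<open>The commutator identity for the heat semigroup\<close>

lemma heat_has_derivative:
  fixes x y :: "'a::euclidean_space"
  shows
  "((\<lambda>x. heat l (x - y)) has_derivative (\<lambda>v. - (((x - y) \<bullet> v) / (2 * l)) * heat l (x - y))) (at x)"
proof -
  have "((\<lambda>x. (norm (x - y))\<^sup>2) has_derivative (\<lambda>v. 2 * ((x - y) \<bullet> v))) (at x)"
    unfolding power2_norm_eq_inner by (auto intro!: derivative_eq_intros simp: inner_commute)
  then have "((\<lambda>x. (- 1 / (4 * l)) * (norm (x - y))\<^sup>2) has_derivative (\<lambda>v. (- 1 / (4 * l)) * (2 * ((x - y) \<bullet> v)))) (at x)"
    by (rule has_derivative_mult_right)
  from has_derivative_mult_right[OF has_derivative_exp[OF this], of "(4 * pi * l) powr (- real DIM('a) / 2)"]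
  show ?thesis by (simp add: heat_def mult_ac)
qed

lemma smooth_heat: "smooth (\<lambda>x. heat l (x - y :: 'a::euclidean_space))"
proof -
  have "smooth (\<lambda>x. (x - y) \<bullet> b)" for b :: 'a unfolding inner_diff_left by (intro smooth_diff smooth_inner smooth_const)
  then have "smooth (\<lambda>x. (norm (x - y))\<^sup>2)" 
    unfolding norm_sq_Basis unfolding power2_eq_square by (intro smooth_sum smooth_mult)
  then have "smooth (\<lambda>x. (- 1 / (4 * l)) * (norm (x - y))\<^sup>2)" by (intro smooth_mult smooth_const)
  from smooth_compose[OF smooth_exp this] have "smooth (\<lambda>x. (4 * pi * l) powr (- real DIM('a) / 2) * exp ((- 1 / (4 * l)) * (norm (x - y))\<^sup>2))"
    by (intro smooth_mult smooth_const)
  then show ?thesis unfolding heat_def by simp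
qed

text \<open>Half of the Gaussian exponent absorbs the factor |h|; the other half is still
  integrable.\<close>

lemma heat_weight_integrable:
  assumes l: "0 < l"
  shows "integrable lborel (\<lambda>h::'a::euclidean_space. norm h * heat l h)"
proof -
  have "integrable lborel (\<lambda>h::'a. ((1 + 8 * l) * (4 * pi * l) powr (- real DIM('a) / 2)) * exp (- (1 / (8 * l)) * (norm h)\<^sup>2))"
    using gaussian_integrable[of "1 / (8 * l)"] l by (intro integrable_mult_right) auto
  then show ?thesis
  proof (rule Bochner_Integration.integrable_bound)
    show "(\<lambda>h::'a. norm h * heat l h) \<in> borel_measurable lborel" by measurable
    show "AE h in lborel. norm (norm h * heat l h) \<le> norm (((1 + 8 * l) * (4 * pi * l) powr (- real DIM('a) / 2)) * exp (- (1 / (8 * l)) * (norm (h::'a))\<^sup>2))"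
    proof (rule AE_I2)
      fix h :: 'a
      \<comment> \<open>The heat kernel carries exp (- 2 z). From |h| \<le> 1 + |h|^2 = 1 + 8 l z
        \<le> (1 + 8 l) exp z a factor exp (- z) remains.\<close>
      define z where "z = (norm h)\<^sup>2 / (8 * l)"
      have z: "0 \<le> z" "(norm h)\<^sup>2 = 8 * l * z" using l by (auto simp: z_def)
      have "norm h \<le> 1 + (norm h)\<^sup>2" using sum_squares_bound[of "norm h" 1] norm_ge_zero[of h] by (simp add: power2_eq_square) (smt (verit) zero_le_square)
      also have "\<dots> \<le> exp z + 8 * l * exp z" 
      proof -
        have "1 \<le> exp z" "z \<le> exp z" using z exp_ge_add_one_self[of z] by linarith+
        then show ?thesis using z l by (intro add_mono) (auto intro: mult_left_mono)
      qed
      finally have "norm h \<le> (1 + 8 * l) * exp z" by (simp add: algebra_simps)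
      then have "norm h * exp (- (2 * z)) \<le> (1 + 8 * l) * exp z * exp (- (2 * z))" by (intro mult_right_mono) auto
      also have "\<dots> = (1 + 8 * l) * exp (- z)" by (simp add: exp_add[symmetric])
      finally have "norm h * exp (- (2 * z)) * (4 * pi * l) powr (- real DIM('a) / 2) \<le> (1 + 8 * l) * exp (- z) * (4 * pi * l) powr (- real DIM('a) / 2)"
        by (intro mult_right_mono) auto
      moreover have "heat l h = (4 * pi * l) powr (- real DIM('a) / 2) * exp (- (2 * z))" by (simp add: heat_def z_def)
      ultimately show "norm (norm h * heat l h) \<le> norm (((1 + 8 * l) * (4 * pi * l) powr (- real DIM('a) / 2)) * exp (- (1 / (8 * l)) * (norm h)\<^sup>2))"
        using l by (simp add: z_def mult_ac)
    qed
  qed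
qed

text \<open>The divergence of $x \mapsto k_l(x-y)\,\nabla\psi(x)$, where $k_l$ is the heat kernel.\<close>

definition heat_div :: "real \<Rightarrow> ('a::euclidean_space \<Rightarrow> real) \<Rightarrow> 'a \<Rightarrow> 'a \<Rightarrow> real" where
  "heat_div l \<psi> x y = heat l (x - y) * laplacian \<psi> x - ((x - y) \<bullet> grad \<psi> x) / (2 * l) * heat l (x - y)"

lemma heat_div_eq_sum:
  assumes t: "test_function UNIV \<psi>"
  shows "heat_div l \<psi> x y = (\<Sum>b\<in>Basis. frechet_derivative (\<lambda>x. heat l (x - y) * frechet_derivative \<psi> (at x) b) (at x) b)"
proof -
  have "frechet_derivative (\<lambda>x. heat l (x - y)) (at x) v = - (((x - y) \<bullet> v) / (2 * l)) * heat l (x - y)" for v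
    using frechet_derivative_at[OF heat_has_derivative[of l y x]] by (metis (no_types, lifting))
  then have "frechet_derivative (\<lambda>x. heat l (x - y) * frechet_derivative \<psi> (at x) b) (at x) b
    = heat l (x - y) * frechet_derivative (\<lambda>x. frechet_derivative \<psi> (at x) b) (at x) b
      - ((x - y) \<bullet> b) * frechet_derivative \<psi> (at x) b / (2 * l) * heat l (x - y)" for b
    using frechet_derivative_mult_smooth[OF smooth_heat smooth_frechet[OF test_function_smooth[OF t]], of l y b x b]
    by (simp add: algebra_simps)
  then have "(\<Sum>b\<in>Basis. frechet_derivative (\<lambda>x. heat l (x - y) * frechet_derivative \<psi> (at x) b) (at x) b)
    = heat l (x - y) * laplacian \<psi> x - (\<Sum>b\<in>Basis. ((x - y) \<bullet> b) * frechet_derivative \<psi> (at x) b) / (2 * l) * heat l (x - y)"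
    by (simp add: laplacian_eq sum_subtractf sum_distrib_left sum_distrib_right sum_divide_distrib)
  also have "(\<Sum>b\<in>Basis. ((x - y) \<bullet> b) * frechet_derivative \<psi> (at x) b) = (x - y) \<bullet> grad \<psi> x"
    by (subst (2) euclidean_inner) (simp add: grad_inner_Basis)
  finally show ?thesis by (simp add: heat_div_def)
qed

lemma grad_bounded:
  assumes t: "test_function UNIV \<psi>"
  shows "\<exists>B>0. \<forall>x. norm (grad \<psi> x) \<le> B"
proof -
  have "\<exists>B. \<forall>x. \<bar>frechet_derivative \<psi> (at x) b\<bar> \<le> B" for b
    using test_function_bounds[OF test_function_frechet[OF t, of b]] by blast
  then obtain B where B: "\<And>b x. \<bar>frechet_derivative \<psi> (at x) b\<bar> \<le> B b" by metis
  have "norm (grad \<psi> x) \<le> (\<Sum>b\<in>Basis. B b) + 1" for x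
  proof -
    have "norm (grad \<psi> x) \<le> (\<Sum>b\<in>Basis. \<bar>grad \<psi> x \<bullet> b\<bar>)" by (rule norm_le_l1)
    also have "\<dots> \<le> (\<Sum>b\<in>Basis. B b)" using B by (intro sum_mono) (simp add: grad_inner_Basis)
    finally show ?thesis by simp
  qed
  moreover have "0 \<le> B b" for b using order_trans[OF abs_ge_zero B] .
  ultimately show ?thesis by (intro exI[of _ "(\<Sum>b\<in>Basis. B b) + 1"]) (auto intro!: add_nonneg_pos sum_nonneg)
qed

lemma measurable_grad:
  assumes t: "smooth \<psi>"
  shows "grad \<psi> \<in> borel_measurable borel"
  unfolding grad_def
  by (intro borel_measurable_sum borel_measurable_scaleR borel_measurable_const smooth_measurable smooth_frechet t)

lemma measurable_laplacian:
  assumes t: "smooth \<psi>"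
  shows "laplacian \<psi> \<in> borel_measurable borel"
  by (intro smooth_measurable smooth_laplacian t)

text \<open>For fixed y, the heat kernel times a derivative of \<psi> is a test function in x, since
  \<psi> has compact support. Testing the weak gradient with it and summing over coordinates
  produces the divergence.\<close>

lemma weak_gradient_heat:
  fixes u :: "'a::euclidean_space \<Rightarrow> real"
  assumes u: "L2 u" and GL: "\<And>b. b \<in> Basis \<Longrightarrow> L2 (\<lambda>x. G x \<bullet> b)"
    and G: "has_weak_gradient UNIV u G" and t: "test_function UNIV \<psi>"
  shows "(LINT x|lborel. (grad \<psi> x \<bullet> G x) * heat l (x - y)) = - (LINT x|lborel. u x * heat_div l \<psi> x y)"
proof -
  have tb: "test_function UNIV (\<lambda>x. heat l (x - y) * frechet_derivative \<psi> (at x) b)" for b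
    by (intro test_function_mult test_function_frechet t smooth_heat)
  have "(LINT x|lborel. u x * heat_div l \<psi> x y) = (LINT x|lborel. (\<Sum>b\<in>Basis. u x * frechet_derivative (\<lambda>x. heat l (x - y) * frechet_derivative \<psi> (at x) b) (at x) b))"
    unfolding heat_div_eq_sum[OF t] sum_distrib_left ..
  also have "\<dots> = (\<Sum>b\<in>Basis. LINT x|lborel. u x * frechet_derivative (\<lambda>x. heat l (x - y) * frechet_derivative \<psi> (at x) b) (at x) b)"
    by (intro Bochner_Integration.integral_sum L2_prod_integrable[OF u] test_function_L2[of UNIV] test_function_frechet tb)
  also have "\<dots> = (\<Sum>b\<in>Basis. - (LINT x|lborel. (heat l (x - y) * frechet_derivative \<psi> (at x) b) * (G x \<bullet> b)))"
    by (intro sum.cong refl weak_gradient_component[OF G tb])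
  also have "\<dots> = - (LINT x|lborel. (\<Sum>b\<in>Basis. (heat l (x - y) * frechet_derivative \<psi> (at x) b) * (G x \<bullet> b)))"
    unfolding sum_negf
    by (subst Bochner_Integration.integral_sum) (auto intro!: L2_prod_integrable GL test_function_L2[OF tb])
  also have "(\<lambda>x. \<Sum>b\<in>Basis. (heat l (x - y) * frechet_derivative \<psi> (at x) b) * (G x \<bullet> b)) = (\<lambda>x. (grad \<psi> x \<bullet> G x) * heat l (x - y))"
  proof
    fix x
    have "grad \<psi> x \<bullet> G x = (\<Sum>b\<in>Basis. frechet_derivative \<psi> (at x) b * (G x \<bullet> b))"
      by (subst euclidean_inner) (simp add: grad_inner_Basis)
    then show "(\<Sum>b\<in>Basis. (heat l (x - y) * frechet_derivative \<psi> (at x) b) * (G x \<bullet> b)) = (grad \<psi> x \<bullet> G x) * heat l (x - y)"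
      by (simp add: sum_distrib_left mult_ac)
  qed
  finally show ?thesis by simp
qed

lemma integral_heat_div:
  assumes t: "test_function UNIV \<psi>"
  shows "(LINT x|lborel. heat_div l \<psi> x y) = 0"
proof -
  have tb: "test_function UNIV (\<lambda>x. heat l (x - y) * frechet_derivative \<psi> (at x) b)" for b
    by (intro test_function_mult test_function_frechet t smooth_heat)
  show ?thesis
    unfolding heat_div_eq_sum[OF t]
    by (subst Bochner_Integration.integral_sum)
      (auto intro!: test_function_integrable[of UNIV] test_function_frechet tb sum.neutral integral_frechet_test_function[OF tb])
qed

lemma L2_grad_inner:
  fixes G :: "'a::euclidean_space \<Rightarrow> 'a"
  assumes GL: "\<And>b. b \<in> Basis \<Longrightarrow> L2 (\<lambda>x. G x \<bullet> b)" and t: "test_function UNIV \<psi>"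
  shows "L2 (\<lambda>x. grad \<psi> x \<bullet> G x)"
proof -
  have "L2 (\<lambda>x. \<Sum>b\<in>Basis. frechet_derivative \<psi> (at x) b * (G x \<bullet> b))"
  proof (rule L2_sum)
    fix b :: 'a assume b: "b \<in> Basis"
    obtain B where "\<And>x. \<bar>frechet_derivative \<psi> (at x) b\<bar> \<le> B"
      using test_function_bounds[OF test_function_frechet[OF t, of b]] by blast
    then show "L2 (\<lambda>x. frechet_derivative \<psi> (at x) b * (G x \<bullet> b))"
      using test_function_measurable[OF test_function_frechet[OF t, of b]] by (intro L2_bounded_mult_real GL b) auto
  qed
  moreover have "grad \<psi> x \<bullet> G x = (\<Sum>b\<in>Basis. frechet_derivative \<psi> (at x) b * (G x \<bullet> b))" for x
    by (subst euclidean_inner) (simp add: grad_inner_Basis)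
  ultimately show ?thesis by simp
qed

text \<open>The kernels below depend on both points through \<psi> and are no convolutions; an
  integrable convolution majorant gives them the same integrability.\<close>

lemma dominated_kernel_integrable:
  fixes f g :: "'a::euclidean_space \<Rightarrow> real"
  assumes f: "L2 f" and g: "L2 g" and j: "integrable lborel j"
    and [measurable]: "(\<lambda>(x, y). K x y) \<in> borel_measurable (lborel \<Otimes>\<^sub>M lborel)"
    and K: "\<And>x y. \<bar>K x y\<bar> \<le> j (x - y)"
  shows "integrable (lborel \<Otimes>\<^sub>M lborel) (\<lambda>(x, y). f x * g y * K x y)"
    and "integrable (lborel \<Otimes>\<^sub>M lborel) (\<lambda>(x, y). (f x)\<^sup>2 * K x y)"
    and "integrable (lborel \<Otimes>\<^sub>M lborel) (\<lambda>(x, y). (f y)\<^sup>2 * K x y)"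
proof -
  have [measurable]: "f \<in> borel_measurable borel" "g \<in> borel_measurable borel" using f g by (auto simp: L2_def)
  have j0: "0 \<le> j h" for h using order_trans[OF abs_ge_zero K[of h 0]] by simp
  show "integrable (lborel \<Otimes>\<^sub>M lborel) (\<lambda>(x, y). f x * g y * K x y)"
    by (rule Bochner_Integration.integrable_bound[OF kernel_integrable(1)[OF f g j]], measurable)
      (use K j0 in \<open>auto simp: abs_mult intro!: AE_I2 mult_left_mono\<close>)
  show "integrable (lborel \<Otimes>\<^sub>M lborel) (\<lambda>(x, y). (f x)\<^sup>2 * K x y)"
    by (rule Bochner_Integration.integrable_bound[OF kernel_sq_integrable(1)[OF f j]], measurable)
      (use K j0 in \<open>auto simp: abs_mult intro!: AE_I2 mult_left_mono\<close>)
  show "integrable (lborel \<Otimes>\<^sub>M lborel) (\<lambda>(x, y). (f y)\<^sup>2 * K x y)"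
    by (rule Bochner_Integration.integrable_bound[OF kernel_sq_integrable(3)[OF f j]], measurable)
      (use K j0 in \<open>auto simp: abs_mult intro!: AE_I2 mult_left_mono\<close>)
qed

lemma integral_pair_swap:
  fixes f :: "'a::euclidean_space \<Rightarrow> 'b::euclidean_space \<Rightarrow> real"
  assumes "(\<lambda>(x, y). f x y) \<in> borel_measurable (lborel \<Otimes>\<^sub>M lborel)"
  shows "(LINT z|(lborel \<Otimes>\<^sub>M lborel). f (snd z) (fst z)) = (LINT z|(lborel \<Otimes>\<^sub>M lborel). f (fst z) (snd z))"
  using lborel_pair.integral_product_swap[OF assms] by (simp add: case_prod_beta')

text \<open>Symmetrisation turns the separate gradients into the difference \<nabla>\<psi>(x) -
  \<nabla>\<psi>(y). Its Lipschitz bound contributes the second power of |x - y| needed against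
  1/(2l).\<close>

definition heat_comm :: "real \<Rightarrow> ('a::euclidean_space \<Rightarrow> real) \<Rightarrow> 'a \<Rightarrow> 'a \<Rightarrow> real" where
  "heat_comm l \<psi> x y = heat_div l \<psi> x y + heat_div l \<psi> y x"

lemma heat_comm_eq:
  "heat_comm l \<psi> x y = heat l (x - y) * (laplacian \<psi> x + laplacian \<psi> y - ((x - y) \<bullet> (grad \<psi> x - grad \<psi> y)) / (2 * l))"
  unfolding heat_comm_def heat_div_def heat_commute[of l y x]
  by (simp add: algebra_simps inner_diff_left inner_diff_right diff_divide_distrib add_divide_distrib)

text \<open>Bounded second derivatives give a multiple of the heat kernel, bounded first derivatives
  its first moment. The majorant is even, so it also serves after the two points are
  exchanged.\<close>

lemma heat_div_dominated:
  assumes l: "0 < l" and t: "test_function UNIV \<psi>"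
  shows "\<exists>j. integrable lborel j \<and> (\<forall>x y. \<bar>heat_div l \<psi> x y\<bar> \<le> j (x - y)) \<and> (\<forall>h. j (- h) = j h)"
proof -
  obtain B where B: "\<And>x. \<bar>laplacian \<psi> x\<bar> \<le> B" using test_function_bounds[OF test_function_laplacian[OF t]] by blast
  obtain A where A: "0 < A" "\<And>x. norm (grad \<psi> x) \<le> A" using grad_bounded[OF t] by blast
  define j where "j h = B * heat l h + A / (2 * l) * (norm h * heat l h)" for h :: 'a
  have "integrable lborel j" unfolding j_def
    using l by (intro Bochner_Integration.integrable_add integrable_mult_right heat_weight_integrable integrable_heat)
  moreover have "\<bar>heat_div l \<psi> x y\<bar> \<le> j (x - y)" for x y
  proof -
    have "\<bar>heat_div l \<psi> x y\<bar> \<le> \<bar>heat l (x - y) * laplacian \<psi> x\<bar> + \<bar>((x - y) \<bullet> grad \<psi> x) / (2 * l) * heat l (x - y)\<bar>"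
      unfolding heat_div_def by (rule abs_triangle_ineq4)
    also have "\<dots> \<le> B * heat l (x - y) + (norm (x - y) * A) / (2 * l) * heat l (x - y)"
    proof (rule add_mono)
      show "\<bar>heat l (x - y) * laplacian \<psi> x\<bar> \<le> B * heat l (x - y)"
        using mult_right_mono[OF B[of x], of "heat l (x - y)"] by (simp add: abs_mult mult.commute)
      have "\<bar>(x - y) \<bullet> grad \<psi> x\<bar> \<le> norm (x - y) * A"
        using Cauchy_Schwarz_ineq2[of "x - y" "grad \<psi> x"] mult_left_mono[OF A(2)[of x], of "norm (x - y)"] by simp
      then show "\<bar>((x - y) \<bullet> grad \<psi> x) / (2 * l) * heat l (x - y)\<bar> \<le> (norm (x - y) * A) / (2 * l) * heat l (x - y)"
        using l by (auto simp: abs_mult intro!: mult_right_mono divide_right_mono)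
    qed
    also have "\<dots> = j (x - y)" by (simp add: j_def)
    finally show ?thesis .
  qed
  moreover have "j (- h) = j h" for h by (simp add: j_def)
  ultimately show ?thesis by blast
qed

lemma measurable_heat_div:
  assumes t: "test_function UNIV \<psi>"
  shows "(\<lambda>(x, y). heat_div l \<psi> x y) \<in> borel_measurable (lborel \<Otimes>\<^sub>M lborel)"
proof -
  have [measurable]: "laplacian \<psi> \<in> borel_measurable borel" "grad \<psi> \<in> borel_measurable borel"
    using measurable_laplacian measurable_grad test_function_smooth[OF t] by blast+
  show ?thesis unfolding heat_div_def by measurable
qed

lemma heat_comm_dominated:
  assumes l: "0 < l" and t: "test_function UNIV \<psi>"
  shows "\<exists>j. integrable lborel j \<and> (\<forall>x y. \<bar>heat_comm l \<psi> x y\<bar> \<le> j (x - y))"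
proof -
  obtain j where j: "integrable lborel j" "\<And>x y. \<bar>heat_div l \<psi> x y\<bar> \<le> j (x - y)" "\<And>h. j (- h) = j h"
    using heat_div_dominated[OF l t] by blast
  have "\<bar>heat_comm l \<psi> x y\<bar> \<le> j (x - y) + j (x - y)" for x y
    unfolding heat_comm_def using j(2)[of x y] j(2)[of y x] j(3)[of "x - y"] abs_triangle_ineq[of "heat_div l \<psi> x y" "heat_div l \<psi> y x"]
    by simp
  then show ?thesis using j(1) by (intro exI[of _ "\<lambda>h. j h + j h"]) auto
qed

lemma measurable_heat_comm:
  assumes t: "test_function UNIV \<psi>"
  shows "(\<lambda>(x, y). heat_comm l \<psi> x y) \<in> borel_measurable (lborel \<Otimes>\<^sub>M lborel)"
proof -
  have [measurable]: "laplacian \<psi> \<in> borel_measurable borel" "grad \<psi> \<in> borel_measurable borel"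
    using measurable_laplacian measurable_grad test_function_smooth[OF t] by blast+
  show ?thesis unfolding heat_comm_eq by measurable
qed

text \<open>Of the divergence in x, the Laplacian term has total mass 1 in y and the gradient term
  is odd in x - y. The other half is a divergence in y of a compactly supported field and integrates
  to 0.\<close>

lemma integral_heat_comm:
  assumes l: "0 < l" and t: "test_function UNIV \<psi>"
  shows "(LINT y|lborel. heat_comm l \<psi> x y) = laplacian \<psi> x"
proof -
  have i1: "integrable lborel (\<lambda>y. heat l (x - y) * laplacian \<psi> x)"
    using integrable_reflect[OF integrable_heat[OF l], of x] by simp
  have "integrable lborel (\<lambda>y. (norm (x - y) * heat l (x - y)) * (norm (grad \<psi> x) / (2 * l)))"
    by (rule integrable_mult_left[OF integrable_reflect[OF heat_weight_integrable[OF l]]])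
  then have i2: "integrable lborel (\<lambda>y. ((x - y) \<bullet> grad \<psi> x) / (2 * l) * heat l (x - y))"
  proof (rule Bochner_Integration.integrable_bound)
    show "AE y in lborel. norm (((x - y) \<bullet> grad \<psi> x) / (2 * l) * heat l (x - y)) \<le> norm ((norm (x - y) * heat l (x - y)) * (norm (grad \<psi> x) / (2 * l)))"
    proof (rule AE_I2)
      fix y
      have "\<bar>(x - y) \<bullet> grad \<psi> x\<bar> * heat l (x - y) \<le> (norm (x - y) * norm (grad \<psi> x)) * heat l (x - y)"
        by (intro mult_right_mono Cauchy_Schwarz_ineq2) simp
      then show "norm (((x - y) \<bullet> grad \<psi> x) / (2 * l) * heat l (x - y)) \<le> norm ((norm (x - y) * heat l (x - y)) * (norm (grad \<psi> x) / (2 * l)))"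
        using l by (simp add: abs_mult divide_right_mono mult_ac)
    qed
  qed measurable
  have odd: "(LINT y|lborel. ((x - y) \<bullet> grad \<psi> x) / (2 * l) * heat l (x - y)) = 0"
  proof -
    define q where "q h = (h \<bullet> grad \<psi> x) / (2 * l) * heat l h" for h
    have "(LINT h|lborel. q h) = (LINT h|lborel. q (0 - h))" by (rule integral_reflect[symmetric])
    also have "\<dots> = - (LINT h|lborel. q h)" by (simp add: q_def)
    finally have "(LINT h|lborel. q h) = 0" by simp
    then have "(LINT y|lborel. q (x - y)) = 0" using integral_reflect[of q x] by simp
    then show ?thesis by (simp only: q_def)
  qed
  have d: "integrable lborel (\<lambda>y. heat_div l \<psi> x y)" "(LINT y|lborel. heat_div l \<psi> x y) = laplacian \<psi> x"
    unfolding heat_div_def using i1 i2 odd integral_reflect[of "heat l" x] integral_heat[OF l, where 'a='a]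
    by simp_all
  obtain j where j: "integrable lborel j" "\<And>x y. \<bar>heat_div l \<psi> x y\<bar> \<le> j (x - y)" "\<And>h. j (- h) = j h"
    using heat_div_dominated[OF l t] by blast
  have "(\<lambda>y. heat_div l \<psi> y x) \<in> borel_measurable lborel"
    using measurable_heat_div[OF t, of l] by measurable
  then have "integrable lborel (\<lambda>y. heat_div l \<psi> y x)"
    using integrable_translate[OF j(1), of "- x"] j(2)
    by (elim Bochner_Integration.integrable_bound[rotated]) (auto intro!: AE_I2 order_trans[OF _ abs_ge_self])
  then show ?thesis unfolding heat_comm_def using d integral_heat_div[OF t] by simp
qed

text \<open>The product u(x) u(y) is half of u(x)^2 + u(y)^2 - (u(x) - u(y))^2. The pure squares
  integrate in the other variable to \<Delta>\<psi>; halving once for symmetrisation and once for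
  polarisation explains the factor 1/4 and, with two equal squares, the factor 1/2.\<close>

lemma heat_commutator:
  fixes u :: "'a::euclidean_space \<Rightarrow> real"
  assumes l: "0 < l" and u: "L2 u" and GL: "\<And>b. b \<in> Basis \<Longrightarrow> L2 (\<lambda>x. G x \<bullet> b)"
    and G: "has_weak_gradient UNIV u G" and t: "test_function UNIV \<psi>"
  shows "integrable (lborel \<Otimes>\<^sub>M lborel) (\<lambda>z. (u (fst z) - u (snd z))\<^sup>2 * heat_comm l \<psi> (fst z) (snd z))"
    and "heat_form l (\<lambda>x. grad \<psi> x \<bullet> G x) u = - (LINT x|lborel. (u x)\<^sup>2 * laplacian \<psi> x) / 2
      + (LINT z|(lborel \<Otimes>\<^sub>M lborel). (u (fst z) - u (snd z))\<^sup>2 * heat_comm l \<psi> (fst z) (snd z)) / 4"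
proof -
  let ?P = "lborel \<Otimes>\<^sub>M lborel :: ('a \<times> 'a) measure"
  define W where "W = (\<lambda>x. grad \<psi> x \<bullet> G x)"
  have W: "L2 W" unfolding W_def by (rule L2_grad_inner[OF GL t])
  have [measurable]: "u \<in> borel_measurable borel" using u by (simp add: L2_def)
  note [measurable] = measurable_heat_div[OF t, of l] measurable_heat_comm[OF t, of l]
  obtain j where j: "integrable lborel j" "\<And>x y. \<bar>heat_div l \<psi> x y\<bar> \<le> j (x - y)"
    using heat_div_dominated[OF l t] by blast
  obtain k where k: "integrable lborel k" "\<And>x y. \<bar>heat_comm l \<psi> x y\<bar> \<le> k (x - y)"
    using heat_comm_dominated[OF l t] by blast
  note dj = dominated_kernel_integrable[OF u u j(1) measurable_heat_div[OF t] j(2), unfolded case_prod_beta']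
  note dk = dominated_kernel_integrable[OF u u k(1) measurable_heat_comm[OF t] k(2), unfolded case_prod_beta']
  have sq: "(u (fst z) - u (snd z))\<^sup>2 * heat_comm l \<psi> (fst z) (snd z) = 
     (u (fst z))\<^sup>2 * heat_comm l \<psi> (fst z) (snd z) + (u (snd z))\<^sup>2 * heat_comm l \<psi> (fst z) (snd z)
      - 2 * (u (fst z) * u (snd z) * heat_comm l \<psi> (fst z) (snd z))" for z
    by (simp add: power2_diff algebra_simps)
  show "integrable ?P (\<lambda>z. (u (fst z) - u (snd z))\<^sup>2 * heat_comm l \<psi> (fst z) (snd z))"
    unfolding sq using dk by simp
  have comm: "heat_comm l \<psi> y x = heat_comm l \<psi> x y" for x y by (simp add: heat_comm_def)
  have "(LINT z|?P. (u (snd z))\<^sup>2 * heat_comm l \<psi> (fst z) (snd z)) = (LINT z|?P. (u (fst z))\<^sup>2 * heat_comm l \<psi> (fst z) (snd z))"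
    using integral_pair_swap[of "\<lambda>x y. (u x)\<^sup>2 * heat_comm l \<psi> x y"] by (simp add: comm)
  then have 1: "(LINT z|?P. (u (fst z) - u (snd z))\<^sup>2 * heat_comm l \<psi> (fst z) (snd z)) = 
     2 * (LINT z|?P. (u (fst z))\<^sup>2 * heat_comm l \<psi> (fst z) (snd z)) - 2 * (LINT z|?P. u (fst z) * u (snd z) * heat_comm l \<psi> (fst z) (snd z))"
    unfolding sq using dk by simp
  have "(LINT z|?P. (u (fst z))\<^sup>2 * heat_comm l \<psi> (fst z) (snd z)) = (LINT x|lborel. LINT y|lborel. (u x)\<^sup>2 * heat_comm l \<psi> x y)"
    using lborel_pair.integral_fst'[OF dk(2)] by simp
  then have 2: "(LINT z|?P. (u (fst z))\<^sup>2 * heat_comm l \<psi> (fst z) (snd z)) = (LINT x|lborel. (u x)\<^sup>2 * laplacian \<psi> x)"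
    by (simp add: integral_heat_comm[OF l t])
  have 3: "(LINT z|?P. u (fst z) * u (snd z) * heat_comm l \<psi> (fst z) (snd z)) = 2 * (LINT z|?P. u (fst z) * u (snd z) * heat_div l \<psi> (fst z) (snd z))"
  proof -
    have swi: "integrable ?P (\<lambda>z. u (fst z) * u (snd z) * heat_div l \<psi> (snd z) (fst z))"
      using lborel_pair.integrable_product_swap[OF dj(1)] by (simp add: case_prod_beta' mult_ac)
    have "(LINT z|?P. u (fst z) * u (snd z) * heat_div l \<psi> (snd z) (fst z)) = (LINT z|?P. u (fst z) * u (snd z) * heat_div l \<psi> (fst z) (snd z))"
      using integral_pair_swap[of "\<lambda>x y. u x * u y * heat_div l \<psi> x y"] by (simp add: mult_ac)
    then show ?thesis unfolding heat_comm_def distrib_left using dj(1) swi by simp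
  qed
  have hW: "integrable ?P (\<lambda>z. W (fst z) * u (snd z) * heat l (fst z - snd z))" by (rule heat_form_integrable[OF l W u])
  have "heat_form l W u = (LINT y|lborel. LINT x|lborel. W x * u y * heat l (x - y))"
    unfolding heat_form_def using lborel_pair.integral_snd[of "\<lambda>x y. W x * u y * heat l (x - y)"] hW
    by (simp add: case_prod_beta')
  also have "\<dots> = (LINT y|lborel. - (LINT x|lborel. u x * u y * heat_div l \<psi> x y))"
  proof (rule Bochner_Integration.integral_cong[OF refl])
    fix y
    have "(LINT x|lborel. W x * u y * heat l (x - y)) = u y * (LINT x|lborel. W x * heat l (x - y))"
      by (subst integral_mult_right_zero[symmetric]) (simp add: mult_ac)
    also have "\<dots> = u y * - (LINT x|lborel. u x * heat_div l \<psi> x y)"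
      unfolding W_def by (simp only: weak_gradient_heat[OF u GL G t])
    also have "\<dots> = - (LINT x|lborel. u x * u y * heat_div l \<psi> x y)"
      unfolding mult_minus_right by (subst integral_mult_right_zero[symmetric]) (simp add: mult_ac)
    finally show "(LINT x|lborel. W x * u y * heat l (x - y)) = - (LINT x|lborel. u x * u y * heat_div l \<psi> x y)" .
  qed
  also have "\<dots> = - (LINT z|?P. u (fst z) * u (snd z) * heat_div l \<psi> (fst z) (snd z))"
    using lborel_pair.integral_snd[of "\<lambda>x y. u x * u y * heat_div l \<psi> x y"] dj(1) by (simp add: case_prod_beta')
  finally have "heat_form l W u = - (LINT z|?P. u (fst z) * u (snd z) * heat_div l \<psi> (fst z) (snd z))" .
  then show "heat_form l (\<lambda>x. grad \<psi> x \<bullet> G x) u = - (LINT x|lborel. (u x)\<^sup>2 * laplacian \<psi> x) / 2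
      + (LINT z|?P. (u (fst z) - u (snd z))\<^sup>2 * heat_comm l \<psi> (fst z) (snd z)) / 4"
    using 1 2 3 unfolding W_def by linarith
qed

section \<open>Subordination: from the heat semigroup to the fractional Laplacian\<close>

text \<open>The unnormalised density that represents the power a^s by the functions 1 - exp (- l a).
  It is cut to l > 0, so values of the heat kernel at other times never contribute.\<close>

definition subord :: "real \<Rightarrow> real \<Rightarrow> real" where
  "subord s l = indicator {0<..} l * l powr (- 1 - s)"

lemma subord_nonneg [simp]: "0 \<le> subord s l" by (simp add: subord_def)

lemma measurable_subord [measurable]: "subord s \<in> borel_measurable borel"
  unfolding subord_def by measurable

lemma subord_scale: "0 < c \<Longrightarrow> subord s (c * l) = c powr (- 1 - s) * subord s l"
  by (auto simp: subord_def indicator_def zero_less_mult_iff powr_mult)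

lemma integrable_powr_near_0:
  assumes "a > -1" shows "integrable lborel (\<lambda>x::real. indicator {0..1} x * x powr a)"
proof (rule integrableI_bounded)
  have "((\<lambda>x. if x \<in> {0..1} then x powr a else 0) has_integral (1 powr (a+1) / (a+1))) UNIV"
    unfolding has_integral_restrict_UNIV by (rule has_integral_powr_from_0[OF assms]) simp
  then have "((\<lambda>x. indicator {0..1} x * x powr a) has_integral (1 powr (a+1) / (a+1))) UNIV"
    by (rule has_integral_cong[THEN iffD1, rotated]) (auto simp: indicator_def)
  from nn_integral_has_integral_lborel[OF _ _ this]
  show "(\<integral>\<^sup>+ x. ennreal (norm (indicator {0..1} x * x powr a)) \<partial>lborel) < \<infinity>" by simp
qed measurable

lemma integrable_powr_at_top:
  assumes "a < -1" shows "integrable lborel (\<lambda>x::real. indicator {1..} x * x powr a)"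
proof (rule integrableI_bounded)
  have "((\<lambda>x. if x \<in> {1..} then x powr a else 0) has_integral (-(1 powr (a+1)) / (a+1))) UNIV"
    unfolding has_integral_restrict_UNIV by (rule has_integral_powr_to_inf[OF assms]) simp
  then have "((\<lambda>x. indicator {1..} x * x powr a) has_integral (-(1 powr (a+1)) / (a+1))) UNIV"
    by (rule has_integral_cong[THEN iffD1, rotated]) (auto simp: indicator_def)
  from nn_integral_has_integral_lborel[OF _ _ this]
  show "(\<integral>\<^sup>+ x. ennreal (norm (indicator {1..} x * x powr a)) \<partial>lborel) < \<infinity>" by simp
qed measurable

text \<open>Under $l \mapsto 2l$ the integral of $l^{-1-s}$ would be multiplied by $2^s \neq 1$.\<close>

lemma subord_not_integrable:
  assumes s: "0 < s" shows "\<not> integrable lborel (subord s)"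
proof
  assume i: "integrable lborel (subord s)"
  have "(LINT l|lborel. subord s l) = \<bar>2\<bar> *\<^sub>R (LINT l|lborel. subord s (0 + 2 * l))"
    by (rule lborel_integral_real_affine) simp
  also have "\<dots> = 2 * (2 powr (- 1 - s)) * (LINT l|lborel. subord s l)" by (simp add: subord_scale)
  also have "2 * (2 powr (- 1 - s)) = 2 powr (- s)" using powr_add[of 2 1 "- 1 - s"] by simp
  finally have "(1 - 2 powr (- s)) * (LINT l|lborel. subord s l) = 0" by (simp add: algebra_simps)
  moreover have "2 powr (- s) \<noteq> 1" using s by simp
  ultimately have "(LINT l|lborel. subord s l) = 0" by simp
  then have ae: "AE l in lborel. subord s l = 0" using integral_nonneg_eq_0_iff_AE[OF i] by simp
  have "AE l in lborel. l \<notin> {0<..<1::real}" using ae by eventually_elim (auto simp: subord_def)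
  then have "{0<..<1::real} \<in> null_sets lborel" by (subst AE_iff_null_sets) auto
  then have "emeasure lborel {0<..<1::real} = 0" by (rule null_setsD1)
  then show False by (subst (asm) emeasure_lborel_Ioo) auto
qed

text \<open>This is \<Gamma>(1 - s) / s, the reciprocal of the constant in front of the
  subordination formula for p.\<close>

definition subord_const :: "real \<Rightarrow> real" where
  "subord_const s = (LINT l|lborel. subord s l * (1 - exp (- l)))"

text \<open>Near 0 the factor 1 - exp (- l) \<le> l leaves l^(-s), integrable because s < 1; at
  infinity l^(-1-s) is integrable because s > 0.\<close>

lemma subord_integrable_1:
  assumes s: "0 < s" "s < 1"
  shows "integrable lborel (\<lambda>l. subord s l * (1 - exp (- l)))"
proof -
  have "integrable lborel (\<lambda>x::real. indicator {0..1} x * x powr (- s) + indicator {1..} x * x powr (- 1 - s))"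
    using integrable_powr_near_0[of "- s"] integrable_powr_at_top[of "- 1 - s"] s by simp
  then show ?thesis
  proof (rule Bochner_Integration.integrable_bound)
    show "AE l in lborel. norm (subord s l * (1 - exp (- l))) \<le> norm (indicator {0..1} l * l powr (- s) + indicator {1..} l * l powr (- 1 - s))"
    proof (rule AE_I2)
      fix l :: real
      consider "l \<le> 0" | "0 < l" "l < 1" | "1 \<le> l" by linarith
      then show "norm (subord s l * (1 - exp (- l))) \<le> norm (indicator {0..1} l * l powr (- s) + indicator {1..} l * l powr (- 1 - s))"
      proof cases
        case 1 then show ?thesis by (simp add: subord_def)
      next
        case 2
        have "1 - exp (- l) \<le> l" using exp_ge_add_one_self[of "- l"] by linarith
        then have "l powr (- 1 - s) * (1 - exp (- l)) \<le> l powr (- 1 - s) * l powr 1" using 2 by (intro mult_left_mono) auto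
        also have "\<dots> = l powr (- s)" using 2 by (subst powr_add[symmetric]) simp
        finally show ?thesis using 2 by (simp add: subord_def)
      next
        case 3
        have "l powr (- 1 - s) * (1 - exp (- l)) \<le> l powr (- 1 - s)" using 3 by (simp add: mult_left_le)
        then show ?thesis using 3 by (simp add: subord_def abs_mult add_increasing)
      qed
    qed
  qed measurable
qed

lemma subord_const_pos:
  assumes s: "0 < s" "s < 1" shows "0 < subord_const s"
proof -
  have nn: "0 \<le> subord s l * (1 - exp (- l))" for l by (cases "0 < l") (auto simp: subord_def)
  have "subord_const s \<noteq> 0"
  proof
    assume "subord_const s = 0"
    then have ae: "AE l in lborel. subord s l * (1 - exp (- l)) = 0"
      using integral_nonneg_eq_0_iff_AE[OF subord_integrable_1[OF s]] nn by (simp add: subord_const_def)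
    have "AE l in lborel. l \<notin> {0<..<1::real}" using ae by eventually_elim (auto simp: subord_def)
    then have "{0<..<1::real} \<in> null_sets lborel" by (subst AE_iff_null_sets) auto
    then have "emeasure lborel {0<..<1::real} = 0" by (rule null_setsD1)
    then show False by (subst (asm) emeasure_lborel_Ioo) auto
  qed
  moreover have "0 \<le> subord_const s" unfolding subord_const_def by (intro Bochner_Integration.integral_nonneg nn)
  ultimately show ?thesis by simp
qed

text \<open>The case a > 0 follows from a = 1 by scaling l, which produces a^s; for a = 0 both sides
  vanish.\<close>

lemma
  assumes s: "0 < s" "s < 1" and a: "0 \<le> a"
  shows subord_integrable: "integrable lborel (\<lambda>l. subord s l * (1 - exp (- l * a)))"
    and subord_integral: "(LINT l|lborel. subord s l * (1 - exp (- l * a))) = subord_const s * a powr s"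
proof -
  define f where "f l = subord s l * (1 - exp (- l))" for l
  have "integrable lborel (\<lambda>l. subord s l * (1 - exp (- l * a))) \<and> 
    (LINT l|lborel. subord s l * (1 - exp (- l * a))) = subord_const s * a powr s"
  proof (cases "a = 0")
    case True then show ?thesis by simp
  next
    case False
    then have a: "0 < a" using a by simp
    have fa: "f (0 + a * l) = a powr (- 1 - s) * (subord s l * (1 - exp (- l * a)))" for l
      by (simp add: f_def subord_scale[OF a] mult_ac)
    have i: "integrable lborel (\<lambda>l. a powr (- 1 - s) * (subord s l * (1 - exp (- l * a))))"
      unfolding fa[symmetric] using subord_integrable_1[OF s] a 
      by (subst lborel_integrable_real_affine_iff) (auto simp: f_def[abs_def])
    have "(LINT l|lborel. f l) = \<bar>a\<bar> *\<^sub>R (LINT l|lborel. f (0 + a * l))" 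
      by (rule lborel_integral_real_affine) (use a in simp)
    also have "\<dots> = a * a powr (- 1 - s) * (LINT l|lborel. subord s l * (1 - exp (- l * a)))"
      unfolding fa using a by simp
    also have "a * a powr (- 1 - s) = a powr (- s)" using a powr_add[of a 1 "- 1 - s"] by simp
    finally have e: "subord_const s = a powr (- s) * (LINT l|lborel. subord s l * (1 - exp (- l * a)))"
      by (simp add: subord_const_def f_def)
    have "subord_const s * a powr s = (a powr (- s) * a powr s) * (LINT l|lborel. subord s l * (1 - exp (- l * a)))"
      unfolding e by (simp only: mult_ac)
    also have "a powr (- s) * a powr s = 1" using a by (simp add: powr_add[symmetric])
    finally show ?thesis using i a by simp
  qed
  then show "integrable lborel (\<lambda>l. subord s l * (1 - exp (- l * a)))"
    and "(LINT l|lborel. subord s l * (1 - exp (- l * a))) = subord_const s * a powr s" by auto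
qed

section \<open>Integrals of negative powers times exp (- a / l)\<close>

text \<open>A single term of the exponential series is at most the whole sum.\<close>

lemma power_exp_bound:
  fixes a z :: real assumes "0 < a" "0 \<le> z"
  shows "z ^ n * exp (- a * z) \<le> fact n / a ^ n"
proof -
  have "(\<Sum>k\<in>{n}. (a * z) ^ k /\<^sub>R fact k) \<le> (\<Sum>k. (a * z) ^ k /\<^sub>R fact k)"
    using assms summable_exp_generic[of "a * z"] by (intro sum_le_suminf) auto
  then have "(a * z) ^ n / fact n \<le> exp (a * z)" by (simp add: exp_def divide_inverse mult.commute)
  then have "(a * z) ^ n * exp (- (a * z)) \<le> fact n"
    by (simp add: exp_minus field_simps)
  then show ?thesis using assms by (simp add: power_mult_distrib field_simps)
qed

lemma powr_exp_bound:
  fixes a r :: real assumes a: "0 < a"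
  shows "\<exists>M. \<forall>l. 0 < l \<and> l \<le> 1 \<longrightarrow> l powr (- r) * exp (- a / l) \<le> M"
proof -
  define n where "n = nat \<lceil>r\<rceil>"
  have "l powr (- r) * exp (- a / l) \<le> fact n / a ^ n" if l: "0 < l" "l \<le> 1" for l
  proof -
    have "l powr (- r) \<le> l powr (- real n)" using l real_nat_ceiling_ge[of r] by (intro powr_mono') (auto simp: n_def)
    also have "\<dots> = (1 / l) ^ n" using l by (simp add: powr_minus powr_realpow power_divide divide_inverse power_inverse)
    finally have "l powr (- r) * exp (- a / l) \<le> (1 / l) ^ n * exp (- a * (1 / l))" by (simp add: mult_right_mono)
    also have "\<dots> \<le> fact n / a ^ n" using l a by (intro power_exp_bound) auto
    finally show ?thesis .
  qed
  then show ?thesis by blast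
qed

lemma integrable_powr_exp:
  fixes a r :: real assumes a: "0 < a" and r: "1 < r"
  shows "integrable lborel (\<lambda>l::real. indicator {0<..} l * (l powr (- r) * exp (- a / l)))"
proof -
  obtain M where M: "\<And>l. 0 < l \<Longrightarrow> l \<le> 1 \<Longrightarrow> l powr (- r) * exp (- a / l) \<le> M" using powr_exp_bound[OF a] by blast
  have "exp (- a) \<le> M" using M[of 1] by simp
  then have M0: "0 \<le> M" using exp_ge_zero[of "- a"] by linarith
  have "integrable lborel (indicator {0..1::real} :: real \<Rightarrow> real)" by (intro integrable_real_indicator) auto
  then have "integrable lborel (\<lambda>x::real. M * indicator {0..1} x + indicator {1..} x * x powr (- r))"
    using integrable_powr_at_top[of "- r"] r by (intro Bochner_Integration.integrable_add integrable_mult_right) auto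
  then show ?thesis
  proof (rule Bochner_Integration.integrable_bound)
    show "AE l in lborel. norm (indicator {0<..} l * (l powr (- r) * exp (- a / l))) \<le> norm (M * indicator {0..1} l + indicator {1..} l * l powr (- r))"
    proof (rule AE_I2)
      fix l :: real
      consider "l \<le> 0" | "0 < l" "l < 1" | "1 \<le> l" by linarith
      then show "norm (indicator {0<..} l * (l powr (- r) * exp (- a / l))) \<le> norm (M * indicator {0..1} l + indicator {1..} l * l powr (- r))"
      proof cases
        case 1 then show ?thesis by simp
      next
        case 2 then show ?thesis using M[of l] by simp
      next
        case 3
        have "l powr (- r) * exp (- a / l) \<le> l powr (- r) * 1" using 3 a by (intro mult_left_mono) auto
        also have "\<dots> \<le> M * indicator {0..1} l + l powr (- r)" using M0 by (simp add: indicator_def)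
        finally show ?thesis using 3 M0 by (simp add: abs_mult)
      qed
    qed
  qed measurable
qed

lemma powr_minus_plus_1: "0 < x \<Longrightarrow> x powr (- (q + 1)) = x powr (- q) / x" for x q :: real
proof -
  assume x: "0 < x"
  have "x powr (- (q + 1)) = x powr (- q) / x powr 1" unfolding powr_diff[symmetric] by simp
  then show ?thesis using x by simp
qed

text \<open>The integrand of the difference is the derivative of l^(-q) exp (- a / l), which
  vanishes at both ends. It is the functional equation of the Gamma function in the variable a / l,
  and it is where the constant d + 2s is produced.\<close>

lemma integral_powr_exp_rec:
  fixes a q :: real assumes a: "0 < a" and q: "0 < q"
  shows "a * (LINT l|lborel. indicator {0<..} l * (l powr (- (q + 2)) * exp (- a / l)))
       = q * (LINT l|lborel. indicator {0<..} l * (l powr (- (q + 1)) * exp (- a / l)))"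
proof -
  define F where "F l = l powr (- q) * exp (- a / l)" for l :: real
  define f where "f l = a * (l powr (- (q + 2)) * exp (- a / l)) - q * (l powr (- (q + 1)) * exp (- a / l))" for l :: real
  note i = integrable_powr_exp[OF a, of "q + 2"] integrable_powr_exp[OF a, of "q + 1"]
  have e: "(\<lambda>l. indicator {0<..} l *\<^sub>R f l) = (\<lambda>l. a * (indicator {0<..} l * (l powr (- (q + 2)) * exp (- a / l))) - q * (indicator {0<..} l * (l powr (- (q + 1)) * exp (- a / l))))"
    by (auto simp: f_def fun_eq_iff algebra_simps)
  have si: "set_integrable lborel {0<..} f" unfolding set_integrable_def e using i q by simp
  have "(LBINT x=0..\<infinity>. f x) = 0 - 0"
  proof (rule interval_integral_FTC_integrable[where F=F])
    show "(0::ereal) < \<infinity>" by simp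
    fix x :: real assume "0 < ereal x" "ereal x < \<infinity>"
    then have x: "0 < x" by simp
    have p: "x powr (- (q + 1)) = x powr (- q) / x" "x powr (- (q + 2)) = x powr (- q) / x\<^sup>2"
      using powr_minus_plus_1[OF x, of q] powr_minus_plus_1[OF x, of "q + 1"]
      by (simp_all add: power2_eq_square add.assoc)
    have "(F has_real_derivative f x) (at x)"
      unfolding F_def f_def p using x
      by (auto intro!: derivative_eq_intros simp: p powr_diff field_simps power2_eq_square)
    then show "(F has_vector_derivative f x) (at x)" by (simp add: has_real_derivative_iff_has_vector_derivative)
    show "isCont f x" unfolding f_def using x by (intro continuous_intros) auto
  next
    show "set_integrable lborel (einterval 0 \<infinity>) f"
      using si by (simp add: zero_ereal_def einterval_eq)
    have F0: "(F \<longlongrightarrow> 0) (at_right 0)"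
    proof -
      \<comment> \<open>Boundedness with the exponent q + 1 leaves a spare factor l, so F tends to 0
        at 0.\<close>
      obtain M where M: "\<And>l. 0 < l \<Longrightarrow> l \<le> 1 \<Longrightarrow> l powr (- (q + 1)) * exp (- a / l) \<le> M" using powr_exp_bound[OF a] by blast
      have Fb: "F l \<le> M * l" if l: "0 < l" "l \<le> 1" for l
      proof -
        have "F l = (l powr (- (q + 1)) * l powr 1) * exp (- a / l)" unfolding F_def powr_add[symmetric] by simp
        also have "\<dots> = (l powr (- (q + 1)) * exp (- a / l)) * l" using l by simp
        also have "\<dots> \<le> M * l" using M[OF l] l by (intro mult_right_mono) auto
        finally show ?thesis .
      qed
      show ?thesis
      proof (rule tendsto_sandwich[of "\<lambda>_. 0" _ _ "\<lambda>l. M * l"])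
        show "\<forall>\<^sub>F l in at_right 0. 0 \<le> F l" by (simp add: F_def)
        show "\<forall>\<^sub>F l in at_right 0. F l \<le> M * l"
          using eventually_at_right_less[of 0] eventually_at_right[of 0 1] 
          by (auto simp: eventually_at_right_field intro!: Fb exI[of _ 1])
        have "((\<lambda>l. M * l) \<longlongrightarrow> M * 0) (at_right 0)" by (intro tendsto_intros)
        then show "((\<lambda>l. M * l) \<longlongrightarrow> 0) (at_right 0)" by simp
      qed simp
    qed
    then show "((F \<circ> real_of_ereal) \<longlongrightarrow> 0) (at_right 0)" by (simp add: zero_ereal_def ereal_tendsto_simps)
    have "(F \<longlongrightarrow> 0) at_top"
    proof (rule tendsto_sandwich[of "\<lambda>_. 0" _ _ "\<lambda>l. l powr (- q)"])
      show "\<forall>\<^sub>F l in at_top. F l \<le> l powr (- q)"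
        using eventually_gt_at_top[of 0] by eventually_elim (use a in \<open>auto simp: F_def mult_left_le\<close>)
      show "((\<lambda>l. l powr (- q)) \<longlongrightarrow> 0) at_top" using q by (intro tendsto_neg_powr filterlim_ident) auto
    qed (simp_all add: F_def)
    then show "((F \<circ> real_of_ereal) \<longlongrightarrow> 0) (at_left \<infinity>)" by (simp add: ereal_tendsto_simps)
  qed
  then have "(LINT x|lborel. indicator {0<..} x *\<^sub>R f x) = 0"
    unfolding interval_lebesgue_integral_0_infty set_lebesgue_integral_def by simp
  then show ?thesis unfolding e using i q by simp
qed

text \<open>For h \<noteq> 0 and s > 0 this is a multiple of |h|^(-d-2s), kept as an integral in l.
  At h = 0 the integral diverges and the value is 0 by convention; every double integral multiplies
  it there by a vanishing squared difference.\<close>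

definition frac_kernel :: "real \<Rightarrow> 'a::euclidean_space \<Rightarrow> real" where
  "frac_kernel s h = (LINT l|lborel. subord s l * heat l h)"

lemma measurable_heat2 [measurable]: "(\<lambda>(l, h). heat l h) \<in> borel_measurable (borel \<Otimes>\<^sub>M borel)"
  unfolding heat_def by measurable

lemma measurable_frac_kernel [measurable]: "frac_kernel s \<in> borel_measurable borel"
  unfolding frac_kernel_def by measurable

lemma frac_kernel_nonneg [simp]: "0 \<le> frac_kernel s h"
  unfolding frac_kernel_def by simp

text \<open>With a = |h|^2 / 4 and q = s + d / 2 both integrands are powers of l times exp (- a /
  l), with exponents differing by one. The recursion in q then gives the factor 2 q = d + 2
  s.\<close>

lemma
  fixes h :: "'a::euclidean_space"
  assumes s: "0 < s" and h: "h \<noteq> 0"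
  shows subord_heat_integrable: "integrable lborel (\<lambda>l. subord s l * heat l h)"
    and subord_heat_weight_integrable: "integrable lborel (\<lambda>l. subord s l * (heat l h * ((norm h)\<^sup>2 / (2 * l))))"
    and subord_heat_weight_integral: "(LINT l|lborel. subord s l * (heat l h * ((norm h)\<^sup>2 / (2 * l)))) = (real DIM('a) + 2 * s) * frac_kernel s h"
proof -
  define C where "C = (4 * pi) powr (- real DIM('a) / 2)"
  define a where "a = (norm h)\<^sup>2 / 4"
  define q where "q = s + real DIM('a) / 2"
  have a: "0 < a" using h by (simp add: a_def)
  have q: "0 < q" using s by (simp add: q_def add_pos_nonneg)
  have e1: "subord s l * heat l h = C * (indicator {0<..} l * (l powr (- (q + 1)) * exp (- a / l)))" for l
  proof (cases "0 < l")
    case True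
    have "(4 * pi * l) powr (- real DIM('a) / 2) = C * l powr (- real DIM('a) / 2)"
      unfolding C_def using True by (intro powr_mult) 
    moreover have "l powr (- 1 - s) * l powr (- real DIM('a) / 2) = l powr (- (q + 1))"
      by (simp add: powr_add[symmetric] q_def algebra_simps)
    moreover have "- (norm h)\<^sup>2 / (4 * l) = - a / l" by (simp add: a_def)
    ultimately show ?thesis using True by (simp add: subord_def heat_def mult_ac)
  qed (simp add: subord_def)
  have e2: "subord s l * (heat l h * ((norm h)\<^sup>2 / (2 * l))) = (2 * a * C) * (indicator {0<..} l * (l powr (- (q + 2)) * exp (- a / l)))" for l
  proof (cases "0 < l")
    case True
    define P where "P = l powr (- (q + 1))"
    have P: "l powr (- (q + 2)) = P / l" using powr_minus_plus_1[OF True, of "q + 1"] by (simp add: P_def add.assoc)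
    have "subord s l * (heat l h * ((norm h)\<^sup>2 / (2 * l))) = (subord s l * heat l h) * (2 * a) / l" by (simp add: a_def)
    then show ?thesis unfolding e1 P P_def[symmetric] using True by (simp add: mult_ac)
  qed (simp add: subord_def)
  show "integrable lborel (\<lambda>l. subord s l * heat l h)"
    unfolding e1 using integrable_powr_exp[OF a, of "q + 1"] q by (intro integrable_mult_right) simp
  show "integrable lborel (\<lambda>l. subord s l * (heat l h * ((norm h)\<^sup>2 / (2 * l))))"
    unfolding e2 using integrable_powr_exp[OF a, of "q + 2"] q by (intro integrable_mult_right) simp
  show "(LINT l|lborel. subord s l * (heat l h * ((norm h)\<^sup>2 / (2 * l)))) = (real DIM('a) + 2 * s) * frac_kernel s h"
  proof -
    have *: "2 * a * C * I2 = (real DIM('a) + 2 * s) * (C * I1)" if "a * I2 = q * I1" for I1 I2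
    proof -
      have "2 * a * C * I2 = 2 * C * (a * I2)" by simp
      also have "\<dots> = (real DIM('a) + 2 * s) * (C * I1)" unfolding that by (simp add: q_def algebra_simps)
      finally show ?thesis .
    qed
    show ?thesis
      unfolding frac_kernel_def e1 e2 integral_mult_right_zero by (rule *[OF integral_powr_exp_rec[OF a q]])
  qed
qed

text \<open>Integration in l comes first: for fixed \<xi> it gives |\<xi>|^(2s) times the constant,
  and the kernel in l is nonnegative, so absolute integrability of the weighted R justifies Fubini
  for R of either sign.\<close>

lemma subord_fourier:
  fixes R :: "'a::euclidean_space \<Rightarrow> real"
  assumes s: "0 < s" "s < 1" and [measurable]: "R \<in> borel_measurable borel"
    and R: "integrable lborel (\<lambda>\<xi>. norm \<xi> powr (2 * s) * R \<xi>)"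
  shows "integrable lborel (\<lambda>l. subord s l * (LINT \<xi>|lborel. (1 - exp (- l * (norm \<xi>)\<^sup>2)) * R \<xi>))"
    and "(LINT l|lborel. subord s l * (LINT \<xi>|lborel. (1 - exp (- l * (norm \<xi>)\<^sup>2)) * R \<xi>)) 
      = subord_const s * (LINT \<xi>|lborel. norm \<xi> powr (2 * s) * R \<xi>)"
proof -
  define \<Psi> where "\<Psi> = (\<lambda>l \<xi>. subord s l * ((1 - exp (- l * (norm \<xi>)\<^sup>2)) * R \<xi>))"
  have pw: "((norm \<xi>)\<^sup>2) powr s = norm \<xi> powr (2 * s)" for \<xi> :: 'a
    by (cases "\<xi> = 0") (auto simp: powr_powr powr_numeral[symmetric] simp del: powr_numeral)
  have inner: "integrable lborel (\<lambda>l. subord s l * (1 - exp (- l * (norm \<xi>)\<^sup>2)))"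
    "(LINT l|lborel. subord s l * (1 - exp (- l * (norm \<xi>)\<^sup>2))) = subord_const s * norm \<xi> powr (2 * s)" for \<xi> :: 'a
    using subord_integrable[OF s, of "(norm \<xi>)\<^sup>2"] subord_integral[OF s, of "(norm \<xi>)\<^sup>2"] by (simp_all add: pw)
  have nn: "0 \<le> subord s l * (1 - exp (- l * (norm \<xi>)\<^sup>2))" for l and \<xi> :: 'a
    by (cases "0 < l") (auto simp: subord_def)
  have i: "integrable (lborel \<Otimes>\<^sub>M lborel) (\<lambda>(\<xi>, l). \<Psi> l \<xi>)"
  proof (rule integrable_pairI)
    show "(\<lambda>(\<xi>, l). \<Psi> l \<xi>) \<in> borel_measurable (lborel \<Otimes>\<^sub>M lborel)" unfolding \<Psi>_def by measurable
    have "(\<integral>\<^sup>+ l. ennreal (norm (\<Psi> l \<xi>)) \<partial>lborel) = ennreal (norm (subord_const s * (norm \<xi> powr (2 * s) * R \<xi>)))" for \<xi>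
    proof -
      have "norm (\<Psi> l \<xi>) = (subord s l * (1 - exp (- l * (norm \<xi>)\<^sup>2))) * \<bar>R \<xi>\<bar>" for l
        unfolding \<Psi>_def mult.assoc[symmetric] real_norm_def abs_mult[of "_ * _" "R \<xi>"] by (simp only: abs_of_nonneg[OF nn])
      moreover have "(\<integral>\<^sup>+ l. ennreal ((subord s l * (1 - exp (- l * (norm \<xi>)\<^sup>2))) * \<bar>R \<xi>\<bar>) \<partial>lborel)
        = ennreal (LINT l|lborel. (subord s l * (1 - exp (- l * (norm \<xi>)\<^sup>2))) * \<bar>R \<xi>\<bar>)"
        by (rule nn_integral_eq_integral) (use inner nn in auto)
      ultimately show ?thesis
        using subord_const_pos[OF s] by (simp add: inner(2)[simplified] abs_mult)
    qed
    then have "(\<integral>\<^sup>+ \<xi>. \<integral>\<^sup>+ l. ennreal (norm (\<Psi> l \<xi>)) \<partial>lborel \<partial>lborel) = (\<integral>\<^sup>+ \<xi>. ennreal (norm (subord_const s * (norm \<xi> powr (2 * s) * R \<xi>))) \<partial>lborel)"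
      by simp
    also have "\<dots> < \<infinity>" using integrable_mult_right[OF R, of "subord_const s"] unfolding integrable_iff_bounded by blast
    finally show "(\<integral>\<^sup>+ \<xi>. \<integral>\<^sup>+ l. ennreal (norm (\<Psi> l \<xi>)) \<partial>lborel \<partial>lborel) < \<infinity>" .
  qed
  have e: "(LINT \<xi>|lborel. \<Psi> l \<xi>) = subord s l * (LINT \<xi>|lborel. (1 - exp (- l * (norm \<xi>)\<^sup>2)) * R \<xi>)" for l
    unfolding \<Psi>_def by (rule integral_mult_right_zero)
  have e': "(LINT l|lborel. \<Psi> l \<xi>) = subord_const s * (norm \<xi> powr (2 * s) * R \<xi>)" for \<xi>
    unfolding \<Psi>_def mult.assoc[symmetric] integral_mult_left_zero inner(2) ..
  show "integrable lborel (\<lambda>l. subord s l * (LINT \<xi>|lborel. (1 - exp (- l * (norm \<xi>)\<^sup>2)) * R \<xi>))"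
    using lborel_pair.integrable_snd[OF i] unfolding e .
  show "(LINT l|lborel. subord s l * (LINT \<xi>|lborel. (1 - exp (- l * (norm \<xi>)\<^sup>2)) * R \<xi>)) 
      = subord_const s * (LINT \<xi>|lborel. norm \<xi> powr (2 * s) * R \<xi>)"
    using lborel_pair.Fubini_integral[OF i] unfolding e e' by simp
qed

section \<open>The Pohozaev identity for truncated dilations\<close>

lemma measurable_fst_borel [measurable]: "fst \<in> borel_measurable (borel :: ('a::euclidean_space \<times> 'b::euclidean_space) measure)"
  and measurable_snd_borel [measurable]: "snd \<in> borel_measurable (borel :: ('a::euclidean_space \<times> 'b::euclidean_space) measure)"
  by (auto intro!: borel_measurable_continuous_onI continuous_intros)

lemma parseval_heat_diff:
  fixes f g :: "'a::euclidean_space \<Rightarrow> real"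
  assumes l: "0 < l" and f: "L2 f" and g: "L2 g"
  shows "(LINT \<xi>|lborel. (1 - exp (- l * (norm \<xi>)\<^sup>2)) * Re (fourier f \<xi> * cnj (fourier g \<xi>))) = (LINT x|lborel. f x * g x) - heat_form l f g"
proof -
  define R where "R = (\<lambda>\<xi>. Re (fourier f \<xi> * cnj (fourier g \<xi>)))"
  have R: "integrable lborel R" unfolding R_def by (rule integrable_Re[OF fourier_inner_integrable[OF f g]])
  have [measurable]: "R \<in> borel_measurable borel" using R by simp
  have "integrable lborel (\<lambda>\<xi>. exp (- l * (norm \<xi>)\<^sup>2) * R \<xi>)"
    by (rule Bochner_Integration.integrable_bound[OF R], measurable)
      (use l in \<open>auto simp: abs_mult intro!: AE_I2 mult_left_le_one_le\<close>)
  then have "(LINT \<xi>|lborel. (1 - exp (- l * (norm \<xi>)\<^sup>2)) * R \<xi>) = (LINT \<xi>|lborel. R \<xi>) - (LINT \<xi>|lborel. exp (- l * (norm \<xi>)\<^sup>2) * R \<xi>)"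
    using R by (simp add: left_diff_distrib)
  then show ?thesis unfolding R_def parseval[OF f g] parseval_heat[OF l f g] .
qed

text \<open>Since the heat kernel has mass 1, each of the two squares contributes ||u||^2. The
  result expresses the quadratic form of 1 - exp (l \<Delta>) by squared differences.\<close>

lemma heat_form_difference_quotient:
  fixes u :: "'a::euclidean_space \<Rightarrow> real"
  assumes l: "0 < l" and u: "L2 u"
  shows "integrable lborel (\<lambda>z. (u (fst z) - u (snd z))\<^sup>2 * heat l (fst z - snd z))"
    and "(LINT z|lborel. (u (fst z) - u (snd z))\<^sup>2 * heat l (fst z - snd z)) = 2 * (LINT x|lborel. u x * u x) - 2 * heat_form l u u"
proof -
  note k = kernel_sq_integrable[OF u integrable_heat[OF l], unfolded case_prod_beta' lborel_prod integral_heat[OF l]]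
  note h = heat_form_integrable[OF l u u, unfolded lborel_prod]
  have sq: "(u (fst z) - u (snd z))\<^sup>2 * heat l (fst z - snd z) = 
     (u (fst z))\<^sup>2 * heat l (fst z - snd z) + (u (snd z))\<^sup>2 * heat l (fst z - snd z) - 2 * (u (fst z) * u (snd z) * heat l (fst z - snd z))" for z
    by (simp add: power2_diff algebra_simps)
  show "integrable lborel (\<lambda>z. (u (fst z) - u (snd z))\<^sup>2 * heat l (fst z - snd z))"
    unfolding sq using k h by simp
  show "(LINT z|lborel. (u (fst z) - u (snd z))\<^sup>2 * heat l (fst z - snd z)) = 2 * (LINT x|lborel. u x * u x) - 2 * heat_form l u u"
    unfolding sq heat_form_def lborel_prod using k h by (simp add: L2sq_def power2_eq_square)
qed

text \<open>The Gagliardo form of the energy. Absolute integrability is checked in the order z, then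
  l: at fixed l the integral over pairs has a Fourier expression, and its integral in l is known.
  The reverse order produces the singular kernel.\<close>

lemma gagliardo_integrable_prod:
  fixes u :: "'a::euclidean_space \<Rightarrow> real"
  assumes s: "0 < s" "s < 1" and u: "L2 u"
    and R: "integrable lborel (\<lambda>\<xi>. norm \<xi> powr (2 * s) * (cmod (fourier u \<xi>))\<^sup>2)"
  shows "integrable (lborel \<Otimes>\<^sub>M lborel) (\<lambda>(z, l). subord s l * ((u (fst z) - u (snd z))\<^sup>2 * heat l (fst z - snd z)))"
    and "integrable lborel (\<lambda>z. (u (fst z) - u (snd z))\<^sup>2 * frac_kernel s (fst z - snd z))"
    and "(LINT z|lborel. (u (fst z) - u (snd z))\<^sup>2 * frac_kernel s (fst z - snd z)) 
      = 2 * subord_const s * (LINT \<xi>|lborel. norm \<xi> powr (2 * s) * (cmod (fourier u \<xi>))\<^sup>2)"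
proof -
  have [measurable]: "u \<in> borel_measurable borel" "fourier u \<in> borel_measurable borel"
    using u L2_fourier[OF u] by (auto simp: L2_def)
  define \<Phi> where "\<Phi> = (\<lambda>(z::'a \<times> 'a) l. subord s l * ((u (fst z) - u (snd z))\<^sup>2 * heat l (fst z - snd z)))"
  define e where "e l = subord s l * (LINT \<xi>|lborel. (1 - exp (- l * (norm \<xi>)\<^sup>2)) * (cmod (fourier u \<xi>))\<^sup>2)" for l
  have ie: "integrable lborel e" "(LINT l|lborel. e l) = subord_const s * (LINT \<xi>|lborel. norm \<xi> powr (2 * s) * (cmod (fourier u \<xi>))\<^sup>2)"
    unfolding e_def by (rule subord_fourier[OF s _ R], measurable)+
  have nn: "0 \<le> \<Phi> z l" for z l unfolding \<Phi>_def by simp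
  have \<Phi>l: "integrable lborel (\<lambda>z. \<Phi> z l) \<and> (LINT z|lborel. \<Phi> z l) = 2 * e l" for l
  proof (cases "0 < l")
    case True
    have "Re (fourier u \<xi> * cnj (fourier u \<xi>)) = (cmod (fourier u \<xi>))\<^sup>2" for \<xi>
      by (simp add: complex_norm_square[symmetric])
    then have "(LINT z|lborel. (u (fst z) - u (snd z))\<^sup>2 * heat l (fst z - snd z)) = 2 * (LINT \<xi>|lborel. (1 - exp (- l * (norm \<xi>)\<^sup>2)) * (cmod (fourier u \<xi>))\<^sup>2)"
      unfolding heat_form_difference_quotient(2)[OF True u] using parseval_heat_diff[OF True u u] by simp
    then show ?thesis
      unfolding \<Phi>_def e_def using heat_form_difference_quotient(1)[OF True u] by (simp add: integral_mult_right_zero)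
  qed (simp add: \<Phi>_def e_def subord_def)
  have m: "(\<lambda>(z, l). \<Phi> z l) \<in> borel_measurable (lborel \<Otimes>\<^sub>M lborel)" unfolding \<Phi>_def by measurable
  have i: "integrable (lborel \<Otimes>\<^sub>M lborel) (\<lambda>(z, l). \<Phi> z l)"
  proof (rule integrable_pairI[OF m])
    have m': "(\<lambda>(z, l). ennreal (norm (\<Phi> z l))) \<in> borel_measurable (lborel \<Otimes>\<^sub>M lborel)" unfolding \<Phi>_def by measurable
    have "(\<integral>\<^sup>+ z. \<integral>\<^sup>+ l. ennreal (norm (\<Phi> z l)) \<partial>lborel \<partial>lborel) = (\<integral>\<^sup>+ l. \<integral>\<^sup>+ z. ennreal (norm (\<Phi> z l)) \<partial>lborel \<partial>lborel)"
      by (rule nn_integral_pair_swap[OF m'])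
    also have "\<dots> = (\<integral>\<^sup>+ l. ennreal (2 * e l) \<partial>lborel)"
    proof (rule nn_integral_cong)
      fix l
      show "(\<integral>\<^sup>+ z. ennreal (norm (\<Phi> z l)) \<partial>lborel) = ennreal (2 * e l)"
        using nn_integral_eq_integral[of lborel "\<lambda>z. \<Phi> z l"] \<Phi>l[of l] nn by simp
    qed
    also have "\<dots> \<le> (\<integral>\<^sup>+ l. ennreal (norm (2 * e l)) \<partial>lborel)" by (intro nn_integral_mono ennreal_leI) simp
    also have "\<dots> < \<infinity>" using integrable_mult_right[OF ie(1), of 2] unfolding integrable_iff_bounded by blast
    finally show "(\<integral>\<^sup>+ z. \<integral>\<^sup>+ l. ennreal (norm (\<Phi> z l)) \<partial>lborel \<partial>lborel) < \<infinity>" .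
  qed
  then show "integrable (lborel \<Otimes>\<^sub>M lborel) (\<lambda>(z, l). subord s l * ((u (fst z) - u (snd z))\<^sup>2 * heat l (fst z - snd z)))"
    unfolding \<Phi>_def .
  have e': "(LINT l|lborel. \<Phi> z l) = (u (fst z) - u (snd z))\<^sup>2 * frac_kernel s (fst z - snd z)" for z
    unfolding \<Phi>_def frac_kernel_def by (subst integral_mult_right_zero[symmetric]) (simp add: mult_ac)
  show "integrable lborel (\<lambda>z. (u (fst z) - u (snd z))\<^sup>2 * frac_kernel s (fst z - snd z))"
    using lborel_pair.integrable_fst'[OF i] by (simp add: e')
  show "(LINT z|lborel. (u (fst z) - u (snd z))\<^sup>2 * frac_kernel s (fst z - snd z)) 
      = 2 * subord_const s * (LINT \<xi>|lborel. norm \<xi> powr (2 * s) * (cmod (fourier u \<xi>))\<^sup>2)"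
    using lborel_pair.Fubini_integral[OF i] \<Phi>l ie by (simp add: e')
qed

text \<open>The kernel below contains $0/0 = 0$ on the diagonal, where it is multiplied by
  $(u(x)-u(y))^2 = 0$.\<close>

definition dilation_mult :: "real \<Rightarrow> ('a::euclidean_space \<Rightarrow> real) \<Rightarrow> 'a \<Rightarrow> 'a \<Rightarrow> real" where
  "dilation_mult s \<psi> x y = laplacian \<psi> x + laplacian \<psi> y 
    - (real DIM('a) + 2 * s) * (((x - y) \<bullet> (grad \<psi> x - grad \<psi> y)) / (norm (x - y))\<^sup>2)"

lemma grad_lipschitz:
  fixes \<psi> :: "'a::euclidean_space \<Rightarrow> real"
  assumes t: "test_function UNIV \<psi>"
  shows "\<exists>L>0. \<forall>x y. norm (grad \<psi> x - grad \<psi> y) \<le> L * norm (x - y)"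
proof -
  have "\<exists>L>0. \<forall>x y. \<bar>frechet_derivative \<psi> (at x) b - frechet_derivative \<psi> (at y) b\<bar> \<le> L * norm (x - y)" for b
    by (rule test_function_lipschitz[OF test_function_frechet[OF t]])
  then obtain L where L: "\<And>b. 0 < L b" "\<And>b x y. \<bar>frechet_derivative \<psi> (at x) b - frechet_derivative \<psi> (at y) b\<bar> \<le> L b * norm (x - y)" by metis
  have "norm (grad \<psi> x - grad \<psi> y) \<le> (\<Sum>b\<in>(Basis::'a set). L b) * norm (x - y)" for x y
  proof -
    have "norm (grad \<psi> x - grad \<psi> y) \<le> (\<Sum>b\<in>Basis. \<bar>(grad \<psi> x - grad \<psi> y) \<bullet> b\<bar>)" by (rule norm_le_l1)
    also have "\<dots> \<le> (\<Sum>b\<in>(Basis::'a set). L b * norm (x - y))" using L(2) by (intro sum_mono) (simp add: grad_inner_Basis inner_diff_left)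
    finally show ?thesis by (simp add: sum_distrib_right)
  qed
  moreover have "0 < (\<Sum>b\<in>(Basis::'a set). L b)" by (intro sum_pos L) auto
  ultimately show ?thesis by blast
qed

text \<open>With W = \<nabla>\<psi> . \<nabla>u, the difference of the pairings of W with u and with
  exp (l \<Delta>) u integrates in l to a multiple of the pairing of W with p. The commutator
  identity rewrites it as a term constant in l minus one quarter of the double integral; the former
  drops out, and the factor - 1/4 survives.\<close>

lemma pohozaev:
  fixes u p :: "'a::euclidean_space \<Rightarrow> real"
  assumes s: "0 < s" "s < 1" and u: "L2 u" 
    and p: "L2 p" "AE \<xi> in lborel. fourier p \<xi> = complex_of_real (norm \<xi> powr (2 * s)) * fourier u \<xi>"
    and GL: "\<And>b. b \<in> Basis \<Longrightarrow> L2 (\<lambda>x. G x \<bullet> b)"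
    and G: "has_weak_gradient UNIV u G" and t: "test_function UNIV \<psi>"
  shows "subord_const s * (LINT x|lborel. (grad \<psi> x \<bullet> G x) * p x) 
    = - (LINT z|lborel. (u (fst z) - u (snd z))\<^sup>2 * frac_kernel s (fst z - snd z) * dilation_mult s \<psi> (fst z) (snd z)) / 4"
proof -
  define W where "W = (\<lambda>x. grad \<psi> x \<bullet> G x)"
  have W: "L2 W" unfolding W_def by (rule L2_grad_inner[OF GL t])
  have [measurable]: "u \<in> borel_measurable borel" "fourier u \<in> borel_measurable borel" "fourier W \<in> borel_measurable borel"
    "fourier p \<in> borel_measurable borel"
    using u L2_fourier[OF u] L2_fourier[OF W] L2_fourier[OF p(1)] by (auto simp: L2_def)
  have [measurable]: "laplacian \<psi> \<in> borel_measurable borel" "grad \<psi> \<in> borel_measurable borel"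
    using measurable_laplacian measurable_grad test_function_smooth[OF t] by blast+
  have ip: "integrable lborel (\<lambda>\<xi>. norm \<xi> powr (2 * s) * Re (fourier f \<xi> * cnj (fourier u \<xi>)))"
    "(LINT \<xi>|lborel. norm \<xi> powr (2 * s) * Re (fourier f \<xi> * cnj (fourier u \<xi>))) = (LINT x|lborel. f x * p x)"
    if f: "L2 f" for f
  proof -
    have [measurable]: "fourier f \<in> borel_measurable borel" using L2_fourier[OF f] by (auto simp: L2_def)
    have ae: "AE \<xi> in lborel. Re (fourier f \<xi> * cnj (fourier p \<xi>)) = norm \<xi> powr (2 * s) * Re (fourier f \<xi> * cnj (fourier u \<xi>))"
      using p(2) by eventually_elim (simp add: algebra_simps)
    have i: "integrable lborel (\<lambda>\<xi>. Re (fourier f \<xi> * cnj (fourier p \<xi>)))"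
      by (rule integrable_Re[OF fourier_inner_integrable[OF f p(1)]])
    show "integrable lborel (\<lambda>\<xi>. norm \<xi> powr (2 * s) * Re (fourier f \<xi> * cnj (fourier u \<xi>)))"
      by (rule integrable_cong_AE_imp[OF i _ ae]) measurable
    have "(LINT \<xi>|lborel. norm \<xi> powr (2 * s) * Re (fourier f \<xi> * cnj (fourier u \<xi>))) = (LINT \<xi>|lborel. Re (fourier f \<xi> * cnj (fourier p \<xi>)))"
      using ae by (intro integral_cong_AE) (auto elim!: eventually_mono)
    then show "(LINT \<xi>|lborel. norm \<xi> powr (2 * s) * Re (fourier f \<xi> * cnj (fourier u \<xi>))) = (LINT x|lborel. f x * p x)"
      unfolding parseval[OF f p(1)] .
  qed
  have "Re (fourier u \<xi> * cnj (fourier u \<xi>)) = (cmod (fourier u \<xi>))\<^sup>2" for \<xi> by (simp add: complex_norm_square[symmetric])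
  then have Ru: "integrable lborel (\<lambda>\<xi>. norm \<xi> powr (2 * s) * (cmod (fourier u \<xi>))\<^sup>2)" using ip(1)[OF u] by simp
  note gag = gagliardo_integrable_prod[OF s u Ru]
  obtain B where B: "\<And>x. \<bar>laplacian \<psi> x\<bar> \<le> B" using test_function_bounds[OF test_function_laplacian[OF t]] by blast
  obtain L where L: "0 < L" "\<And>x y. norm (grad \<psi> x - grad \<psi> y) \<le> L * norm (x - y)" using grad_lipschitz[OF t] by blast
  define \<Phi> where "\<Phi> = (\<lambda>(z::'a \<times> 'a) l. subord s l * ((u (fst z) - u (snd z))\<^sup>2 * heat l (fst z - snd z)))"
  have i1: "integrable (lborel \<Otimes>\<^sub>M lborel) (\<lambda>(z, l). \<Phi> z l)" using gag(1) unfolding \<Phi>_def .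
  define w where "w = (\<lambda>z::'a \<times> 'a. (u (fst z) - u (snd z))\<^sup>2)"
  have w: "w z = 0" if "fst z - snd z = 0" for z using that by (simp add: w_def)
  have w0: "0 \<le> w z" for z by (simp add: w_def)
  have [measurable]: "w \<in> borel_measurable borel" unfolding w_def by measurable
  \<comment> \<open>The Lipschitz bound of \<nabla>\<psi> leads to the weight |x-y|^2 / (2l). Its
    integral in l is again the singular kernel times d + 2s, so \<Phi> and \<Phi>2 together form an
    integrable majorant of \<Theta>.\<close>
  define \<Phi>2 where "\<Phi>2 = (\<lambda>(z::'a \<times> 'a) l. subord s l * (w z * (heat l (fst z - snd z) * ((norm (fst z - snd z))\<^sup>2 / (2 * l)))))"
  have \<Phi>2: "integrable lborel (\<lambda>l. \<Phi>2 z l) \<and> (LINT l|lborel. \<Phi>2 z l) = (real DIM('a) + 2 * s) * (w z * frac_kernel s (fst z - snd z))" for z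
  proof (cases "fst z - snd z = 0")
    case True then show ?thesis by (simp add: \<Phi>2_def w)
  next
    case False
    have e: "\<Phi>2 z = (\<lambda>l. w z * (subord s l * (heat l (fst z - snd z) * ((norm (fst z - snd z))\<^sup>2 / (2 * l)))))"
      by (simp add: \<Phi>2_def fun_eq_iff)
    show ?thesis unfolding e integral_mult_right_zero subord_heat_weight_integral[OF s(1) False]
      using subord_heat_weight_integrable[OF s(1) False] by (intro conjI integrable_mult_right) (auto simp: mult_ac)
  qed
  have \<Phi>2nn: "0 \<le> \<Phi>2 z l" for z l by (cases "0 < l") (auto simp: \<Phi>2_def w_def subord_def)
  have i2: "integrable (lborel \<Otimes>\<^sub>M lborel) (\<lambda>(z, l). \<Phi>2 z l)"
  proof (rule integrable_pairI)
    show "(\<lambda>(z, l). \<Phi>2 z l) \<in> borel_measurable (lborel \<Otimes>\<^sub>M lborel)" unfolding \<Phi>2_def by measurable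
    have "(\<integral>\<^sup>+ z. \<integral>\<^sup>+ l. ennreal (norm (\<Phi>2 z l)) \<partial>lborel \<partial>lborel) = (\<integral>\<^sup>+ z. ennreal (norm ((real DIM('a) + 2 * s) * (w z * frac_kernel s (fst z - snd z)))) \<partial>lborel)"
    proof (rule nn_integral_cong)
      fix z
      have "(\<integral>\<^sup>+ l. ennreal (norm (\<Phi>2 z l)) \<partial>lborel) = ennreal ((real DIM('a) + 2 * s) * (w z * frac_kernel s (fst z - snd z)))"
        using nn_integral_eq_integral[of lborel "\<Phi>2 z"] \<Phi>2[of z] \<Phi>2nn by simp
      then show "(\<integral>\<^sup>+ l. ennreal (norm (\<Phi>2 z l)) \<partial>lborel) = ennreal (norm ((real DIM('a) + 2 * s) * (w z * frac_kernel s (fst z - snd z))))"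
        using s w0[of z] by (simp add: abs_mult)
    qed
    also have "\<dots> < \<infinity>" using integrable_mult_right[OF gag(2), of "real DIM('a) + 2 * s"] unfolding integrable_iff_bounded w_def by blast
    finally show "(\<integral>\<^sup>+ z. \<integral>\<^sup>+ l. ennreal (norm (\<Phi>2 z l)) \<partial>lborel \<partial>lborel) < \<infinity>" .
  qed
  define \<Theta> where "\<Theta> = (\<lambda>(z::'a \<times> 'a) l. subord s l * (w z * heat_comm l \<psi> (fst z) (snd z)))"
  have i3: "integrable (lborel \<Otimes>\<^sub>M lborel) (\<lambda>(z, l). \<Theta> z l)"
  proof (rule Bochner_Integration.integrable_bound)
    show "integrable (lborel \<Otimes>\<^sub>M lborel) (\<lambda>zl. 2 * B * (\<lambda>(z, l). \<Phi> z l) zl + L * (\<lambda>(z, l). \<Phi>2 z l) zl)"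
      by (intro Bochner_Integration.integrable_add integrable_mult_right i1 i2)
    show "(\<lambda>(z, l). \<Theta> z l) \<in> borel_measurable (lborel \<Otimes>\<^sub>M lborel)" unfolding \<Theta>_def heat_comm_eq by measurable
    have "\<bar>\<Theta> z l\<bar> \<le> 2 * B * \<Phi> z l + L * \<Phi>2 z l" for z l
    proof (cases "0 < l")
      case True
      define x y where "x = fst z" and "y = snd z"
      have "\<bar>(x - y) \<bullet> (grad \<psi> x - grad \<psi> y)\<bar> \<le> norm (x - y) * (L * norm (x - y))"
        using Cauchy_Schwarz_ineq2[of "x - y" "grad \<psi> x - grad \<psi> y"] mult_left_mono[OF L(2)[of x y], of "norm (x - y)"] by simp
      then have "\<bar>((x - y) \<bullet> (grad \<psi> x - grad \<psi> y)) / (2 * l)\<bar> \<le> L * ((norm (x - y))\<^sup>2 / (2 * l))"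
        using True by (simp add: power2_eq_square divide_right_mono mult_ac)
      then have "\<bar>laplacian \<psi> x + laplacian \<psi> y - ((x - y) \<bullet> (grad \<psi> x - grad \<psi> y)) / (2 * l)\<bar> \<le> 2 * B + L * ((norm (x - y))\<^sup>2 / (2 * l))"
        using B[of x] B[of y] by linarith
      then have "\<bar>\<Theta> z l\<bar> \<le> (subord s l * w z * heat l (x - y)) * (2 * B + L * ((norm (x - y))\<^sup>2 / (2 * l)))"
        unfolding \<Theta>_def heat_comm_eq x_def[symmetric] y_def[symmetric] using w0[of z]
        by (simp add: abs_mult mult.assoc) (intro mult_left_mono, auto)
      also have "\<dots> = 2 * B * \<Phi> z l + L * \<Phi>2 z l"
        unfolding \<Phi>_def \<Phi>2_def w_def x_def[symmetric] y_def[symmetric] by (simp add: algebra_simps)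
      finally show ?thesis .
    qed (simp add: \<Theta>_def \<Phi>_def \<Phi>2_def subord_def)
    then show "AE zl in lborel \<Otimes>\<^sub>M lborel. norm ((\<lambda>(z, l). \<Theta> z l) zl) \<le> norm (2 * B * (\<lambda>(z, l). \<Phi> z l) zl + L * (\<lambda>(z, l). \<Phi>2 z l) zl)"
      by (intro AE_I2) (auto simp: split_beta intro: order_trans[OF _ abs_ge_self])
  qed
  \<comment> \<open>Off the diagonal the integral in l replaces 1/(2l) by (d + 2s) / |x-y|^2, which
    turns the heat commutator into \<open>dilation_mult\<close>. On the diagonal w is 0.\<close>
  have \<Theta>z: "(LINT l|lborel. \<Theta> z l) = w z * frac_kernel s (fst z - snd z) * dilation_mult s \<psi> (fst z) (snd z)" for z
  proof (cases "fst z - snd z = 0")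
    case True then show ?thesis by (simp add: \<Theta>_def w)
  next
    case False
    define x y where "x = fst z" and "y = snd z"
    have xy: "x - y \<noteq> 0" using False by (simp add: x_def y_def)
    define c where "c = ((x - y) \<bullet> (grad \<psi> x - grad \<psi> y)) / (norm (x - y))\<^sup>2"
    define f1 where "f1 = (\<lambda>l. subord s l * heat l (x - y))"
    define f2 where "f2 = (\<lambda>l. subord s l * (heat l (x - y) * ((norm (x - y))\<^sup>2 / (2 * l))))"
    have f: "integrable lborel f1" "integrable lborel f2" "(LINT l|lborel. f1 l) = frac_kernel s (x - y)"
      "(LINT l|lborel. f2 l) = (real DIM('a) + 2 * s) * frac_kernel s (x - y)"
      using subord_heat_integrable[OF s(1) xy] subord_heat_weight_integrable[OF s(1) xy] subord_heat_weight_integral[OF s(1) xy]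
      unfolding f1_def f2_def frac_kernel_def by blast+
    have "\<Theta> z l = w z * (laplacian \<psi> x + laplacian \<psi> y) * f1 l - w z * c * f2 l" for l
    proof -
      have c: "((x - y) \<bullet> (grad \<psi> x - grad \<psi> y)) / (2 * l) = c * ((norm (x - y))\<^sup>2 / (2 * l))" using xy by (simp add: c_def)
      show ?thesis unfolding \<Theta>_def heat_comm_eq x_def[symmetric] y_def[symmetric] c f1_def f2_def by (simp add: algebra_simps)
    qed
    then have "(LINT l|lborel. \<Theta> z l) = w z * (laplacian \<psi> x + laplacian \<psi> y) * frac_kernel s (x - y) - w z * c * ((real DIM('a) + 2 * s) * frac_kernel s (x - y))"
      using f by simp
    also have "\<dots> = w z * frac_kernel s (x - y) * dilation_mult s \<psi> x y"
      unfolding dilation_mult_def c_def[symmetric] by (simp add: algebra_simps)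
    finally show ?thesis by (simp add: x_def y_def)
  qed
  define R where "R = (\<lambda>\<xi>. Re (fourier W \<xi> * cnj (fourier u \<xi>)))"
  have [measurable]: "R \<in> borel_measurable borel" unfolding R_def by measurable
  have iR: "integrable lborel (\<lambda>\<xi>. norm \<xi> powr (2 * s) * R \<xi>)" unfolding R_def by (rule ip(1)[OF W])
  note sf = subord_fourier[OF s _ iR]
  \<comment> \<open>D = 0 is the integrated chain rule, \<integral> u \<nabla>u . \<nabla>\<psi> = -
    (1/2) \<integral> u^2 \<Delta>\<psi>. It is not proved directly: D multiplies
    \<open>subord s l\<close> alone, while all remaining terms are integrable in l.\<close>
  define D where "D = (LINT x|lborel. W x * u x) + (LINT x|lborel. (u x)\<^sup>2 * laplacian \<psi> x) / 2"
  have key: "subord s l * D = subord s l * (LINT \<xi>|lborel. (1 - exp (- l * (norm \<xi>)\<^sup>2)) * R \<xi>) + (LINT z|lborel. \<Theta> z l) / 4" for l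
  proof (cases "0 < l")
    case True
    have h: "heat_form l W u = - (LINT x|lborel. (u x)\<^sup>2 * laplacian \<psi> x) / 2 + (LINT z|lborel. w z * heat_comm l \<psi> (fst z) (snd z)) / 4"
      using heat_commutator(2)[OF True u GL G t] unfolding W_def w_def lborel_prod .
    have a: "(LINT z|lborel. \<Theta> z l) = subord s l * (LINT z|lborel. w z * heat_comm l \<psi> (fst z) (snd z))"
      unfolding \<Theta>_def by (rule integral_mult_right_zero)
    have b: "(LINT \<xi>|lborel. (1 - exp (- l * (norm \<xi>)\<^sup>2)) * R \<xi>) = (LINT x|lborel. W x * u x) - heat_form l W u"
      unfolding R_def by (rule parseval_heat_diff[OF True W u])
    have "S * (wu + A / 2) = S * (wu - (- A / 2 + E / 4)) + S * E / 4" for S wu A E :: real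
      by (simp add: algebra_simps)
    then show ?thesis unfolding D_def a b h .
  qed (simp add: subord_def \<Theta>_def)
  have i\<Theta>: "integrable lborel (\<lambda>l. LINT z|lborel. \<Theta> z l)" using lborel_pair.integrable_snd[OF i3] by simp
  have "integrable lborel (\<lambda>l. subord s l * D)" unfolding key using sf(1) i\<Theta> by simp
  then have "D = 0" using subord_not_integrable[OF s(1)] by (cases "D = 0") auto
  then have "(LINT l|lborel. subord s l * (LINT \<xi>|lborel. (1 - exp (- l * (norm \<xi>)\<^sup>2)) * R \<xi>) + (LINT z|lborel. \<Theta> z l) / 4) = 0"
    using key by simp
  then have "subord_const s * (LINT \<xi>|lborel. norm \<xi> powr (2 * s) * R \<xi>) + (LINT l|lborel. LINT z|lborel. \<Theta> z l) / 4 = 0"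
    using sf i\<Theta> by simp
  moreover have "(LINT l|lborel. LINT z|lborel. \<Theta> z l) = (LINT z|lborel. LINT l|lborel. \<Theta> z l)"
    using lborel_pair.Fubini_integral[OF i3] by simp
  moreover have "(LINT \<xi>|lborel. norm \<xi> powr (2 * s) * R \<xi>) = (LINT x|lborel. W x * p x)"
    unfolding R_def by (rule ip(2)[OF W])
  ultimately show ?thesis unfolding \<Theta>z unfolding w_def W_def by simp
qed

section \<open>Truncated quadratic weights\<close>

text \<open>Smooth on the whole line and zero for v \<ge> 1. The factor e / 2 compensates hexp 1 = 1
  / e: the slope at 0 is 1/2, and for v \<ge> 0 the value is at most v / 2. The argument v stands
  for |x|^2.\<close>

definition weight_profile :: "real \<Rightarrow> real" where
  "weight_profile v = v * (exp 1 / 2 * hexp (1 - v))"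

definition trunc_weight :: "real \<Rightarrow> 'a::euclidean_space \<Rightarrow> real" where
  "trunc_weight c x = (1 / c\<^sup>2) * weight_profile ((norm (c *\<^sub>R x))\<^sup>2)"

lemma smooth_weight_factor: "smooth (\<lambda>v. exp 1 / 2 * hexp (1 - v))"
  by (intro smooth_mult smooth_const smooth_compose[OF smooth_hexp] smooth_diff smooth_linear bounded_linear_ident)

lemma smooth_weight_profile: "smooth weight_profile"
proof -
  have "smooth (\<lambda>v. v * (exp 1 / 2 * hexp (1 - v)))"
    by (intro smooth_mult[OF _ smooth_weight_factor] smooth_linear bounded_linear_ident)
  then show ?thesis unfolding weight_profile_def[abs_def] .
qed

definition weight_slope :: "real \<Rightarrow> real" where
  "weight_slope v = frechet_derivative weight_profile (at v) 1"

lemma smooth_weight_slope: "smooth weight_slope"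
  using smooth_frechet[OF smooth_weight_profile, of 1] unfolding weight_slope_def[abs_def] .

lemma weight_slope_0: "weight_slope 0 = 1 / 2"
proof -
  have "frechet_derivative weight_profile (at 0) 1 = exp 1 / 2 * hexp 1"
    using frechet_derivative_mult_smooth[OF smooth_linear[OF bounded_linear_ident] smooth_weight_factor, of 0 1]
    unfolding weight_profile_def[abs_def] by simp
  then show ?thesis by (simp add: weight_slope_def hexp_def exp_minus)
qed

lemma weight_profile_derivative: "(weight_profile has_real_derivative weight_slope v) (at v)"
proof -
  have d: "(weight_profile has_derivative frechet_derivative weight_profile (at v)) (at v)"
    by (rule smooth_has_derivative[OF smooth_weight_profile])
  have "frechet_derivative weight_profile (at v) = (*) (weight_slope v)"
  proof
    fix r :: real
    have "frechet_derivative weight_profile (at v) (r *\<^sub>R 1) = r *\<^sub>R frechet_derivative weight_profile (at v) 1"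
      by (rule linear_scale[OF has_derivative_linear[OF d]])
    then show "frechet_derivative weight_profile (at v) r = weight_slope v * r" by (simp add: weight_slope_def)
  qed
  then show ?thesis using d by (simp add: has_field_derivative_def)
qed

abbreviation weight1 :: "'a::euclidean_space \<Rightarrow> real" where
  "weight1 \<equiv> (\<lambda>x. weight_profile ((norm x)\<^sup>2))"

lemma frechet_weight1:
  fixes x :: "'a::euclidean_space"
  shows "frechet_derivative weight1 (at x) v = 2 * weight_slope ((norm x)\<^sup>2) * (x \<bullet> v)"
proof -
  have "((\<lambda>x. (norm x)\<^sup>2) has_derivative (\<lambda>v. 2 * (x \<bullet> v))) (at x)"
    unfolding power2_norm_eq_inner by (auto intro!: derivative_eq_intros simp: inner_commute)
  from has_derivative_compose[OF this, of weight_profile "(*) (weight_slope ((norm x)\<^sup>2))"] weight_profile_derivative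
  have "(weight1 has_derivative (\<lambda>v. weight_slope ((norm x)\<^sup>2) * (2 * (x \<bullet> v)))) (at x)"
    by (simp add: has_field_derivative_def)
  from frechet_derivative_at[OF this] have "frechet_derivative weight1 (at x) = (\<lambda>v. weight_slope ((norm x)\<^sup>2) * (2 * (x \<bullet> v)))" by simp
  then show ?thesis by simp
qed

lemma test_function_weight1: "test_function UNIV (weight1 :: 'a::euclidean_space \<Rightarrow> real)"
proof (rule test_functionI[of _ "cball 0 1"])
  show "smooth (weight1 :: 'a \<Rightarrow> real)" by (rule smooth_compose[OF smooth_weight_profile smooth_norm_sq])
  fix x :: 'a assume "x \<notin> cball 0 1"
  then have "1 < norm x" by simp
  then have "1 \<le> (norm x)\<^sup>2" by (simp add: one_le_power)
  then show "weight1 x = 0" by (simp add: weight_profile_def hexp_def)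
qed auto

text \<open>The derivative in direction b is 2 \<open>weight_slope\<close> (|y|^2) times y . b. At
  the origin only the term that differentiates the linear factor remains, with coefficient 2 (1/2) =
  1 per coordinate.\<close>

lemma laplacian_weight1_0: "laplacian weight1 (0::'a::euclidean_space) = real DIM('a)"
proof -
  have s: "smooth (\<lambda>x::'a. 2 * weight_slope ((norm x)\<^sup>2))"
    by (intro smooth_mult smooth_const smooth_compose[OF smooth_weight_slope smooth_norm_sq])
  have "frechet_derivative (\<lambda>y::'a. 2 * weight_slope ((norm y)\<^sup>2) * (y \<bullet> b)) (at 0) b = b \<bullet> b" for b :: 'a
    using frechet_derivative_mult_smooth[OF s smooth_inner[of b], of 0 b] frechet_derivative_at[OF bounded_linear_imp_has_derivative[OF bounded_linear_inner_left[of b]], of 0]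
    by (simp add: weight_slope_0)
  then show ?thesis unfolding laplacian_eq frechet_weight1 by (simp add: inner_Basis)
qed

lemma frechet_rescale:
  fixes f :: "'a::euclidean_space \<Rightarrow> real"
  assumes f: "smooth f"
  shows "frechet_derivative (\<lambda>x. a * f (c *\<^sub>R x)) (at x) v = a * c * frechet_derivative f (at (c *\<^sub>R x)) v"
proof -
  have d: "(f has_derivative frechet_derivative f (at (c *\<^sub>R x))) (at (c *\<^sub>R x))" by (rule smooth_has_derivative[OF f])
  have "((\<lambda>x. c *\<^sub>R x) has_derivative (\<lambda>v. c *\<^sub>R v)) (at x)" by (auto intro!: derivative_eq_intros)
  from has_derivative_mult_right[OF has_derivative_compose[OF this d], of a]
  have "((\<lambda>x. a * f (c *\<^sub>R x)) has_derivative (\<lambda>v. a * frechet_derivative f (at (c *\<^sub>R x)) (c *\<^sub>R v))) (at x)" .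
  from frechet_derivative_at[OF this]
  have "frechet_derivative (\<lambda>x. a * f (c *\<^sub>R x)) (at x) = (\<lambda>v. a * frechet_derivative f (at (c *\<^sub>R x)) (c *\<^sub>R v))" by simp
  then show ?thesis using linear_scale[OF has_derivative_linear[OF d]] by simp
qed

lemma smooth_rescale:
  fixes f :: "'a::euclidean_space \<Rightarrow> real"
  assumes f: "smooth f" shows "smooth (\<lambda>x. a * f (c *\<^sub>R x))"
  by (intro smooth_mult smooth_const smooth_compose_linear[OF f] bounded_linear_scaleR_right)

lemma test_function_trunc_weight:
  assumes c: "0 < c" shows "test_function UNIV (trunc_weight c :: 'a::euclidean_space \<Rightarrow> real)"
proof (rule test_functionI[of _ "cball 0 (1 / c)"])
  have "smooth (\<lambda>x::'a. (1 / c\<^sup>2) * weight1 (c *\<^sub>R x))" by (rule smooth_rescale[OF test_function_smooth[OF test_function_weight1]])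
  then show "smooth (trunc_weight c :: 'a \<Rightarrow> real)" unfolding trunc_weight_def[abs_def] .
  fix x :: 'a assume "x \<notin> cball 0 (1 / c)"
  then have "1 < norm (c *\<^sub>R x)" using c by (simp add: field_simps)
  then have "1 \<le> (norm (c *\<^sub>R x))\<^sup>2" by (simp only: one_le_power less_imp_le)
  then show "trunc_weight c x = 0" by (simp add: trunc_weight_def weight_profile_def hexp_def)
qed auto

lemma trunc_weight_eq: "c \<noteq> 0 \<Longrightarrow> trunc_weight c x = (norm x)\<^sup>2 / 2 * (exp 1 * hexp (1 - c\<^sup>2 * (norm x)\<^sup>2))"
  by (simp add: trunc_weight_def weight_profile_def power_mult_distrib)

lemma grad_trunc_weight:
  fixes x :: "'a::euclidean_space"
  assumes "c \<noteq> 0" shows "grad (trunc_weight c) x = (1 / c) *\<^sub>R grad weight1 (c *\<^sub>R x)"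
proof -
  note s = test_function_smooth[OF test_function_weight1]
  have "frechet_derivative (trunc_weight c) (at x) b = (1 / c) * frechet_derivative weight1 (at (c *\<^sub>R x)) b" for b
    using frechet_rescale[OF s, of "1 / c\<^sup>2" c x b] assms
    unfolding trunc_weight_def[abs_def] by (simp add: power2_eq_square)
  then show ?thesis by (simp add: grad_def scaleR_sum_right)
qed

lemma laplacian_trunc_weight:
  fixes x :: "'a::euclidean_space"
  assumes "c \<noteq> 0" shows "laplacian (trunc_weight c) x = laplacian weight1 (c *\<^sub>R x)"
proof -
  note s = test_function_smooth[OF test_function_weight1]
  have *: "frechet_derivative (trunc_weight c) (at x) b = (1 / c) * frechet_derivative weight1 (at (c *\<^sub>R x)) b" for b x :: 'a
    using frechet_rescale[OF s, of "1 / c\<^sup>2" c x b] assms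
    unfolding trunc_weight_def[abs_def] by (simp add: power2_eq_square)
  show ?thesis unfolding laplacian_eq * frechet_rescale[OF smooth_frechet[OF s]] using assms by simp
qed

lemma grad_trunc_weight': 
  fixes x :: "'a::euclidean_space"
  assumes "c \<noteq> 0" shows "grad (trunc_weight c) x = (2 * weight_slope (c\<^sup>2 * (norm x)\<^sup>2)) *\<^sub>R x"
proof -
  have "grad weight1 y = (2 * weight_slope ((norm y)\<^sup>2)) *\<^sub>R y" for y :: 'a
    unfolding grad_def frechet_weight1 scaleR_scaleR[symmetric] scaleR_sum_right[symmetric] euclidean_representation ..
  then show ?thesis unfolding grad_trunc_weight[OF assms] using assms by (simp add: power_mult_distrib)
qed

text \<open>The scale is c = 1 / (n + 1). Second derivatives are unchanged in size by this scaling,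
  and their limits are the values of the unscaled weight at the origin, where its Hessian is the
  identity. On the diagonal the quotient in \<open>dilation_mult\<close> is 0 / 0 = 0 and the limit
  would be 2d, hence the condition x \<noteq> y.\<close>

lemma exists_truncated_weights:
  fixes s :: real
  shows "\<exists>\<psi> :: nat \<Rightarrow> 'a::euclidean_space \<Rightarrow> real. (\<forall>n. test_function UNIV (\<psi> n)) \<and> 
    (\<forall>n x. 0 \<le> \<psi> n x \<and> \<psi> n x \<le> (norm x)\<^sup>2 / 2) \<and> (\<forall>x. (\<lambda>n. \<psi> n x) \<longlonglongrightarrow> (norm x)\<^sup>2 / 2) \<and>
    (\<exists>B. \<forall>n x. \<bar>laplacian (\<psi> n) x\<bar> \<le> B) \<and> (\<forall>x. (\<lambda>n. laplacian (\<psi> n) x) \<longlonglongrightarrow> real DIM('a)) \<and>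
    (\<exists>K. \<forall>n x y. \<bar>dilation_mult s (\<psi> n) x y\<bar> \<le> K) \<and>
    (\<forall>x y. x \<noteq> y \<longrightarrow> (\<lambda>n. dilation_mult s (\<psi> n) x y) \<longlonglongrightarrow> real DIM('a) - 2 * s)"
proof -
  define c where "c n = inverse (real (Suc n))" for n
  have c: "0 < c n" "c n \<noteq> 0" for n by (auto simp: c_def)
  have c0: "c \<longlonglongrightarrow> 0" unfolding c_def by (rule LIMSEQ_inverse_real_of_nat)
  have c2: "(\<lambda>n. (c n)\<^sup>2 * a) \<longlonglongrightarrow> 0" for a
    using tendsto_mult_right[OF tendsto_power[OF c0, of 2], of a] by simp
  define \<psi> :: "nat \<Rightarrow> 'a \<Rightarrow> real" where "\<psi> n = trunc_weight (c n)" for n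
  have t: "test_function UNIV (\<psi> n)" for n unfolding \<psi>_def by (rule test_function_trunc_weight[OF c(1)])
  have w: "0 \<le> \<psi> n x \<and> \<psi> n x \<le> (norm x)\<^sup>2 / 2" for n x
  proof -
    have "exp 1 * hexp (1 - (c n)\<^sup>2 * (norm x)\<^sup>2) \<le> exp 1 * hexp 1" by (intro mult_left_mono hexp_mono) auto
    also have "\<dots> = 1" by (simp add: hexp_def exp_minus)
    finally show ?thesis unfolding \<psi>_def trunc_weight_eq[OF c(2)] using hexp_bounds(1)
      by (auto intro!: mult_left_le)
  qed
  have lim: "(\<lambda>n. \<psi> n x) \<longlonglongrightarrow> (norm x)\<^sup>2 / 2" for x
  proof -
    have "(\<lambda>n. hexp (1 - (c n)\<^sup>2 * (norm x)\<^sup>2)) \<longlonglongrightarrow> hexp (1 - 0)"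
      by (intro isCont_tendsto_compose[OF smooth_isCont[OF smooth_hexp]] tendsto_intros c2)
    then have "(\<lambda>n. (norm x)\<^sup>2 / 2 * (exp 1 * hexp (1 - (c n)\<^sup>2 * (norm x)\<^sup>2))) \<longlonglongrightarrow> (norm x)\<^sup>2 / 2 * (exp 1 * hexp (1 - 0))"
      by (intro tendsto_intros)
    then show ?thesis unfolding \<psi>_def trunc_weight_eq[OF c(2)] by (simp add: hexp_def exp_minus)
  qed
  obtain B where B: "\<And>x::'a. \<bar>laplacian weight1 x\<bar> \<le> B" using test_function_bounds[OF test_function_laplacian[OF test_function_weight1]] by blast
  have lap: "laplacian (\<psi> n) x = laplacian weight1 (c n *\<^sub>R x)" for n x
    unfolding \<psi>_def by (rule laplacian_trunc_weight[OF c(2)])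
  have lapB: "\<bar>laplacian (\<psi> n) x\<bar> \<le> B" for n x unfolding lap by (rule B)
  have laplim: "(\<lambda>n. laplacian (\<psi> n) x) \<longlonglongrightarrow> real DIM('a)" for x
  proof -
    have "(\<lambda>n. c n *\<^sub>R x) \<longlonglongrightarrow> 0 *\<^sub>R x" by (intro tendsto_intros c0)
    then have "(\<lambda>n. laplacian weight1 (c n *\<^sub>R x)) \<longlonglongrightarrow> laplacian weight1 (0::'a)"
      by (intro isCont_tendsto_compose[OF smooth_isCont[OF smooth_laplacian[OF test_function_smooth[OF test_function_weight1]]]]) simp
    then show ?thesis unfolding lap laplacian_weight1_0 .
  qed
  obtain L where L: "0 < L" "\<And>x y::'a. norm (grad weight1 x - grad weight1 y) \<le> L * norm (x - y)"
    using grad_lipschitz[OF test_function_weight1] by blast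
  have gr: "norm (grad (\<psi> n) x - grad (\<psi> n) y) \<le> L * norm (x - y)" for n x y
  proof -
    have "norm (grad (\<psi> n) x - grad (\<psi> n) y) = (1 / c n) * norm (grad weight1 (c n *\<^sub>R x) - grad weight1 (c n *\<^sub>R y))"
      unfolding \<psi>_def grad_trunc_weight[OF c(2)] scaleR_diff_right[symmetric] using c(1)[of n] by simp
    also have "\<dots> \<le> (1 / c n) * (L * norm (c n *\<^sub>R x - c n *\<^sub>R y))" using c(1)[of n] by (intro mult_left_mono L) simp
    also have "norm (c n *\<^sub>R x - c n *\<^sub>R y) = c n * norm (x - y)" unfolding scaleR_diff_right[symmetric] using c(1)[of n] by simp
    finally show ?thesis using c[of n] by simp
  qed
  have q: "\<bar>((x - y) \<bullet> (grad (\<psi> n) x - grad (\<psi> n) y)) / (norm (x - y))\<^sup>2\<bar> \<le> L" for n x y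
  proof (cases "x = y")
    case False
    have "\<bar>(x - y) \<bullet> (grad (\<psi> n) x - grad (\<psi> n) y)\<bar> \<le> norm (x - y) * (L * norm (x - y))"
      using Cauchy_Schwarz_ineq2[of "x - y" "grad (\<psi> n) x - grad (\<psi> n) y"] mult_left_mono[OF gr[of n x y], of "norm (x - y)"] by simp
    then show ?thesis using False by (simp add: divide_le_eq power2_eq_square mult_ac)
  qed (use L in simp)
  have K: "\<bar>dilation_mult s (\<psi> n) x y\<bar> \<le> 2 * B + \<bar>real DIM('a) + 2 * s\<bar> * L" for n x y
  proof -
    have "\<bar>(real DIM('a) + 2 * s) * (((x - y) \<bullet> (grad (\<psi> n) x - grad (\<psi> n) y)) / (norm (x - y))\<^sup>2)\<bar> \<le> \<bar>real DIM('a) + 2 * s\<bar> * L"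
      unfolding abs_mult using q by (intro mult_left_mono) auto
    then show ?thesis unfolding dilation_mult_def using lapB[of n x] lapB[of n y] by linarith
  qed
  have dil: "(\<lambda>n. dilation_mult s (\<psi> n) x y) \<longlonglongrightarrow> real DIM('a) - 2 * s" if xy: "x \<noteq> y" for x y
  proof -
    have g: "(\<lambda>n. grad (\<psi> n) x) \<longlonglongrightarrow> x" for x
    proof -
      have "(\<lambda>n. weight_slope ((c n)\<^sup>2 * (norm x)\<^sup>2)) \<longlonglongrightarrow> weight_slope 0"
        by (intro isCont_tendsto_compose[OF smooth_isCont[OF smooth_weight_slope]] c2)
      then have "(\<lambda>n. (2 * weight_slope ((c n)\<^sup>2 * (norm x)\<^sup>2)) *\<^sub>R x) \<longlonglongrightarrow> (2 * weight_slope 0) *\<^sub>R x"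
        by (intro tendsto_intros)
      then show ?thesis unfolding \<psi>_def grad_trunc_weight'[OF c(2)] by (simp add: weight_slope_0)
    qed
    have "(\<lambda>n. dilation_mult s (\<psi> n) x y) \<longlonglongrightarrow> real DIM('a) + real DIM('a) - (real DIM('a) + 2 * s) * (((x - y) \<bullet> (x - y)) / (norm (x - y))\<^sup>2)"
      unfolding dilation_mult_def by (intro tendsto_intros laplim g) (use xy in auto)
    moreover have "((x - y) \<bullet> (x - y)) / (norm (x - y))\<^sup>2 = 1" using xy by (simp add: power2_norm_eq_inner)
    ultimately show ?thesis by simp
  qed
  show ?thesis
    by (rule exI[of _ \<psi>]) (use t w lim lapB laplim K dil in blast)
qed

section \<open>Time slices\<close>

text \<open>The exponents needed for regularity 1 + s are s for the energy, 1 for the gradient and 2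
  s for p; the last one is admissible because s < 1.\<close>

lemma
  fixes u :: "'a::euclidean_space \<Rightarrow> real"
  assumes u: "sobolev \<sigma> u" and a: "0 \<le> a" "a \<le> \<sigma>"
  shows sobolev_weight_L2: "L2 (\<lambda>\<xi>. complex_of_real (norm \<xi> powr a) * fourier u \<xi>)"
    and sobolev_weight_le: "ennreal (L2sq (\<lambda>\<xi>. complex_of_real (norm \<xi> powr a) * fourier u \<xi>)) \<le> sobolev_sqnorm \<sigma> u"
proof -
  have uL: "L2 u" and fin: "sobolev_sqnorm \<sigma> u < \<infinity>" using u by (auto simp: sobolev_def)
  have [measurable]: "fourier u \<in> borel_measurable borel" using L2_fourier[OF uL] by (simp add: L2_def)
  have w: "(norm \<xi> powr a)\<^sup>2 \<le> (1 + (norm \<xi>)\<^sup>2) powr \<sigma>" for \<xi> :: 'a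
  proof (cases "\<xi> = 0")
    case False
    have "(norm \<xi> powr a)\<^sup>2 = (norm \<xi> powr 2) powr a" using False by (simp add: powr_powr powr_numeral[symmetric] mult.commute del: powr_numeral)
    also have "\<dots> = ((norm \<xi>)\<^sup>2) powr a" using False by simp
    also have "\<dots> \<le> (1 + (norm \<xi>)\<^sup>2) powr a" using a by (intro powr_mono2) auto
    also have "\<dots> \<le> (1 + (norm \<xi>)\<^sup>2) powr \<sigma>" using a by (intro powr_mono) auto
    finally show ?thesis .
  qed simp
  have le: "(\<integral>\<^sup>+ \<xi>. ennreal ((norm (complex_of_real (norm \<xi> powr a) * fourier u \<xi>))\<^sup>2) \<partial>lborel) \<le> sobolev_sqnorm \<sigma> u"
    unfolding sobolev_sqnorm_def
    by (intro nn_integral_mono ennreal_leI) (auto simp: norm_mult power_mult_distrib intro!: mult_right_mono w)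
  show L: "L2 (\<lambda>\<xi>. complex_of_real (norm \<xi> powr a) * fourier u \<xi>)"
    using le_less_trans[OF le fin] by (auto simp: L2_def)
  show "ennreal (L2sq (\<lambda>\<xi>. complex_of_real (norm \<xi> powr a) * fourier u \<xi>)) \<le> sobolev_sqnorm \<sigma> u"
    using le unfolding nn_integral_L2sq[OF L] .
qed

lemma sobolev_L2sq_le:
  fixes u :: "'a::euclidean_space \<Rightarrow> real"
  assumes u: "sobolev \<sigma> u" and \<sigma>: "0 \<le> \<sigma>"
  shows "ennreal (L2sq u) \<le> sobolev_sqnorm \<sigma> u"
proof -
  have uL: "L2 u" using u by (simp add: sobolev_def)
  have "ennreal (L2sq u) = (\<integral>\<^sup>+ \<xi>. ennreal ((norm (fourier u \<xi>))\<^sup>2) \<partial>lborel)"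
    unfolding nn_integral_L2sq[OF L2_fourier[OF uL]] L2sq_fourier[OF uL] ..
  also have "\<dots> \<le> sobolev_sqnorm \<sigma> u" unfolding sobolev_sqnorm_def
  proof (intro nn_integral_mono ennreal_leI)
    fix \<xi> :: 'a
    have "1 \<le> (1 + (norm \<xi>)\<^sup>2) powr \<sigma>" using \<sigma> by (intro ge_one_powr_ge_zero) auto
    then show "(norm (fourier u \<xi>))\<^sup>2 \<le> (1 + (norm \<xi>)\<^sup>2) powr \<sigma> * (norm (fourier u \<xi>))\<^sup>2"
      using mult_right_mono[of 1 "(1 + (norm \<xi>)\<^sup>2) powr \<sigma>" "(norm (fourier u \<xi>))\<^sup>2"] by simp
  qed
  finally show ?thesis .
qed

section \<open>One fixed time: v is the slice of u, and G and p are its gradient and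
  pressure\<close>

context
  fixes s :: real and v p :: "'a::euclidean_space \<Rightarrow> real" and G :: "'a \<Rightarrow> 'a"
  assumes s: "0 < s" "s < 1" and v: "sobolev (1 + s) v" and G: "has_weak_gradient UNIV v G"
    and pm: "p \<in> borel_measurable borel" and p: "AE x in lborel. p x = frac_laplacian s v x"
begin

definition slice_energy :: real where "slice_energy = L2sq (frac_laplacian (s / 2) v)"

lemma slice_L2: "L2 v" using v by (simp add: sobolev_def)

lemma slice_frac_half: "L2 (frac_laplacian (s / 2) v)"
  and slice_energy_eq: "slice_energy = L2sq (\<lambda>\<xi>. complex_of_real (norm \<xi> powr s) * fourier v \<xi>)"
proof -
  have m: "L2 (\<lambda>\<xi>. complex_of_real (norm \<xi> powr (2 * (s / 2))) * fourier v \<xi>)"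
    using sobolev_weight_L2[OF v, of s] s by simp
  note f = frac_laplacian_spec[OF slice_L2 m]
  show L: "L2 (frac_laplacian (s / 2) v)" by (rule f(1))
  have "slice_energy = L2sq (fourier (frac_laplacian (s / 2) v))" by (simp add: slice_energy_def L2sq_fourier[OF L])
  also have "\<dots> = L2sq (\<lambda>\<xi>. complex_of_real (norm \<xi> powr s) * fourier v \<xi>)"
    using L2sq_cong_AE[OF L2_measurable[OF m] L2_measurable[OF L2_fourier[OF L]] f(2)] by simp
  finally show "slice_energy = L2sq (\<lambda>\<xi>. complex_of_real (norm \<xi> powr s) * fourier v \<xi>)" .
qed

lemma slice_energy_nn: "(\<integral>\<^sup>+ x. ennreal ((frac_laplacian (s / 2) v x)\<^sup>2) \<partial>lborel) = ennreal slice_energy"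
  using nn_integral_L2sq[OF slice_frac_half] by (simp add: slice_energy_def)

lemma slice_energy_integral:
  "integrable lborel (\<lambda>\<xi>. norm \<xi> powr (2 * s) * (cmod (fourier v \<xi>))\<^sup>2)"
  "(LINT \<xi>|lborel. norm \<xi> powr (2 * s) * (cmod (fourier v \<xi>))\<^sup>2) = slice_energy"
proof -
  have m: "L2 (\<lambda>\<xi>. complex_of_real (norm \<xi> powr s) * fourier v \<xi>)" using sobolev_weight_L2[OF v, of s] s by simp
  have e: "(norm (complex_of_real (norm \<xi> powr s) * fourier v \<xi>))\<^sup>2 = norm \<xi> powr (2 * s) * (cmod (fourier v \<xi>))\<^sup>2" for \<xi>
    by (cases "\<xi> = 0") (auto simp: norm_mult power_mult_distrib power2_eq_square powr_add[symmetric])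
  show "integrable lborel (\<lambda>\<xi>. norm \<xi> powr (2 * s) * (cmod (fourier v \<xi>))\<^sup>2)"
    using L2_integrable[OF m] unfolding e .
  show "(LINT \<xi>|lborel. norm \<xi> powr (2 * s) * (cmod (fourier v \<xi>))\<^sup>2) = slice_energy"
    unfolding slice_energy_eq L2sq_def e ..
qed

text \<open>The last bound controls p by the norm of v in the Sobolev space of order 1 + s. Square
  integrability of the pressure over space-time is obtained from it.\<close>

lemma slice_p: "L2 p" "AE \<xi> in lborel. fourier p \<xi> = complex_of_real (norm \<xi> powr (2 * s)) * fourier v \<xi>"
  "ennreal (L2sq p) \<le> sobolev_sqnorm (1 + s) v"
proof -
  have m: "L2 (\<lambda>\<xi>. complex_of_real (norm \<xi> powr (2 * s)) * fourier v \<xi>)" using sobolev_weight_L2[OF v, of "2 * s"] s by simp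
  note f = frac_laplacian_spec[OF slice_L2 m]
  show L: "L2 p" by (rule L2_cong_AE[OF f(1) _ p]) (use pm in simp)
  have "fourier p = fourier (frac_laplacian s v)" by (rule fourier_cong_AE[OF L2_measurable[OF L] L2_measurable[OF f(1)] p])
  then show ae: "AE \<xi> in lborel. fourier p \<xi> = complex_of_real (norm \<xi> powr (2 * s)) * fourier v \<xi>" using f(2) by simp
  have "L2sq p = L2sq (fourier p)" by (simp add: L2sq_fourier[OF L])
  also have "\<dots> = L2sq (\<lambda>\<xi>. complex_of_real (norm \<xi> powr (2 * s)) * fourier v \<xi>)"
    using L2sq_cong_AE[OF L2_measurable[OF m] L2_measurable[OF L2_fourier[OF L]] ae] by simp
  finally show "ennreal (L2sq p) \<le> sobolev_sqnorm (1 + s) v" using sobolev_weight_le[OF v, of "2 * s"] s by simp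
qed

text \<open>The multiplier |\<xi>|^(2s) of p, paired with v, is the squared multiplier of the
  energy.\<close>

lemma slice_vp: "(LINT x|lborel. p x * v x) = slice_energy"
proof -
  have "(LINT x|lborel. p x * v x) = (LINT \<xi>|lborel. Re (fourier p \<xi> * cnj (fourier v \<xi>)))"
    by (rule parseval[symmetric, OF slice_p(1) slice_L2])
  also have "\<dots> = (LINT \<xi>|lborel. norm \<xi> powr (2 * s) * (cmod (fourier v \<xi>))\<^sup>2)"
  proof (rule integral_cong_AE)
    show "AE \<xi> in lborel. Re (fourier p \<xi> * cnj (fourier v \<xi>)) = norm \<xi> powr (2 * s) * (cmod (fourier v \<xi>))\<^sup>2"
      using slice_p(2) by eventually_elim (simp only: mult.assoc complex_norm_square[symmetric] of_real_mult[symmetric] Re_complex_of_real)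
  qed (use L2_fourier[OF slice_p(1)] L2_fourier[OF slice_L2] in \<open>auto simp: L2_def\<close>)
  finally show ?thesis unfolding slice_energy_integral(2) .
qed

lemma slice_G: 
  assumes "b \<in> Basis"
  shows "L2 (\<lambda>x. G x \<bullet> b)" "ennreal (L2sq (\<lambda>x. G x \<bullet> b)) \<le> sobolev_sqnorm (1 + s) v"
proof -
  have n: "norm \<xi> powr 1 = norm \<xi>" for \<xi> :: 'a by simp
  have m: "L2 (\<lambda>\<xi>. complex_of_real (norm \<xi>) * fourier v \<xi>)" using sobolev_weight_L2[OF v, of 1] s unfolding n by simp
  show "L2 (\<lambda>x. G x \<bullet> b)" by (rule weak_gradient_L2(1)[OF slice_L2 m G assms])
  have "ennreal (L2sq (\<lambda>x. G x \<bullet> b)) \<le> ennreal (L2sq (\<lambda>\<xi>. complex_of_real (norm \<xi>) * fourier v \<xi>))"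
    by (intro ennreal_leI weak_gradient_L2(2)[OF slice_L2 m G assms])
  also have "\<dots> \<le> sobolev_sqnorm (1 + s) v" using sobolev_weight_le[OF v, of 1] s unfolding n by simp
  finally show "ennreal (L2sq (\<lambda>x. G x \<bullet> b)) \<le> sobolev_sqnorm (1 + s) v" .
qed

lemma slice_energy_le: "ennreal slice_energy \<le> sobolev_sqnorm (1 + s) v"
  using sobolev_weight_le[OF v, of s] s by (simp add: slice_energy_eq)

lemma slice_gagliardo:
  "integrable lborel (\<lambda>z. (v (fst z) - v (snd z))\<^sup>2 * frac_kernel s (fst z - snd z))"
  "(LINT z|lborel. (v (fst z) - v (snd z))\<^sup>2 * frac_kernel s (fst z - snd z)) = 2 * subord_const s * slice_energy"
  using gagliardo_integrable_prod(2,3)[OF s slice_L2 slice_energy_integral(1)] unfolding slice_energy_integral(2) .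

text \<open>The rate of change of the integral of v \<psi> that the equation prescribes: the two
  spatial terms of the weak formulation at one time.\<close>

definition slice_flux :: "('a \<Rightarrow> real) \<Rightarrow> real" where
  "slice_flux \<psi> = (LINT x|lborel. p x * v x * laplacian \<psi> x + p x * (G x \<bullet> grad \<psi> x))"

lemma slice_flux_eq:
  assumes t: "test_function UNIV \<psi>"
  shows "slice_flux \<psi> = (LINT x|lborel. p x * v x * laplacian \<psi> x) 
    - (LINT z|lborel. (v (fst z) - v (snd z))\<^sup>2 * frac_kernel s (fst z - snd z) * dilation_mult s \<psi> (fst z) (snd z)) / (4 * subord_const s)"
proof -
  obtain B where B: "\<And>x. \<bar>laplacian \<psi> x\<bar> \<le> B" using test_function_bounds[OF test_function_laplacian[OF t]] by blast
  have [measurable]: "laplacian \<psi> \<in> borel_measurable borel" by (rule measurable_laplacian[OF test_function_smooth[OF t]])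
  have L: "L2 (\<lambda>x. laplacian \<psi> x * v x)" by (rule L2_bounded_mult_real[OF slice_L2 _ B]) measurable
  have 1: "integrable lborel (\<lambda>x. p x * v x * laplacian \<psi> x)"
    using L2_prod_integrable[OF slice_p(1) L] by (simp add: mult_ac)
  have 2: "integrable lborel (\<lambda>x. p x * (G x \<bullet> grad \<psi> x))"
    using L2_prod_integrable[OF slice_p(1) L2_grad_inner[OF slice_G(1) t]] by (simp add: inner_commute)
  have "subord_const s * (LINT x|lborel. p x * (G x \<bullet> grad \<psi> x)) 
    = - (LINT z|lborel. (v (fst z) - v (snd z))\<^sup>2 * frac_kernel s (fst z - snd z) * dilation_mult s \<psi> (fst z) (snd z)) / 4"
    using pohozaev[OF s slice_L2 slice_p(1,2) slice_G(1) G t] by (simp add: mult.commute inner_commute)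
  then have "(LINT x|lborel. p x * (G x \<bullet> grad \<psi> x)) 
    = - (LINT z|lborel. (v (fst z) - v (snd z))\<^sup>2 * frac_kernel s (fst z - snd z) * dilation_mult s \<psi> (fst z) (snd z)) / (4 * subord_const s)"
    using subord_const_pos[OF s] by (simp add: field_simps)
  then show ?thesis unfolding slice_flux_def using 1 2 by simp
qed

lemma measurable_dilation_mult:
  assumes "test_function UNIV \<psi>"
  shows "(\<lambda>z. dilation_mult s \<psi> (fst z) (snd z)) \<in> borel_measurable (borel :: ('a \<times> 'a) measure)"
proof -
  have [measurable]: "laplacian \<psi> \<in> borel_measurable borel" "grad \<psi> \<in> borel_measurable borel"
    using measurable_laplacian measurable_grad test_function_smooth[OF assms] by blast+
  show ?thesis unfolding dilation_mult_def by measurable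
qed

text \<open>The weight enters only through B and K, which are common to all truncated weights, and
  the slice only through quantities integrable in time. This is the majorant for the passage to the
  limit under the time integral.\<close>

lemma slice_flux_bound:
  assumes t: "test_function UNIV \<psi>" and B: "\<And>x. \<bar>laplacian \<psi> x\<bar> \<le> B"
    and K: "\<And>x y. \<bar>dilation_mult s \<psi> x y\<bar> \<le> K"
  shows "\<bar>slice_flux \<psi>\<bar> \<le> B * (L2sq p + L2sq v) + K / 2 * slice_energy"
proof -
  have vm: "v \<in> borel_measurable borel" using slice_L2 by (simp add: L2_def)
  have lm: "laplacian \<psi> \<in> borel_measurable borel" by (rule measurable_laplacian[OF test_function_smooth[OF t]])
  note [measurable] = vm lm pm measurable_dilation_mult[OF t]
  have B0: "0 \<le> B" using order_trans[OF abs_ge_zero B[of 0]] .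
  have i1: "integrable lborel (\<lambda>x. B * ((p x)\<^sup>2 + (v x)\<^sup>2))"
    using L2_integrable[OF slice_p(1)] L2_integrable[OF slice_L2] by simp
  have "\<bar>LINT x|lborel. p x * v x * laplacian \<psi> x\<bar> \<le> (LINT x|lborel. B * ((p x)\<^sup>2 + (v x)\<^sup>2))"
  proof -
    have b: "\<bar>p x * v x * laplacian \<psi> x\<bar> \<le> B * ((p x)\<^sup>2 + (v x)\<^sup>2)" for x
    proof -
      have "2 * (\<bar>p x\<bar> * \<bar>v x\<bar>) \<le> (p x)\<^sup>2 + (v x)\<^sup>2" "0 \<le> \<bar>p x\<bar> * \<bar>v x\<bar>"
        using sum_squares_bound[of "\<bar>p x\<bar>" "\<bar>v x\<bar>"] by (simp_all add: mult.assoc)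
      then have "\<bar>p x * v x\<bar> \<le> (p x)\<^sup>2 + (v x)\<^sup>2" unfolding abs_mult by linarith
      then have "\<bar>p x * v x\<bar> * \<bar>laplacian \<psi> x\<bar> \<le> ((p x)\<^sup>2 + (v x)\<^sup>2) * B" by (intro mult_mono B) auto
      then show ?thesis by (simp add: abs_mult mult.commute)
    qed
    have "\<bar>LINT x|lborel. p x * v x * laplacian \<psi> x\<bar> \<le> (LINT x|lborel. \<bar>p x * v x * laplacian \<psi> x\<bar>)" by (rule integral_abs_bound)
    also have "\<dots> \<le> (LINT x|lborel. B * ((p x)\<^sup>2 + (v x)\<^sup>2))"
    proof (rule integral_mono[OF _ i1 b])
      show "integrable lborel (\<lambda>x. \<bar>p x * v x * laplacian \<psi> x\<bar>)"
        by (rule Bochner_Integration.integrable_bound[OF i1], measurable) (auto intro!: AE_I2 order_trans[OF b] abs_ge_self)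
    qed
    finally show ?thesis .
  qed
  also have "\<dots> = B * (L2sq p + L2sq v)"
    using L2_integrable[OF slice_p(1)] L2_integrable[OF slice_L2] by (simp add: L2sq_def)
  finally have 1: "\<bar>LINT x|lborel. p x * v x * laplacian \<psi> x\<bar> \<le> B * (L2sq p + L2sq v)" .
  let ?w = "\<lambda>z. (v (fst z) - v (snd z))\<^sup>2 * frac_kernel s (fst z - snd z)"
  have "\<bar>LINT z|lborel. ?w z * dilation_mult s \<psi> (fst z) (snd z)\<bar> \<le> (LINT z|lborel. \<bar>?w z * dilation_mult s \<psi> (fst z) (snd z)\<bar>)"
    by (rule integral_abs_bound)
  also have "\<dots> \<le> (LINT z|lborel. K * ?w z)"
  proof (rule integral_mono)
    have b: "\<bar>?w z * dilation_mult s \<psi> (fst z) (snd z)\<bar> \<le> K * ?w z" for z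
    proof -
      have "?w z * \<bar>dilation_mult s \<psi> (fst z) (snd z)\<bar> \<le> ?w z * K" by (intro mult_left_mono K) simp
      then show ?thesis by (simp add: abs_mult mult.commute)
    qed
    then show "\<bar>?w z * dilation_mult s \<psi> (fst z) (snd z)\<bar> \<le> K * ?w z" for z .
    show i: "integrable lborel (\<lambda>z. K * ?w z)" by (rule integrable_mult_right[OF slice_gagliardo(1)])
    show "integrable lborel (\<lambda>z. \<bar>?w z * dilation_mult s \<psi> (fst z) (snd z)\<bar>)"
      by (rule Bochner_Integration.integrable_bound[OF i], measurable)
        (intro AE_I2, simp only: real_norm_def abs_abs, rule order_trans[OF b abs_ge_self])
  qed
  also have "\<dots> = K * (2 * subord_const s * slice_energy)" by (simp only: integral_mult_right_zero slice_gagliardo(2))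
  finally have "\<bar>(LINT z|lborel. ?w z * dilation_mult s \<psi> (fst z) (snd z)) / (4 * subord_const s)\<bar> \<le> K / 2 * slice_energy"
    using subord_const_pos[OF s] by (simp add: divide_le_eq mult_ac)
  then show ?thesis unfolding slice_flux_eq[OF t] using 1 by linarith
qed

lemma slice_flux_tendsto:
  assumes t: "\<And>n. test_function UNIV (\<psi> n)" and B: "\<And>n x. \<bar>laplacian (\<psi> n) x\<bar> \<le> B"
    and K: "\<And>n x y. \<bar>dilation_mult s (\<psi> n) x y\<bar> \<le> K"
    and lap: "\<And>x. (\<lambda>n. laplacian (\<psi> n) x) \<longlonglongrightarrow> real DIM('a)"
    and dil: "\<And>x y. x \<noteq> y \<Longrightarrow> (\<lambda>n. dilation_mult s (\<psi> n) x y) \<longlonglongrightarrow> real DIM('a) - 2 * s"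
  shows "(\<lambda>n. slice_flux (\<psi> n)) \<longlonglongrightarrow> (real DIM('a) + 2 * s) / 2 * slice_energy"
proof -
  have vm: "v \<in> borel_measurable borel" using slice_L2 by (simp add: L2_def)
  have lm: "laplacian (\<psi> n) \<in> borel_measurable borel" for n by (rule measurable_laplacian[OF test_function_smooth[OF t]])
  note [measurable] = vm lm pm measurable_dilation_mult[OF t]
  have pv: "integrable lborel (\<lambda>x. p x * v x)" by (rule L2_prod_integrable[OF slice_p(1) slice_L2])
  have 1: "(\<lambda>n. LINT x|lborel. p x * v x * laplacian (\<psi> n) x) \<longlonglongrightarrow> (LINT x|lborel. p x * v x * real DIM('a))"
  proof (rule integral_dominated_convergence)
    show "integrable lborel (\<lambda>x. \<bar>p x * v x\<bar> * B)" using pv by auto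
    show "AE x in lborel. (\<lambda>n. p x * v x * laplacian (\<psi> n) x) \<longlonglongrightarrow> p x * v x * real DIM('a)"
      by (intro AE_I2 tendsto_intros lap)
    show "AE x in lborel. norm (p x * v x * laplacian (\<psi> n) x) \<le> \<bar>p x * v x\<bar> * B" for n
      unfolding norm_mult[of "_ * _"] by (intro AE_I2) (auto intro!: mult_left_mono B)
  qed measurable
  let ?w = "\<lambda>z. (v (fst z) - v (snd z))\<^sup>2 * frac_kernel s (fst z - snd z)"
  have 2: "(\<lambda>n. LINT z|lborel. ?w z * dilation_mult s (\<psi> n) (fst z) (snd z)) \<longlonglongrightarrow> (LINT z|lborel. ?w z * (real DIM('a) - 2 * s))"
  proof (rule integral_dominated_convergence)
    show "integrable lborel (\<lambda>z. ?w z * K)" by (rule integrable_mult_left[OF slice_gagliardo(1)])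
    show "AE z in lborel. (\<lambda>n. ?w z * dilation_mult s (\<psi> n) (fst z) (snd z)) \<longlonglongrightarrow> ?w z * (real DIM('a) - 2 * s)"
    proof (rule AE_I2)
      fix z :: "'a \<times> 'a"
      \<comment> \<open>On the diagonal the multiplier has a different limit, but there the squared
        difference is 0.\<close>
      show "(\<lambda>n. ?w z * dilation_mult s (\<psi> n) (fst z) (snd z)) \<longlonglongrightarrow> ?w z * (real DIM('a) - 2 * s)"
        by (cases "fst z = snd z") (auto intro!: tendsto_intros dil)
    qed
    show "AE z in lborel. norm (?w z * dilation_mult s (\<psi> n) (fst z) (snd z)) \<le> ?w z * K" for n
    proof (rule AE_I2)
      fix z :: "'a \<times> 'a"
      have "?w z * \<bar>dilation_mult s (\<psi> n) (fst z) (snd z)\<bar> \<le> ?w z * K" by (intro mult_left_mono K) simp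
      then show "norm (?w z * dilation_mult s (\<psi> n) (fst z) (snd z)) \<le> ?w z * K" by (simp add: abs_mult)
    qed
  qed measurable
  have "(\<lambda>n. slice_flux (\<psi> n)) \<longlonglongrightarrow> (LINT x|lborel. p x * v x * real DIM('a)) - (LINT z|lborel. ?w z * (real DIM('a) - 2 * s)) / (4 * subord_const s)"
    unfolding slice_flux_eq[OF t] by (intro tendsto_diff tendsto_divide tendsto_const 1 2) (use subord_const_pos[OF s] in simp)
  also have "(LINT x|lborel. p x * v x * real DIM('a)) = slice_energy * real DIM('a)" by (simp only: integral_mult_left_zero slice_vp)
  also have "(LINT z|lborel. ?w z * (real DIM('a) - 2 * s)) = 2 * subord_const s * slice_energy * (real DIM('a) - 2 * s)"
    by (simp only: integral_mult_left_zero slice_gagliardo(2))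
  also have "slice_energy * real DIM('a) - 2 * subord_const s * slice_energy * (real DIM('a) - 2 * s) / (4 * subord_const s) = (real DIM('a) + 2 * s) / 2 * slice_energy"
    using subord_const_pos[OF s] by (simp add: field_simps)
  finally show ?thesis .
qed

end

section \<open>From the weak formulation in time to almost every time\<close>

text \<open>The weak form of m' = F with m(0) = a0. Given \<zeta> supported in t > 0, a compactly
  supported \<eta> with \<eta>' = \<zeta> on t > 0 is inserted; this shows that m - a0 - H
  annihilates every such \<zeta>, and the fundamental lemma concludes.\<close>

lemma du_bois_reymond_time:
  fixes m F :: "real \<Rightarrow> real"
  assumes [measurable]: "m \<in> borel_measurable borel" and loc: "\<And>a c. integrable lborel (\<lambda>t. indicator (cbox a c) t * m t)"
    and F: "integrable lborel F"
    and weak: "\<And>\<eta>. test_function UNIV \<eta> \<Longrightarrow> - (LINT t|lborel. indicator {0<..} t * (deriv \<eta> t * m t))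
       - (LINT t|lborel. indicator {0<..} t * (\<eta> t * F t)) = \<eta> 0 * a0"
  shows "AE t in lborel. 0 < t \<longrightarrow> m t = a0 + (LINT r|lborel. indicator {0<..<t} r * F r)"
proof -
  have [measurable]: "F \<in> borel_measurable borel" using F by simp
  define H where "H t = (LINT r|lborel. (if 0 < r \<and> r < t then F r else 0))" for t
  have [measurable]: "H \<in> borel_measurable borel" unfolding H_def by measurable
  have HF: "\<bar>H t\<bar> \<le> (LINT r|lborel. \<bar>F r\<bar>)" for t
  proof -
    have "\<bar>H t\<bar> \<le> (LINT r|lborel. \<bar>if 0 < r \<and> r < t then F r else 0\<bar>)" unfolding H_def by (rule integral_abs_bound)
    also have "\<dots> \<le> (LINT r|lborel. \<bar>F r\<bar>)"
      by (rule integral_mono) (auto intro!: Bochner_Integration.integrable_bound[OF F] F)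
    finally show ?thesis .
  qed
  define f where "f t = m t - (a0 + H t)" for t
  have "AE t in lborel. t \<in> {0<..} \<longrightarrow> f t = 0"
  proof (rule fundamental_lemma)
    show "f \<in> borel_measurable borel" unfolding f_def by measurable
    fix a c :: real
    have "integrable lborel (indicator (cbox a c) :: real \<Rightarrow> real)"       by (intro integrable_real_indicator emeasure_lborel_cbox_finite) simp
    from integrable_mult_left[OF this, of "\<bar>a0\<bar> + (LINT r|lborel. \<bar>F r\<bar>)"]
    have "integrable lborel (\<lambda>t. indicator (cbox a c) t * (a0 + H t))"
    proof (rule Bochner_Integration.integrable_bound)
      show "AE t in lborel. norm (indicator (cbox a c) t * (a0 + H t)) \<le> norm (indicator (cbox a c) t * (\<bar>a0\<bar> + (LINT r|lborel. \<bar>F r\<bar>)))"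
      proof (rule AE_I2)
        fix t
        have "\<bar>a0 + H t\<bar> \<le> \<bar>a0\<bar> + (LINT r|lborel. \<bar>F r\<bar>)" using HF[of t] by linarith
        then show "norm (indicator (cbox a c) t * (a0 + H t)) \<le> norm (indicator (cbox a c) t * (\<bar>a0\<bar> + (LINT r|lborel. \<bar>F r\<bar>)))"
          by (simp add: indicator_def)
      qed
    qed measurable
    then show "integrable lborel (\<lambda>t. indicator (cbox a c) t * f t)"
      using loc[of a c] by (simp add: f_def right_diff_distrib)
  next
    fix \<zeta> :: "real \<Rightarrow> real" assume t: "test_function {0<..} \<zeta>"
    note sm = test_function_smooth[OF t]
    have [measurable]: "\<zeta> \<in> borel_measurable borel" by (rule test_function_measurable[OF t])
    have i\<zeta>: "integrable lborel \<zeta>" by (rule test_function_integrable[OF t])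
    obtain B L where BL: "0 < L" "\<And>x. \<bar>\<zeta> x\<bar> \<le> B" "\<And>x. L \<le> norm x \<Longrightarrow> \<zeta> x = 0" using test_function_bounds[OF t] by blast
    have z0: "\<zeta> x = 0" if "x \<le> 0" for x
    proof (rule ccontr)
      assume "\<zeta> x \<noteq> 0"
      then have "x \<in> closure {x. \<zeta> x \<noteq> 0}" by (intro subsetD[OF closure_subset]) simp
      then show False using t that by (auto simp: test_function_def)
    qed
    define c where "c = (LINT r|lborel. \<zeta> r)"
    \<comment> \<open>A primitive of \<zeta> written as an oriented integral from 0, so that it is
      differentiable at every real r; it is 0 for r \<le> 0 and equals c from L on.\<close>
    define S where "S r = (LBINT y=ereal 0..ereal r. \<zeta> y)" for r
    have dS: "(S has_real_derivative \<zeta> r) (at r)" for r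
    proof -
      have "(S has_vector_derivative \<zeta> r) (at r within {min 0 r - 1..max 0 r + 1})"
        unfolding S_def by (rule interval_integral_FTC2) (auto intro: smooth_continuous[OF sm])
      moreover have "at r within {min 0 r - 1..max 0 r + 1} = at r" by (rule at_within_interior) (auto simp: interior_atLeastAtMost_real)
      ultimately show ?thesis by (simp add: has_real_derivative_iff_has_vector_derivative)
    qed
    have Spos: "S r = (LINT y|lborel. indicator {..r} y * \<zeta> y)" if "0 \<le> r" for r
    proof -
      have "S r = (LINT y|lborel. indicator {0..r} y *\<^sub>R \<zeta> y)"
        unfolding S_def using that by (simp add: interval_integral_Icc set_lebesgue_integral_def)
      also have "\<dots> = (LINT y|lborel. indicator {..r} y * \<zeta> y)"
        by (intro Bochner_Integration.integral_cong) (auto simp: indicator_def z0)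
      finally show ?thesis .
    qed
    have Sneg: "S r = 0" if "r \<le> 0" for r
    proof -
      have "S r = - (LINT y|lborel. indicator {r..0} y *\<^sub>R \<zeta> y)"
        unfolding S_def using that by (subst interval_integral_endpoints_reverse) (simp add: interval_integral_Icc set_lebesgue_integral_def)
      also have "(LINT y|lborel. indicator {r..0} y *\<^sub>R \<zeta> y) = (LINT y|(lborel::real measure). 0)"
        by (intro Bochner_Integration.integral_cong) (auto simp: indicator_def z0)
      finally show ?thesis by simp
    qed
    have SL: "S r = c" if "L \<le> r" for r
    proof -
      have e: "indicator {..r} y * \<zeta> y = \<zeta> y" for y using BL(3)[of y] that by (auto simp: indicator_def)
      have "S r = (LINT y|lborel. indicator {..r} y * \<zeta> y)" using that BL(1) by (intro Spos) simp
      then show ?thesis unfolding e c_def .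
    qed
    \<comment> \<open>A primitive of \<zeta> alone need not have compact support. Subtracting its
      shift by L restores this, and for r \<ge> 0 the shifted term is the constant c; so the
      derivative is still \<zeta> for positive times, and \<eta> 0 = - c.\<close>
    define \<eta> where "\<eta> r = S r - S (r + L)" for r
    have d\<eta>: "(\<eta> has_real_derivative \<zeta> r - \<zeta> (r + L)) (at r)" for r
      unfolding \<eta>_def by (intro DERIV_diff dS DERIV_shift[THEN iffD1] dS)
    have "smooth (\<lambda>r::real. r + L)" by (intro smooth_add smooth_const smooth_linear bounded_linear_ident)
    then have "smooth \<eta>" by (intro smooth_real[OF d\<eta>] smooth_diff sm smooth_compose[OF sm])
    then have t\<eta>: "test_function UNIV \<eta>"
    proof (rule test_functionI[of _ "cball 0 L"])
      fix r :: real assume "r \<notin> cball 0 L"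
      then consider "r < - L" | "L < r" by (auto simp: abs_if split: if_splits)
      then show "\<eta> r = 0" by cases (use BL(1) in \<open>auto simp: \<eta>_def Sneg SL\<close>)
    qed auto
    have deriv: "deriv \<eta> r = \<zeta> r" if "0 < r" for r
      using DERIV_imp_deriv[OF d\<eta>[of r]] BL(3)[of "r + L"] BL(1) that by simp
    have "(LINT t|lborel. indicator {0<..} t * (deriv \<eta> t * m t)) = (LINT t|lborel. m t * \<zeta> t)"
      by (intro Bochner_Integration.integral_cong) (auto simp: indicator_def deriv z0)
    moreover have "\<eta> 0 = - c" using Sneg[of 0] SL[of L] by (simp add: \<eta>_def)
    moreover have "(LINT t|lborel. indicator {0<..} t * (\<eta> t * F t)) = - (LINT t|lborel. H t * \<zeta> t)"
    proof -
      \<comment> \<open>Fubini on the triangle 0 < r < y: integrating \<zeta> over y > r gives c - S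
        r = - \<eta> r, integrating F over r gives H.\<close>
      define Q where "Q = (\<lambda>r y. if 0 < r \<and> r < y then F r * \<zeta> y else 0)"
      have iQ: "integrable (lborel \<Otimes>\<^sub>M lborel) (\<lambda>(r, y). Q r y)"
      proof (rule Bochner_Integration.integrable_bound[OF integrable_tensor[OF F i\<zeta>]])
        show "(\<lambda>(r, y). Q r y) \<in> borel_measurable (lborel \<Otimes>\<^sub>M lborel)" unfolding Q_def by measurable
      qed (auto simp: Q_def)
      have 1: "(LINT y|lborel. Q r y) = - (indicator {0<..} r * (\<eta> r * F r))" for r
      proof (cases "0 < r")
        case True
        have "(LINT y|lborel. Q r y) = (LINT y|lborel. F r * (\<zeta> y - indicator {..r} y * \<zeta> y))"
          using True by (intro Bochner_Integration.integral_cong) (auto simp: Q_def indicator_def)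
        also have "\<dots> = F r * (c - S r)"
          using i\<zeta> integrable_real_mult_indicator[OF _ i\<zeta>, of "{..r}"] True
          by (simp add: Spos c_def mult.commute)
        also have "\<dots> = - (indicator {0<..} r * (\<eta> r * F r))"
          using True BL(1) SL[of "r + L"] by (simp add: \<eta>_def algebra_simps)
        finally show ?thesis .
      qed (simp add: Q_def)
      have 2: "(LINT r|lborel. Q r y) = H y * \<zeta> y" for y
        unfolding H_def integral_mult_left_zero[symmetric] by (intro Bochner_Integration.integral_cong) (auto simp: Q_def)
      show ?thesis using lborel_pair.Fubini_integral[OF iQ] unfolding 1 2 by simp
    qed
    ultimately have eq: "(LINT t|lborel. m t * \<zeta> t) = a0 * c + (LINT t|lborel. H t * \<zeta> t)"
      using weak[OF t\<eta>] by (simp add: algebra_simps)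
    have im: "integrable lborel (\<lambda>t. m t * \<zeta> t)"
    proof (rule Bochner_Integration.integrable_bound[OF integrable_mult_left[OF loc[of "- L" L], of B]])
      show "AE t in lborel. norm (m t * \<zeta> t) \<le> norm (indicator (cbox (- L) L) t * m t * B)"
      proof (rule AE_I2)
        fix t
        have B0: "0 \<le> B" using order_trans[OF abs_ge_zero BL(2)] .
        show "norm (m t * \<zeta> t) \<le> norm (indicator (cbox (- L) L) t * m t * B)"
        proof (cases "L \<le> norm t")
          case True then show ?thesis using BL(3) by simp
        next
          case False
          then show ?thesis using BL(2)[of t] B0 by (auto simp: abs_mult indicator_def abs_le_iff intro!: mult_left_mono)
        qed
      qed
    qed measurable
    have iH: "integrable lborel (\<lambda>t. H t * \<zeta> t)"
    proof (rule Bochner_Integration.integrable_bound[OF integrable_mult_right[OF i\<zeta>, of "LINT r|lborel. \<bar>F r\<bar>"]])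
      show "AE t in lborel. norm (H t * \<zeta> t) \<le> norm ((LINT r|lborel. \<bar>F r\<bar>) * \<zeta> t)"
        using HF by (intro AE_I2) (auto simp: abs_mult intro!: mult_right_mono order_trans[OF HF])
    qed measurable
    have "(LINT t|lborel. f t * \<zeta> t) = (LINT t|lborel. m t * \<zeta> t - (a0 * \<zeta> t + H t * \<zeta> t))"
      by (simp add: f_def algebra_simps)
    also have "\<dots> = (LINT t|lborel. m t * \<zeta> t) - (a0 * c + (LINT t|lborel. H t * \<zeta> t))"
      using im iH i\<zeta> by (simp add: c_def)
    finally show "(LINT t|lborel. f t * \<zeta> t) = 0" using eq by simp
  qed auto
  moreover have "H t = (LINT r|lborel. indicator {0<..<t} r * F r)" for t
    unfolding H_def by (intro Bochner_Integration.integral_cong) (auto simp: indicator_def)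
  ultimately show ?thesis by (auto simp: f_def)
qed

section \<open>The weak formulation tested with separated variables\<close>

lemma lborel_fubini:
  fixes K :: "'a::euclidean_space \<times> 'b::euclidean_space \<Rightarrow> 'c::{banach, second_countable_topology}"
  assumes K: "integrable lborel K"
  shows "(LINT z|lborel. K z) = (LINT t|lborel. LINT x|lborel. K (t, x))"
    and "integrable lborel (\<lambda>t. LINT x|lborel. K (t, x))"
  using lborel_pair.integral_fst'[of K] lborel_pair.integrable_fst'[of K] K by (simp_all add: lborel_prod)

lemma L2_tensor:
  fixes f :: "'a::euclidean_space \<Rightarrow> real" and g :: "'b::euclidean_space \<Rightarrow> real"
  assumes f: "L2 f" and g: "L2 g" shows "L2 (\<lambda>z. f (fst z) * g (snd z))"
proof -
  have [measurable]: "f \<in> borel_measurable borel" "g \<in> borel_measurable borel" using f g by (auto simp: L2_def)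
  have "integrable lborel (\<lambda>z::'a \<times> 'b. (f (fst z))\<^sup>2 * (g (snd z))\<^sup>2)"
    using integrable_tensor[of "\<lambda>x. (f x)\<^sup>2" "\<lambda>x. (g x)\<^sup>2"] L2_integrable[OF f] L2_integrable[OF g]
    by (simp add: lborel_prod case_prod_beta')
  moreover have "(\<lambda>z. f (fst z) * g (snd z)) \<in> borel_measurable borel" by measurable
  ultimately show ?thesis by (simp add: L2_iff power_mult_distrib)
qed

lemma test_function_tensor:
  fixes \<eta> :: "'a::euclidean_space \<Rightarrow> real" and \<psi> :: "'b::euclidean_space \<Rightarrow> real"
  assumes \<eta>: "test_function UNIV \<eta>" and \<psi>: "test_function UNIV \<psi>"
  shows "test_function UNIV (\<lambda>z. \<eta> (fst z) * \<psi> (snd z))"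
proof -
  obtain r1 where r1: "\<And>x. r1 \<le> norm x \<Longrightarrow> \<eta> x = 0" using test_function_bounds[OF \<eta>] by blast
  obtain r2 where r2: "\<And>x. r2 \<le> norm x \<Longrightarrow> \<psi> x = 0" using test_function_bounds[OF \<psi>] by blast
  show ?thesis
  proof (rule test_functionI[of _ "cball 0 r1 \<times> cball 0 r2"])
    show "smooth (\<lambda>z. \<eta> (fst z) * \<psi> (snd z))"
      by (rule smooth_mult[OF smooth_compose_linear[OF test_function_smooth[OF \<eta>] bounded_linear_fst]
        smooth_compose_linear[OF test_function_smooth[OF \<psi>] bounded_linear_snd]])
    show "closed (cball 0 r1 \<times> cball 0 r2)" "bounded (cball 0 r1 \<times> cball 0 r2)"
      by (auto intro: closed_Times bounded_Times)
    fix z :: "'a \<times> 'b" assume "z \<notin> cball 0 r1 \<times> cball 0 r2"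
    then have "r1 \<le> norm (fst z) \<or> r2 \<le> norm (snd z)" by (cases z) auto
    then show "\<eta> (fst z) * \<psi> (snd z) = 0" using r1 r2 by auto
  qed simp
qed

lemma frechet_cmult:
  fixes f :: "'a::euclidean_space \<Rightarrow> real"
  assumes "smooth f" shows "frechet_derivative (\<lambda>x. a * f x) (at x) v = a * frechet_derivative f (at x) v"
  using frechet_rescale[OF assms, of a 1 x v] by simp

lemma grad_cmult: "smooth f \<Longrightarrow> grad (\<lambda>x. a * f x) x = a *\<^sub>R grad f x"
  by (simp add: grad_def frechet_cmult scaleR_sum_right)

lemma laplacian_cmult: "smooth f \<Longrightarrow> laplacian (\<lambda>x. a * f x) x = a * laplacian f x"
  by (simp add: laplacian_eq frechet_cmult smooth_frechet sum_distrib_left)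

lemma smooth_deriv:
  fixes f :: "real \<Rightarrow> real"
  assumes "smooth f" shows "(f has_real_derivative deriv f x) (at x)"
  using smooth_differentiable[OF assms, of x] by (simp add: DERIV_deriv_iff_real_differentiable)

lemma test_function_deriv:
  assumes t: "test_function UNIV \<eta>" shows "test_function UNIV (deriv \<eta>)"
proof -
  have "frechet_derivative \<eta> (at x) 1 = deriv \<eta> x" for x
    using frechet_derivative_at[OF smooth_deriv[OF test_function_smooth[OF t], of x, unfolded has_field_derivative_def]]
    by (metis mult.right_neutral)
  then show ?thesis using test_function_frechet[OF t, of 1] by simp
qed

text \<open>U and P are thought of as extended by 0 to t \<le> 0, so that the integrals run over a
  full product space. Square integrability makes all products with bounded factors integrable, which
  justifies Fubini; the test function \<eta>(t) \<psi>(x) then reduces the equation to the weak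
  differential equation in time treated above.\<close>

lemma weak_formulation_slices:
  fixes U P :: "real \<times> 'a::euclidean_space \<Rightarrow> real" and \<Gamma> :: "real \<times> 'a \<Rightarrow> 'a"
  assumes U: "L2 U" and P: "L2 P" and \<Gamma>: "\<And>b. b \<in> Basis \<Longrightarrow> L2 (\<lambda>z. \<Gamma> z \<bullet> b)" and t: "test_function UNIV \<psi>"
    and zero: "\<And>z. fst z \<le> 0 \<Longrightarrow> U z = 0" "\<And>z. fst z \<le> 0 \<Longrightarrow> P z = 0"
    and weak: "\<And>\<phi> :: real \<times> 'a \<Rightarrow> real. test_function UNIV \<phi> \<Longrightarrow> 
      - (LINT z|lborel. U z * deriv (\<lambda>r. \<phi> (r, snd z)) (fst z))
      - (LINT z|lborel. P z * U z * laplacian (\<lambda>y. \<phi> (fst z, y)) (snd z))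
      - (LINT z|lborel. P z * (\<Gamma> z \<bullet> grad (\<lambda>y. \<phi> (fst z, y)) (snd z)))
      = (LINT x|lborel. u0 x * \<phi> (0, x))"
  defines "F \<equiv> \<lambda>r. LINT x|lborel. P (r, x) * U (r, x) * laplacian \<psi> x + P (r, x) * (\<Gamma> (r, x) \<bullet> grad \<psi> x)"
  shows "integrable lborel F"
    and "AE t in lborel. 0 < t \<longrightarrow> (LINT x|lborel. U (t, x) * \<psi> x) = (LINT x|lborel. u0 x * \<psi> x) + (LINT r|lborel. indicator {0<..<t} r * F r)"
proof -
  note sm = test_function_smooth[OF t]
  note tlap = test_function_laplacian[OF t]
  have [measurable]: "U \<in> borel_measurable borel" "P \<in> borel_measurable borel" using U P by (auto simp: L2_def)
  have [measurable]: "\<psi> \<in> borel_measurable borel" "laplacian \<psi> \<in> borel_measurable borel"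
    using test_function_measurable[OF t] test_function_measurable[OF tlap] by auto
  have gsum: "P z * (\<Gamma> z \<bullet> grad \<psi> x) = (\<Sum>b\<in>Basis. P z * (frechet_derivative \<psi> (at x) b * (\<Gamma> z \<bullet> b)))" for z x
    by (subst euclidean_inner) (simp add: grad_inner_Basis sum_distrib_left mult_ac)
  define Fz where "Fz z = P z * U z * laplacian \<psi> (snd z) + P z * (\<Gamma> z \<bullet> grad \<psi> (snd z))" for z
  have bm: "L2 (\<lambda>z::real \<times> 'a. (c z * g (snd z)) * f z)" 
    if f: "L2 f" and g: "test_function UNIV g" and c: "c \<in> borel_measurable borel" "\<And>z. \<bar>c z\<bar> \<le> C" for f c C and g :: "'a \<Rightarrow> real"
  proof -
    obtain B where B: "\<And>x. \<bar>g x\<bar> \<le> B" using test_function_bounds[OF g] by blast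
    have [measurable]: "g \<in> borel_measurable borel" by (rule test_function_measurable[OF g])
    have C0: "0 \<le> C" using order_trans[OF abs_ge_zero c(2)] .
    show ?thesis
      by (rule L2_bounded_mult_real[OF f, of _ "C * B"]) (use c(1) in \<open>auto simp: abs_mult intro!: mult_mono c(2) B C0\<close>)
  qed
  have split1: "integrable lborel (\<lambda>z. P z * ((c z * laplacian \<psi> (snd z)) * U z))"
    and split2: "integrable lborel (\<lambda>z. P z * ((c z * frechet_derivative \<psi> (at (snd z)) b) * (\<Gamma> z \<bullet> b)))"
    if "c \<in> borel_measurable borel" "\<And>z. \<bar>c z\<bar> \<le> C" "b \<in> Basis" for c C b
    by (rule L2_prod_integrable[OF P bm[OF U tlap that(1,2)]],
      rule L2_prod_integrable[OF P bm[OF \<Gamma>[OF that(3)] test_function_frechet[OF t] that(1,2)]])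
  have iA: "integrable lborel (\<lambda>z. c z * (P z * U z * laplacian \<psi> (snd z)))"
    and iB: "integrable lborel (\<lambda>z. c z * (P z * (\<Gamma> z \<bullet> grad \<psi> (snd z))))"
    if c: "c \<in> borel_measurable borel" "\<And>z. \<bar>c z\<bar> \<le> C" for c C
  proof -
    show "integrable lborel (\<lambda>z. c z * (P z * U z * laplacian \<psi> (snd z)))"
      using split1[OF c SOME_Basis] by (simp add: mult_ac)
    have "integrable lborel (\<lambda>z. \<Sum>b\<in>Basis. P z * ((c z * frechet_derivative \<psi> (at (snd z)) b) * (\<Gamma> z \<bullet> b)))"
      by (intro Bochner_Integration.integrable_sum split2[OF c])
    then show "integrable lborel (\<lambda>z. c z * (P z * (\<Gamma> z \<bullet> grad \<psi> (snd z))))"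
      unfolding gsum by (simp add: sum_distrib_left mult_ac)
  qed
  have iFz: "integrable lborel Fz" unfolding Fz_def using iA[of "\<lambda>_. 1" 1] iB[of "\<lambda>_. 1" 1] by simp
  have Fe: "F r = (LINT x|lborel. Fz (r, x))" for r by (simp add: F_def Fz_def)
  show iF: "integrable lborel F" unfolding Fe using lborel_fubini(2)[OF iFz] .
  define m where "m t = (LINT x|lborel. U (t, x) * \<psi> x)" for t
  have "AE t in lborel. 0 < t \<longrightarrow> m t = (LINT x|lborel. u0 x * \<psi> x) + (LINT r|lborel. indicator {0<..<t} r * F r)"
  proof (rule du_bois_reymond_time[OF _ _ iF])
    show "m \<in> borel_measurable borel" unfolding m_def by measurable
    fix a c :: real
    have "integrable lborel (\<lambda>z. (indicator (cbox a c) (fst z) * \<psi> (snd z)) * U z)"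
      by (intro L2_prod_integrable L2_tensor L2_indicator_cbox test_function_L2[OF t] U)
    moreover have "(LINT x|lborel. (indicator (cbox a c) (fst (t, x)) * \<psi> (snd (t, x))) * U (t, x)) = indicator (cbox a c) t * m t" for t
      unfolding m_def by (subst integral_mult_right_zero[symmetric]) (simp add: mult_ac)
    ultimately show "integrable lborel (\<lambda>t. indicator (cbox a c) t * m t)"
      using lborel_fubini(2)[of "\<lambda>z. (indicator (cbox a c) (fst z) * \<psi> (snd z)) * U z"] by simp
  next
    fix \<eta> :: "real \<Rightarrow> real" assume \<eta>: "test_function UNIV \<eta>"
    note sme = test_function_smooth[OF \<eta>]
    have [measurable]: "\<eta> \<in> borel_measurable borel" by (rule test_function_measurable[OF \<eta>])
    obtain C where C: "\<And>x. \<bar>\<eta> x\<bar> \<le> C" using test_function_bounds[OF \<eta>] by blast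
    have d: "deriv (\<lambda>r. \<eta> r * \<psi> x) r = deriv \<eta> r * \<psi> x" for r x
      by (rule DERIV_imp_deriv[OF DERIV_cmult_right[OF smooth_deriv[OF sme]]])
    have 1: "(LINT z|lborel. U z * (deriv \<eta> (fst z) * \<psi> (snd z))) = (LINT t|lborel. indicator {0<..} t * (deriv \<eta> t * m t))"
    proof -
      have "integrable lborel (\<lambda>z. U z * (deriv \<eta> (fst z) * \<psi> (snd z)))"
        by (intro L2_prod_integrable U L2_tensor test_function_L2[OF test_function_deriv[OF \<eta>]] test_function_L2[OF t])
      from lborel_fubini(1)[OF this] have "(LINT z|lborel. U z * (deriv \<eta> (fst z) * \<psi> (snd z))) = (LINT r|lborel. LINT x|lborel. U (r, x) * (deriv \<eta> r * \<psi> x))"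
        by simp
      also have "\<dots> = (LINT r|lborel. deriv \<eta> r * m r)"
        unfolding m_def integral_mult_right_zero[symmetric] by (simp add: mult_ac)
      also have "\<dots> = (LINT t|lborel. indicator {0<..} t * (deriv \<eta> t * m t))"
        by (intro Bochner_Integration.integral_cong) (auto simp: indicator_def m_def zero)
      finally show ?thesis .
    qed
    have 2: "(LINT z|lborel. P z * U z * (\<eta> (fst z) * laplacian \<psi> (snd z))) + (LINT z|lborel. P z * (\<Gamma> z \<bullet> (\<eta> (fst z) *\<^sub>R grad \<psi> (snd z))))
       = (LINT t|lborel. indicator {0<..} t * (\<eta> t * F t))"
    proof -
      have c: "(\<lambda>z::real \<times> 'a. \<eta> (fst z)) \<in> borel_measurable borel" by measurable
      have "(LINT z|lborel. P z * U z * (\<eta> (fst z) * laplacian \<psi> (snd z))) + (LINT z|lborel. P z * (\<Gamma> z \<bullet> (\<eta> (fst z) *\<^sub>R grad \<psi> (snd z))))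
         = (LINT z|lborel. \<eta> (fst z) * (P z * U z * laplacian \<psi> (snd z))) + (LINT z|lborel. \<eta> (fst z) * (P z * (\<Gamma> z \<bullet> grad \<psi> (snd z))))"
        by (simp add: mult_ac)
      also have "\<dots> = (LINT z|lborel. \<eta> (fst z) * (P z * U z * laplacian \<psi> (snd z)) + \<eta> (fst z) * (P z * (\<Gamma> z \<bullet> grad \<psi> (snd z))))"
        by (rule Bochner_Integration.integral_add[symmetric]) (rule iA[OF c C] iB[OF c C])+
      also have "\<dots> = (LINT z|lborel. \<eta> (fst z) * Fz z)" by (simp add: Fz_def distrib_left)
      also have "\<dots> = (LINT r|lborel. \<eta> r * F r)"
      proof -
        have "integrable lborel (\<lambda>z. \<eta> (fst z) * Fz z)"
          unfolding Fz_def distrib_left by (rule Bochner_Integration.integrable_add) (rule iA[OF c C] iB[OF c C])+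
        from lborel_fubini(1)[OF this] show ?thesis by (simp add: Fe)
      qed
      also have "\<dots> = (LINT t|lborel. indicator {0<..} t * (\<eta> t * F t))"
        by (intro Bochner_Integration.integral_cong) (auto simp: indicator_def F_def zero)
      finally show ?thesis .
    qed
    have "- (LINT z|lborel. U z * (deriv \<eta> (fst z) * \<psi> (snd z)))
      - (LINT z|lborel. P z * U z * (\<eta> (fst z) * laplacian \<psi> (snd z)))
      - (LINT z|lborel. P z * (\<Gamma> z \<bullet> (\<eta> (fst z) *\<^sub>R grad \<psi> (snd z)))) = (LINT x|lborel. u0 x * (\<eta> 0 * \<psi> x))"
      using weak[OF test_function_tensor[OF \<eta> t]] by (simp add: d grad_cmult[OF sm] laplacian_cmult[OF sm])
    moreover have "(LINT x|lborel. u0 x * (\<eta> 0 * \<psi> x)) = \<eta> 0 * (LINT x|lborel. u0 x * \<psi> x)"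
      by (subst integral_mult_right_zero[symmetric]) (simp add: mult_ac)
    ultimately show "- (LINT t|lborel. indicator {0<..} t * (deriv \<eta> t * m t))
       - (LINT t|lborel. indicator {0<..} t * (\<eta> t * F t)) = \<eta> 0 * (LINT x|lborel. u0 x * \<psi> x)"
      using 1 2 by linarith
  qed
  then show "AE t in lborel. 0 < t \<longrightarrow> (LINT x|lborel. U (t, x) * \<psi> x) = (LINT x|lborel. u0 x * \<psi> x) + (LINT r|lborel. indicator {0<..<t} r * F r)"
    unfolding m_def .
qed

section \<open>Extension by zero to all times, and square integrability in space-time\<close>

lemma measurable_Q_UNIV:
  fixes f :: "real \<Rightarrow> 'a::euclidean_space \<Rightarrow> 'b::euclidean_space"
  assumes "measurable_Q UNIV f"
  shows "(\<lambda>z. indicator {0<..} (fst z) *\<^sub>R f (fst z) (snd z)) \<in> borel_measurable borel"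
proof -
  have "(\<lambda>z. indicator ({0<..} \<times> UNIV) z *\<^sub>R (\<lambda>(t, x). f t x) z) \<in> borel_measurable lborel"
    using assms by (simp add: measurable_Q_def set_borel_measurable_def)
  also have "(\<lambda>z. indicator ({0<..} \<times> UNIV) z *\<^sub>R (\<lambda>(t, x). f t x) z) = (\<lambda>z. indicator {0<..} (fst z) *\<^sub>R f (fst z) (snd z))"
    by (auto simp: fun_eq_iff indicator_def)
  finally show ?thesis by simp
qed

text \<open>Tonelli in time. The bound N is the squared Sobolev norm of order 1 + s of u, whose
  integral in time is finite for a weak solution.\<close>

lemma L2_space_time:
  fixes f :: "real \<Rightarrow> 'a::euclidean_space \<Rightarrow> real"
  assumes [measurable]: "(\<lambda>z. indicator {0<..} (fst z) * f (fst z) (snd z)) \<in> borel_measurable borel"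
    and b: "AE t in lborel. 0 < t \<longrightarrow> L2 (f t) \<and> ennreal (L2sq (f t)) \<le> N t"
    and N: "(\<integral>\<^sup>+ t\<in>{0<..}. N t \<partial>lborel) < \<infinity>"
  shows "L2 (\<lambda>z. indicator {0<..} (fst z) * f (fst z) (snd z))"
proof -
  have m: "(\<lambda>z. ennreal ((norm (indicator {0<..} (fst z) * f (fst z) (snd z)))\<^sup>2)) \<in> borel_measurable (lborel \<Otimes>\<^sub>M lborel)"
    unfolding lborel_prod by measurable
  have "(\<integral>\<^sup>+ z. ennreal ((norm (indicator {0<..} (fst z) * f (fst z) (snd z)))\<^sup>2) \<partial>lborel)
    = (\<integral>\<^sup>+ t. \<integral>\<^sup>+ x. ennreal ((norm (indicator {0<..} t * f t x))\<^sup>2) \<partial>lborel \<partial>lborel)"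
    using lborel.nn_integral_fst[OF m] by (simp add: lborel_prod)
  also have "\<dots> \<le> (\<integral>\<^sup>+ t\<in>{0<..}. N t \<partial>lborel)"
  proof (rule nn_integral_mono_AE)
    show "AE t in lborel. (\<integral>\<^sup>+ x. ennreal ((norm (indicator {0<..} t * f t x))\<^sup>2) \<partial>lborel) \<le> N t * indicator {0<..} t"
      using b
    proof eventually_elim
      case (elim t)
      show ?case
      proof (cases "0 < t")
        case True then show ?thesis using elim nn_integral_L2sq[of "f t"] by simp
      qed simp
    qed
  qed
  also note N
  finally show ?thesis by (simp add: L2_def)
qed

section \<open>The second moment inequality\<close>

text \<open>The integrated flux c may be negative for a truncated weight, where
  \<open>ennreal\<close> cuts it to 0; the inequality survives because a is nonnegative.\<close>

lemma ennreal_add_le: "0 \<le> a \<Longrightarrow> ennreal (a + c) \<le> ennreal a + ennreal c"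
  by (cases "0 \<le> c") (auto simp: ennreal_plus ennreal_neg intro!: ennreal_leI)

text \<open>Working with extended nonnegative integrals covers an infinite initial moment as well.
  For each truncated weight an exact identity holds with finite terms; the initial moment is then
  only bounded from above, while the flux converges.\<close>

lemma weak_solution_second_moment:
  fixes u p :: "real \<Rightarrow> 'a::euclidean_space \<Rightarrow> real" and G :: "real \<Rightarrow> 'a \<Rightarrow> 'a"
  assumes s: "0 < s" "s < 1" and u0: "L2 u0" "AE x in lborel. 0 \<le> u0 x"
    and ws: "weak_solution s u0 u p G"
  shows "AE t in lborel. 0 < t \<longrightarrow>
    (\<integral>\<^sup>+ x. ennreal ((norm x)\<^sup>2 / 2 * u t x) \<partial>lborel)
    \<le> (\<integral>\<^sup>+ x. ennreal ((norm x)\<^sup>2 / 2 * u0 x) \<partial>lborel)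
      + ennreal ((real DIM('a) + 2 * s) / 2) *
        (\<integral>\<^sup>+ r\<in>{0<..<t}.
           (\<integral>\<^sup>+ x. ennreal ((frac_laplacian (s / 2) (u r) x)\<^sup>2) \<partial>lborel) \<partial>lborel)"
proof -
  let ?d = "real DIM('a)"
  have [measurable]: "u0 \<in> borel_measurable borel" using u0 by (simp add: L2_def)
  have ws_nonneg: "AE (t, x) in lborel. 0 < t \<longrightarrow> 0 \<le> u t x" 
    and ws_u: "L2_sobolev (1 + s) u" and ws_G: "measurable_Q UNIV G"
    and ws_grad: "AE t in lborel. 0 < t \<longrightarrow> has_weak_gradient UNIV (u t) (G t)"
    and ws_p: "AE t in lborel. 0 < t \<longrightarrow> (AE x in lborel. p t x = frac_laplacian s (u t) x)"
    and ws_pS: "L2_sobolev (1 - s) p"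
    using ws by (auto simp: weak_solution_def)
  define U where "U = (\<lambda>z. indicator {0<..} (fst z) * u (fst z) (snd z))"
  define P where "P = (\<lambda>z. indicator {0<..} (fst z) * p (fst z) (snd z))"
  define \<Gamma> where "\<Gamma> = (\<lambda>z. indicator {0<..} (fst z) *\<^sub>R G (fst z) (snd z))"
  define N where "N t = sobolev_sqnorm (1 + s) (u t)" for t
  have N: "(\<integral>\<^sup>+ t\<in>{0<..}. N t \<partial>lborel) < \<infinity>" using ws_u by (simp add: L2_sobolev_def N_def)
  have Um: "U \<in> borel_measurable borel" using measurable_Q_UNIV[of u] ws_u by (simp add: L2_sobolev_def U_def)
  have Pm: "P \<in> borel_measurable borel" using measurable_Q_UNIV[of p] ws_pS by (simp add: L2_sobolev_def P_def)
  have \<Gamma>m: "\<Gamma> \<in> borel_measurable borel" using measurable_Q_UNIV[OF ws_G] by (simp add: \<Gamma>_def)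
  note [measurable] = Um Pm \<Gamma>m
  have "AE t in lborel. 0 < t \<longrightarrow> sobolev (1 + s) (u t)" "AE t in lborel. 0 < t \<longrightarrow> sobolev (1 - s) (p t)"
    using ws_u ws_pS by (auto simp: L2_sobolev_def)
  then have slice: "AE t in lborel. 0 < t \<longrightarrow> sobolev (1 + s) (u t) \<and> has_weak_gradient UNIV (u t) (G t) \<and>
    p t \<in> borel_measurable borel \<and> (AE x in lborel. p t x = frac_laplacian s (u t) x)"
    using ws_grad ws_p by eventually_elim (auto simp: sobolev_def L2_def)
  have LU: "L2 U" unfolding U_def
  proof (rule L2_space_time[OF _ _ N])
    show "AE t in lborel. 0 < t \<longrightarrow> L2 (u t) \<and> ennreal (L2sq (u t)) \<le> N t"
      using slice by eventually_elim (use s in \<open>auto simp: N_def sobolev_def intro!: sobolev_L2sq_le\<close>)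
  qed (use Um in \<open>simp add: U_def\<close>)
  have LP: "L2 P" unfolding P_def
  proof (rule L2_space_time[OF _ _ N])
    show "AE t in lborel. 0 < t \<longrightarrow> L2 (p t) \<and> ennreal (L2sq (p t)) \<le> N t"
      using slice by eventually_elim (use s in \<open>auto simp: N_def intro!: slice_p\<close>)
  qed (use Pm in \<open>simp add: P_def\<close>)
  have L\<Gamma>: "L2 (\<lambda>z. \<Gamma> z \<bullet> b)" if b: "b \<in> Basis" for b
  proof -
    have "L2 (\<lambda>z. indicator {0<..} (fst z) * (G (fst z) (snd z) \<bullet> b))"
    proof (rule L2_space_time[OF _ _ N])
      show "AE t in lborel. 0 < t \<longrightarrow> L2 (\<lambda>x. G t x \<bullet> b) \<and> ennreal (L2sq (\<lambda>x. G t x \<bullet> b)) \<le> N t"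
        using slice by eventually_elim (use s b in \<open>auto simp: N_def intro!: slice_G\<close>)
      have "(\<lambda>z. \<Gamma> z \<bullet> b) \<in> borel_measurable borel" by measurable
      then show "(\<lambda>z. indicator {0<..} (fst z) * (G (fst z) (snd z) \<bullet> b)) \<in> borel_measurable borel" by (simp add: \<Gamma>_def)
    qed
    then show ?thesis by (simp add: \<Gamma>_def)
  qed
  have weak: "- (LINT z|lborel. U z * deriv (\<lambda>r. \<phi> (r, snd z)) (fst z))
      - (LINT z|lborel. P z * U z * laplacian (\<lambda>y. \<phi> (fst z, y)) (snd z))
      - (LINT z|lborel. P z * (\<Gamma> z \<bullet> grad (\<lambda>y. \<phi> (fst z, y)) (snd z)))
      = (LINT x|lborel. u0 x * \<phi> (0, x))" if t: "test_function UNIV \<phi>" for \<phi> :: "real \<times> 'a \<Rightarrow> real"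
  proof -
    have W: "- (LINT (t, x):{0<..} \<times> UNIV|lborel. u t x * deriv (\<lambda>r. \<phi> (r, x)) t)
        - (LINT (t, x):{0<..} \<times> UNIV|lborel. p t x * u t x * laplacian (\<lambda>y. \<phi> (t, y)) x)
        - (LINT (t, x):{0<..} \<times> UNIV|lborel. p t x * (G t x \<bullet> grad (\<lambda>y. \<phi> (t, y)) x))
        = (LINT x|lborel. u0 x * \<phi> (0, x))"
      using ws t unfolding weak_solution_def by blast
    have e1: "(LINT (t, x):{0<..} \<times> UNIV|lborel. u t x * deriv (\<lambda>r. \<phi> (r, x)) t) = (LINT z|lborel. U z * deriv (\<lambda>r. \<phi> (r, snd z)) (fst z))"
      unfolding set_lebesgue_integral_def U_def by (intro Bochner_Integration.integral_cong) (auto simp: indicator_def)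
    have e2: "(LINT (t, x):{0<..} \<times> UNIV|lborel. p t x * u t x * laplacian (\<lambda>y. \<phi> (t, y)) x) = (LINT z|lborel. P z * U z * laplacian (\<lambda>y. \<phi> (fst z, y)) (snd z))"
      unfolding set_lebesgue_integral_def U_def P_def by (intro Bochner_Integration.integral_cong) (auto simp: indicator_def)
    have e3: "(LINT (t, x):{0<..} \<times> UNIV|lborel. p t x * (G t x \<bullet> grad (\<lambda>y. \<phi> (t, y)) x)) = (LINT z|lborel. P z * (\<Gamma> z \<bullet> grad (\<lambda>y. \<phi> (fst z, y)) (snd z)))"
      unfolding set_lebesgue_integral_def \<Gamma>_def P_def by (intro Bochner_Integration.integral_cong) (auto simp: indicator_def)
    show ?thesis using W unfolding e1 e2 e3 .
  qed
  have Uz: "U z = 0" "P z = 0" if "fst z \<le> 0" for z using that by (auto simp: U_def P_def)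
  obtain \<psi> :: "nat \<Rightarrow> 'a \<Rightarrow> real" and B K where t: "\<And>n. test_function UNIV (\<psi> n)" 
    and w: "\<And>n x. 0 \<le> \<psi> n x" "\<And>n x. \<psi> n x \<le> (norm x)\<^sup>2 / 2" and wlim: "\<And>x. (\<lambda>n. \<psi> n x) \<longlonglongrightarrow> (norm x)\<^sup>2 / 2"
    and B: "\<And>n x. \<bar>laplacian (\<psi> n) x\<bar> \<le> B" and lap: "\<And>x. (\<lambda>n. laplacian (\<psi> n) x) \<longlonglongrightarrow> ?d"
    and K: "\<And>n x y. \<bar>dilation_mult s (\<psi> n) x y\<bar> \<le> K"
    and dil: "\<And>x y. x \<noteq> y \<Longrightarrow> (\<lambda>n. dilation_mult s (\<psi> n) x y) \<longlonglongrightarrow> ?d - 2 * s"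
    using exists_truncated_weights[where 'a='a, of s] by (elim exE conjE) blast
  have [measurable]: "\<psi> n \<in> borel_measurable borel" for n by (rule test_function_measurable[OF t])
  define F where "F n r = (LINT x|lborel. P (r, x) * U (r, x) * laplacian (\<psi> n) x + P (r, x) * (\<Gamma> (r, x) \<bullet> grad (\<psi> n) x))" for n r
  have iF: "integrable lborel (F n)" for n
    unfolding F_def by (rule weak_formulation_slices(1)[OF LU LP L\<Gamma> t Uz weak])
  \<comment> \<open>Each weight has its own null set of times; as there are countably many weights,
    n can tend to infinity at a fixed time.\<close>
  have evol: "AE t in lborel. \<forall>n. 0 < t \<longrightarrow> (LINT x|lborel. U (t, x) * \<psi> n x) = (LINT x|lborel. u0 x * \<psi> n x) + (LINT r|lborel. indicator {0<..<t} r * F n r)"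
    unfolding AE_all_countable F_def by (intro allI weak_formulation_slices(2)[OF LU LP L\<Gamma> t Uz weak])
  \<comment> \<open>The energy in a form visibly measurable in time: \<open>frac_laplacian\<close>
    is chosen afresh for each r, whereas this double integral depends measurably on r and agrees
    with the energy for almost all r > 0. The divisor normalises the Gagliardo form.\<close>
  define e where "e r = (LINT z|lborel. (U (r, fst z) - U (r, snd z))\<^sup>2 * frac_kernel s (fst z - snd z)) / (2 * subord_const s)" for r
  have [measurable]: "e \<in> borel_measurable borel" unfolding e_def by measurable
  have e0: "0 \<le> e r" for r unfolding e_def using subord_const_pos[OF s] by (intro divide_nonneg_nonneg Bochner_Integration.integral_nonneg) auto
  have Ut: "U (r, x) = u r x" "P (r, x) = p r x" "\<Gamma> (r, x) = G r x" if "0 < r" for r x using that by (simp_all add: U_def P_def \<Gamma>_def)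
  have e_eq: "AE r in lborel. 0 < r \<longrightarrow> e r = slice_energy s (u r) \<and> ennreal (e r) \<le> N r \<and> 
     (\<integral>\<^sup>+ x. ennreal ((frac_laplacian (s / 2) (u r) x)\<^sup>2) \<partial>lborel) = ennreal (e r)"
    using slice
  proof eventually_elim
    case (elim r)
    show ?case
    proof
      assume r: "0 < r"
      have "e r = slice_energy s (u r)"
        unfolding e_def Ut[OF r] using slice_gagliardo(2)[OF s, of "u r" "G r" "p r"] elim r subord_const_pos[OF s] by simp
      then show "e r = slice_energy s (u r) \<and> ennreal (e r) \<le> N r \<and> 
        (\<integral>\<^sup>+ x. ennreal ((frac_laplacian (s / 2) (u r) x)\<^sup>2) \<partial>lborel) = ennreal (e r)"
        using slice_energy_le[OF s, of "u r" "G r" "p r"] slice_energy_nn[OF s, of "u r" "G r" "p r"] elim r by (simp add: N_def)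
    qed
  qed
  have ie: "integrable lborel (\<lambda>r. indicator {0<..} r * e r)"
  proof (rule integrableI_bounded)
    have "(\<integral>\<^sup>+ r. ennreal (norm (indicator {0<..} r * e r)) \<partial>lborel) \<le> (\<integral>\<^sup>+ r\<in>{0<..}. N r \<partial>lborel)"
      by (rule nn_integral_mono_AE) (use e_eq e0 in \<open>auto elim!: eventually_mono simp: indicator_def\<close>)
    then show "(\<integral>\<^sup>+ r. ennreal (norm (indicator {0<..} r * e r)) \<partial>lborel) < \<infinity>" using N by (rule le_less_trans)
  qed measurable
  \<comment> \<open>The bound for the flux of a slice, written with the space-time functions so that
    Fubini gives its integrability in time.\<close>
  define q where "q r = B * ((LINT x|lborel. (P (r, x))\<^sup>2) + (LINT x|lborel. (U (r, x))\<^sup>2)) + K / 2 * (indicator {0<..} r * e r)" for r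
  have iq: "integrable lborel q" unfolding q_def
    using lborel_fubini(2)[OF L2_integrable[OF LU]] lborel_fubini(2)[OF L2_integrable[OF LP]] ie
    by (intro Bochner_Integration.integrable_add integrable_mult_right) auto
  have Fr: "AE r in lborel. 0 < r \<longrightarrow> (\<forall>n. \<bar>F n r\<bar> \<le> q r) \<and> (\<lambda>n. F n r) \<longlonglongrightarrow> (?d + 2 * s) / 2 * e r"
    using slice e_eq
  proof eventually_elim
    case (elim r)
    show ?case
    proof
      assume r: "0 < r"
      have h: "sobolev (1 + s) (u r)" "has_weak_gradient UNIV (u r) (G r)" "p r \<in> borel_measurable borel"
        "AE x in lborel. p r x = frac_laplacian s (u r) x" "e r = slice_energy s (u r)" using elim r by auto
      have Ff: "F n r = slice_flux (u r) (p r) (G r) (\<psi> n)" for n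
        unfolding F_def slice_flux_def[OF s h(1-4)] Ut[OF r] ..
      have "\<bar>F n r\<bar> \<le> q r" for n
        using slice_flux_bound[OF s h(1-4) t B K, of n] r unfolding Ff q_def Ut[OF r] by (simp add: h(5) L2sq_def)
      moreover have "(\<lambda>n. F n r) \<longlonglongrightarrow> (?d + 2 * s) / 2 * e r"
        unfolding Ff h(5) by (rule slice_flux_tendsto[OF s h(1-4) t B K lap dil])
      ultimately show "(\<forall>n. \<bar>F n r\<bar> \<le> q r) \<and> (\<lambda>n. F n r) \<longlonglongrightarrow> (?d + 2 * s) / 2 * e r" by blast
    qed
  qed
  have Flim: "(\<lambda>n. LINT r|lborel. indicator {0<..<t} r * F n r) \<longlonglongrightarrow> (LINT r|lborel. indicator {0<..<t} r * ((?d + 2 * s) / 2 * e r))" for t :: real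
  proof (rule integral_dominated_convergence[OF _ _ iq])
    have [measurable]: "F n \<in> borel_measurable borel" for n using iF[of n] by simp
    show "(\<lambda>r. indicator {0<..<t} r * F n r) \<in> borel_measurable lborel" for n by measurable
    show "(\<lambda>r. indicator {0<..<t} r * ((?d + 2 * s) / 2 * e r)) \<in> borel_measurable lborel" by measurable
    show "AE r in lborel. (\<lambda>n. indicator {0<..<t} r * F n r) \<longlonglongrightarrow> indicator {0<..<t} r * ((?d + 2 * s) / 2 * e r)"
      using Fr by eventually_elim (auto simp: indicator_def)
    \<comment> \<open>The majorant has to be nonnegative off (0, t) as well. For r > 0 it dominates
      an absolute value; for r \<le> 0 all extended functions vanish and it is 0.\<close>
    have q0: "0 \<le> q r" if "0 < r \<longrightarrow> (\<forall>n. \<bar>F n r\<bar> \<le> q r)" for r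
    proof (cases "0 < r")
      case True then show ?thesis using that order_trans[OF abs_ge_zero] by blast
    next
      case False
      then show ?thesis using Uz[of "(r, _)"] by (simp add: q_def)
    qed
    show "AE r in lborel. norm (indicator {0<..<t} r * F n r) \<le> q r" for n
      using Fr by eventually_elim (use q0 in \<open>auto simp: indicator_def\<close>)
  qed
  have "AE t in lborel. AE x in lborel. 0 < t \<longrightarrow> 0 \<le> u t x"
  proof -
    have "AE z in lborel \<Otimes>\<^sub>M lborel. 0 < fst z \<longrightarrow> 0 \<le> u (fst z) (snd z)"
      using ws_nonneg unfolding lborel_prod by (simp add: case_prod_beta')
    from lborel_pair.AE_pair[OF this] show ?thesis by simp
  qed
  then show ?thesis
    using evol slice
  proof eventually_elim
    case (elim t)
    show ?case
    proof
      assume t0: "0 < t"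
      have [measurable]: "u t \<in> borel_measurable borel" using elim t0 by (auto simp: sobolev_def L2_def)
      have Lu: "L2 (u t)" using elim t0 by (simp add: sobolev_def)
      define A where "A = (\<integral>\<^sup>+ x. ennreal ((norm x)\<^sup>2 / 2 * u0 x) \<partial>lborel)"
      define a where "a n = (LINT x|lborel. u0 x * \<psi> n x)" for n
      define c where "c n = (LINT r|lborel. indicator {0<..<t} r * F n r)" for n
      define E where "E = (LINT r|lborel. indicator {0<..<t} r * ((?d + 2 * s) / 2 * e r))"
      have ut: "AE x in lborel. 0 \<le> u t x" using elim(1) t0 by simp
      have iu: "integrable lborel (\<lambda>x. u t x * \<psi> n x)" and iu0: "integrable lborel (\<lambda>x. u0 x * \<psi> n x)" for n
        by (intro L2_prod_integrable Lu u0 test_function_L2[OF t])+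
      have ac: "(LINT x|lborel. u t x * \<psi> n x) = a n + c n" for n
        using elim(2) t0 by (simp add: a_def c_def Ut)
      have a0: "0 \<le> a n" for n unfolding a_def
        by (rule integral_nonneg_AE) (use u0(2) w(1) in \<open>auto elim!: eventually_mono\<close>)
      have aA: "ennreal (a n) \<le> A" for n
      proof -
        have "ennreal (a n) = (\<integral>\<^sup>+ x. ennreal (u0 x * \<psi> n x) \<partial>lborel)"
          unfolding a_def by (rule nn_integral_eq_integral[symmetric, OF iu0]) (use u0(2) w(1) in \<open>auto elim!: eventually_mono\<close>)
        also have "\<dots> \<le> A" unfolding A_def
        proof (rule nn_integral_mono_AE)
          show "AE x in lborel. ennreal (u0 x * \<psi> n x) \<le> ennreal ((norm x)\<^sup>2 / 2 * u0 x)"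
            using u0(2)
          proof eventually_elim
            case (elim x)
            show ?case using mult_left_mono[OF w(2)[of n x] elim] by (intro ennreal_leI) (simp add: mult.commute)
          qed
        qed
        finally show ?thesis .
      qed
      have "(\<integral>\<^sup>+ x. ennreal ((norm x)\<^sup>2 / 2 * u t x) \<partial>lborel) = (\<integral>\<^sup>+ x. liminf (\<lambda>n. ennreal (u t x * \<psi> n x)) \<partial>lborel)"
      proof (rule nn_integral_cong)
        fix x
        have "(\<lambda>n. ennreal (u t x * \<psi> n x)) \<longlonglongrightarrow> ennreal (u t x * ((norm x)\<^sup>2 / 2))" by (intro tendsto_intros wlim)
        then have "liminf (\<lambda>n. ennreal (u t x * \<psi> n x)) = ennreal (u t x * ((norm x)\<^sup>2 / 2))" by (intro lim_imp_Liminf) auto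
        then show "ennreal ((norm x)\<^sup>2 / 2 * u t x) = liminf (\<lambda>n. ennreal (u t x * \<psi> n x))" by (simp add: mult.commute)
      qed
      also have "\<dots> \<le> liminf (\<lambda>n. \<integral>\<^sup>+ x. ennreal (u t x * \<psi> n x) \<partial>lborel)" by (rule nn_integral_liminf) measurable
      also have "(\<lambda>n. \<integral>\<^sup>+ x. ennreal (u t x * \<psi> n x) \<partial>lborel) = (\<lambda>n. ennreal (a n + c n))"
      proof
        fix n
        show "(\<integral>\<^sup>+ x. ennreal (u t x * \<psi> n x) \<partial>lborel) = ennreal (a n + c n)"
          unfolding ac[symmetric] by (rule nn_integral_eq_integral[OF iu]) (use ut w(1) in \<open>auto elim!: eventually_mono\<close>)
      qed
      \<comment> \<open>The initial term is bounded by its supremum A before the limit, so only the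
        flux needs to converge; splitting the sum this way stays valid when c n is negative.\<close>
      also have "liminf (\<lambda>n. ennreal (a n + c n)) \<le> liminf (\<lambda>n. A + ennreal (c n))"
        by (intro Liminf_mono always_eventually allI order_trans[OF ennreal_add_le[OF a0] add_right_mono[OF aA]])
      also have "\<dots> = A + ennreal E"
      proof (rule lim_imp_Liminf)
        have "(\<lambda>n. ennreal (c n)) \<longlonglongrightarrow> ennreal E" using Flim[of t] by (intro tendsto_ennrealI) (simp add: c_def E_def)
        then show "(\<lambda>n. A + ennreal (c n)) \<longlonglongrightarrow> A + ennreal E" by (intro tendsto_add tendsto_const)
      qed simp
      \<comment> \<open>The measurable representative \<open>e\<close> is exchanged for the original
        inner integral, with which it agrees for almost every r in (0, t).\<close>
      also have "ennreal E = ennreal ((?d + 2 * s) / 2) * (\<integral>\<^sup>+ r\<in>{0<..<t}. (\<integral>\<^sup>+ x. ennreal ((frac_laplacian (s / 2) (u r) x)\<^sup>2) \<partial>lborel) \<partial>lborel)"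
      proof -
        have i: "integrable lborel (\<lambda>r. indicator {0<..<t} r * e r)"
          by (rule Bochner_Integration.integrable_bound[OF ie]) (auto simp: indicator_def)
        have "E = (?d + 2 * s) / 2 * (LINT r|lborel. indicator {0<..<t} r * e r)"
          unfolding E_def by (subst integral_mult_right_zero[symmetric]) (simp add: mult_ac)
        then have "ennreal E = ennreal ((?d + 2 * s) / 2) * ennreal (LINT r|lborel. indicator {0<..<t} r * e r)"
          using s by (simp only:) (rule ennreal_mult', simp)
        also have "ennreal (LINT r|lborel. indicator {0<..<t} r * e r) = (\<integral>\<^sup>+ r. ennreal (indicator {0<..<t} r * e r) \<partial>lborel)"
          by (rule nn_integral_eq_integral[symmetric, OF i]) (simp add: e0)
        also have "\<dots> = (\<integral>\<^sup>+ r\<in>{0<..<t}. (\<integral>\<^sup>+ x. ennreal ((frac_laplacian (s / 2) (u r) x)\<^sup>2) \<partial>lborel) \<partial>lborel)"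
          by (rule nn_integral_cong_AE) (use e_eq in \<open>auto elim!: eventually_mono simp: indicator_def\<close>)
        finally show ?thesis .
      qed
      finally show "(\<integral>\<^sup>+ x. ennreal ((norm x)\<^sup>2 / 2 * u t x) \<partial>lborel)
        \<le> (\<integral>\<^sup>+ x. ennreal ((norm x)\<^sup>2 / 2 * u0 x) \<partial>lborel)
          + ennreal ((?d + 2 * s) / 2) * (\<integral>\<^sup>+ r\<in>{0<..<t}. (\<integral>\<^sup>+ x. ennreal ((frac_laplacian (s / 2) (u r) x)\<^sup>2) \<partial>lborel) \<partial>lborel)"
        unfolding A_def .
    qed
  qed
qed

theorem lemma5p2:
  fixes s :: real
    and u0 :: "'a::euclidean_space \<Rightarrow> real"
    and u p :: "real \<Rightarrow> 'a \<Rightarrow> real"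
    and G :: "real \<Rightarrow> 'a \<Rightarrow> 'a"
  assumes "0 < s" and "s < 1"
    and "u0 \<in> borel_measurable lborel" and "AE x in lborel. 0 \<le> u0 x"
    and "sobolev s u0" and "entropy u0 < \<infinity>"
    and "constructed_weak_solution s u0 u p G"
    and "AE t in lborel. 0 < t \<longrightarrow> L2 (\<lambda>x. x \<bullet> G t x)"
  shows "AE t in lborel. 0 < t \<longrightarrow>
    (\<integral>\<^sup>+ x. ennreal ((norm x)\<^sup>2 / 2 * u t x) \<partial>lborel)
    \<le> (\<integral>\<^sup>+ x. ennreal ((norm x)\<^sup>2 / 2 * u0 x) \<partial>lborel)
      + ennreal ((real DIM('a) + 2 * s) / 2) *
        (\<integral>\<^sup>+ r\<in>{0<..<t}.
           (\<integral>\<^sup>+ x. ennreal ((frac_laplacian (s / 2) (u r) x)\<^sup>2) \<partial>lborel) \<partial>lborel)"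
proof (rule weak_solution_second_moment)
  show "L2 u0" using assms(5) by (simp add: sobolev_def)
  show "weak_solution s u0 u p G" using assms(7) by (simp add: constructed_weak_solution_def)
qed (use assms in auto)


end
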